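(* Let $\tilde K=\min(n,K)$ and $\epsilon>0$. There exists an algorithm in the massively parallel computation (MPC) model (\textsc{Distributed Sieve+Max}) that runs in $O(1/\epsilon)$ rounds on $\sqrt{n/\tilde K}$ machines, each with $O(\sqrt{n\tilde K})$ memory, in which each machine uses query complexity and running time $O(\sqrt{n\tilde K})$ per round, and which outputs a $(\tfrac12-\epsilon)$-approximation to the problem of maximizing a non-negative monotone submodular function subject to a knapsack constraint.
   Context: Problem (submodular maximization under a knapsack constraint): a finite universe $U$ and a set $E=\{e_1,\dots,e_n\}\subseteq U$ of $n$ items, a cost function $c$ on items, a capacity $K>0$, and value-oracle access to a set function $f:2^U\to\mathbb R_{\ge 0}$ that is monotone and submodular ($f(T\cup\{e\})-f(T)\le f(S\cup\{e\})-f(S)$ for all $S\subseteq T\subseteq U$, $e\in U$). For $S\subseteq E$, $c(S)=\sum_{e\in S}c(e)$; $S$ is feasible if $c(S)\le K$; $\mathsf{OPT}$ denotes an optimal feasible set. Standing assumption: $1\le c(e)\le K$ for every item, so $\tilde K=\min(n,K)$ bounds the size of any feasible set. An $\alpha$-approximation is a feasible output $S$ with $f(S)\ge\alpha f(\mathsf{OPT})$. MPC model: the input $E$ is arbitrarily distributed across $m$ machines with local memory each; one machine is a designated central machine that outputs the solution; the machines communicate in synchronous rounds, and in each round each machine receives an input of bounded size, performs local computation (with oracle access to $f$), and sends output of bounded size to other machines before the next round begins. The algorithm may be randomized. *)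

theory Defs
  imports "HOL-Probability.Probability"
begin

section \<open>Submodular maximization under a knapsack constraint\<close>

locale submodular_knapsack =
  fixes U E :: "'a set" and c :: "'a \<Rightarrow> real" and K :: real and f :: "'a set \<Rightarrow> real"
  assumes finite_universe: "finite U"
    and items_subset: "E \<subseteq> U"
    and items_nonempty: "E \<noteq> {}"
    and capacity_pos: "K > 0"
    and cost_bounds: "e \<in> E \<Longrightarrow> 1 \<le> c e \<and> c e \<le> K"
    and nonneg: "S \<subseteq> U \<Longrightarrow> 0 \<le> f S"
    and monotone: "S \<subseteq> T \<Longrightarrow> T \<subseteq> U \<Longrightarrow> f S \<le> f T"
    and submodular: "S \<subseteq> T \<Longrightarrow> T \<subseteq> U \<Longrightarrow> e \<in> U \<Longrightarrow>
      f (T \<union> {e}) - f T \<le> f (S \<union> {e}) - f S"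

definition feasible :: "'a set \<Rightarrow> ('a \<Rightarrow> real) \<Rightarrow> real \<Rightarrow> 'a set \<Rightarrow> bool" where
  "feasible E c K S \<longleftrightarrow> S \<subseteq> E \<and> (\<Sum>e\<in>S. c e) \<le> K"

definition optimal ::
  "'a set \<Rightarrow> ('a \<Rightarrow> real) \<Rightarrow> real \<Rightarrow> ('a set \<Rightarrow> real) \<Rightarrow> 'a set \<Rightarrow> bool" where
  "optimal E c K f Opt \<longleftrightarrow> feasible E c K Opt \<and> (\<forall>S. feasible E c K S \<longrightarrow> f S \<le> f Opt)"

definition is_approximation ::
  "'a set \<Rightarrow> ('a \<Rightarrow> real) \<Rightarrow> real \<Rightarrow> ('a set \<Rightarrow> real) \<Rightarrow> real \<Rightarrow> 'a set \<Rightarrow> bool" where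
  "is_approximation E c K f \<alpha> S \<longleftrightarrow>
     feasible E c K S \<and> (\<forall>Opt. optimal E c K f Opt \<longrightarrow> f S \<ge> \<alpha> * f Opt)"

definition Ktilde :: "'a set \<Rightarrow> real \<Rightarrow> real" where
  "Ktilde E K = min (real (card E)) K"


section \<open>Local computation: a randomized unit-cost RAM with a value oracle\<close>

text \<open>
  A word is a natural number (used for addressing and counting), a real number (oracle values
  and costs), or an item. Items are opaque: a program can copy, send and compare them, ask for
  their cost and put them on the oracle tape, but it can neither create nor decode them.
  As usual for a real RAM there is no rounding from reals to naturals; naturals can only be added
  and subtracted, so that unit-cost arithmetic cannot be abused.
\<close>

datatype 'a word = NatW nat | RealW real | ItemW 'a

datatype arith = Add | Sub | Mul | Div

text \<open>
  All operands are addresses of memory cells; only \<open>Load\<close>, \<open>Store\<close> and \<open>Receive\<close> address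
  indirectly. Programs do not mention items and hence do not depend on the instance.
\<close>

datatype instr =
    ConstN nat nat       \<comment> \<open>\<open>a := k\<close>\<close>
  | ConstR nat real      \<comment> \<open>\<open>a := x\<close>\<close>
  | Move nat nat         \<comment> \<open>\<open>a := b\<close>\<close>
  | Arith arith nat nat nat  \<comment> \<open>\<open>a := b \<circ> d\<close>\<close>
  | ToReal nat nat       \<comment> \<open>\<open>a := real b\<close>\<close>
  | Load nat nat         \<comment> \<open>\<open>a := mem[b]\<close>\<close>
  | Store nat nat        \<comment> \<open>\<open>mem[a] := b\<close>\<close>
  | Cost nat nat         \<comment> \<open>\<open>a := c(b)\<close>\<close>
  | TapeInsert nat       \<comment> \<open>put the item in \<open>a\<close> on the oracle tape\<close>
  | TapeDelete nat       \<comment> \<open>remove the item in \<open>a\<close> from the oracle tape\<close>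
  | Query nat            \<comment> \<open>\<open>a := f(T)\<close> for the set \<open>T\<close> on the oracle tape\<close>
  | Random nat nat       \<comment> \<open>\<open>a :=\<close> uniformly random natural number below \<open>b\<close>\<close>
  | InboxLength nat      \<comment> \<open>\<open>a := length inbox\<close>\<close>
  | Receive nat nat      \<comment> \<open>\<open>a := inbox[b]\<close>\<close>
  | Send nat nat         \<comment> \<open>send the word in \<open>b\<close> to machine number \<open>a\<close>\<close>
  | Output nat           \<comment> \<open>add the item in \<open>a\<close> to the solution\<close>

datatype test = Less nat nat | Equal nat nat

datatype cmd = Basic instr | Cond test "cmd list" "cmd list" | Loop test "cmd list"

type_synonym program = "cmd list"

record 'a machine =
  mem :: "nat \<rightharpoonup> 'a word"
  tape :: "'a set"
  inbox :: "'a word list"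
  outbox :: "(nat \<times> 'a word) list"
  solution :: "'a set"
  queries :: nat

definition get :: "'a machine \<Rightarrow> nat \<Rightarrow> 'a word" where
  "get s a = (case mem s a of None \<Rightarrow> NatW 0 | Some w \<Rightarrow> w)"

definition put :: "nat \<Rightarrow> 'a word \<Rightarrow> 'a machine \<Rightarrow> 'a machine" where
  "put a w s = s\<lparr>mem := (mem s)(a \<mapsto> w)\<rparr>"

text \<open>Ill-typed operations and accesses outside the inbox yield the word \<open>NatW 0\<close> or do nothing.\<close>

fun arith_word :: "arith \<Rightarrow> 'a word \<Rightarrow> 'a word \<Rightarrow> 'a word" where
  "arith_word Add (NatW i) (NatW j) = NatW (i + j)"
| "arith_word Sub (NatW i) (NatW j) = NatW (i - j)"
| "arith_word Add (RealW x) (RealW y) = RealW (x + y)"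
| "arith_word Sub (RealW x) (RealW y) = RealW (x - y)"
| "arith_word Mul (RealW x) (RealW y) = RealW (x * y)"
| "arith_word Div (RealW x) (RealW y) = RealW (x / y)"
| "arith_word _ _ _ = NatW 0"

fun less_word :: "'a word \<Rightarrow> 'a word \<Rightarrow> bool" where
  "less_word (NatW i) (NatW j) \<longleftrightarrow> i < j"
| "less_word (RealW x) (RealW y) \<longleftrightarrow> x < y"
| "less_word _ _ \<longleftrightarrow> False"

fun holds :: "test \<Rightarrow> 'a machine \<Rightarrow> bool" where
  "holds (Less a b) s \<longleftrightarrow> less_word (get s a) (get s b)"
| "holds (Equal a b) s \<longleftrightarrow> get s a = get s b"

fun exec :: "('a set \<Rightarrow> real) \<Rightarrow> ('a \<Rightarrow> real) \<Rightarrow> instr \<Rightarrow> 'a machine \<Rightarrow> 'a machine pmf" where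
  "exec f c (ConstN a k) s = return_pmf (put a (NatW k) s)"
| "exec f c (ConstR a x) s = return_pmf (put a (RealW x) s)"
| "exec f c (Move a b) s = return_pmf (put a (get s b) s)"
| "exec f c (Arith opr a b d) s = return_pmf (put a (arith_word opr (get s b) (get s d)) s)"
| "exec f c (ToReal a b) s = return_pmf
     (put a (case get s b of NatW k \<Rightarrow> RealW (real k) | _ \<Rightarrow> NatW 0) s)"
| "exec f c (Load a b) s = return_pmf
     (put a (case get s b of NatW k \<Rightarrow> get s k | _ \<Rightarrow> NatW 0) s)"
| "exec f c (Store a b) s = return_pmf
     (case get s a of NatW k \<Rightarrow> put k (get s b) s | _ \<Rightarrow> s)"
| "exec f c (Cost a b) s = return_pmf
     (put a (case get s b of ItemW e \<Rightarrow> RealW (c e) | _ \<Rightarrow> NatW 0) s)"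
| "exec f c (TapeInsert a) s = return_pmf
     (case get s a of ItemW e \<Rightarrow> s\<lparr>tape := insert e (tape s)\<rparr> | _ \<Rightarrow> s)"
| "exec f c (TapeDelete a) s = return_pmf
     (case get s a of ItemW e \<Rightarrow> s\<lparr>tape := tape s - {e}\<rparr> | _ \<Rightarrow> s)"
| "exec f c (Query a) s = return_pmf
     (put a (RealW (f (tape s))) (s\<lparr>queries := Suc (queries s)\<rparr>))"
| "exec f c (Random a b) s =
     (case get s b of
        NatW k \<Rightarrow> if k = 0 then return_pmf s
                  else map_pmf (\<lambda>i. put a (NatW i) s) (pmf_of_set {..<k})
      | _ \<Rightarrow> return_pmf s)"
| "exec f c (InboxLength a) s = return_pmf (put a (NatW (length (inbox s))) s)"
| "exec f c (Receive a b) s = return_pmf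
     (put a (case get s b of NatW k \<Rightarrow> if k < length (inbox s) then inbox s ! k else NatW 0
                           | _ \<Rightarrow> NatW 0) s)"
| "exec f c (Send a b) s = return_pmf
     (case get s a of NatW k \<Rightarrow> s\<lparr>outbox := outbox s @ [(k, get s b)]\<rparr> | _ \<Rightarrow> s)"
| "exec f c (Output a) s = return_pmf
     (case get s a of ItemW e \<Rightarrow> s\<lparr>solution := insert e (solution s)\<rparr> | _ \<Rightarrow> s)"

text \<open>
  A configuration consists of the commands still to be executed and the state of the machine.
  Every step, in particular every oracle query, costs one unit of time.
\<close>

type_synonym 'a config = "program \<times> 'a machine"

fun step :: "('a set \<Rightarrow> real) \<Rightarrow> ('a \<Rightarrow> real) \<Rightarrow> 'a config \<Rightarrow> 'a config pmf" where
  "step f c ([], s) = return_pmf ([], s)"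
| "step f c (Basic i # cs, s) = map_pmf (Pair cs) (exec f c i s)"
| "step f c (Cond b p q # cs, s) = return_pmf (if holds b s then p @ cs else q @ cs, s)"
| "step f c (Loop b p # cs, s) =
     return_pmf (if holds b s then p @ Loop b p # cs else cs, s)"

primrec steps ::
  "('a set \<Rightarrow> real) \<Rightarrow> ('a \<Rightarrow> real) \<Rightarrow> nat \<Rightarrow> 'a config \<Rightarrow> 'a config pmf" where
  "steps f c 0 x = return_pmf x"
| "steps f c (Suc t) x = bind_pmf (steps f c t x) (step f c)"

text \<open>
  Memory is the largest address written so far (plus one) together with everything the machine
  holds outside its addressable cells.
\<close>

definition memory_used :: "'a machine \<Rightarrow> nat" where
  "memory_used s = Max (insert 0 (Suc ` dom (mem s))) + card (tape s) + length (inbox s)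
     + length (outbox s) + card (solution s)"

text \<open>
  On every random choice the program halts within \<open>T\<close> steps having asked at most \<open>Q\<close> queries,
  and at no time occupies more than \<open>M\<close> words.
\<close>

definition runs_within ::
  "('a set \<Rightarrow> real) \<Rightarrow> ('a \<Rightarrow> real) \<Rightarrow> program \<Rightarrow> nat \<Rightarrow> nat \<Rightarrow> nat \<Rightarrow> 'a machine \<Rightarrow> bool" where
  "runs_within f c P T Q M s \<longleftrightarrow>
     (\<forall>(cs, s') \<in> set_pmf (steps f c T (P, s)). cs = [] \<and> queries s' \<le> Q) \<and>
     (\<forall>t\<le>T. \<forall>(cs, s') \<in> set_pmf (steps f c t (P, s)). memory_used s' \<le> M)"


section \<open>The massively parallel computation model\<close>

text \<open>
  The machines are numbered \<open>0, \<dots>, m - 1\<close>, machine 0 being the central one. All of them run the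
  same program in every round, with independent randomness. Initially a machine knows its number,
  the number of machines, the number of items and the capacity, and its inbox holds its share of
  the input. Memory contents and oracle tape persist from one round to the next.
\<close>

definition initial_machine ::
  "nat \<Rightarrow> nat \<Rightarrow> real \<Rightarrow> (nat \<Rightarrow> 'a list) \<Rightarrow> nat \<Rightarrow> 'a machine" where
  "initial_machine m n K inp i =
     \<lparr>mem = [0 \<mapsto> NatW i, 1 \<mapsto> NatW m, 2 \<mapsto> NatW n, 3 \<mapsto> RealW K],
      tape = {}, inbox = map ItemW (inp i), outbox = [], solution = {}, queries = 0\<rparr>"

text \<open>
  The inbox for the next round lists the received words by sender and, for each sender, in the
  order of sending.
\<close>

definition deliver :: "nat \<Rightarrow> (nat \<Rightarrow> 'a machine) \<Rightarrow> nat \<Rightarrow> 'a machine" where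
  "deliver m g j = (g j)
     \<lparr>inbox := concat (map (\<lambda>i. map snd (filter (\<lambda>x. fst x = j) (outbox (g i)))) [0..<m]),
      outbox := [], queries := 0\<rparr>"

text \<open>
  \<open>T\<close> is the duration of a round. The states of non-existing machines are irrelevant and are
  fixed to \<open>undefined\<close>.
\<close>

definition mpc_round ::
  "('a set \<Rightarrow> real) \<Rightarrow> ('a \<Rightarrow> real) \<Rightarrow> program \<Rightarrow> nat \<Rightarrow> nat \<Rightarrow>
   (nat \<Rightarrow> 'a machine) \<Rightarrow> (nat \<Rightarrow> 'a machine) pmf" where
  "mpc_round f c P T m g = map_pmf (deliver m)
     (Pi_pmf {..<m} undefined (\<lambda>i. map_pmf snd (steps f c T (P, g i))))"

primrec mpc_rounds ::
  "('a set \<Rightarrow> real) \<Rightarrow> ('a \<Rightarrow> real) \<Rightarrow> program \<Rightarrow> nat \<Rightarrow> nat \<Rightarrow>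
   nat \<Rightarrow> (nat \<Rightarrow> 'a machine) \<Rightarrow> (nat \<Rightarrow> 'a machine) pmf" where
  "mpc_rounds f c P T m 0 g = return_pmf g"
| "mpc_rounds f c P T m (Suc r) g = bind_pmf (mpc_rounds f c P T m r g) (mpc_round f c P T m)"

definition mpc_within ::
  "('a set \<Rightarrow> real) \<Rightarrow> ('a \<Rightarrow> real) \<Rightarrow> program \<Rightarrow> nat \<Rightarrow> nat \<Rightarrow> nat \<Rightarrow> nat \<Rightarrow>
   nat \<Rightarrow> (nat \<Rightarrow> 'a machine) \<Rightarrow> bool" where
  "mpc_within f c P T Q M m R g \<longleftrightarrow>
     (\<forall>r<R. \<forall>g' \<in> set_pmf (mpc_rounds f c P T m r g). \<forall>i<m. runs_within f c P T Q M (g' i))"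

definition mpc_output ::
  "('a set \<Rightarrow> real) \<Rightarrow> ('a \<Rightarrow> real) \<Rightarrow> program \<Rightarrow> nat \<Rightarrow> nat \<Rightarrow>
   nat \<Rightarrow> (nat \<Rightarrow> 'a machine) \<Rightarrow> 'a set pmf" where
  "mpc_output f c P T m R g = map_pmf (\<lambda>g'. solution (g' 0)) (mpc_rounds f c P T m R g)"

text \<open>The items \<open>E\<close> are split among \<open>m\<close> machines, none of which gets more than \<open>L\<close> of them.\<close>

definition distributed_input :: "'a set \<Rightarrow> nat \<Rightarrow> real \<Rightarrow> (nat \<Rightarrow> 'a list) \<Rightarrow> bool" where
  "distributed_input E m L inp \<longleftrightarrow>
     (\<Union>i<m. set (inp i)) = E \<and>
     (\<forall>i<m. distinct (inp i) \<and> real (length (inp i)) \<le> L) \<and>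
     (\<forall>i<m. \<forall>j<m. i \<noteq> j \<longrightarrow> set (inp i) \<inter> set (inp j) = {})"

end

theory Submission
  imports Defs
begin

text \<open>
  The machines repeatedly extend a common feasible list \<open>G\<close> greedily at a density threshold \<open>t\<close>. Each
  machine broadcasts about \<open>K'\<close> random items of its input, where \<open>K' = Ktilde E K\<close>, and every machine
  runs the greedy algorithm on the whole sample. An input item which is still acceptable afterwards
  would have been accepted whenever it was drawn; as \<open>G\<close> has at most \<open>K'\<close> elements, the expected number
  of such items is at most the maximal input size of a machine, \<open>O (sqrt (n K'))\<close>. By Markov's inequality
  they usually fit into the central machine, which finishes the greedy run, so that \<open>G\<close> becomes
  saturated: no item that fits has density above \<open>t\<close>.

  Let \<open>x\<close> be an item of largest cost in an optimal set of value \<open>V\<close>. Put \<open>b = K - c x\<close> and let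
  \<open>t b \<le> V / 2 \<le> t (b + e K)\<close>. Saturate at \<open>t\<close>, and then further at \<open>4 e t\<close>. One of the two lists, or
  the first one extended by its best fitting item, or the best single item, has value at least
  \<open>(1/2 - 2 e) V\<close>. Given a number \<open>L\<close> with \<open>V \<le> L \<le> 49 V\<close>, some \<open>t = L / (2 e K k)\<close> with \<open>k = O (1/e)\<close>
  is suitable. All \<open>k\<close> are tried one after the other, but only the two saturations for the right
  one have to succeed, so the failure probability does not depend on \<open>e\<close>.

  The estimate \<open>L\<close> comes from a one-pass algorithm with constant approximation ratio. It is run on
  a sample which, being several times larger than an ordinary one, has with high probability an
  optimum at least as large as that of the next ordinary sample. Its value gives a threshold at which the
  next sample leaves few survivors, and these are passed to the same algorithm on the central machine.

  For all resources it suffices to bound the number of steps: a step asks at most one query and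
  occupies at most one word outside the addressable cells.
\<close>

section \<open>Monotone submodular functions\<close>

text \<open>The constant \<open>C\<close> is chosen before \<open>\<epsilon>\<close>: resources per
  round depend on \<open>\<delta>\<close> and \<open>A\<close> only, while the number of rounds
  grows like \<open>1 / \<epsilon>\<close>. A union bound over all rounds would make the bound on
  survivors, and so the memory, grow too. Hence just five random events matter, three for the
  estimate and two for the right guess, each failing with probability at most
  \<open>d \<le> \<delta> / 5\<close>; all other samples may be arbitrary. Resource bounds, in
  contrast, hold for every outcome: survivors are counted before they are sent, and if there are too
  many, none is sent. An unlucky sample thus costs the approximation guarantee, never memory or
  feasibility. The estimate meets a circularity, since sieving needs a threshold of the order of the
  optimum divided by \<open>K\<close>. A sample may miss the decisive items, so its optimum may be
  far too small. But its threshold only has to keep the greedy list of the next sample within half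
  the capacity; whatever valuable was missed then survives and reaches the center.\<close>

context submodular_knapsack
begin

abbreviation cost :: "'a list \<Rightarrow> real" where
  "cost G \<equiv> sum_list (map c G)"

lemma finite_items: "finite E"
  using finite_subset[OF items_subset finite_universe] .

lemma Ktilde_ge_1: "1 \<le> Ktilde E K"
proof -
  obtain x where "x \<in> E" using items_nonempty by auto
  then have "1 \<le> K" using cost_bounds by fastforce
  moreover have "1 \<le> real (card E)"
    using items_nonempty finite_items by (simp add: Suc_le_eq card_gt_0_iff)
  ultimately show ?thesis by (simp add: Ktilde_def)
qed

lemma marginal_antimono:
  assumes "S \<subseteq> S'" "S' \<subseteq> U" "T \<subseteq> U"
  shows "f (S' \<union> T) - f S' \<le> f (S \<union> T) - f S"
proof -
  have "finite T" using assms finite_universe finite_subset by blast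
  then show ?thesis using assms(3)
  proof (induction T)
    case (insert e T)
    have "f (S' \<union> T \<union> {e}) - f (S' \<union> T) \<le> f (S \<union> T \<union> {e}) - f (S \<union> T)"
      by (rule submodular) (use insert assms in auto)
    then show ?case using insert by simp
  qed simp
qed

lemma subadditive:
  assumes "S \<subseteq> U" "T \<subseteq> U"
  shows "f (S \<union> T) \<le> f S + f T"
  using marginal_antimono[of "{}" S T] nonneg[of "{}"] assms by simp

lemma union_le_sum_marginals:
  assumes "S \<subseteq> U" "T \<subseteq> U"
  shows "f (S \<union> T) \<le> f S + (\<Sum>e\<in>T. f (insert e S) - f S)"
proof -
  have "finite T" using assms finite_universe finite_subset by blast
  then show ?thesis using assms(2)
  proof (induction T)
    case (insert e T)
    have "f (S \<union> T \<union> {e}) - f (S \<union> T) \<le> f (S \<union> {e}) - f S"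
      by (rule submodular) (use insert assms in auto)
    then show ?case using insert by simp
  qed simp
qed

text \<open>Submodularity bounds the joint gain of \<open>T\<close> over \<open>S\<close> by the sum
  of the single gains. Applied to parts of the optimum, whose cost is bounded, this turns a density
  bound into a bound on their value.\<close>

lemma cover_by_density:
  assumes "S \<subseteq> U" "T \<subseteq> E" "\<And>e. e \<in> T \<Longrightarrow> f (insert e S) - f S \<le> t * c e"
  shows "f T \<le> f S + t * (\<Sum>e\<in>T. c e)"
proof -
  have T: "T \<subseteq> U" using assms items_subset by auto
  have "f T \<le> f (S \<union> T)" by (rule monotone) (use assms T in auto)
  also have "\<dots> \<le> f S + (\<Sum>e\<in>T. f (insert e S) - f S)"
    by (rule union_le_sum_marginals) (use assms T in auto)
  also have "\<dots> \<le> f S + (\<Sum>e\<in>T. t * c e)"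
    using assms(3) by (intro add_left_mono sum_mono) auto
  finally show ?thesis by (simp add: sum_distrib_left)
qed

text \<open>The larger set gains at most as much as the smaller one and, by monotonicity, does not
  end lower. This is what allows the oracle tape to hold only a subset of the current list with the
  same value.\<close>

lemma insert_equivalent:
  assumes "S \<subseteq> T" "T \<subseteq> U" "f S = f T" "e \<in> U"
  shows "f (insert e S) = f (insert e T)"
  using submodular[OF assms(1,2,4)] monotone[of "insert e S" "insert e T"] assms by auto

lemma length_le_cost: "set G \<subseteq> E \<Longrightarrow> real (length G) \<le> cost G"
proof (induction G)
  case (Cons a G)
  then show ?case using cost_bounds[of a] by auto
qed simp

lemma cost_distinct: "distinct G \<Longrightarrow> (\<Sum>e\<in>set G. c e) = cost G"
  by (simp add: sum_list_distinct_conv_sum_set)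

section \<open>Threshold greedy\<close>

text \<open>The strict inequality makes every item of \<open>G\<close> unacceptable for
  \<open>t \<ge> 0\<close>, including \<open>t = 0\<close>, since its marginal is 0. So lists stay
  distinct without a membership test.\<close>

definition acc :: "real \<Rightarrow> 'a list \<Rightarrow> 'a \<Rightarrow> bool" where
  "acc t G e \<longleftrightarrow> t * c e < f (insert e (set G)) - f (set G) \<and> cost G + c e \<le> K"

definition ext :: "real \<Rightarrow> 'a list \<Rightarrow> 'a \<Rightarrow> 'a list" where
  "ext t G e = (if acc t G e then G @ [e] else G)"

lemma ext_acc: "acc t G e \<Longrightarrow> ext t G e = G @ [e]" "\<not> acc t G e \<Longrightarrow> ext t G e = G"
  by (simp_all add: ext_def)

definition good_list :: "'a list \<Rightarrow> bool" where
  "good_list G \<longleftrightarrow> set G \<subseteq> E \<and> distinct G \<and> cost G \<le> K"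

lemma good_list_Nil [simp]: "good_list []"
  using capacity_pos by (simp add: good_list_def)

lemma good_list_feasible: "good_list G \<Longrightarrow> feasible E c K (set G)"
  by (simp add: good_list_def feasible_def cost_distinct)

lemma acc_notin: "acc t G e \<Longrightarrow> 0 \<le> t \<Longrightarrow> e \<in> E \<Longrightarrow> e \<notin> set G"
  using cost_bounds[of e] by (auto simp: acc_def insert_absorb mult_less_0_iff)

lemma good_list_ext: "good_list G \<Longrightarrow> 0 \<le> t \<Longrightarrow> e \<in> E \<Longrightarrow> good_list (ext t G e)"
  using acc_notin[of t G e] by (auto simp: good_list_def ext_def) (simp add: acc_def)

lemma good_list_foldl_ext:
  "good_list G \<Longrightarrow> 0 \<le> t \<Longrightarrow> set xs \<subseteq> E \<Longrightarrow> good_list (foldl (ext t) G xs)"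
  by (induction xs arbitrary: G) (auto simp: good_list_ext)

text \<open>Here the assumption that costs are at least 1 enters: it bounds the length by the cost.
  The bound limits both the work of broadcasting a list and the expected number of accepted
  draws.\<close>

lemma length_good_list: "good_list G \<Longrightarrow> real (length G) \<le> Ktilde E K"
  using length_le_cost[of G] card_mono[OF finite_items, of "set G"]
  by (auto simp: good_list_def Ktilde_def distinct_card)

lemma set_subset_foldl_ext: "set G \<subseteq> set (foldl (ext t) G xs)"
proof (induction xs arbitrary: G)
  case (Cons x xs)
  have "set G \<subseteq> set (ext t G x)" by (auto simp: ext_def)
  then show ?case using Cons[of "ext t G x"] by auto
qed simp

lemma cost_foldl_ext_ge:
  "set xs \<subseteq> E \<Longrightarrow> cost G \<le> cost (foldl (ext t) G xs)"
proof (induction xs arbitrary: G)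
  case (Cons x xs)
  have "cost G \<le> cost (ext t G x)" using cost_bounds[of x] Cons.prems by (auto simp: ext_def)
  then show ?case using Cons.IH[of "ext t G x"] Cons.prems by auto
qed simp

lemma set_foldl_ext: "set (foldl (ext t) G xs) \<subseteq> set G \<union> set xs"
proof (induction xs arbitrary: G)
  case (Cons x xs)
  then show ?case using Cons[of "ext t G x"] by (cases "acc t G x") (auto simp: ext_acc)
qed simp

text \<open>A longer list has smaller marginals and less remaining capacity. That acceptability can
  only be lost is behind both the saturation and the count of survivors.\<close>

lemma acc_antimono:
  assumes "acc t G' e" "set G \<subseteq> set G'" "cost G \<le> cost G'" "set G' \<subseteq> E" "e \<in> E"
  shows "acc t G e"
  using assms submodular[of "set G" "set G'" e] items_subset by (force simp: acc_def)

lemma not_acc_foldl_ext: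
  assumes "\<not> acc t G e" "good_list G" "0 \<le> t" "set xs \<subseteq> E" "e \<in> E"
  shows "\<not> acc t (foldl (ext t) G xs) e"
  using acc_antimono[of t "foldl (ext t) G xs" e G] assms set_subset_foldl_ext[of G t xs]
    cost_foldl_ext_ge[of xs G t] good_list_foldl_ext[of G t xs]
  by (auto simp: good_list_def)

lemma not_acc_processed:
  assumes "good_list G" "0 \<le> t" "set xs \<subseteq> E" "e \<in> set xs"
  shows "\<not> acc t (foldl (ext t) G xs) e"
  using assms
proof (induction xs arbitrary: G)
  case (Cons x xs)
  show ?case
  proof (cases "e = x")
    case True
    have "\<not> acc t (ext t G x) x"
      using acc_notin[of t "ext t G x" x] Cons.prems by (auto simp: ext_def)
    then show ?thesis using True not_acc_foldl_ext[of t "ext t G x" x xs] good_list_ext[of G t x]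
        Cons.prems by auto
  next
    case False
    then show ?thesis using Cons.IH[of "ext t G x"] Cons.prems good_list_ext[of G t x] by auto
  qed
qed simp

definition saturated :: "real \<Rightarrow> 'a list \<Rightarrow> bool" where
  "saturated t G \<longleftrightarrow> (\<forall>e\<in>E. \<not> acc t G e)"

lemma saturated_after_survivors:
  assumes "good_list G" "0 \<le> t" "set xs \<subseteq> E" "\<And>e. e \<in> E \<Longrightarrow> acc t G e \<Longrightarrow> e \<in> set xs"
  shows "saturated t (foldl (ext t) G xs)"
  unfolding saturated_def using not_acc_processed[OF assms(1-3)] not_acc_foldl_ext[OF _ assms(1-3)]
    assms(4) by blast

lemma foldl_ext_value:
  assumes "good_list G" "0 \<le> t" "set xs \<subseteq> E"
  shows "f (set (foldl (ext t) G xs)) \<ge> f (set G) + t * (cost (foldl (ext t) G xs) - cost G)"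
  using assms
proof (induction xs arbitrary: G)
  case (Cons x xs)
  have "f (set (ext t G x)) \<ge> f (set G) + t * (cost (ext t G x) - cost G)"
    by (auto simp: ext_def acc_def algebra_simps)
  then show ?case using Cons.IH[of "ext t G x"] Cons.prems good_list_ext[of G t x]
    by (auto simp: algebra_simps)
qed simp

text \<open>Complements \<open>foldl_ext_value\<close> at threshold 0, where that bound yields no
  gain: every acceptance still raises the value, so a run that ends at the value of \<open>G\<close>
  has accepted nothing.\<close>

lemma foldl_ext_strict:
  assumes "0 \<le> t" "set xs \<subseteq> E" "foldl (ext t) G xs \<noteq> G"
  shows "f (set (foldl (ext t) G xs)) > f (set G)"
  using assms
proof (induction xs arbitrary: G)
  case (Cons x xs)
  have *: "ext t G x \<noteq> G \<Longrightarrow> f (set (ext t G x)) > f (set G)"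
    using Cons.prems(1,2) cost_bounds[of x]
    by (auto simp: ext_def acc_def split: if_splits) (smt (verit) mult_nonneg_nonneg)
  show ?case using * Cons.IH[of "ext t G x"] Cons.prems
    by (cases "foldl (ext t) (ext t G x) xs = ext t G x"; cases "ext t G x = G") fastforce+
qed simp

lemma foldl_ext_prefix: "\<exists>ys. foldl (ext t) G xs = G @ ys"
proof (induction xs arbitrary: G)
  case (Cons x xs)
  show ?case using Cons[of "ext t G x"] by (cases "acc t G x") (auto simp: ext_acc)
qed simp

text \<open>Rejected items leave the list unchanged, so omitting them does not affect the later
  tests. Hence the center has to send only the items it accepted, and the other machines reach the
  same list by running the same code on them.\<close>

lemma foldl_ext_replay:
  assumes "foldl (ext t) G xs = G @ new"
  shows "foldl (ext t) G new = G @ new"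
  using assms
proof (induction xs arbitrary: G new)
  case (Cons x xs)
  show ?case
  proof (cases "acc t G x")
    case True
    have e: "foldl (ext t) (G @ [x]) xs = G @ new" using Cons.prems True by (simp add: ext_acc)
    obtain ys where "foldl (ext t) (G @ [x]) xs = (G @ [x]) @ ys"
      using foldl_ext_prefix by blast
    then obtain new' where new: "new = x # new'" using e by auto
    then show ?thesis using Cons.IH[of "G @ [x]" new'] e True by (simp add: ext_acc)
  next
    case False
    then show ?thesis using Cons by (simp add: ext_acc)
  qed
qed simp

section \<open>Approximation guarantee for a correct guess of the density threshold\<close>

text \<open>Let \<open>b\<close> be the capacity left beside \<open>o1\<close>; the rest of
  \<open>Opt\<close> costs at most \<open>b\<close>. If \<open>G\<close> costs at most
  \<open>b\<close>, then \<open>o1\<close> and every cheaper item still fit, so saturation bounds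
  all densities and \<open>G\<close> with \<open>o1\<close> is good enough. Otherwise
  \<open>G\<close> has crossed \<open>b\<close> at density \<open>t\<close>, so its value is at
  least \<open>t * b\<close>, which misses \<open>f Opt / 2\<close> by at most
  \<open>t * e * K\<close>. This is a small fraction of \<open>t * b\<close> unless
  \<open>b < K / 4\<close>. In that case the second list helps: the factor 4 in its threshold makes
  a further cost of \<open>K / 4\<close> worth the missing \<open>t * e * K\<close>.\<close>

lemma threshold_half_approximation:
  assumes Opt: "feasible E c K Opt" and o1: "o1 \<in> Opt" "\<And>e. e \<in> Opt \<Longrightarrow> c e \<le> c o1"
    and eps: "0 < e" "e \<le> 1/4" and t: "0 \<le> t" "t * (K - c o1) \<le> f Opt / 2"
      "f Opt / 2 \<le> t * (K - c o1 + e * K)"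
    and G: "good_list G" "t * cost G \<le> f (set G)" "saturated t G"
    and G': "good_list G'" "f (set G) + 4 * e * t * (cost G' - cost G) \<le> f (set G')"
      "saturated (4 * e * t) G'"
    and V: "f {o1} \<le> V" "f (set G') \<le> V" "f (set G) \<le> V"
      "\<And>x. x \<in> E \<Longrightarrow> cost G + c x \<le> K \<Longrightarrow> f (insert x (set G)) \<le> V"
  shows "(1/2 - 2 * e) * f Opt \<le> V"
proof -
  define b where "b = K - c o1"
  define Rest where "Rest = Opt - {o1}"
  have OE: "Opt \<subseteq> E" "(\<Sum>x\<in>Opt. c x) \<le> K" using Opt by (auto simp: feasible_def)
  have fin: "finite Opt" using OE finite_items finite_subset by blast
  have OU: "Opt \<subseteq> U" "Rest \<subseteq> E" "Rest \<subseteq> U" "o1 \<in> U" "o1 \<in> E"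
    using OE items_subset o1 by (auto simp: Rest_def)
  have GU: "set G \<subseteq> U" "set G' \<subseteq> U"
    using G G' items_subset by (auto simp: good_list_def)
  have cO': "(\<Sum>x\<in>Rest. c x) \<le> b"
    using OE fin o1 by (simp add: Rest_def b_def sum_diff1)
  have b0: "0 \<le> b" using cost_bounds[OF \<open>o1 \<in> E\<close>] by (simp add: b_def)
  have f0: "0 \<le> f Opt" using nonneg OU by auto
  have cO'le: "c x \<le> b" if "x \<in> Rest" for x
  proof -
    have "c x \<le> (\<Sum>x\<in>Rest. c x)"
      by (rule member_le_sum) (use that fin OU cost_bounds in \<open>force simp: Rest_def\<close>)+
    then show ?thesis using cO' by simp
  qed
  have split: "f Opt \<le> f Rest + f {o1}"
    using subadditive[of Rest "{o1}"] OU o1 by (simp add: Rest_def insert_absorb)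
  have tb: "t * b \<le> f Opt / 2" "f Opt / 2 \<le> t * (b + e * K)" using t by (auto simp: b_def)
  have ef: "0 \<le> e * f Opt" using eps f0 by simp
  consider (fits) "cost G \<le> b" | (half) "f (set G) \<ge> f Opt / 2"
    | (cross) "cost G > b" "f (set G) < f Opt / 2" by linarith
  then show ?thesis
  proof cases
    case fits
    have "f (insert x (insert o1 (set G))) - f (insert o1 (set G)) \<le> t * c x" if x: "x \<in> Rest" for x
    proof -
      have "x \<in> E" "c x \<le> c o1" using x OU o1 by (auto simp: Rest_def)
      then have "f (insert x (set G)) - f (set G) \<le> t * c x"
        using G(3) fits by (auto simp: saturated_def acc_def b_def)
      moreover have "f (insert o1 (set G) \<union> {x}) - f (insert o1 (set G)) \<le> f (set G \<union> {x}) - f (set G)"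
        by (rule submodular) (use GU OU x in auto)
      ultimately show ?thesis by simp
    qed
    then have "f (insert o1 (set G) \<union> Rest) \<le> f (insert o1 (set G)) + (\<Sum>x\<in>Rest. t * c x)"
      using union_le_sum_marginals[of "insert o1 (set G)" Rest] GU OU
        sum_mono[of Rest "\<lambda>x. f (insert x (insert o1 (set G))) - f (insert o1 (set G))" "\<lambda>x. t * c x"]
      by fastforce
    also have "\<dots> \<le> f (insert o1 (set G)) + t * b"
      using cO' t(1) by (simp add: sum_distrib_left[symmetric] mult_left_mono)
    also have "\<dots> \<le> V + f Opt / 2"
      using V(4)[OF \<open>o1 \<in> E\<close>] fits tb by (simp add: b_def)
    finally have "f (insert o1 (set G) \<union> Rest) \<le> V + f Opt / 2" .
    moreover have "f Opt \<le> f (insert o1 (set G) \<union> Rest)"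
      by (rule monotone) (use GU OU o1 in \<open>auto simp: Rest_def\<close>)
    ultimately show ?thesis using ef by (simp add: algebra_simps)
  next
    case half
    then show ?thesis using V ef by (simp add: algebra_simps)
  next
    case cross
    have tG: "t * b \<le> f (set G)" using cross(1) t(1) G(2) mult_left_mono[of b "cost G" t] by linarith
    \<comment> \<open>At cost \<open>b + e * K\<close>, density \<open>t\<close> alone would already
      yield half of the optimum.\<close>
    have cG: "cost G < b + e * K"
    proof (rule ccontr)
      assume "\<not> ?thesis"
      then have "t * (b + e * K) \<le> t * cost G" using t(1) by (intro mult_left_mono) auto
      then show False using G(2) tb cross(2) by linarith
    qed
    show ?thesis
    proof (cases "K / 4 \<le> b")
      case True
      have "b + e * K \<le> (1 + 4 * e) * b" using True eps by (simp add: algebra_simps)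
      then have "f Opt / 2 \<le> t * ((1 + 4 * e) * b)"
        using tb t(1) mult_left_mono[of "b + e * K" "(1 + 4 * e) * b" t] by linarith
      also have "\<dots> = t * b + 4 * e * (t * b)" by (simp add: algebra_simps)
      also have "\<dots> \<le> f (set G) + 4 * e * (f Opt / 2)"
        using tG tb eps by (intro add_mono mult_left_mono) auto
      finally show ?thesis using V by (simp add: algebra_simps)
    next
      case False
      show ?thesis
      \<comment> \<open>Either low densities bound the value of \<open>Rest\<close>, and
        \<open>o1\<close> is charged to the best single item, or a dense item no longer fits and
        \<open>G'\<close> is nearly full.\<close>
      proof (cases "\<forall>x\<in>Rest. f (insert x (set G')) - f (set G') \<le> 4 * e * t * c x")
        case True
        then have "f Rest \<le> f (set G') + 4 * e * t * (\<Sum>x\<in>Rest. c x)"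
          by (intro cover_by_density) (use GU OU in auto)
        also have "\<dots> \<le> f (set G') + 4 * e * t * b"
          using cO' t(1) eps by (intro add_left_mono mult_left_mono) auto
        also have "\<dots> = f (set G') + 4 * e * (t * b)" by simp
        also have "\<dots> \<le> f (set G') + 4 * e * (f Opt / 2)"
          using tb eps by (intro add_left_mono mult_left_mono) auto
        finally show ?thesis using split V ef by (simp add: algebra_simps)
      next
        case False
        then obtain x where x: "x \<in> Rest" "\<not> f (insert x (set G')) - f (set G') \<le> 4 * e * t * c x"
          by auto
        moreover have "\<not> acc (4 * e * t) G' x" using G'(3) OU x by (auto simp: saturated_def)
        ultimately have "cost G' + c x > K" by (simp add: acc_def not_le)
        then have "cost G' > K - b" using cO'le[OF x(1)] by simp
        moreover have "e * K \<le> K / 4" using eps capacity_pos by (simp add: mult_right_mono)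
        \<comment> \<open>\<open>G'\<close> costs more than \<open>3 * K / 4\<close> and
          \<open>G\<close> less than \<open>K / 2\<close>, because \<open>b < K / 4\<close> and
          \<open>e \<le> 1/4\<close>.\<close>
        ultimately have "cost G' - cost G \<ge> K / 4"
          using cG \<open>\<not> K / 4 \<le> b\<close> by linarith
        then have "4 * e * t * (K / 4) \<le> 4 * e * t * (cost G' - cost G)"
          using eps t by (intro mult_left_mono) auto
        then have "t * b + t * (e * K) \<le> f (set G')" using G'(2) tG by (simp add: mult.commute mult.left_commute)
        then have "f Opt / 2 \<le> f (set G')" using tb by (simp add: algebra_simps)
        then show ?thesis using V ef by (simp add: algebra_simps)
      qed
    qed
  qed
qed

text \<open>With \<open>y = b * L / (e * K * OPT)\<close>, the two inequalities for
  \<open>t = L / (2 * e * K * k)\<close> say \<open>y \<le> k\<close> and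
  \<open>k \<le> y + L / OPT\<close>. This interval has length at least 1 and so contains an
  integer. As \<open>y \<le> a / e\<close>, the number of guesses is linear in
  \<open>1 / e\<close>.\<close>

lemma threshold_grid:
  assumes "0 < OPT" "OPT \<le> L" "L \<le> a * OPT" "0 \<le> b" "b \<le> K" "0 < e" "e \<le> 1"
  obtains k :: nat where "1 \<le> k" "real k \<le> 2 * a / e"
    "L / (2 * e * K * k) * b \<le> OPT / 2" "OPT / 2 \<le> L / (2 * e * K * k) * (b + e * K)"
proof -
  define y where "y = b * L / (e * K * OPT)"
  have K: "K > 0" by (rule capacity_pos)
  have y0: "0 \<le> y" using assms K by (simp add: y_def)
  \<comment> \<open>For \<open>y = 0\<close> the ceiling would be 0 and \<open>k\<close> would be no
    valid divisor; the value 1 still lies in the interval because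
    \<open>1 \<le> L / OPT\<close>.\<close>
  define k where "k = (if y = 0 then 1 else nat \<lceil>y\<rceil>)"
  have k1: "1 \<le> k" "y \<le> k"
    using y0 by (auto simp: k_def) linarith+
  have r: "1 \<le> L / OPT" "L / OPT \<le> a" using assms by (simp_all add: field_simps)
  have ky: "k \<le> y + L / OPT"
    using y0 r by (auto simp: k_def) linarith
  have "y = (b / K) * (L / OPT) / e" by (simp add: y_def)
  also have "\<dots> \<le> 1 * a / e" using assms K r
    by (intro divide_right_mono mult_mono) (auto simp: field_simps)
  finally have "y \<le> a / e" by simp
  moreover have "0 \<le> a" using r by linarith
  then have "a \<le> a / e" using assms(6,7) by (simp add: field_simps mult_left_le)
  ultimately have "k \<le> a / e + a / e" using ky r by linarith
  then have kb: "k \<le> 2 * a / e" by simp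
  have "b * L \<le> k * (e * K * OPT)"
    using k1(2) assms K by (simp add: y_def field_simps)
  then have 1: "L / (2 * e * K * k) * b \<le> OPT / 2"
    using assms K k1 by (simp add: field_simps)
  have "k * (e * K * OPT) \<le> b * L + L * (e * K)"
    using ky assms K by (simp add: y_def field_simps)
  then have 2: "OPT / 2 \<le> L / (2 * e * K * k) * (b + e * K)"
    using assms K k1 by (simp add: field_simps)
  show ?thesis using that[OF k1(1) kb 1 2] .
qed

section \<open>A streaming estimate of the optimum\<close>

text \<open>\<open>r\<close> is the value of the last list that became full. The threshold
  \<open>2 * r / K\<close> forces the next full list to at least double it, so the discarded values
  grow geometrically. A list reaching cost \<open>K\<close> is discarded at once, which keeps the
  current one strictly below the capacity; \<open>r + r\<close> mirrors the machine code.\<close>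

definition qstep :: "real \<times> 'a list \<Rightarrow> 'a \<Rightarrow> real \<times> 'a list" where
  "qstep st e = (case st of (r, S) \<Rightarrow>
     if (r + r) / K * c e < f (insert e (set S)) - f (set S)
     then if cost (S @ [e]) < K then (r, S @ [e]) else (f (set (S @ [e])), [])
     else (r, S))"

definition estimate :: "'a list \<Rightarrow> real" where
  "estimate xs = (case foldl qstep (0, []) xs of (r, S) \<Rightarrow> r + f (set S))"

text \<open>\<open>P\<close> collects the items of the discarded sets.\<close>

definition qinv :: "real \<Rightarrow> 'a set \<Rightarrow> 'a set \<Rightarrow> real \<times> 'a list \<Rightarrow> bool" where
  "qinv V ys P st \<longleftrightarrow> (case st of (r, S) \<Rightarrow>
     0 \<le> r \<and> r \<le> 2 * V \<and> P \<subseteq> E \<and> f P \<le> 2 * r + f {} \<and> good_list S \<and> cost S < K \<and>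
     (r + r) / K * cost S \<le> f (set S) \<and>
     (\<forall>e\<in>ys. f (insert e (P \<union> set S)) - f (P \<union> set S) \<le> (r + r) / K * c e))"

lemma marginal_insert_mono:
  assumes "S \<subseteq> T" "T \<subseteq> E" "e \<in> E"
  shows "f (insert e T) - f T \<le> f (insert e S) - f S"
  using submodular[of S T e] assms items_subset by auto

text \<open>A list that becomes full has cost at least \<open>K\<close> at density
  \<open>2 * r / K\<close>, so its value \<open>r'\<close> is at least \<open>2 * r\<close>, and
  \<open>f P + r'\<close> stays within \<open>2 * r' + f {}\<close>. Its last item may exceed the
  capacity, hence only \<open>r' \<le> 2 * V\<close>: the list before it and the item alone are
  feasible. Old density bounds survive because marginals shrink and the threshold rises.\<close>

lemma qinv_step:
  assumes inv: "qinv V ys P st" and x: "x \<in> E" and ys: "ys \<subseteq> E"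
    and V: "\<And>S. feasible E c K S \<Longrightarrow> f S \<le> V"
  shows "\<exists>P'. qinv V (insert x ys) P' (qstep st x)"
proof -
  obtain r S where st: "st = (r, S)" by (cases st)
  note i = inv[unfolded qinv_def st, simplified]
  have K: "K > 0" by (rule capacity_pos)
  define t where "t = (r + r) / K"
  have t0: "0 \<le> t" using i K by (simp add: t_def)
  have cx: "1 \<le> c x" "c x \<le> K" using cost_bounds[OF x] by auto
  have SE: "set S \<subseteq> E" "distinct S" using i by (auto simp: good_list_def)
  have SU: "set S \<subseteq> U" "P \<subseteq> U" "x \<in> U" using SE i x items_subset by auto
  show ?thesis
  proof (cases "t * c x < f (insert x (set S)) - f (set S)")
    case acc: True
    have xS: "x \<notin> set S"
    proof
      assume "x \<in> set S"
      then have "t * c x < 0" using acc by (simp add: insert_absorb)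
      then show False using t0 cx by (simp add: mult_less_0_iff)
    qed
    have val: "t * cost (S @ [x]) \<le> f (insert x (set S))"
      using acc i by (simp add: t_def algebra_simps add_divide_distrib)
    have dec: "f (insert e (P \<union> insert x (set S))) - f (P \<union> insert x (set S)) \<le> t * c e"
      if "e \<in> insert x ys" for e
    proof (cases "e = x")
      case True
      then show ?thesis using t0 cx by (simp add: insert_absorb)
    next
      case False
      then have "e \<in> ys" using that by auto
      have "f (insert e (P \<union> insert x (set S))) - f (P \<union> insert x (set S))
          \<le> f (insert e (P \<union> set S)) - f (P \<union> set S)"
        by (rule marginal_insert_mono) (use i SE x ys \<open>e \<in> ys\<close> in auto)
      also have "\<dots> \<le> t * c e" using i \<open>e \<in> ys\<close> by (auto simp: t_def)
      finally show ?thesis .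
    qed
    show ?thesis
    proof (cases "cost (S @ [x]) < K")
      case True
      then have "qinv V (insert x ys) P (r, S @ [x])"
        using i SE x xS val dec K cx by (auto simp: qinv_def good_list_def t_def)
      then show ?thesis using acc True by (auto simp: st qstep_def t_def)
    next
      case False
      define r' where "r' = f (insert x (set S))"
      have "f (insert x (set S)) \<le> f (set S) + f {x}"
        using subadditive[of "set S" "{x}"] SU by simp
      moreover have "f (set S) \<le> V" using V good_list_feasible i by blast
      moreover have "f {x} \<le> V" using V[of "{x}"] x cx by (simp add: feasible_def)
      ultimately have r'V: "r' \<le> 2 * V" by (simp add: r'_def)
      have "t * K \<le> t * cost (S @ [x])" using False t0 by (intro mult_left_mono) auto
      then have rr: "r + r \<le> r'" using val K by (simp add: t_def r'_def)
      have "f (P \<union> insert x (set S)) \<le> f P + r'"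
        unfolding r'_def by (rule subadditive) (use SU in auto)
      then have fP: "f (P \<union> insert x (set S)) \<le> 2 * r' + f {}" using i rr by simp
      have r0: "0 \<le> r'" unfolding r'_def by (rule nonneg) (use SU in auto)
      have tt: "t \<le> (r' + r') / K" using i rr K by (simp add: t_def divide_right_mono)
      have "qinv V (insert x ys) (P \<union> insert x (set S)) (r', [])"
        unfolding qinv_def prod.case
      proof (intro conjI ballI)
        fix e assume e: "e \<in> insert x ys"
        then have "t * c e \<le> (r' + r') / K * c e"
          using tt ys x cost_bounds[of e] by (intro mult_right_mono) auto
        then show "f (insert e (P \<union> insert x (set S) \<union> set [])) - f (P \<union> insert x (set S) \<union> set [])
            \<le> (r' + r') / K * c e"
          using dec[OF e] by simp
      qed (use i SE x r0 r'V fP nonneg[of "{}"] K cx in auto)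
      then show ?thesis using acc False by (auto simp: st qstep_def t_def r'_def)
    qed
  next
    case False
    have "f (insert x (P \<union> set S)) - f (P \<union> set S) \<le> f (insert x (set S)) - f (set S)"
      by (rule marginal_insert_mono) (use i SE x in auto)
    then have "qinv V (insert x ys) P (r, S)"
      using i False by (auto simp: qinv_def t_def)
    then show ?thesis using False by (auto simp: st qstep_def t_def)
  qed
qed

lemma qinv_foldl:
  assumes "qinv V ys P st" "set xs \<subseteq> E" "ys \<subseteq> E" "\<And>S. feasible E c K S \<Longrightarrow> f S \<le> V"
  shows "\<exists>P'. qinv V (ys \<union> set xs) P' (foldl qstep st xs)"
  using assms(1-3)
proof (induction xs arbitrary: ys P st)
  case (Cons x xs)
  obtain P' where "qinv V (insert x ys) P' (qstep st x)"
    using qinv_step[of V ys P st x] Cons.prems assms(4) by auto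
  then show ?case using Cons.IH[of "insert x ys" P' "qstep st x"] Cons.prems by auto
qed auto

text \<open>The factor 3 is \<open>r \<le> 2 * V\<close> plus \<open>f (set S) \<le> V\<close>. For
  the factor 4, the discarded items are worth at most \<open>2 * r + f {}\<close>, and everything
  seen has density at most \<open>2 * r / K\<close> over them and \<open>S\<close>, which adds
  another \<open>2 * r\<close>.\<close>

lemma estimate_bounds:
  assumes xs: "set xs \<subseteq> E" and V: "\<And>S. feasible E c K S \<Longrightarrow> f S \<le> V"
  shows "0 \<le> estimate xs" "estimate xs \<le> 3 * V"
    "\<And>S. S \<subseteq> set xs \<Longrightarrow> feasible E c K S \<Longrightarrow> f S \<le> 4 * estimate xs"
proof -
  have "0 \<le> V" using nonneg[of "{}"] V[of "{}"] capacity_pos by (simp add: feasible_def)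
  then have "qinv V {} {} (0, [])"
    using nonneg[of "{}"] capacity_pos by (simp add: qinv_def)
  then obtain P where P: "qinv V (set xs) P (foldl qstep (0, []) xs)"
    using qinv_foldl[of V "{}" "{}" "(0, [])" xs] xs V by auto
  obtain r S where rS: "foldl qstep (0, []) xs = (r, S)" by (cases "foldl qstep (0, []) xs")
  note i = P[unfolded qinv_def rS, simplified]
  have K: "K > 0" by (rule capacity_pos)
  have e: "estimate xs = r + f (set S)" by (simp add: estimate_def rS)
  have SU: "set S \<subseteq> U" "P \<subseteq> U" using i items_subset by (auto simp: good_list_def)
  have fS: "f (set S) \<le> V" "0 \<le> f (set S)" "f {} \<le> f (set S)"
    using V good_list_feasible i nonneg monotone[of "{}" "set S"] SU by auto
  show "0 \<le> estimate xs" "estimate xs \<le> 3 * V" using e i fS by auto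
  fix T assume T: "T \<subseteq> set xs" "feasible E c K T"
  have "f T \<le> f (P \<union> set S) + (r + r) / K * (\<Sum>e\<in>T. c e)"
    by (rule cover_by_density) (use T SU i in \<open>auto simp: feasible_def\<close>)
  also have "\<dots> \<le> (f P + f (set S)) + (r + r) / K * K"
    using T i K SU by (intro add_mono subadditive mult_left_mono) (auto simp: feasible_def)
  also have "\<dots> \<le> 4 * estimate xs" using i e fS K by simp
  finally show "f T \<le> 4 * estimate xs" .
qed

text \<open>No feasible set inside the sample \<open>D\<close> is worth more than
  \<open>4 * L1\<close>. At threshold \<open>8 * L1 / K\<close> its greedy list therefore costs at
  most \<open>K / 2\<close>, so an item of \<open>Opt\<close> that does not fit costs more than
  \<open>K / 2\<close>, and there is at most one. It is charged to \<open>v\<close>. The others are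
  acceptable, hence in \<open>X\<close>, or of low density; the latter contribute
  \<open>4 * L1\<close> for the list and \<open>8 * L1\<close> for threshold times capacity.\<close>

lemma optimum_estimate:
  assumes D: "set D \<subseteq> E" and X: "set X \<subseteq> E" and L1: "0 \<le> L1"
    and small: "\<And>S. S \<subseteq> set D \<Longrightarrow> feasible E c K S \<Longrightarrow> f S \<le> 4 * L1"
    and G: "G = foldl (ext (8 * L1 / K)) [] D"
    and alive: "\<And>e. e \<in> E \<Longrightarrow> acc (8 * L1 / K) G e \<Longrightarrow> e \<in> set X"
    and v: "\<And>e. e \<in> E \<Longrightarrow> f {e} \<le> v" "f {} \<le> v"
    and Opt: "feasible E c K Opt"
  shows "f Opt \<le> 12 * L1 + 4 * estimate X + v"
proof -
  define t where "t = 8 * L1 / K"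
  have K: "K > 0" by (rule capacity_pos)
  have t0: "0 \<le> t" "t * K = 8 * L1" using L1 K by (auto simp: t_def)
  have gl: "good_list G" using good_list_foldl_ext[of "[]" t D] t0 D by (simp add: G t_def)
  have GD: "set G \<subseteq> set D" using set_foldl_ext[of t "[]" D] by (simp add: G t_def)
  have fG: "f (set G) \<le> 4 * L1" using small[OF GD good_list_feasible[OF gl]] .
  have GU: "set G \<subseteq> U" using GD D items_subset by auto
  have OE: "Opt \<subseteq> E" "(\<Sum>e\<in>Opt. c e) \<le> K" "finite Opt"
    using Opt finite_subset[OF _ finite_items] by (auto simp: feasible_def)
  have sub: "feasible E c K S" if "S \<subseteq> Opt" for S
  proof -
    have "(\<Sum>e\<in>S. c e) \<le> (\<Sum>e\<in>Opt. c e)"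
      by (rule sum_mono2) (use OE that cost_bounds in force)+
    then show ?thesis using that OE by (auto simp: feasible_def)
  qed
  have cG: "2 * cost G \<le> K"
  \<comment> \<open>At threshold 0 the density bound says nothing about the cost. Instead, the value
    of \<open>G\<close> cannot exceed \<open>f {}\<close>, which forbids any acceptance.\<close>
  proof (cases "L1 = 0")
    case True
    then have "\<not> f (set G) > f {}" using fG nonneg[of "{}"] by auto
    then have "G = []" using foldl_ext_strict[of t D "[]"] t0 D by (auto simp: G t_def)
    then show ?thesis using K by simp
  next
    case False
    have "t * cost G \<le> f (set G)"
      using foldl_ext_value[of "[]" t D] t0 D nonneg[of "{}"] by (simp add: G t_def)
    then have "8 * L1 * cost G \<le> K * f (set G)" using K by (simp add: t_def field_simps)
    also have "\<dots> \<le> K * (4 * L1)" using fG K by (intro mult_left_mono) auto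
    finally have "8 * L1 * cost G \<le> 4 * L1 * K" by simp
    then show ?thesis using False L1 by simp
  qed
  define A where "A = {e \<in> Opt. acc t G e}"
  define B where "B = {e \<in> Opt. f (insert e (set G)) - f (set G) \<le> t * c e}"
  define Z where "Z = {e \<in> Opt. K < cost G + c e}"
  have OptABZ: "Opt = A \<union> B \<union> Z" by (auto simp: A_def B_def Z_def acc_def)
  have sets: "A \<subseteq> Opt" "B \<subseteq> Opt" "Z \<subseteq> Opt" by (auto simp: A_def B_def Z_def)
  have AX: "A \<subseteq> set X" using alive OE by (auto simp: A_def t_def)
  have ex: "\<exists>V. \<forall>S. feasible E c K S \<longrightarrow> f S \<le> V"
  proof -
    have "f S \<le> f E" if "feasible E c K S" for S
      by (rule monotone) (use that items_subset in \<open>auto simp: feasible_def\<close>)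
    then show ?thesis by blast
  qed
  then have fA: "f A \<le> 4 * estimate X" using estimate_bounds(3)[OF X _ AX] sub sets by blast
  have "f B \<le> f (set G) + t * (\<Sum>e\<in>B. c e)"
    by (rule cover_by_density) (use GU OE sets in \<open>auto simp: B_def\<close>)
  also have "\<dots> \<le> 4 * L1 + t * K"
    using fG sub[OF sets(2)] t0 by (intro add_mono mult_left_mono) (auto simp: feasible_def)
  finally have fB: "f B \<le> 12 * L1" using t0 by simp
  have fZ: "f Z \<le> v"
  proof (cases "Z = {}")
    case False
    then obtain z where z: "z \<in> Z" by auto
    have "Z = {z}"
    proof (rule ccontr)
      assume "Z \<noteq> {z}"
      then obtain y where y: "y \<in> Z" "y \<noteq> z" using z by auto
      have "(\<Sum>e\<in>{y, z}. c e) \<le> K"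
        using sub[of "{y,z}"] y z sets by (auto simp: feasible_def)
      then show False using y z cG by (auto simp: Z_def)
    qed
    then show ?thesis using v z sets OE by auto
  qed (use v in simp)
  have "f Opt \<le> f A + f B + f Z"
    using subadditive[of "A \<union> B" Z] subadditive[of A B] sets OE items_subset OptABZ
    by (smt (verit) subset_trans le_sup_iff)
  then show ?thesis using fA fB fZ by simp
qed

end

section \<open>Independent draws\<close>

definition draw :: "'a list \<Rightarrow> 'a pmf" where
  "draw X = map_pmf ((!) X) (pmf_of_set {..<length X})"

primrec draws :: "'a list list \<Rightarrow> 'a list pmf" where
  "draws [] = return_pmf []"
| "draws (X # Xs) = bind_pmf (draw X) (\<lambda>x. map_pmf ((#) x) (draws Xs))"

lemma set_draw: "X \<noteq> [] \<Longrightarrow> set_pmf (draw X) = set X"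
  by (subst draw_def) (auto simp: set_conv_nth lessThan_empty_iff)

lemma length_filter_mono:
  "(\<And>x. x \<in> set xs \<Longrightarrow> P x \<Longrightarrow> Q x) \<Longrightarrow> length (filter P xs) \<le> length (filter Q xs)"
  by (induction xs) auto

lemma draws_append:
  "draws (Xs @ Ys) = bind_pmf (draws Xs) (\<lambda>xs. map_pmf ((@) xs) (draws Ys))"
proof (induction Xs)
  case Nil
  have "(@) [] = (\<lambda>ys :: 'a list. ys)" by auto
  then show ?case by (simp add: bind_return_pmf)
next
  case (Cons X Xs)
  have "(@) (x # xs) = (\<lambda>ys :: 'a list. x # xs @ ys)" for x xs by auto
  then show ?case using Cons
    by (simp add: map_bind_pmf bind_map_pmf bind_assoc_pmf pmf.map_comp o_def)
qed

lemma set_draws: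
  assumes "[] \<notin> set Xs" "D \<in> set_pmf (draws Xs)"
  shows "set D \<subseteq> (\<Union>X\<in>set Xs. set X)" "length D = length Xs"
proof -
  have "set D \<subseteq> (\<Union>X\<in>set Xs. set X) \<and> length D = length Xs"
    using assms
  proof (induction Xs arbitrary: D)
    case (Cons X Xs)
    then show ?case using set_draw[of X] by fastforce
  qed simp
  then show "set D \<subseteq> (\<Union>X\<in>set Xs. set X)" "length D = length Xs" by auto
qed

lemma finite_set_draws: "[] \<notin> set Xs \<Longrightarrow> finite (set_pmf (draws Xs))"
  by (induction Xs) (auto simp: set_draw)

lemma expectation_draws_Cons:
  fixes h :: "'a list \<Rightarrow> real"
  assumes "X \<noteq> []" "[] \<notin> set Xs"
  shows "measure_pmf.expectation (draws (X # Xs)) h =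
    (\<Sum>i<length X. measure_pmf.expectation (draws Xs) (\<lambda>D. h (X ! i # D))) / length X"
proof -
  have "measure_pmf.expectation (draws (X # Xs)) h =
      (\<Sum>i\<in>{..<length X}. measure_pmf.expectation (map_pmf ((#) (X ! i)) (draws Xs)) h
         /\<^sub>R real (card {..<length X}))"
    using assms finite_set_draws[OF assms(2)]
    by (simp only: draws.simps draw_def bind_map_pmf)
      (subst pmf_expectation_bind_pmf_of_set, auto simp: lessThan_empty_iff)
  then show ?thesis by (simp add: sum_divide_distrib divide_inverse mult.commute sum_distrib_left)
qed

lemma sum_nth_of_bool_filter:
  "(\<Sum>i<length X. of_bool (P (X ! i))) = real (length (filter P X))"
proof -
  have "(\<Sum>i<length X. of_bool (P (X ! i))) = real (card {i. i < length X \<and> P (X ! i)})"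
    by (simp add: of_bool_def sum.If_cases Int_def)
  then show ?thesis by (simp add: length_filter_conv_card)
qed

lemma prob_bind:
  "measure_pmf.prob (bind_pmf p q) S = measure_pmf.expectation p (\<lambda>x. measure_pmf.prob (q x) S)"
proof -
  have "ennreal (measure_pmf.prob (bind_pmf p q) S) = (\<integral>\<^sup>+x. ennreal (measure_pmf.prob (q x) S) \<partial>measure_pmf p)"
    using emeasure_bind_pmf[of p q S] by (simp add: measure_pmf.emeasure_eq_measure)
  also have "\<dots> = ennreal (measure_pmf.expectation p (\<lambda>x. measure_pmf.prob (q x) S))"
    by (rule nn_integral_eq_integral)
      (auto intro!: measure_pmf.integrable_const_bound[where B = 1])
  finally show ?thesis by (simp add: integral_nonneg_AE)
qed

lemma integrable_prob: "integrable (measure_pmf p) (\<lambda>x. measure_pmf.prob (q x) S)"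
  by (rule measure_pmf.integrable_const_bound[where B = 1]) auto

lemma prob_mono_support:
  "(\<And>x. x \<in> set_pmf p \<Longrightarrow> x \<in> A \<Longrightarrow> x \<in> B) \<Longrightarrow> measure_pmf.prob p A \<le> measure_pmf.prob p B"
  by (rule measure_pmf.finite_measure_mono_AE) (auto simp: AE_measure_pmf_iff)

lemma integrable_indicator_mult: "integrable (measure_pmf p) (\<lambda>x. indicator X x * b :: real)"
  by (rule measure_pmf.integrable_const_bound[where B = "\<bar>b\<bar>"]) (auto simp: indicator_def)

lemma prob_bind_le_mult:
  assumes "0 \<le> b" "\<And>x. x \<in> set_pmf p \<Longrightarrow> x \<in> X \<Longrightarrow> measure_pmf.prob (q x) S \<le> b"
    "\<And>x. x \<in> set_pmf p \<Longrightarrow> x \<notin> X \<Longrightarrow> measure_pmf.prob (q x) S \<le> 0"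
  shows "measure_pmf.prob (bind_pmf p q) S \<le> measure_pmf.prob p X * b"
proof -
  have "measure_pmf.prob (bind_pmf p q) S \<le> measure_pmf.expectation p (\<lambda>x. indicator X x * b)"
    unfolding prob_bind
    by (rule integral_mono_AE[OF integrable_prob integrable_indicator_mult])
      (use assms in \<open>auto simp: AE_measure_pmf_iff indicator_def\<close>)
  then show ?thesis by simp
qed

text \<open>The union bound for consecutive rounds, by
  \<open>(1 - a) * (1 - b) \<ge> 1 - (a + b)\<close>. With \<open>b = 0\<close> it absorbs stages
  that succeed from every state in \<open>X\<close>.\<close>

lemma prob_bind_ge:
  assumes "1 - a \<le> measure_pmf.prob p X" "0 \<le> a" "0 \<le> b"
    "\<And>x. x \<in> set_pmf p \<Longrightarrow> x \<in> X \<Longrightarrow> 1 - b \<le> measure_pmf.prob (q x) S"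
  shows "1 - (a + b) \<le> measure_pmf.prob (bind_pmf p q) S"
proof (cases "b \<le> 1")
  case True
  have "measure_pmf.expectation p (\<lambda>x. indicator X x * (1 - b)) \<le> measure_pmf.prob (bind_pmf p q) S"
    unfolding prob_bind
    by (rule integral_mono_AE[OF integrable_indicator_mult integrable_prob])
      (use assms True in \<open>auto simp: AE_measure_pmf_iff indicator_def\<close>)
  then have "measure_pmf.prob p X * (1 - b) \<le> measure_pmf.prob (bind_pmf p q) S" by simp
  moreover have "(1 - a) * (1 - b) \<le> measure_pmf.prob p X * (1 - b)"
    using assms True by (intro mult_right_mono) auto
  moreover have "1 - (a + b) \<le> (1 - a) * (1 - b)" using assms by (simp add: algebra_simps)
  ultimately show ?thesis by linarith
next
  case False
  then show ?thesis using assms(2) measure_nonneg[of "measure_pmf (bind_pmf p q)" S] by linarith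
qed

section \<open>Expected number of survivors of a sampled greedy run\<close>

context submodular_knapsack
begin

text \<open>An item that would still be accepted at the end of the run would have been accepted at any
  earlier point, so each draw is accepted at least with the probability of hitting such an item.\<close>

lemma expected_survivors:
  assumes "0 \<le> t" "good_list G" "[] \<notin> set Xs" "\<And>X. X \<in> set Xs \<Longrightarrow> set X \<subseteq> E"
  shows "measure_pmf.expectation (draws Xs) (\<lambda>D. \<Sum>X\<leftarrow>Xs.
      real (length (filter (acc t (foldl (ext t) G D)) X)) / real (length X))
    \<le> measure_pmf.expectation (draws Xs) (\<lambda>D. real (length (foldl (ext t) G D)) - real (length G))"
  using assms(2-4)
proof (induction Xs arbitrary: G)
  case (Cons X Xs)
  let ?r = "\<lambda>G D Y. real (length (filter (acc t (foldl (ext t) G D)) Y)) / real (length Y)"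
  let ?n = "\<lambda>G D. real (length (foldl (ext t) G D))"
  have X: "X \<noteq> []" "[] \<notin> set Xs" "set X \<subseteq> E" using Cons.prems by auto
  have int: "integrable (measure_pmf (draws Xs)) (h :: 'a list \<Rightarrow> real)" for h
    by (rule integrable_measure_pmf_finite[OF finite_set_draws[OF X(2)]])
  \<comment> \<open>The final survivors of \<open>X\<close> are at most its items acceptable before
    this draw, as acceptability is only lost. The term \<open>of_bool\<close> accounts for the
    element by which the draw itself lengthens the list.\<close>
  have step: "measure_pmf.expectation (draws Xs) (\<lambda>D. \<Sum>Y\<leftarrow>X # Xs. ?r G (X ! i # D) Y)
      \<le> measure_pmf.expectation (draws Xs) (\<lambda>D. ?n G (X ! i # D) - real (length G))
        - of_bool (acc t G (X ! i)) + real (length (filter (acc t G) X)) / real (length X)"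
    if i: "i < length X" for i
  proof -
    let ?G = "ext t G (X ! i)"
    have xE: "X ! i \<in> E" using i X by auto
    have gG: "good_list ?G" using good_list_ext Cons.prems(1) assms(1) xE by blast
    have b: "?r ?G D X \<le> real (length (filter (acc t G) X)) / real (length X)"
      if D: "D \<in> set_pmf (draws Xs)" for D
    proof -
      have DE: "set (X ! i # D) \<subseteq> E" using set_draws(1)[OF X(2) D] Cons.prems(3) xE by auto
      have "length (filter (acc t (foldl (ext t) G (X ! i # D))) X) \<le> length (filter (acc t G) X)"
        using not_acc_foldl_ext[OF _ Cons.prems(1) assms(1) DE] X(3)
        by (intro length_filter_mono) auto
      then show ?thesis by (simp add: divide_right_mono)
    qed
    have "measure_pmf.expectation (draws Xs) (\<lambda>D. \<Sum>Y\<leftarrow>X # Xs. ?r G (X ! i # D) Y)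
        = measure_pmf.expectation (draws Xs) (\<lambda>D. ?r ?G D X)
          + measure_pmf.expectation (draws Xs) (\<lambda>D. \<Sum>Y\<leftarrow>Xs. ?r ?G D Y)"
      using int by simp
    also have "\<dots> \<le> measure_pmf.expectation (draws Xs) (\<lambda>D. real (length (filter (acc t G) X)) / real (length X))
          + measure_pmf.expectation (draws Xs) (\<lambda>D. ?n ?G D - real (length ?G))"
    proof (rule add_mono)
      show "measure_pmf.expectation (draws Xs) (\<lambda>D. ?r ?G D X)
          \<le> measure_pmf.expectation (draws Xs) (\<lambda>D. real (length (filter (acc t G) X)) / real (length X))"
        using b int by (intro integral_mono_AE) (auto simp: AE_measure_pmf_iff)
    qed (use Cons.IH[OF gG X(2)] Cons.prems(3) in auto)
    also have "measure_pmf.expectation (draws Xs) (\<lambda>D. ?n ?G D - real (length ?G))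
        = measure_pmf.expectation (draws Xs) (\<lambda>D. ?n G (X ! i # D) - real (length G))
          - of_bool (acc t G (X ! i))"
      using int by (simp add: ext_def)
    finally show ?thesis by simp
  qed
  have "measure_pmf.expectation (draws (X # Xs)) (\<lambda>D. \<Sum>Y\<leftarrow>X # Xs. ?r G D Y)
     \<le> (\<Sum>i<length X. measure_pmf.expectation (draws Xs) (\<lambda>D. ?n G (X ! i # D) - real (length G))
        - of_bool (acc t G (X ! i)) + real (length (filter (acc t G) X)) / real (length X)) / length X"
    unfolding expectation_draws_Cons[OF X(1,2)]
    by (intro divide_right_mono sum_mono step) auto
  \<comment> \<open>Averaged over the draw, the probability of acceptance equals the acceptable
    fraction of \<open>X\<close>, so the two correction terms cancel.\<close>
  also have "\<dots> = measure_pmf.expectation (draws (X # Xs)) (\<lambda>D. ?n G D - real (length G))"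
    unfolding expectation_draws_Cons[OF X(1,2)] using X(1)
    by (simp add: sum.distrib sum_subtractf sum_nth_of_bool_filter del: of_bool_eq_iff)
  finally show ?case .
qed simp

text \<open>In \<open>expected_survivors\<close> each of the \<open>B\<close> copies of
  \<open>inp i\<close> weighs its survivors by \<open>1 / length (inp i)\<close>, which is at least
  \<open>1 / Lm\<close>. So \<open>B / Lm\<close> times the expected total is at most the expected
  growth of the list, which is at most \<open>Ktilde E K \<le> B\<close>. The expectation is
  therefore at most \<open>Lm\<close>, the input size of a single machine.\<close>

lemma survivors_Markov:
  fixes B m :: nat and lim Lm :: real and inp :: "nat \<Rightarrow> 'a list"
  defines "Xs \<equiv> concat (map (\<lambda>i. if inp i = [] then [] else replicate B (inp i)) [0..<m])"
  assumes t: "0 \<le> t" and G: "good_list G" and inp: "\<And>i. i < m \<Longrightarrow> set (inp i) \<subseteq> E"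
    and Lm: "\<And>i. i < m \<Longrightarrow> real (length (inp i)) \<le> Lm" "0 < Lm"
    and B: "0 < B" "Ktilde E K \<le> real B" and lim: "0 < lim"
  shows "measure_pmf.prob (draws Xs)
    {D. lim < (\<Sum>i<m. real (length (filter (acc t (foldl (ext t) G D)) (inp i))))} \<le> Lm / lim"
proof -
  define N where "N D = (\<Sum>i<m. real (length (filter (acc t (foldl (ext t) G D)) (inp i))))" for D
  have ne: "[] \<notin> set Xs" by (auto simp: Xs_def)
  have XE: "\<And>X. X \<in> set Xs \<Longrightarrow> set X \<subseteq> E"
    using inp by (fastforce simp: Xs_def split: if_splits)
  have int: "integrable (measure_pmf (draws Xs)) (h :: 'a list \<Rightarrow> real)" for h
    by (rule integrable_measure_pmf_finite[OF finite_set_draws[OF ne]])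
  have sumXs: "(\<Sum>X\<leftarrow>Xs. h X) = (\<Sum>i<m. if inp i = [] then 0 else real B * h (inp i))"
    for h :: "'a list \<Rightarrow> real"
  proof -
    have "(\<Sum>X\<leftarrow>Xs. h X) = (\<Sum>i\<leftarrow>[0..<m]. if inp i = [] then 0 else real B * h (inp i))"
      unfolding Xs_def by (induction m) (auto simp: sum_list_replicate)
    then show ?thesis by (simp add: interv_sum_list_conv_sum_set_nat atLeast0LessThan)
  qed
  have "B / Lm * N D \<le> (\<Sum>X\<leftarrow>Xs. real (length (filter (acc t (foldl (ext t) G D)) X)) / real (length X))" for D
    unfolding sumXs N_def sum_distrib_left
  proof (rule sum_mono)
    fix i assume i: "i \<in> {..<m}"
    show "B / Lm * real (length (filter (acc t (foldl (ext t) G D)) (inp i)))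
        \<le> (if inp i = [] then 0 else real B * (real (length (filter (acc t (foldl (ext t) G D)) (inp i))) / real (length (inp i))))"
      using Lm(1)[of i] Lm(2) i by (auto intro!: divide_left_mono mult_pos_pos)
  qed
  then have "measure_pmf.expectation (draws Xs) (\<lambda>D. B / Lm * N D)
      \<le> measure_pmf.expectation (draws Xs) (\<lambda>D. \<Sum>X\<leftarrow>Xs. real (length (filter (acc t (foldl (ext t) G D)) X)) / real (length X))"
    by (intro integral_mono int)
  also have "\<dots> \<le> measure_pmf.expectation (draws Xs) (\<lambda>D. real (length (foldl (ext t) G D)) - real (length G))"
    by (rule expected_survivors[OF t G ne XE])
  also have "\<dots> \<le> measure_pmf.expectation (draws Xs) (\<lambda>D. Ktilde E K)"
  proof (rule integral_mono_AE[OF int int], unfold AE_measure_pmf_iff, intro ballI)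
    fix D assume "D \<in> set_pmf (draws Xs)"
    then have "set D \<subseteq> E" using set_draws(1)[OF ne] XE by blast
    then show "real (length (foldl (ext t) G D)) - real (length G) \<le> Ktilde E K"
      using length_good_list[OF good_list_foldl_ext[OF G t]] by fastforce
  qed
  finally have "B / Lm * measure_pmf.expectation (draws Xs) N \<le> B" using B by simp
  then have EN: "measure_pmf.expectation (draws Xs) N \<le> Lm" using B Lm(2) by (simp add: field_simps)
  have "measure_pmf.prob (draws Xs) {D. lim < N D} \<le> measure_pmf.prob (draws Xs) {D \<in> space (measure_pmf (draws Xs)). lim \<le> N D}"
    by (rule measure_pmf.finite_measure_mono) auto
  also have "\<dots> \<le> measure_pmf.expectation (draws Xs) N / lim"
    by (rule integral_Markov_inequality_measure[where A = UNIV])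
      (use lim int in \<open>auto simp: N_def intro!: sum_nonneg\<close>)
  also have "\<dots> \<le> Lm / lim" using EN lim by (intro divide_right_mono) auto
  finally show ?thesis by (simp add: N_def)
qed

end

section \<open>Quantiles and the regrouping of samples\<close>

lemma quantile:
  fixes h :: "'b \<Rightarrow> real"
  assumes "finite (set_pmf p)" "0 \<le> d" "d \<le> 1"
  obtains x where "measure_pmf.prob p {y. x < h y} \<le> d" "d \<le> measure_pmf.prob p {y. x \<le> h y}"
proof -
  \<comment> \<open>The witness is the least value on the support whose strict upper tail has
    probability at most \<open>d\<close>.\<close>
  define X where "X = {x \<in> h ` set_pmf p. measure_pmf.prob p {y. x < h y} \<le> d}"
  have fin: "finite X" using assms(1) by (simp add: X_def)
  let ?M = "Max (h ` set_pmf p)"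
  have "?M \<in> h ` set_pmf p" by (rule Max_in) (use assms(1) set_pmf_not_empty in auto)
  moreover have "h y \<le> ?M" if "y \<in> set_pmf p" for y using that assms(1) by simp
  then have "set_pmf p \<inter> {y. ?M < h y} = {}" using leD by blast
  then have "measure_pmf.prob p {y. ?M < h y} = 0" by (subst measure_pmf_zero_iff)
  ultimately have "?M \<in> X" using assms by (simp add: X_def)
  then have ne: "X \<noteq> {}" by auto
  define x where "x = Min X"
  have xX: "x \<in> X" using Min_in[OF fin ne] by (simp add: x_def)
  define Y where "Y = {z \<in> h ` set_pmf p. z < x}"
  show ?thesis
  proof (cases "Y = {}")
    case True
    then have "measure_pmf.prob p {y. x \<le> h y} = 1"
      by (subst measure_pmf.prob_eq_1) (auto simp: AE_measure_pmf_iff Y_def not_less)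
    then show ?thesis using that[of x] xX assms by (auto simp: X_def)
  next
    case False
    have finY: "finite Y" using assms(1) by (simp add: Y_def)
    \<comment> \<open>The value just below \<open>x\<close> violates the tail condition by
      minimality, and its strict upper tail is the weak upper tail of \<open>x\<close>.\<close>
    define z where "z = Max Y"
    have z: "z \<in> Y" using Max_in[OF finY False] by (simp add: z_def)
    then have "z \<notin> X" using Min_le[OF fin, of z] by (auto simp: Y_def x_def)
    then have "d < measure_pmf.prob p {y. z < h y}" using z by (auto simp: X_def Y_def)
    also have "\<dots> \<le> measure_pmf.prob p {y. x \<le> h y}"
    proof (rule prob_mono_support)
      show "y \<in> {y. x \<le> h y}" if "y \<in> set_pmf p" "y \<in> {y. z < h y}" for y
      proof (rule ccontr)
        assume "\<not> ?thesis"
        then have "h y \<in> Y" using that by (auto simp: Y_def)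
        then show False using Max_ge[OF finY, of "h y"] that by (simp add: z_def)
      qed
    qed
    finally show ?thesis using that[of x] xX by (auto simp: X_def)
  qed
qed

text \<open>Forgetting the order makes the distribution depend only on the multiset of lists drawn
  from. The large sample, which is ordered by machine, can then be regrouped into independent
  ordinary samples.\<close>

definition draw_set :: "'a list list \<Rightarrow> 'a set pmf" where
  "draw_set Xs = map_pmf set (draws Xs)"

lemma draw_set_append:
  "draw_set (Xs @ Ys) = bind_pmf (draw_set Xs) (\<lambda>A. map_pmf (\<lambda>B. A \<union> B) (draw_set Ys))"
  by (simp add: draw_set_def draws_append map_bind_pmf bind_map_pmf pmf.map_comp o_def)

lemma draw_set_append_commute: "draw_set (Xs @ Ys) = draw_set (Ys @ Xs)"
  unfolding draw_set_append map_pmf_def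
  by (subst bind_commute_pmf) (simp add: Un_commute)

lemma draw_set_mset_cong: "mset Xs = mset Ys \<Longrightarrow> draw_set Xs = draw_set Ys"
proof (induction Xs arbitrary: Ys)
  case (Cons X Xs)
  then have "X \<in> set Ys" by (metis list.set_intros(1) set_mset_mset)
  then obtain As Bs where Ys: "Ys = As @ X # Bs" by (auto simp: in_set_conv_decomp)
  have "draw_set Xs = draw_set (As @ Bs)" using Cons Ys by auto
  also have "\<dots> = draw_set (Bs @ As)" by (rule draw_set_append_commute)
  finally have "draw_set ([X] @ Xs) = draw_set ([X] @ (Bs @ As))" by (simp only: draw_set_append)
  also have "\<dots> = draw_set ((X # Bs) @ As)" by simp
  also have "\<dots> = draw_set (As @ (X # Bs))" by (rule draw_set_append_commute)
  finally show ?case using Ys by simp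
qed simp

text \<open>As \<open>h\<close> grows under union, the whole sample stays below \<open>x\<close>
  only if each of the \<open>T\<close> independent blocks does, which has probability at most
  \<open>1 - d\<close> per block. The remaining lists \<open>Rs\<close> can only help.\<close>

lemma draw_set_repeat:
  fixes h :: "'a set \<Rightarrow> real"
  assumes mono: "\<And>A B. A \<subseteq> B \<Longrightarrow> B \<subseteq> E \<Longrightarrow> h A \<le> h B"
    and Ys: "[] \<notin> set Ys" "\<And>X. X \<in> set Ys \<Longrightarrow> set X \<subseteq> E"
    and Rs: "[] \<notin> set Rs" "\<And>X. X \<in> set Rs \<Longrightarrow> set X \<subseteq> E"
    and d: "0 \<le> d" "d \<le> 1" "d \<le> measure_pmf.prob (draw_set Ys) {A. x \<le> h A}"
  shows "measure_pmf.prob (draw_set (concat (replicate T Ys) @ Rs)) {A. h A < x} \<le> (1 - d) ^ T"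
proof (induction T)
  case (Suc T)
  let ?Zs = "concat (replicate T Ys) @ Rs"
  have sub: "A \<subseteq> E" if "A \<in> set_pmf (draw_set Xs)" "[] \<notin> set Xs" "\<And>X. X \<in> set Xs \<Longrightarrow> set X \<subseteq> E"
    for A Xs
    using that set_draws(1)[of Xs] by (fastforce simp: draw_set_def)
  have Zs: "[] \<notin> set ?Zs" "\<And>X. X \<in> set ?Zs \<Longrightarrow> set X \<subseteq> E" using Ys Rs by auto
  have 1: "measure_pmf.prob (draw_set Ys) {A. h A < x} \<le> 1 - d"
  proof -
    have "measure_pmf.prob (draw_set Ys) {A. h A < x} = 1 - measure_pmf.prob (draw_set Ys) {A. x \<le> h A}"
      by (subst measure_pmf.prob_compl[symmetric]) (auto intro!: arg_cong2[where f = measure])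
    then show ?thesis using d by simp
  qed
  have "measure_pmf.prob (draw_set (Ys @ ?Zs)) {A. h A < x}
      \<le> measure_pmf.prob (draw_set Ys) {A. h A < x} * (1 - d) ^ T"
    unfolding draw_set_append[of Ys]
  proof (rule prob_bind_le_mult)
    fix A assume A: "A \<in> set_pmf (draw_set Ys)"
    have AE: "A \<subseteq> E" using sub[OF A Ys] .
    have m: "h A \<le> h (A \<union> B)" "h B \<le> h (A \<union> B)" if "B \<in> set_pmf (draw_set ?Zs)" for B
      using mono sub[OF that Zs] AE by auto
    have "measure_pmf.prob (map_pmf (\<lambda>B. A \<union> B) (draw_set ?Zs)) {A. h A < x}
        \<le> measure_pmf.prob (draw_set ?Zs) {A. h A < x}"
      unfolding measure_map_pmf by (rule prob_mono_support) (use m in force)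
    then show "measure_pmf.prob (map_pmf (\<lambda>B. A \<union> B) (draw_set ?Zs)) {A. h A < x} \<le> (1 - d) ^ T"
      using Suc by linarith
    assume "A \<notin> {A. h A < x}"
    then have "\<not> h (A \<union> B) < x" if "B \<in> set_pmf (draw_set ?Zs)" for B using m(1)[OF that] by auto
    then show "measure_pmf.prob (map_pmf (\<lambda>B. A \<union> B) (draw_set ?Zs)) {A. h A < x} \<le> 0"
      unfolding measure_map_pmf by (intro eq_refl, subst measure_pmf_zero_iff) auto
  qed (use d in auto)
  also have "\<dots> \<le> (1 - d) * (1 - d) ^ T" using 1 d by (intro mult_right_mono) auto
  finally show ?case by simp
qed simp

section \<open>Reasoning about programs\<close>

text \<open>A function for symbolic evaluation. Its value on \<open>Random\<close> is a dummy that
  the condition \<open>det\<close> keeps out of every rule.\<close>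

fun det_exec :: "('a set \<Rightarrow> real) \<Rightarrow> ('a \<Rightarrow> real) \<Rightarrow> instr \<Rightarrow> 'a machine \<Rightarrow> 'a machine" where
  "det_exec f c (ConstN a k) s = put a (NatW k) s"
| "det_exec f c (ConstR a x) s = put a (RealW x) s"
| "det_exec f c (Move a b) s = put a (get s b) s"
| "det_exec f c (Arith opr a b d) s = put a (arith_word opr (get s b) (get s d)) s"
| "det_exec f c (ToReal a b) s = put a (case get s b of NatW k \<Rightarrow> RealW (real k) | _ \<Rightarrow> NatW 0) s"
| "det_exec f c (Load a b) s = put a (case get s b of NatW k \<Rightarrow> get s k | _ \<Rightarrow> NatW 0) s"
| "det_exec f c (Store a b) s = (case get s a of NatW k \<Rightarrow> put k (get s b) s | _ \<Rightarrow> s)"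
| "det_exec f c (Cost a b) s = put a (case get s b of ItemW e \<Rightarrow> RealW (c e) | _ \<Rightarrow> NatW 0) s"
| "det_exec f c (TapeInsert a) s =
     (case get s a of ItemW e \<Rightarrow> s\<lparr>tape := insert e (tape s)\<rparr> | _ \<Rightarrow> s)"
| "det_exec f c (TapeDelete a) s =
     (case get s a of ItemW e \<Rightarrow> s\<lparr>tape := tape s - {e}\<rparr> | _ \<Rightarrow> s)"
| "det_exec f c (Query a) s = put a (RealW (f (tape s))) (s\<lparr>queries := Suc (queries s)\<rparr>)"
| "det_exec f c (Random a b) s = s"
| "det_exec f c (InboxLength a) s = put a (NatW (length (inbox s))) s"
| "det_exec f c (Receive a b) s =
     put a (case get s b of NatW k \<Rightarrow> if k < length (inbox s) then inbox s ! k else NatW 0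
                           | _ \<Rightarrow> NatW 0) s"
| "det_exec f c (Send a b) s =
     (case get s a of NatW k \<Rightarrow> s\<lparr>outbox := outbox s @ [(k, get s b)]\<rparr> | _ \<Rightarrow> s)"
| "det_exec f c (Output a) s =
     (case get s a of ItemW e \<Rightarrow> s\<lparr>solution := insert e (solution s)\<rparr> | _ \<Rightarrow> s)"

fun det :: "instr \<Rightarrow> bool" where
  "det (Random a b) = False"
| "det _ = True"

lemma exec_det: "det i \<Longrightarrow> exec f c i s = return_pmf (det_exec f c i s)"
  by (cases i) auto

lemma steps_Suc_front: "steps f c (Suc t) x = bind_pmf (step f c x) (steps f c t)"
proof (induction t arbitrary: x)
  case (Suc t)
  have "steps f c (Suc (Suc t)) x = bind_pmf (steps f c (Suc t) x) (step f c)" by simp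
  also have "\<dots> = bind_pmf (step f c x) (\<lambda>y. bind_pmf (steps f c t y) (step f c))"
    unfolding Suc by (simp add: bind_assoc_pmf)
  finally show ?case by simp
next
  case 0
  have "steps f c 0 = return_pmf" by auto
  then show ?case by (simp add: bind_return_pmf bind_return_pmf')
qed

lemma steps_add: "steps f c (t + u) x = bind_pmf (steps f c t x) (steps f c u)"
proof (induction t arbitrary: x)
  case (Suc t)
  show ?case unfolding add_Suc steps_Suc_front Suc by (simp add: bind_assoc_pmf)
qed (simp add: bind_return_pmf)

lemma steps_halted: "steps f c t ([], s) = return_pmf ([], s)"
  by (induction t) (simp_all add: bind_return_pmf)

text \<open>The running time \<open>t\<close> is the same for all random choices, so that runs can be composed although
  the machines execute a fixed number of steps per round.\<close>

definition runs :: "('a set \<Rightarrow> real) \<Rightarrow> ('a \<Rightarrow> real) \<Rightarrow> program \<Rightarrow> 'a machine \<Rightarrow> nat \<Rightarrow> 'a machine pmf \<Rightarrow> bool"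
  where "runs f c p s t D \<longleftrightarrow> (\<forall>q. steps f c t (p @ q, s) = map_pmf (Pair q) D)"

lemma runs_Nil: "runs f c [] s 0 (return_pmf s)"
  by (simp add: runs_def)

lemma runs_Basic:
  assumes "\<And>s'. s' \<in> set_pmf (exec f c i s) \<Longrightarrow> runs f c p s' t (D s')"
  shows "runs f c (Basic i # p) s (Suc t) (bind_pmf (exec f c i s) D)"
  unfolding runs_def
proof
  fix q
  have "steps f c (Suc t) ((Basic i # p) @ q, s) = bind_pmf (exec f c i s) (\<lambda>s'. steps f c t (p @ q, s'))"
    unfolding steps_Suc_front by (simp add: bind_map_pmf)
  also have "\<dots> = bind_pmf (exec f c i s) (\<lambda>s'. map_pmf (Pair q) (D s'))"
    by (rule bind_pmf_cong[OF refl]) (use assms in \<open>auto simp: runs_def\<close>)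
  finally show "steps f c (Suc t) ((Basic i # p) @ q, s) = map_pmf (Pair q) (bind_pmf (exec f c i s) D)"
    by (simp only: map_bind_pmf)
qed

lemma runs_Basic_det:
  "det i \<Longrightarrow> runs f c p (det_exec f c i s) t D \<Longrightarrow> runs f c (Basic i # p) s (Suc t) D"
  using runs_Basic[of f c i s p t "\<lambda>_. D"] by (simp add: exec_det bind_return_pmf)

lemma runs_Cond:
  "runs f c ((if holds b s then p else q) @ r) s t D \<Longrightarrow> runs f c (Cond b p q # r) s (Suc t) D"
  unfolding runs_def steps_Suc_front by (auto simp: bind_return_pmf split: if_splits)

lemma runs_Loop:
  "runs f c (if holds b s then p @ Loop b p # r else r) s t D \<Longrightarrow> runs f c (Loop b p # r) s (Suc t) D"
  unfolding runs_def steps_Suc_front by (auto simp: bind_return_pmf split: if_splits)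

lemma runs_append:
  assumes "runs f c p s t D" "\<And>s'. s' \<in> set_pmf D \<Longrightarrow> runs f c q s' u (D' s')"
  shows "runs f c (p @ q) s (t + u) (bind_pmf D D')"
  unfolding runs_def
proof
  fix r
  have "steps f c (t + u) ((p @ q) @ r, s) = bind_pmf D (\<lambda>s'. steps f c u (q @ r, s'))"
    using assms(1)[unfolded runs_def, rule_format, of "q @ r"] by (simp add: steps_add bind_map_pmf)
  also have "\<dots> = bind_pmf D (\<lambda>s'. map_pmf (Pair r) (D' s'))"
    by (rule bind_pmf_cong[OF refl]) (use assms(2) in \<open>auto simp: runs_def\<close>)
  finally show "steps f c (t + u) ((p @ q) @ r, s) = map_pmf (Pair r) (bind_pmf D D')"
    by (simp only: map_bind_pmf)
qed

definition achieves ::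
  "('a set \<Rightarrow> real) \<Rightarrow> ('a \<Rightarrow> real) \<Rightarrow> program \<Rightarrow> 'a machine \<Rightarrow> (nat \<Rightarrow> 'a machine \<Rightarrow> bool) \<Rightarrow> bool" where
  "achieves f c p s Q \<longleftrightarrow> (\<exists>t s'. runs f c p s t (return_pmf s') \<and> Q t s')"

text \<open>The final state is a function \<open>h\<close> of a sample from a named distribution
  \<open>d\<close>. Thus postconditions can refer to the sample, and probabilities can be computed
  for \<open>d\<close> alone.\<close>

definition achieves_random ::
  "('a set \<Rightarrow> real) \<Rightarrow> ('a \<Rightarrow> real) \<Rightarrow> program \<Rightarrow> 'a machine \<Rightarrow> 'b pmf \<Rightarrow>
   (nat \<Rightarrow> 'b \<Rightarrow> 'a machine \<Rightarrow> bool) \<Rightarrow> bool" where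
  "achieves_random f c p s d Q \<longleftrightarrow>
     (\<exists>t h. runs f c p s t (map_pmf h d) \<and> (\<forall>x\<in>set_pmf d. Q t x (h x)))"

lemma achieves_Nil: "Q 0 s \<Longrightarrow> achieves f c [] s Q"
  unfolding achieves_def using runs_Nil by blast

lemma achieves_Loop:
  "achieves f c (if holds b s then p @ Loop b p # r else r) s (\<lambda>t. Q (Suc t)) \<Longrightarrow>
   achieves f c (Loop b p # r) s Q"
  unfolding achieves_def using runs_Loop by blast

lemma achieves_append:
  assumes "achieves f c p s (\<lambda>t s'. achieves f c q s' (\<lambda>u. Q (t + u)))"
  shows "achieves f c (p @ q) s Q"
proof -
  obtain t s' u s'' where "runs f c p s t (return_pmf s')" "runs f c q s' u (return_pmf s'')" "Q (t + u) s''"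
    using assms by (auto simp: achieves_def)
  then show ?thesis using runs_append[of f c p s t "return_pmf s'" q u "\<lambda>_. return_pmf s''"]
    by (auto simp: achieves_def bind_return_pmf)
qed

lemma achieves_mono:
  "achieves f c p s Q \<Longrightarrow> (\<And>t s'. Q t s' \<Longrightarrow> R t s') \<Longrightarrow> achieves f c p s R"
  unfolding achieves_def by blast

lemma achieves_seq:
  assumes "achieves f c p s P" "\<And>t s'. P t s' \<Longrightarrow> achieves f c q s' (\<lambda>u. Q (t + u))"
  shows "achieves f c (p @ q) s Q"
  by (rule achieves_append, rule achieves_mono[OF assms(1)], rule assms(2))

lemma achieves_random_det:
  "achieves f c p s (\<lambda>t s'. Q t () s') \<Longrightarrow> achieves_random f c p s (return_pmf ()) Q"
  unfolding achieves_def achieves_random_def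
proof (elim exE conjE)
  fix t s' assume "runs f c p s t (return_pmf s')" "Q t () s'"
  then show "\<exists>t h. runs f c p s t (map_pmf h (return_pmf ())) \<and> (\<forall>x\<in>set_pmf (return_pmf ()). Q t x (h x))"
    by (intro exI[of _ t] exI[of _ "\<lambda>_. s'"]) simp
qed

lemma achieves_random_seq:
  assumes "achieves f c p s P" "\<And>t s'. P t s' \<Longrightarrow> achieves_random f c q s' d (\<lambda>u. Q (t + u))"
  shows "achieves_random f c (p @ q) s d Q"
proof -
  obtain t s' where 1: "runs f c p s t (return_pmf s')" "P t s'" using assms(1) by (auto simp: achieves_def)
  then obtain u h where "runs f c q s' u (map_pmf h d)" "\<forall>x\<in>set_pmf d. Q (t + u) x (h x)"
    using assms(2)[OF 1(2)] unfolding achieves_random_def by blast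
  then show ?thesis using runs_append[of f c p s t "return_pmf s'" q u "\<lambda>_. map_pmf h d"] 1
    by (auto simp: achieves_random_def bind_return_pmf)
qed

lemma achieves_random_Cond:
  "achieves_random f c ((if holds b s then p else q) @ r) s d (\<lambda>t. Q (Suc t)) \<Longrightarrow>
   achieves_random f c (Cond b p q # r) s d Q"
  unfolding achieves_random_def using runs_Cond by blast

lemma achieves_random_Basic:
  "det i \<Longrightarrow> achieves_random f c p (det_exec f c i s) d (\<lambda>t. Q (Suc t)) \<Longrightarrow>
   achieves_random f c (Basic i # p) s d Q"
  unfolding achieves_random_def using runs_Basic_det by blast

lemma achieves_random_mono:
  "achieves_random f c p s d Q \<Longrightarrow> (\<And>t x s'. x \<in> set_pmf d \<Longrightarrow> Q t x s' \<Longrightarrow> R t x s') \<Longrightarrow>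
   achieves_random f c p s d R"
  unfolding achieves_random_def by blast

text \<open>The potential \<open>\<Phi>\<close> pays for inner loops whose cost is amortized over the iterations.\<close>

lemma achieves_for:
  assumes "I 0 s" "\<And>s. I n s \<Longrightarrow> \<not> holds b s"
    "\<And>i s. i < n \<Longrightarrow> I i s \<Longrightarrow> holds b s \<and>
       achieves f c p s (\<lambda>t s'. I (Suc i) s' \<and> t + \<Phi> s' \<le> \<Phi> s + (k :: nat))"
  shows "achieves f c [Loop b p] s (\<lambda>t s'. I n s' \<and> t + \<Phi> s' \<le> \<Phi> s + n * (k + 1) + 1)"
proof -
  have "achieves f c [Loop b p] s (\<lambda>t s'. I n s' \<and> t + \<Phi> s' \<le> \<Phi> s + (n - i) * (k + 1) + 1)"
    if "i \<le> n" "I i s" for i s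
    using that
  proof (induction "n - i" arbitrary: i s)
    case 0
    then show ?case using assms(2) by (intro achieves_Loop) (auto intro!: achieves_Nil)
  next
    case (Suc j)
    then have i: "i < n" by simp
    have h: "holds b s" and a: "achieves f c p s (\<lambda>t s'. I (Suc i) s' \<and> t + \<Phi> s' \<le> \<Phi> s + k)"
      using assms(3)[OF i Suc.prems(2)] by auto
    have "achieves f c (p @ [Loop b p]) s (\<lambda>t s'. I n s' \<and> Suc t + \<Phi> s' \<le> \<Phi> s + (n - i) * (k + 1) + 1)"
    proof (rule achieves_seq[OF a])
      fix t s' assume P: "I (Suc i) s' \<and> t + \<Phi> s' \<le> \<Phi> s + k"
      have "achieves f c [Loop b p] s' (\<lambda>u s''. I n s'' \<and> u + \<Phi> s'' \<le> \<Phi> s' + (n - Suc i) * (k + 1) + 1)"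
        by (rule Suc.hyps(1)) (use Suc.hyps(2) P i in auto)
      moreover have "(n - i) * (k + 1) = (n - Suc i) * (k + 1) + (k + 1)"
        using i by (metis Suc_diff_Suc mult_Suc add.commute)
      ultimately show "achieves f c [Loop b p] s' (\<lambda>u s''. I n s'' \<and> Suc (t + u) + \<Phi> s'' \<le> \<Phi> s + (n - i) * (k + 1) + 1)"
        using P by (elim achieves_mono) auto
    qed
    then show ?case using h by (intro achieves_Loop) simp
  qed
  from this[of 0 s] show ?thesis using assms(1) by simp
qed

lemma achieves_for_const:
  assumes "I 0 s" "\<And>s. I n s \<Longrightarrow> \<not> holds b s"
    "\<And>i s. i < n \<Longrightarrow> I i s \<Longrightarrow> holds b s \<and> achieves f c p s (\<lambda>t s'. I (Suc i) s' \<and> t \<le> k)"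
  shows "achieves f c [Loop b p] s (\<lambda>t s'. I n s' \<and> t \<le> n * (k + 1) + 1)"
  using achieves_for[of I s n b f c p "\<lambda>_. 0" k] assms by simp

section \<open>Resource bounds of a run\<close>

text \<open>All of \<open>memory_used\<close> except the addressable cells. It grows by at most 1
  per step, so the running time bounds it.\<close>

definition load :: "'a machine \<Rightarrow> nat" where
  "load s = card (tape s) + length (inbox s) + length (outbox s) + card (solution s)"

lemma card_insert_le_Suc: "card (insert x A) \<le> Suc (card A)"
  by (cases "finite A") (auto simp: card_insert_if)

lemma load_update:
  "load (s\<lparr>tape := insert e (tape s)\<rparr>) \<le> Suc (load s)"
  "load (s\<lparr>tape := tape s - {e}\<rparr>) \<le> Suc (load s)"
  "load (s\<lparr>outbox := outbox s @ [x]\<rparr>) \<le> Suc (load s)"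
  "load (s\<lparr>solution := insert e (solution s)\<rparr>) \<le> Suc (load s)"
  "load (put a w s) = load s" "load (s\<lparr>queries := n\<rparr>) = load s"
  using card_insert_le_Suc[of e "tape s"] card_insert_le_Suc[of e "solution s"]
    card_Diff1_le[of "tape s" e]
  by (simp_all add: load_def put_def)

lemma exec_resources:
  assumes "s' \<in> set_pmf (exec f c i s)"
  shows "dom (mem s) \<subseteq> dom (mem s')" "queries s' \<le> Suc (queries s)" "load s' \<le> Suc (load s)"
proof -
  have "dom (mem s) \<subseteq> dom (mem s') \<and> queries s' \<le> Suc (queries s) \<and> load s' \<le> Suc (load s)"
  proof (cases "det i")
    case True
    then have "s' = det_exec f c i s" using assms by (simp add: exec_det)
    then show ?thesis
      by (cases i) (simp_all add: load_update put_def[of _ _ s] split: word.split,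
          auto simp: put_def load_def)
  next
    case False
    then obtain a b where i: "i = Random a b" by (cases i) auto
    show ?thesis using assms unfolding i
      by (auto simp: load_update put_def split: word.splits if_splits) (auto simp: load_def)
  qed
  then show "dom (mem s) \<subseteq> dom (mem s')" "queries s' \<le> Suc (queries s)" "load s' \<le> Suc (load s)" by auto
qed

lemma step_resources:
  assumes "x' \<in> set_pmf (step f c x)"
  shows "dom (mem (snd x)) \<subseteq> dom (mem (snd x'))" "queries (snd x') \<le> Suc (queries (snd x))"
    "load (snd x') \<le> Suc (load (snd x))"
proof -
  obtain p s where x: "x = (p, s)" by (cases x)
  have "dom (mem (snd x)) \<subseteq> dom (mem (snd x')) \<and> queries (snd x') \<le> Suc (queries (snd x)) \<and>
     load (snd x') \<le> Suc (load (snd x))"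
  proof (cases p)
    case Nil
    then show ?thesis using assms x by auto
  next
    case (Cons a q)
    show ?thesis
    proof (cases a)
      case (Basic i)
      then obtain s' where "s' \<in> set_pmf (exec f c i s)" "x' = (q, s')" using assms x Cons by auto
      then show ?thesis using exec_resources[of s' f c i s] x by auto
    qed (use assms x Cons in auto)
  qed
  then show "dom (mem (snd x)) \<subseteq> dom (mem (snd x'))" "queries (snd x') \<le> Suc (queries (snd x))"
    "load (snd x') \<le> Suc (load (snd x))" by auto
qed

lemma steps_resources:
  assumes "x' \<in> set_pmf (steps f c t x)"
  shows "dom (mem (snd x)) \<subseteq> dom (mem (snd x'))" "queries (snd x') \<le> queries (snd x) + t"
    "load (snd x') \<le> load (snd x) + t"
proof -
  have "dom (mem (snd x)) \<subseteq> dom (mem (snd x')) \<and> queries (snd x') \<le> queries (snd x) + t \<and>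
    load (snd x') \<le> load (snd x) + t"
    using assms
  proof (induction t arbitrary: x')
    case (Suc t)
    then obtain y where y: "y \<in> set_pmf (steps f c t x)" "x' \<in> set_pmf (step f c y)" by auto
    show ?case using Suc.IH[OF y(1)] step_resources[OF y(2)] by (auto dest!: subsetD)
  qed simp
  then show "dom (mem (snd x)) \<subseteq> dom (mem (snd x'))" "queries (snd x') \<le> queries (snd x) + t"
    "load (snd x') \<le> load (snd x) + t" by auto
qed

lemma memory_used_le:
  assumes "dom (mem s) \<subseteq> {..<a}"
  shows "memory_used s \<le> a + load s"
proof -
  have "finite (dom (mem s))" using assms finite_subset by blast
  then have "Max (insert 0 (Suc ` dom (mem s))) \<le> a" using assms by (subst Max_le_iff) auto
  then show ?thesis by (simp add: memory_used_def load_def)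
qed

text \<open>Cells once written stay in the domain of \<open>mem\<close>, so an address bound at the
  end of a run holds throughout it; everything else grows by at most one per step. After time
  \<open>t\<close> the halted configuration no longer changes, which bridges the gap to
  \<open>T\<close>.\<close>

lemma runs_within_steps:
  assumes run: "runs f c p s t D" and t: "t \<le> T" "t \<le> Q" and q: "queries s = 0"
    and D: "\<And>s'. s' \<in> set_pmf D \<Longrightarrow> dom (mem s') \<subseteq> {..<a}" and M: "a + load s + t \<le> M"
  shows "runs_within f c p T Q M s" "map_pmf snd (steps f c T (p, s)) = D"
proof -
  have st: "steps f c t (p, s) = map_pmf (Pair []) D"
    using run[unfolded runs_def, rule_format, of "[]"] by simp
  have stT: "steps f c (t + u) (p, s) = map_pmf (Pair []) D" for u
    unfolding steps_add st by (simp add: bind_map_pmf steps_halted map_pmf_def[symmetric])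
  from stT[of "T - t"] t have stT': "steps f c T (p, s) = map_pmf (Pair []) D" by simp
  then show "map_pmf snd (steps f c T (p, s)) = D" by (simp add: pmf.map_comp o_def)
  have q': "queries s' \<le> Q" if "s' \<in> set_pmf D" for s'
    using steps_resources(2)[of "([], s')" f c t "(p, s)"] that st q t by auto
  have mem: "memory_used s' \<le> M" if "u \<le> T" "(p', s') \<in> set_pmf (steps f c u (p, s))" for u p' s'
  proof (cases "u \<le> t")
    case True
    \<comment> \<open>An intermediate configuration can be continued to the end of the run, where
      the address bound is known.\<close>
    obtain y where y: "y \<in> set_pmf (steps f c (t - u) (p', s'))" using set_pmf_not_empty by fast
    then have "y \<in> set_pmf (steps f c (u + (t - u)) (p, s))"
      unfolding steps_add using that(2) by auto
    then have "snd y \<in> set_pmf D" using True st by auto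
    then have "dom (mem s') \<subseteq> {..<a}" using D steps_resources(1)[OF y] by fastforce
    moreover have "load s' \<le> load s + t" using steps_resources(3)[OF that(2)] True by simp
    ultimately show ?thesis using memory_used_le[of s' a] M by linarith
  next
    case False
    then have "s' \<in> set_pmf D" using stT[of "u - t"] that(2) by auto
    moreover from this have "load s' \<le> load s + t"
      using steps_resources(3)[of "([], s')" f c t "(p, s)"] st by auto
    ultimately show ?thesis using memory_used_le[of s' a] D[of s'] M by linarith
  qed
  show "runs_within f c p T Q M s"
    unfolding runs_within_def using mem q' by (auto simp: stT')
qed

section \<open>Symbolic execution\<close>

lemma get_put [simp]: "get (put a w s) b = (if a = b then w else get s b)"
  by (simp add: get_def put_def)

lemma get_update [simp]:
  "get (s\<lparr>tape := x\<rparr>) a = get s a" "get (s\<lparr>queries := n\<rparr>) a = get s a"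
  "get (s\<lparr>outbox := y\<rparr>) a = get s a" "get (s\<lparr>solution := x\<rparr>) a = get s a"
  "get (s\<lparr>inbox := z\<rparr>) a = get s a"
  by (simp_all add: get_def)

lemma put_simps [simp]:
  "tape (put a w s) = tape s" "inbox (put a w s) = inbox s" "outbox (put a w s) = outbox s"
  "solution (put a w s) = solution s" "dom (mem (put a w s)) = insert a (dom (mem s))"
  by (simp_all add: put_def)

text \<open>Tape and outbox are left out because many pieces of code change them; they get
  postconditions of their own. Queries are bounded by the running time.\<close>

definition frame :: "nat set \<Rightarrow> 'a machine \<Rightarrow> 'a machine \<Rightarrow> bool" where
  "frame X s s' \<longleftrightarrow> (\<forall>a. a \<notin> X \<longrightarrow> get s' a = get s a) \<and> inbox s' = inbox s \<and> solution s' = solution s"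

lemma frame_refl [simp]: "frame X s s"
  by (simp add: frame_def)

lemma frame_trans: "frame X s s' \<Longrightarrow> frame X s' s'' \<Longrightarrow> frame X s s''"
  by (simp add: frame_def)

lemma frame_put [simp]: "a \<in> X \<Longrightarrow> frame X s (put a w s') = frame X s s'"
  by (auto simp: frame_def)

lemma frame_update [simp]:
  "frame X s (s'\<lparr>tape := x\<rparr>) = frame X s s'" "frame X s (s'\<lparr>queries := n\<rparr>) = frame X s s'"
  "frame X s (s'\<lparr>outbox := y\<rparr>) = frame X s s'"
  by (auto simp: frame_def)

lemma steps_not_lengthen:
  assumes "runs f c p s 0 (return_pmf s')"
  shows "p = []" "s' = s"
  using assms[unfolded runs_def, rule_format, of "[]"] by auto

text \<open>A halted configuration idles, but a nonempty continuation \<open>q\<close> in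
  \<open>runs\<close> would be executed during any surplus time. So running times are exact, and
  \<open>achieves\<close> for the empty program reduces to its postcondition.\<close>

lemma runs_Nil_iff: "runs f c [] s t (return_pmf s') \<longleftrightarrow> t = 0 \<and> s' = s"
proof (cases t)
  case 0
  then show ?thesis using steps_not_lengthen[of f c "[]" s s'] runs_Nil by blast
next
  case (Suc u)
  have "steps f c (Suc u) ([Basic (ConstN 0 0)], s) = return_pmf ([], put 0 (NatW 0) s)"
    unfolding steps_Suc_front by (simp add: bind_return_pmf steps_halted)
  then have "\<not> runs f c [] s t (return_pmf s')"
    unfolding runs_def Suc by (metis append_Nil map_return_pmf list.distinct(1) prod.inject return_pmf_inj)
  then show ?thesis using Suc by simp
qed

lemma achieves_Nil_iff [simp]: "achieves f c [] s Q \<longleftrightarrow> Q 0 s"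
  by (auto simp: achieves_def runs_Nil_iff)

lemma runs_step_iff:
  assumes "p \<noteq> []" "\<And>q. step f c (p @ q, s) = return_pmf (p' @ q, s1)"
  shows "runs f c p s t D \<longleftrightarrow> (\<exists>u. t = Suc u \<and> runs f c p' s1 u D)"
proof (cases t)
  case 0
  have "\<not> runs f c p s 0 D"
  proof
    assume "runs f c p s 0 D"
    then have "return_pmf (p, s) = map_pmf (Pair []) D"
      unfolding runs_def by (auto dest: spec[of _ "[]"])
    then have "set_pmf (return_pmf (p, s)) = Pair [] ` set_pmf D" by (metis set_map_pmf)
    then show False using assms(1) by auto
  qed
  then show ?thesis using 0 by simp
next
  case (Suc u)
  have "steps f c (Suc u) (p @ q, s) = steps f c u (p' @ q, s1)" for q
    unfolding steps_Suc_front assms(2) by (simp add: bind_return_pmf)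
  then show ?thesis using Suc by (auto simp: runs_def simp del: steps.simps)
qed

lemma achieves_Basic_iff [simp]:
  "det i \<Longrightarrow> achieves f c (Basic i # p) s Q \<longleftrightarrow> achieves f c p (det_exec f c i s) (\<lambda>t. Q (Suc t))"
  using runs_step_iff[of "Basic i # p" f c s p "det_exec f c i s"]
  by (auto simp: achieves_def exec_det)

lemma achieves_Cond_iff [simp]:
  "achieves f c (Cond b p q # r) s Q \<longleftrightarrow>
    (if holds b s then achieves f c (p @ r) s (\<lambda>t. Q (Suc t)) else achieves f c (q @ r) s (\<lambda>t. Q (Suc t)))"
  using runs_step_iff[of "Cond b p q # r" f c s "p @ r" s] runs_step_iff[of "Cond b p q # r" f c s "q @ r" s]
  by (auto simp: achieves_def)

section \<open>The program\<close>

text \<open>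
  Cells below 64 are registers. The cells from 64 on hold three interleaved arrays of items: the input of the machine
  at the addresses 0 modulo 4, the current list \<open>G\<close> at 1 modulo 4, the best solution so far at 2 modulo 4;
  \<open>rOE\<close>, \<open>rGE\<close>, \<open>rBE\<close> are their end addresses. \<open>rFG\<close> and \<open>rCG\<close> are value and cost of \<open>G\<close>, \<open>rTAU\<close> is the
  threshold, \<open>rLAM\<close> the estimate of the optimum, \<open>rKK\<close> the number of the current guess (0 during estimation),
  \<open>rPASS\<close> distinguishes the two saturations for a guess, \<open>rGB\<close> is the value of the best solution,
  and \<open>rPC\<close> the kind of the current round.
\<close>

abbreviation (input) "rM \<equiv> 1 :: nat"
abbreviation (input) "rN \<equiv> 2 :: nat"
abbreviation (input) "rK \<equiv> 3 :: nat"
abbreviation (input) "rPC \<equiv> 4 :: nat"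
abbreviation (input) "rONE \<equiv> 5 :: nat"
abbreviation (input) "rFOUR \<equiv> 6 :: nat"
abbreviation (input) "rZERO \<equiv> 7 :: nat"
abbreviation (input) "rRONE \<equiv> 8 :: nat"
abbreviation (input) "rKT \<equiv> 9 :: nat"
abbreviation (input) "rNI \<equiv> 10 :: nat"
abbreviation (input) "rOE \<equiv> 11 :: nat"
abbreviation (input) "rGE \<equiv> 12 :: nat"
abbreviation (input) "rFG \<equiv> 13 :: nat"
abbreviation (input) "rCG \<equiv> 14 :: nat"
abbreviation (input) "rTAU \<equiv> 15 :: nat"
abbreviation (input) "rRHO \<equiv> 16 :: nat"
abbreviation (input) "rLAM \<equiv> 17 :: nat"
abbreviation (input) "rKK \<equiv> 18 :: nat"
abbreviation (input) "rPASS \<equiv> 19 :: nat"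
abbreviation (input) "rGB \<equiv> 20 :: nat"
abbreviation (input) "rBE \<equiv> 21 :: nat"
abbreviation (input) "rBV \<equiv> 22 :: nat"
abbreviation (input) "rBI \<equiv> 23 :: nat"
abbreviation (input) "rCNT \<equiv> 24 :: nat"
abbreviation (input) "rCAP \<equiv> 25 :: nat"
abbreviation (input) "rGP \<equiv> 26 :: nat"
abbreviation (input) "rLIM \<equiv> 27 :: nat"
abbreviation (input) "rRZ \<equiv> 28 :: nat"
abbreviation (input) "rIDX \<equiv> 30 :: nat"
abbreviation (input) "rLEN \<equiv> 31 :: nat"
abbreviation (input) "rX \<equiv> 32 :: nat"
abbreviation (input) "rQ \<equiv> 33 :: nat"
abbreviation (input) "rCX \<equiv> 34 :: nat"
abbreviation (input) "rTC \<equiv> 35 :: nat"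
abbreviation (input) "rSC \<equiv> 36 :: nat"
abbreviation (input) "rMG \<equiv> 37 :: nat"
abbreviation (input) "rRQ \<equiv> 38 :: nat"
abbreviation (input) "rJ \<equiv> 40 :: nat"
abbreviation (input) "rP \<equiv> 41 :: nat"
abbreviation (input) "rD \<equiv> 42 :: nat"
abbreviation (input) "rR \<equiv> 43 :: nat"
abbreviation (input) "rA \<equiv> 44 :: nat"
abbreviation (input) "rT \<equiv> 45 :: nat"

text \<open>
  The second query detects that the item was already on the tape. It is then put back unless it is
  redundant, so that the tape always has the value of \<open>G\<close>, though possibly fewer items.
\<close>

definition test_cmds :: program where
  "test_cmds = [Basic (Cost rCX rX), Basic (Arith Mul rTC rTAU rCX), Basic (Arith Add rSC rCG rCX),
     Basic (TapeInsert rX), Basic (Query rQ), Basic (Arith Sub rMG rQ rFG),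
     Basic (TapeDelete rX), Basic (Query rRQ), Cond (Less rRQ rFG) [Basic (TapeInsert rX)] []]"

definition if_acc :: "program \<Rightarrow> program" where
  "if_acc p = test_cmds @ [Cond (Less rK rSC) [] [Cond (Less rTC rMG) p []]]"

definition add_code :: program where
  "add_code = [Basic (TapeInsert rX), Basic (Store rGE rX), Basic (Arith Add rGE rGE rFOUR),
     Basic (Move rFG rQ), Basic (Move rCG rSC)]"

text \<open>The oracle tape can be emptied only item by item. Deleting the items of \<open>G\<close>
  suffices because the tape never holds others.\<close>

definition clear_code :: program where
  "clear_code = [Basic (ConstN rP 65),
     Loop (Less rP rGE) [Basic (Load rX rP), Basic (TapeDelete rX), Basic (Arith Add rP rP rFOUR)],
     Basic (ConstN rGE 65), Basic (ConstR rCG 0), Basic (Query rFG)]"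

definition qs_code :: program where
  "qs_code = test_cmds @ [Cond (Less rTC rMG)
     (add_code @ [Cond (Less rCG rK) [] ([Basic (Move rRHO rFG), Basic (Arith Add rTAU rRHO rRHO),
        Basic (Arith Div rTAU rTAU rK)] @ clear_code)]) []]"

definition aug_code :: program where
  "aug_code = test_cmds @ [Cond (Less rK rSC) []
     [Cond (Less rBV rQ) [Basic (Move rBV rQ), Basic (Move rBI rX)] []]]"

definition for_inbox :: "program \<Rightarrow> program" where
  "for_inbox p = [Basic (InboxLength rLEN), Basic (ConstN rIDX 0),
     Loop (Less rIDX rLEN) (Basic (Receive rX rIDX) # p @ [Basic (Arith Add rIDX rIDX rONE)])]"

definition for_own :: "program \<Rightarrow> program" where
  "for_own p = [Basic (ConstN rP 64),
     Loop (Less rP rOE) (Basic (Load rX rP) # p @ [Basic (Arith Add rP rP rFOUR)])]"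

definition bcast :: "nat \<Rightarrow> nat \<Rightarrow> program" where
  "bcast j a = [Basic (ConstN rJ j),
     Loop (Less rJ rM) [Basic (Send rJ a), Basic (Arith Add rJ rJ rONE)]]"

text \<open>Counter and limit are reals because \<open>Ktilde E K\<close> may be fractional and a
  program cannot round; the loop thus makes the rounded-up number of draws. Two doublings replace
  the multiplication by 4 that naturals lack. An empty input sets the limit to 0.\<close>

definition draw_code :: program where
  "draw_code = [Basic (ConstR rD 0), Cond (Less rZERO rNI) [] [Basic (Move rLIM rRZ)],
     Loop (Less rD rLIM) ([Basic (Random rR rNI), Basic (Arith Add rR rR rR), Basic (Arith Add rR rR rR),
       Basic (ConstN rA 64), Basic (Arith Add rA rA rR), Basic (Load rX rA)] @ bcast 0 rX @ [Basic (Arith Add rD rD rRONE)])]"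

text \<open>
  Rounds 0 and 1 draw the large and the first ordinary sample; in rounds 2 and 3 the survivors are
  counted and sent to the center. During estimation rounds 4 and 5 follow, otherwise rounds 6 and 7,
  which complete the saturation. Round 8 updates the best solution and starts the next saturation in round 2.
\<close>

definition round0 :: "real \<Rightarrow> real \<Rightarrow> program" where
  "round0 tt z = [Basic (InboxLength rNI), Basic (ConstN rOE 64), Basic (ConstN rIDX 0),
     Loop (Less rIDX rNI) [Basic (Receive rX rIDX), Basic (Store rOE rX),
       Basic (Arith Add rOE rOE rFOUR), Basic (Arith Add rIDX rIDX rONE)],
     Basic (ToReal rKT rN), Cond (Less rK rKT) [Basic (Move rKT rK)] [],
     Basic (ToReal rCAP rM), Basic (Arith Mul rCAP rCAP rKT), Basic (ConstR rT z),
     Basic (Arith Mul rCAP rCAP rT),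
     Basic (ConstN rGE 65), Basic (Query rFG), Basic (ConstR rCG 0), Basic (ConstR rTAU 0),
     Basic (ConstR rRHO 0), Basic (ConstR rLAM 0), Basic (ConstR rKK 0), Basic (ConstN rPASS 1),
     Basic (ConstR rGB (- 1)), Basic (ConstN rBE 66),
     Basic (ConstR rLIM tt), Basic (Arith Mul rLIM rLIM rKT), Basic (ConstN rPC 1)] @ draw_code"

text \<open>The factors 8 and 12 are those of \<open>optimum_estimate\<close>:
  \<open>8 * L1 / K\<close> is the threshold and \<open>12 * L1\<close> the first summand of the
  estimate. The other summands are added in \<open>round5\<close> and \<open>round8\<close>.\<close>

definition round1 :: program where
  "round1 = for_inbox qs_code @
     [Basic (Arith Add rLAM rRHO rFG), Basic (ConstR rT 8), Basic (Arith Mul rTAU rT rLAM),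
      Basic (Arith Div rTAU rTAU rK), Basic (ConstR rT 12), Basic (Arith Mul rLAM rT rLAM)] @
     clear_code @ [Basic (Move rLIM rKT), Basic (ConstN rPC 2)] @ draw_code"

definition round2 :: program where
  "round2 = for_inbox (if_acc add_code) @ [Basic (ConstN rCNT 0)] @
     for_own (if_acc [Basic (Arith Add rCNT rCNT rONE)]) @ bcast 0 rCNT @ [Basic (ConstN rPC 3)]"

text \<open>All machines have received all counts and take the same decision, so an overflowing set
  of survivors is never sent and the memory of the center is safe.\<close>

definition round3 :: program where
  "round3 = [Basic (ConstN rCNT 0)] @ for_inbox [Basic (Arith Add rCNT rCNT rX)] @
     [Basic (ToReal rT rCNT), Cond (Less rCAP rT) [] (for_own (if_acc [Basic (Send rZERO rX)])),
      Cond (Equal rKK rRZ) [Basic (ConstN rPC 4)] [Basic (ConstN rPC 6)]]"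

text \<open>Every machine runs this code, but the survivors went to the center only. Its estimate is
  the first word of each inbox in \<open>round5\<close>, since inboxes are ordered by
  sender.\<close>

definition round4 :: program where
  "round4 = clear_code @ [Basic (ConstR rRHO 0), Basic (ConstR rTAU 0)] @ for_inbox qs_code @
     [Basic (Arith Add rT rRHO rFG), Basic (ConstR rTAU 0)] @ clear_code @ bcast 0 rT @ [Basic (ConstN rPC 5)]"

definition aug_round :: program where
  "aug_round = [Basic (Move rBV rFG)] @ for_own aug_code @
     [Cond (Less rFG rBV) (bcast 0 rBI) [], Basic (ConstN rPC 8)]"

definition round5 :: program where
  "round5 = [Basic (ConstN rIDX 0), Basic (Receive rX rIDX), Basic (ConstR rT 4),
     Basic (Arith Mul rX rT rX), Basic (Arith Add rLAM rLAM rX)] @ aug_round"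

text \<open>Only the center has received survivors, so only its list grows and only it broadcasts.
  Starting at machine 1 leaves out the center, which already holds the new items.\<close>

definition round6 :: program where
  "round6 = [Basic (Move rGP rGE)] @ for_inbox (if_acc add_code) @
     [Loop (Less rGP rGE) (Basic (Load rX rGP) # bcast 1 rX @ [Basic (Arith Add rGP rGP rFOUR)]),
      Basic (ConstN rPC 7)]"

definition round7 :: program where
  "round7 = for_inbox (if_acc add_code) @ aug_round"

definition save_code :: program where
  "save_code = [Basic (Move rGB rBV), Basic (ConstN rBE 66), Basic (ConstN rP 65),
     Loop (Less rP rGE) [Basic (Load rX rP), Basic (Store rBE rX), Basic (Arith Add rBE rBE rFOUR),
       Basic (Arith Add rP rP rFOUR)],
     Cond (Less rFG rBV) [Basic (Store rBE rBI), Basic (Arith Add rBE rBE rFOUR)] []]"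

definition out_code :: program where
  "out_code = [Basic (ConstN rP 66),
     Loop (Less rP rBE) [Basic (Load rX rP), Basic (Output rX), Basic (Arith Add rP rP rFOUR)]]"

text \<open>For \<open>rKK = 0\<close> the list is empty, so the best candidate is the empty set or
  a single item, and \<open>rGB\<close> supplies the last summand of the estimate. After the first
  saturation for a guess the list is kept and the threshold multiplied by \<open>4 * e\<close>;
  after the second the next guess starts from the empty list.\<close>

definition round8 :: "real \<Rightarrow> real \<Rightarrow> program" where
  "round8 e nn = [Basic (Move rBV rFG)] @ for_inbox aug_code @ [Cond (Less rGB rBV) save_code []] @
     [Cond (Equal rKK rRZ) [Basic (Arith Add rLAM rLAM rGB)] []] @
     [Basic (ConstR rT nn), Cond (Equal rPASS rONE)
        ([Cond (Equal rKK rT) out_code [], Basic (ConstN rPASS 0), Basic (Arith Add rKK rKK rRONE),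
          Basic (ConstR rT (2 * e)), Basic (Arith Mul rT rT rK), Basic (Arith Mul rT rT rKK),
          Basic (Arith Div rTAU rLAM rT)] @ clear_code)
        [Basic (ConstN rPASS 1), Basic (ConstR rT (4 * e)), Basic (Arith Mul rTAU rT rTAU)]] @
     [Basic (Move rLIM rKT), Basic (ConstN rPC 2)] @ draw_code"

fun dispatch :: "nat \<Rightarrow> program list \<Rightarrow> program" where
  "dispatch j [] = []"
| "dispatch j (p # ps) = [Basic (ConstN rT j), Cond (Equal rPC rT) p (dispatch (Suc j) ps)]"

definition prologue :: program where
  "prologue = [Basic (ConstN rONE 1), Basic (ConstN rFOUR 4), Basic (ConstN rZERO 0),
     Basic (ConstR rRONE 1), Basic (ConstR rRZ 0)]"

definition round_programs :: "real \<Rightarrow> real \<Rightarrow> real \<Rightarrow> real \<Rightarrow> program list" where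
  "round_programs e tt z nn = [round0 tt z, round1, round2, round3, round4, round5, round6, round7, round8 e nn]"

definition main_program :: "real \<Rightarrow> real \<Rightarrow> real \<Rightarrow> real \<Rightarrow> program" where
  "main_program e tt z nn = prologue @ dispatch 0 (round_programs e tt z nn)"

section \<open>Correctness of the pieces of the program\<close>

definition consts_ok :: "nat \<Rightarrow> real \<Rightarrow> 'a machine \<Rightarrow> bool" where
  "consts_ok m K s \<longleftrightarrow> get s rM = NatW m \<and> get s rK = RealW K \<and> get s rONE = NatW 1 \<and>
     get s rFOUR = NatW 4 \<and> get s rZERO = NatW 0 \<and> get s rRONE = RealW 1 \<and> get s rRZ = RealW 0"

definition own :: "'a list \<Rightarrow> 'a machine \<Rightarrow> bool" where
  "own X s \<longleftrightarrow> get s rNI = NatW (length X) \<and> get s rOE = NatW (64 + 4 * length X) \<and>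
     (\<forall>i<length X. get s (64 + 4 * i) = ItemW (X ! i))"

definition best :: "'a list \<Rightarrow> 'a machine \<Rightarrow> bool" where
  "best B s \<longleftrightarrow> get s rBE = NatW (66 + 4 * length B) \<and> (\<forall>i<length B. get s (66 + 4 * i) = ItemW (B ! i))"

abbreviation "scratch \<equiv> {30..<64 :: nat}"
abbreviation "gcells \<equiv> {a. 64 \<le> a \<and> a mod 4 = (1::nat)}"
abbreviation "bcells \<equiv> {a. 64 \<le> a \<and> a mod 4 = (2::nat)}"

lemma cell_mod [simp]: "(66 + 4 * i) mod 4 = (2::nat)"
  by presburger

lemma cell_neq [simp]:
  "a < 64 \<Longrightarrow> a = 64 + 4 * i \<longleftrightarrow> False" "a < 64 \<Longrightarrow> a = 65 + 4 * i \<longleftrightarrow> False"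
  "a < 64 \<Longrightarrow> a = 66 + 4 * (i::nat) \<longleftrightarrow> False"
  "a < 64 \<Longrightarrow> 64 + 4 * i = a \<longleftrightarrow> False" "a < 64 \<Longrightarrow> 65 + 4 * i = a \<longleftrightarrow> False"
  "a < 64 \<Longrightarrow> 66 + 4 * (i::nat) = a \<longleftrightarrow> False"
  by auto

text \<open>\<open>H\<close> is the common scale of all sizes. The extra 1 makes good lists strictly
  shorter than \<open>H\<close>, which leaves a cell for one appended item.\<close>

locale mpc_machine = submodular_knapsack U E c K f
  for U E :: "'a set" and c :: "'a \<Rightarrow> real" and K :: real and f :: "'a set \<Rightarrow> real" +
  fixes m :: nat and H :: nat
  assumes Ktilde_H: "Ktilde E K + 1 \<le> real H"
begin

abbreviation "addr_lim \<equiv> 80 + 4 * H"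

text \<open>The address bound travels with the frame, so that composing updates also yields the
  memory bound at the end of a round.\<close>

definition upd :: "nat set \<Rightarrow> 'a machine \<Rightarrow> 'a machine \<Rightarrow> bool" where
  "upd X s s' \<longleftrightarrow> frame X s s' \<and> (dom (mem s) \<subseteq> {..<addr_lim} \<longrightarrow> dom (mem s') \<subseteq> {..<addr_lim})"

lemma upd_refl [simp]: "upd X s s"
  by (simp add: upd_def)

lemma upd_trans: "upd X s s' \<Longrightarrow> upd X s' s'' \<Longrightarrow> upd X s s''"
  using frame_trans by (auto simp: upd_def)

lemma upd_subset: "upd X s s' \<Longrightarrow> X \<subseteq> Y \<Longrightarrow> upd Y s s'"
  by (auto simp: upd_def frame_def)

lemma upd_get: "upd X s s' \<Longrightarrow> a \<notin> X \<Longrightarrow> get s' a = get s a"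
  by (auto simp: upd_def frame_def)

lemma upd_same: "upd X s s' \<Longrightarrow> inbox s' = inbox s" "upd X s s' \<Longrightarrow> solution s' = solution s"
  by (simp_all add: upd_def frame_def)

lemma upd_put [simp]: "a \<in> X \<Longrightarrow> a < addr_lim \<Longrightarrow> upd X s s' \<Longrightarrow> upd X s (put a w s')"
  by (auto simp: upd_def)

lemma upd_update [simp]:
  "upd X s (s'\<lparr>tape := x\<rparr>) = upd X s s'" "upd X s (s'\<lparr>queries := n\<rparr>) = upd X s s'"
  "upd X s (s'\<lparr>outbox := y\<rparr>) = upd X s s'"
  by (auto simp: upd_def)

lemma consts_ok_upd:
  assumes "upd X s s'" "consts_ok m K s" "X \<inter> {1,3,5,6,7,8,28} = {}"
  shows "consts_ok m K s'"
proof -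
  have "get s' a = get s a" if "a \<in> {1,3,5,6,7,8,28}" for a
    by (rule upd_get[OF assms(1)]) (use assms(3) that in auto)
  then show ?thesis using assms(2) by (simp add: consts_ok_def)
qed

lemma own_upd:
  assumes "upd X s s'" "own Y s" "X \<subseteq> - {10,11} \<inter> - {a. 64 \<le> a \<and> a mod 4 = 0}"
  shows "own Y s'"
proof -
  have "get s' a = get s a" if "a \<in> {10,11} \<union> {a. 64 \<le> a \<and> a mod 4 = 0}" for a
    by (rule upd_get[OF assms(1)]) (use assms(3) that in auto)
  then show ?thesis using assms(2) by (simp add: own_def)
qed

lemma best_upd:
  assumes "upd X s s'" "best Y s" "X \<subseteq> - {21} \<inter> - bcells"
  shows "best Y s'"
proof -
  have "get s' a = get s a" if "a \<in> {21} \<union> bcells" for a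
    by (rule upd_get[OF assms(1)]) (use assms(3) that in auto)
  then show ?thesis using assms(2) by (simp add: best_def)
qed

definition rep :: "'a list \<Rightarrow> 'a machine \<Rightarrow> bool" where
  "rep G s \<longleftrightarrow> get s rGE = NatW (65 + 4 * length G) \<and> (\<forall>i<length G. get s (65 + 4 * i) = ItemW (G ! i)) \<and>
     get s rFG = RealW (f (set G)) \<and> get s rCG = RealW (cost G) \<and>
     tape s \<subseteq> set G \<and> f (tape s) = f (set G)"

lemma rep_upd:
  assumes "upd X s s'" "rep G s" "X \<subseteq> - {12,13,14} \<inter> - gcells" "tape s' = tape s"
  shows "rep G s'"
proof -
  have "get s' a = get s a" if "a \<in> {12,13,14} \<union> gcells" for a
    by (rule upd_get[OF assms(1)]) (use assms(3) that in auto)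
  then show ?thesis using assms(2,4) by (simp add: rep_def)
qed

text \<open>Deleting \<open>x\<close> after the query takes the value below \<open>f (set G)\<close>
  only if \<open>x\<close> was on the tape before, and then it is put back. Otherwise the smaller
  tape still has the value of \<open>G\<close>, and \<open>insert_equivalent\<close> makes later
  queries correct as well.\<close>

lemma test_cmds:
  assumes "rep G s" "set G \<subseteq> E" "get s rX = ItemW x" "x \<in> E" "get s rTAU = RealW t"
  shows "achieves f c test_cmds s (\<lambda>u s'. u \<le> 10 \<and> upd {33..<39} s s' \<and> outbox s' = outbox s \<and> rep G s' \<and>
     get s' rX = ItemW x \<and> get s' rTAU = RealW t \<and>
     get s' rQ = RealW (f (insert x (set G))) \<and> get s' rTC = RealW (t * c x) \<and>
     get s' rSC = RealW (cost G + c x) \<and> get s' rMG = RealW (f (insert x (set G)) - f (set G)))"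
proof -
  have GU: "set G \<subseteq> U" "x \<in> U" using assms items_subset by auto
  have T: "tape s \<subseteq> set G" "f (tape s) = f (set G)" using assms by (auto simp: rep_def)
  have eq: "f (insert x (tape s)) = f (insert x (set G))"
    using insert_equivalent[of "tape s" "set G" x] T GU by auto
  have le: "f (tape s - {x}) \<le> f (set G)"
    using monotone[of "tape s - {x}" "tape s"] T GU by auto
  show ?thesis
  proof (cases "f (tape s - {x}) < f (set G)")
    case True
    then have "x \<in> tape s" using T by (metis Diff_empty Diff_insert0 less_irrefl)
    then have "insert x (tape s) = tape s" by auto
    then show ?thesis using assms T eq True
      by (simp add: test_cmds_def rep_def)
  next
    case False
    then have "f (tape s - {x}) = f (set G)" using le by simp
    then show ?thesis using assms T eq False by (auto simp: test_cmds_def rep_def)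
  qed
qed

lemma length_less_H: "good_list G \<Longrightarrow> length G < H"
  using length_good_list[of G] Ktilde_H by linarith

lemma add_code:
  assumes "rep G s" "good_list G" "get s rX = ItemW x" "x \<in> E" "consts_ok m K s"
    "get s rQ = RealW (f (insert x (set G)))" "get s rSC = RealW (cost G + c x)"
  shows "achieves f c add_code s (\<lambda>u s'. u = 5 \<and> upd ({12,13,14} \<union> gcells) s s' \<and>
     outbox s' = outbox s \<and> rep (G @ [x]) s')"
proof -
  have "set G \<subseteq> U" "x \<in> U" using assms(2,4) items_subset by (auto simp: good_list_def)
  then have "f (insert x (tape s)) = f (insert x (set G))"
    using insert_equivalent[of "tape s" "set G" x] assms(1) by (auto simp: rep_def)
  then show ?thesis using assms length_less_H[of G]
    by (auto simp: add_code_def rep_def consts_ok_def nth_append less_Suc_eq)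
qed

lemma clear_code:
  assumes "rep G s" "consts_ok m K s"
  shows "achieves f c clear_code s (\<lambda>u s'. u \<le> 4 * length G + 6 \<and> upd {12,13,14,32,41} s s' \<and>
     outbox s' = outbox s \<and> rep [] s')"
proof -
  define I where "I i s' \<longleftrightarrow> upd {32,41} s s' \<and> outbox s' = outbox s \<and> get s' 41 = NatW (65 + 4 * i) \<and>
    tape s' \<subseteq> set (drop i G)" for i s'
  let ?L = "Loop (Less rP rGE) [Basic (Load rX rP), Basic (TapeDelete rX), Basic (Arith Add rP rP rFOUR)]"
  have "achieves f c [?L] (put 41 (NatW 65) s) (\<lambda>t s'. I (length G) s' \<and> t \<le> length G * (3 + 1) + 1)"
  proof (rule achieves_for_const)
    show "I 0 (put 41 (NatW 65) s)" using assms by (simp add: I_def rep_def)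
  next
    fix s' assume "I (length G) s'"
    then show "\<not> holds (Less rP rGE) s'" using assms upd_get[of "{32,41}" s s' 12] by (simp add: I_def rep_def)
  next
    fix i s' assume i: "i < length G" and I: "I i s'"
    have "get s' 12 = get s 12" "get s' (65 + 4 * i) = get s (65 + 4 * i)" "get s' 6 = get s 6"
      using I upd_get[of "{32,41}" s s'] by (auto simp: I_def)
    moreover have "set (drop i G) \<subseteq> insert (G ! i) (set (drop (Suc i) G))"
      using i by (metis Cons_nth_drop_Suc list.simps(15) subset_refl)
    ultimately show "holds (Less rP rGE) s' \<and> achieves f c [Basic (Load rX rP), Basic (TapeDelete rX), Basic (Arith Add rP rP rFOUR)] s'
        (\<lambda>t s'. I (Suc i) s' \<and> t \<le> 3)"
      using i I assms by (auto simp: I_def rep_def consts_ok_def)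
  qed
  then have "achieves f c ([?L] @ [Basic (ConstN rGE 65), Basic (ConstR rCG 0), Basic (Query rFG)]) (put 41 (NatW 65) s)
     (\<lambda>u s'. u \<le> 4 * length G + 5 \<and> upd {12,13,14,32,41} s s' \<and> outbox s' = outbox s \<and> rep [] s')"
  proof (rule achieves_seq)
    fix t s' assume a: "I (length G) s' \<and> t \<le> length G * (3 + 1) + 1"
    then have "upd {12,13,14,32,41} s s'"
      using upd_subset[of "{32,41}" s s' "{12,13,14,32,41}"] by (simp add: I_def)
    then show "achieves f c [Basic (ConstN rGE 65), Basic (ConstR rCG 0), Basic (Query rFG)] s'
      (\<lambda>u s'. t + u \<le> 4 * length G + 5 \<and> upd {12,13,14,32,41} s s' \<and> outbox s' = outbox s \<and> rep [] s')"
      using a by (simp add: I_def rep_def)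
  qed
  then show ?thesis by (simp add: clear_code_def add.commute)
qed

lemma bcast:
  assumes "consts_ok m K s" "a \<noteq> 40"
  shows "achieves f c (bcast j a) s (\<lambda>u s'. u = 3 * (m - j) + 2 \<and> upd {40} s s' \<and> tape s' = tape s \<and>
     outbox s' = outbox s @ map (\<lambda>i. (i, get s a)) [j..<m])"
proof -
  let ?L = "Loop (Less rJ rM) [Basic (Send rJ a), Basic (Arith Add rJ rJ rONE)]"
  have "achieves f c [?L] s' (\<lambda>u s''. u = 3 * (m - j) + 1 \<and> upd {40} s s'' \<and> tape s'' = tape s \<and>
     outbox s'' = outbox s' @ map (\<lambda>i. (i, get s a)) [j..<m])"
    if "upd {40} s s'" "get s' 40 = NatW j" "tape s' = tape s" for j s'
    using that
  proof (induction "m - j" arbitrary: j s')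
    case 0
    have "get s' 1 = get s 1" using 0 upd_get[of "{40}" s s' 1] by simp
    then show ?case using 0 assms by (intro achieves_Loop) (simp add: consts_ok_def)
  next
    case (Suc k)
    have g: "get s' 1 = get s 1" "get s' 5 = get s 5" "get s' a = get s a"
      using Suc.prems upd_get[of "{40}" s s'] assms(2) by auto
    have j: "j < m" using Suc.hyps(2) by simp
    define s2 where "s2 = put 40 (NatW (Suc j)) (s'\<lparr>outbox := outbox s' @ [(j, get s a)]\<rparr>)"
    have "achieves f c [?L] s2 (\<lambda>u s''. u = 3 * (m - Suc j) + 1 \<and> upd {40} s s'' \<and> tape s'' = tape s \<and>
       outbox s'' = outbox s2 @ map (\<lambda>i. (i, get s a)) [Suc j..<m])"
      by (rule Suc.hyps(1)) (use Suc.prems Suc.hyps(2) in \<open>auto simp: s2_def\<close>)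
    then have "achieves f c [?L] s2 (\<lambda>u s''. Suc (Suc (Suc u)) = 3 * (m - j) + 1 \<and> upd {40} s s'' \<and> tape s'' = tape s \<and>
       outbox s'' = outbox s' @ map (\<lambda>i. (i, get s a)) [j..<m])"
      by (rule achieves_mono) (use j in \<open>auto simp: s2_def upt_conv_Cons\<close>)
    then show ?case using Suc.prems assms g j
      by (intro achieves_Loop) (simp add: consts_ok_def s2_def)
  qed
  from this[of "put 40 (NatW j) s" j] show ?thesis by (simp add: bcast_def)
qed

text \<open>The invariant must survive changes to the loop registers (\<open>stable\<close>), and
  the body may change only \<open>Y\<close>, which avoids the loop counter and the constants. The
  potential depends on register 12 alone, the end of the list, because it is the growth of the list
  that prepays for clearing it.\<close>

lemma for_inbox:
  assumes s: "consts_ok m K s" "I 0 s" and n: "length (inbox s) = n"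
    and stable: "\<And>i s s'. I i s \<Longrightarrow> upd {30,31,32,41} s s' \<Longrightarrow> tape s' = tape s \<Longrightarrow> outbox s' = outbox s \<Longrightarrow> I i s'"
    and Y: "Y \<inter> {1,3,5,6,7,8,28,30,31} = {}"
    and \<Phi>: "\<And>s s'. get s' 12 = get s 12 \<Longrightarrow> \<Phi> s' = \<Phi> s"
    and body: "\<And>i s'. i < n \<Longrightarrow> I i s' \<Longrightarrow> consts_ok m K s' \<Longrightarrow> upd ({30,31,32} \<union> Y) s s' \<Longrightarrow> get s' rX = inbox s ! i \<Longrightarrow>
      achieves f c p s' (\<lambda>t s''. I (Suc i) s'' \<and> upd Y s' s'' \<and> t + \<Phi> s'' \<le> \<Phi> s' + k)"
  shows "achieves f c (for_inbox p) s (\<lambda>t s'. I n s' \<and> upd ({30,31,32} \<union> Y) s s' \<and> t + \<Phi> s' \<le> \<Phi> s + n * (k + 3) + 3)"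
proof -
  let ?Z = "{30,31,32} \<union> Y"
  define L where "L i s' \<longleftrightarrow> I i s' \<and> upd ?Z s s' \<and> get s' 30 = NatW i \<and> get s' 31 = NatW n" for i s'
  let ?p = "Basic (Receive rX rIDX) # p @ [Basic (Arith Add rIDX rIDX rONE)]"
  define s1 where "s1 = put 30 (NatW 0) (put 31 (NatW n) s)"
  have "achieves f c [Loop (Less rIDX rLEN) ?p] s1
     (\<lambda>t s'. L n s' \<and> t + \<Phi> s' \<le> \<Phi> s1 + n * (k + 2 + 1) + 1)"
  proof (rule achieves_for)
    show "L 0 s1" using s stable[of 0 s s1] by (simp add: L_def s1_def)
  next
    fix s' assume "L n s'"
    then show "\<not> holds (Less rIDX rLEN) s'" by (simp add: L_def)
  next
    fix i s' assume i: "i < n" and L: "L i s'"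
    define s2 where "s2 = put 32 (inbox s ! i) s'"
    have u2: "upd ?Z s s2" using L by (simp add: s2_def L_def)
    have c2: "consts_ok m K s2" by (rule consts_ok_upd[OF u2 s(1)]) (use Y in auto)
    have I2: "I i s2" using L stable[of i s' s2] by (simp add: s2_def L_def)
    have in': "inbox s' = inbox s" using L upd_same(1)[of ?Z s s'] by (simp add: L_def)
    have "achieves f c (p @ [Basic (Arith Add rIDX rIDX rONE)]) s2
        (\<lambda>t s''. L (Suc i) s'' \<and> Suc t + \<Phi> s'' \<le> \<Phi> s' + (k + 2))"
    proof (rule achieves_seq[OF body[OF i I2 c2 u2]])
      show "get s2 32 = inbox s ! i" by (simp add: s2_def)
    next
      fix t s3 assume a: "I (Suc i) s3 \<and> upd Y s2 s3 \<and> t + \<Phi> s3 \<le> \<Phi> s2 + k"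
      have u3: "upd ?Z s s3" using a u2 upd_trans[of ?Z s s2 s3] upd_subset[of Y s2 s3 ?Z] by auto
      have c3: "consts_ok m K s3" by (rule consts_ok_upd[OF u3 s(1)]) (use Y in auto)
      have g: "get s3 30 = NatW i" "get s3 31 = NatW n"
        using a upd_get[of Y s2 s3] Y L by (auto simp: s2_def L_def)
      define s4 where "s4 = put 30 (NatW (Suc i)) s3"
      have "I (Suc i) s4" using a stable[of "Suc i" s3 s4] by (simp add: s4_def)
      moreover have "\<Phi> s4 = \<Phi> s3" "\<Phi> s2 = \<Phi> s'" by (rule \<Phi>; simp add: s4_def s2_def)+
      ultimately show "achieves f c [Basic (Arith Add rIDX rIDX rONE)] s3
          (\<lambda>u s''. L (Suc i) s'' \<and> Suc (t + u) + \<Phi> s'' \<le> \<Phi> s' + (k + 2))"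
        using c3 g u3 a by (simp add: consts_ok_def L_def s4_def)
    qed
    then show "holds (Less rIDX rLEN) s' \<and> achieves f c ?p s' (\<lambda>t s''. L (Suc i) s'' \<and> t + \<Phi> s'' \<le> \<Phi> s' + (k + 2))"
      using i L n in' by (simp add: L_def s2_def)
  qed
  moreover have "\<Phi> s1 = \<Phi> s" by (rule \<Phi>) (simp add: s1_def)
  ultimately have "achieves f c [Loop (Less rIDX rLEN) ?p] s1
     (\<lambda>t s'. I n s' \<and> upd ?Z s s' \<and> Suc (Suc t) + \<Phi> s' \<le> \<Phi> s + n * (k + 3) + 3)"
    by (elim achieves_mono) (auto simp: L_def algebra_simps)
  then show ?thesis using n by (simp add: for_inbox_def s1_def)
qed

lemma for_own:
  assumes s: "consts_ok m K s" "I 0 s" "own X s"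
    and stable: "\<And>i s s'. I i s \<Longrightarrow> upd {30,31,32,41} s s' \<Longrightarrow> tape s' = tape s \<Longrightarrow> outbox s' = outbox s \<Longrightarrow> I i s'"
    and Y: "Y \<subseteq> - {1,3,5,6,7,8,28,10,11,41} \<inter> - {a. 64 \<le> a \<and> a mod 4 = 0}"
    and body: "\<And>i s'. i < length X \<Longrightarrow> I i s' \<Longrightarrow> consts_ok m K s' \<Longrightarrow> get s' rX = ItemW (X ! i) \<Longrightarrow>
      achieves f c p s' (\<lambda>t s''. I (Suc i) s'' \<and> upd Y s' s'' \<and> t \<le> k)"
  shows "achieves f c (for_own p) s (\<lambda>t s'. I (length X) s' \<and> upd ({32,41} \<union> Y) s s' \<and> t \<le> length X * (k + 3) + 2)"
proof -
  let ?Z = "{32,41} \<union> Y"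
  define L where "L i s' \<longleftrightarrow> I i s' \<and> upd ?Z s s' \<and> get s' 41 = NatW (64 + 4 * i)" for i s'
  let ?p = "Basic (Load rX rP) # p @ [Basic (Arith Add rP rP rFOUR)]"
  define s1 where "s1 = put 41 (NatW 64) s"
  have own: "own X s'" if "upd ?Z s s'" for s'
    by (rule own_upd[OF that s(3)]) (use Y in auto)
  have "achieves f c [Loop (Less rP rOE) ?p] s1 (\<lambda>t s'. L (length X) s' \<and> t \<le> length X * (k + 2 + 1) + 1)"
  proof (rule achieves_for_const)
    show "L 0 s1" using s stable[of 0 s s1] by (simp add: L_def s1_def)
  next
    fix s' assume "L (length X) s'"
    then show "\<not> holds (Less rP rOE) s'" using own by (auto simp: L_def own_def)
  next
    fix i s' assume i: "i < length X" and L: "L i s'"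
    have o: "own X s'" using L own by (simp add: L_def)
    define s2 where "s2 = put 32 (ItemW (X ! i)) s'"
    have u2: "upd ?Z s s2" using L by (simp add: s2_def L_def)
    have c2: "consts_ok m K s2" by (rule consts_ok_upd[OF u2 s(1)]) (use Y in auto)
    have I2: "I i s2" using L stable[of i s' s2] by (simp add: s2_def L_def)
    have "achieves f c (p @ [Basic (Arith Add rP rP rFOUR)]) s2 (\<lambda>t s''. L (Suc i) s'' \<and> Suc t \<le> k + 2)"
    proof (rule achieves_seq[OF body[OF i I2 c2]])
      show "get s2 32 = ItemW (X ! i)" by (simp add: s2_def)
    next
      fix t s3 assume a: "I (Suc i) s3 \<and> upd Y s2 s3 \<and> t \<le> k"
      have u3: "upd ?Z s s3" using a u2 upd_trans[of ?Z s s2 s3] upd_subset[of Y s2 s3 ?Z] by auto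
      have c3: "consts_ok m K s3" by (rule consts_ok_upd[OF u3 s(1)]) (use Y in auto)
      have "41 \<notin> Y" using Y by auto
      then have g: "get s3 41 = NatW (64 + 4 * i)" using a upd_get[of Y s2 s3 41] L by (simp add: s2_def L_def)
      define s4 where "s4 = put 41 (NatW (64 + 4 * Suc i)) s3"
      have "I (Suc i) s4" using a stable[of "Suc i" s3 s4] by (simp add: s4_def)
      then show "achieves f c [Basic (Arith Add rP rP rFOUR)] s3 (\<lambda>u s''. L (Suc i) s'' \<and> Suc (t + u) \<le> k + 2)"
        using c3 g u3 a by (simp add: consts_ok_def L_def s4_def)
    qed
    then show "holds (Less rP rOE) s' \<and> achieves f c ?p s' (\<lambda>t s''. L (Suc i) s'' \<and> t \<le> k + 2)"
      using i L o by (simp add: L_def s2_def own_def)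
  qed
  then have "achieves f c [Loop (Less rP rOE) ?p] s1
     (\<lambda>t s'. I (length X) s' \<and> upd ?Z s s' \<and> Suc t \<le> length X * (k + 3) + 2)"
    by (elim achieves_mono) (auto simp: L_def algebra_simps)
  then show ?thesis by (simp add: for_own_def s1_def)
qed

section \<open>Greedy extension, counting and sending of acceptable items\<close>

definition tested :: "real \<Rightarrow> 'a list \<Rightarrow> 'a \<Rightarrow> 'a machine \<Rightarrow> 'a machine \<Rightarrow> bool" where
  "tested t G x s s' \<longleftrightarrow> upd {33..<39} s s' \<and> outbox s' = outbox s \<and> rep G s' \<and> consts_ok m K s' \<and>
     get s' rX = ItemW x \<and> get s' rTAU = RealW t \<and>
     get s' rQ = RealW (f (insert x (set G))) \<and> get s' rTC = RealW (t * c x) \<and>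
     get s' rSC = RealW (cost G + c x) \<and> get s' rMG = RealW (f (insert x (set G)) - f (set G))"

lemma test_cmds_tested:
  assumes "rep G s" "set G \<subseteq> E" "get s rX = ItemW x" "x \<in> E" "get s rTAU = RealW t" "consts_ok m K s"
  shows "achieves f c test_cmds s (\<lambda>u s'. u \<le> 10 \<and> tested t G x s s')"
proof (rule achieves_mono[OF test_cmds[OF assms(1-5)]], elim conjE)
  fix u :: nat and s'
  assume a: "u \<le> 10" "upd {33..<39} s s'" "outbox s' = outbox s" "rep G s'" "get s' rX = ItemW x"
    "get s' rTAU = RealW t" "get s' rQ = RealW (f (insert x (set G)))" "get s' rTC = RealW (t * c x)"
    "get s' rSC = RealW (cost G + c x)" "get s' rMG = RealW (f (insert x (set G)) - f (set G))"
  have "consts_ok m K s'" by (rule consts_ok_upd[OF a(2) assms(6)]) auto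
  then show "u \<le> 10 \<and> tested t G x s s'" using a by (simp add: tested_def)
qed

lemma if_acc:
  assumes "rep G s" "set G \<subseteq> E" "get s rX = ItemW x" "x \<in> E" "get s rTAU = RealW t" "consts_ok m K s"
    and yes: "\<And>u s'. acc t G x \<Longrightarrow> u \<le> 12 \<Longrightarrow> tested t G x s s' \<Longrightarrow> achieves f c p s' (\<lambda>v. Q (u + v))"
    and no: "\<And>u s'. \<not> acc t G x \<Longrightarrow> u \<le> 12 \<Longrightarrow> tested t G x s s' \<Longrightarrow> Q u s'"
  shows "achieves f c (if_acc p) s Q"
  unfolding if_acc_def
proof (rule achieves_seq[OF test_cmds_tested[OF assms(1-6)]], elim conjE)
  fix u :: nat and s' assume u: "u \<le> 10" and T: "tested t G x s s'"
  show "achieves f c [Cond (Less rK rSC) [] [Cond (Less rTC rMG) p []]] s' (\<lambda>v. Q (u + v))"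
    using T yes[of "u + 2" s'] no[of "u + 1" s'] no[of "u + 2" s'] u
    by (auto simp: tested_def consts_ok_def acc_def)
qed

lemma ext_inbox:
  assumes s: "rep G s" "good_list G" "get s rTAU = RealW t" "0 \<le> t" "consts_ok m K s"
    and xs: "inbox s = map ItemW xs" "set xs \<subseteq> E"
  shows "achieves f c (for_inbox (if_acc add_code)) s (\<lambda>u s'. u \<le> length xs * 20 + 3 \<and>
    upd ({12,13,14} \<union> scratch \<union> gcells) s s' \<and> outbox s' = outbox s \<and> rep (foldl (ext t) G xs) s')"
proof -
  let ?Y = "{12,13,14} \<union> {33..<39} \<union> gcells"
  define I where "I i s' \<longleftrightarrow> rep (foldl (ext t) G (take i xs)) s' \<and> get s' rTAU = RealW t \<and> outbox s' = outbox s" for i s'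
  have "achieves f c (for_inbox (if_acc add_code)) s (\<lambda>u s'. I (length xs) s' \<and> upd ({30,31,32} \<union> ?Y) s s' \<and>
      u + 0 \<le> 0 + length xs * (17 + 3) + 3)"
  proof (rule for_inbox[where \<Phi> = "\<lambda>_. 0"])
    show "I 0 s" using s by (simp add: I_def)
    show "I i s2" if "I i s1" "upd {30,31,32,41} s1 s2" "tape s2 = tape s1" "outbox s2 = outbox s1" for i s1 s2
      using that rep_upd[OF that(2) _ _ that(3)] upd_get[OF that(2), of 15] by (auto simp: I_def)
    show "?Y \<inter> {1,3,5,6,7,8,28,30,31} = {}" by auto
  next
    fix i s1 assume i: "i < length xs" and I: "I i s1" and c1: "consts_ok m K s1" and x: "get s1 rX = inbox s ! i"
    let ?G = "foldl (ext t) G (take i xs)"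
    have xE: "xs ! i \<in> E" using i xs by auto
    have "set (take i xs) \<subseteq> E" using xs(2) set_take_subset by fastforce
    then have gG: "good_list ?G" using good_list_foldl_ext s by blast
    have tk: "foldl (ext t) G (take (Suc i) xs) = ext t ?G (xs ! i)" using i by (simp add: take_Suc_conv_app_nth)
    show "achieves f c (if_acc add_code) s1 (\<lambda>u s'. I (Suc i) s' \<and> upd ?Y s1 s' \<and> u + 0 \<le> 0 + 17)"
    proof (rule if_acc)
      show "rep ?G s1" "set ?G \<subseteq> E" "get s1 rX = ItemW (xs ! i)" "get s1 rTAU = RealW t"
        using I gG x xs i by (auto simp: I_def good_list_def)
      fix u :: nat and s' assume u: "u \<le> 12" and T: "tested t ?G (xs ! i) s1 s'"
      have U1: "upd ?Y s1 s'" using T upd_subset[of "{33..<39}" s1 s' ?Y] by (auto simp: tested_def)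
      { assume a: "\<not> acc t ?G (xs ! i)"
        then show "I (Suc i) s' \<and> upd ?Y s1 s' \<and> u + 0 \<le> 0 + 17"
          using T I u U1 unfolding I_def tk by (simp add: ext_acc tested_def) }
      assume a: "acc t ?G (xs ! i)"
      show "achieves f c add_code s' (\<lambda>v s''. I (Suc i) s'' \<and> upd ?Y s1 s'' \<and> u + v + 0 \<le> 0 + 17)"
      proof (rule achieves_mono[OF add_code[of ?G s' "xs ! i"]])
        fix v :: nat and s'' assume b: "v = 5 \<and> upd ({12,13,14} \<union> gcells) s' s'' \<and> outbox s'' = outbox s' \<and> rep (?G @ [xs ! i]) s''"
        then have U2: "upd ?Y s' s''" using upd_subset[of "{12,13,14} \<union> gcells" s' s'' ?Y] by auto
        then show "I (Suc i) s'' \<and> upd ?Y s1 s'' \<and> u + v + 0 \<le> 0 + 17"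
          using b T I u upd_trans[OF U1 U2] upd_get[OF U2, of 15] a unfolding I_def tk
          by (simp add: ext_acc tested_def)
      qed (use T gG xE in \<open>auto simp: tested_def\<close>)
    qed (use xE c1 in auto)
  qed (use s xs in auto)
  then show ?thesis
  proof (rule achieves_mono, elim conjE)
    fix u :: nat and s' assume "I (length xs) s'" "upd ({30,31,32} \<union> ?Y) s s'" "u + 0 \<le> 0 + length xs * (17 + 3) + 3"
    moreover from this have "upd ({12,13,14} \<union> scratch \<union> gcells) s s'" by (elim upd_subset) auto
    ultimately show "u \<le> length xs * 20 + 3 \<and> upd ({12,13,14} \<union> scratch \<union> gcells) s s' \<and>
      outbox s' = outbox s \<and> rep (foldl (ext t) G xs) s'" by (simp add: I_def)
  qed
qed

lemma count_own:
  assumes s: "rep G s" "set G \<subseteq> E" "get s rTAU = RealW t" "consts_ok m K s"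
    and X: "own X s" "set X \<subseteq> E" and cnt: "get s rCNT = NatW 0"
  shows "achieves f c (for_own (if_acc [Basic (Arith Add rCNT rCNT rONE)])) s
    (\<lambda>u s'. u \<le> length X * 16 + 2 \<and> upd ({24} \<union> scratch) s s' \<and> outbox s' = outbox s \<and> rep G s' \<and>
      get s' rCNT = NatW (length (filter (acc t G) X)))"
proof -
  let ?Y = "{24} \<union> {33..<39}"
  define I where "I i s' \<longleftrightarrow> rep G s' \<and> get s' rTAU = RealW t \<and> outbox s' = outbox s \<and>
    get s' rCNT = NatW (length (filter (acc t G) (take i X)))" for i s'
  have "achieves f c (for_own (if_acc [Basic (Arith Add rCNT rCNT rONE)])) s
    (\<lambda>u s'. I (length X) s' \<and> upd ({32,41} \<union> ?Y) s s' \<and> u \<le> length X * (13 + 3) + 2)"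
  proof (rule for_own)
    show "I 0 s" using s cnt by (simp add: I_def)
    show "I i s2" if "I i s1" "upd {30,31,32,41} s1 s2" "tape s2 = tape s1" "outbox s2 = outbox s1" for i s1 s2
      using that rep_upd[OF that(2) _ _ that(3)] upd_get[OF that(2), of 15] upd_get[OF that(2), of 24] by (auto simp: I_def)
  next
    fix i s1 assume i: "i < length X" and I: "I i s1" and c1: "consts_ok m K s1" and x: "get s1 rX = ItemW (X ! i)"
    have tk: "filter (acc t G) (take (Suc i) X) = filter (acc t G) (take i X) @ (if acc t G (X ! i) then [X ! i] else [])"
      using i by (simp add: take_Suc_conv_app_nth)
    show "achieves f c (if_acc [Basic (Arith Add rCNT rCNT rONE)]) s1 (\<lambda>u s'. I (Suc i) s' \<and> upd ?Y s1 s' \<and> u \<le> 13)"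
    proof (rule if_acc[of G _ "X ! i" t])
      fix u :: nat and s' assume u: "u \<le> 12" and T: "tested t G (X ! i) s1 s'"
      have U1: "upd ?Y s1 s'" using T upd_subset[of "{33..<39}" s1 s' ?Y] by (auto simp: tested_def)
      have g: "get s' 24 = get s1 24" using T upd_get[of "{33..<39}" s1 s' 24] by (auto simp: tested_def)
      { assume a: "\<not> acc t G (X ! i)"
        then show "I (Suc i) s' \<and> upd ?Y s1 s' \<and> u \<le> 13"
          using T I u U1 g unfolding I_def tk by (simp add: tested_def) }
      assume a: "acc t G (X ! i)"
      then show "achieves f c [Basic (Arith Add rCNT rCNT rONE)] s' (\<lambda>v s''. I (Suc i) s'' \<and> upd ?Y s1 s'' \<and> u + v \<le> 13)"
        using T I u U1 g unfolding I_def tk by (simp add: tested_def consts_ok_def rep_def)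
    qed (use c1 x I s X i in \<open>auto simp: I_def\<close>)
  qed (use s X in auto)
  then show ?thesis
  proof (rule achieves_mono, elim conjE)
    fix u :: nat and s' assume "I (length X) s'" "upd ({32,41} \<union> ?Y) s s'" "u \<le> length X * (13 + 3) + 2"
    moreover from this have "upd ({24} \<union> scratch) s s'" by (elim upd_subset) auto
    ultimately show "u \<le> length X * 16 + 2 \<and> upd ({24} \<union> scratch) s s' \<and> outbox s' = outbox s \<and> rep G s' \<and>
      get s' rCNT = NatW (length (filter (acc t G) X))" by (simp add: I_def)
  qed
qed

lemma send_own:
  assumes s: "rep G s" "set G \<subseteq> E" "get s rTAU = RealW t" "consts_ok m K s"
    and X: "own X s" "set X \<subseteq> E"
  shows "achieves f c (for_own (if_acc [Basic (Send rZERO rX)])) s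
    (\<lambda>u s'. u \<le> length X * 16 + 2 \<and> upd scratch s s' \<and> rep G s' \<and>
      outbox s' = outbox s @ map (\<lambda>x. (0, ItemW x)) (filter (acc t G) X))"
proof -
  let ?Y = "{33..<39}"
  define I where "I i s' \<longleftrightarrow> rep G s' \<and> get s' rTAU = RealW t \<and>
    outbox s' = outbox s @ map (\<lambda>x. (0, ItemW x)) (filter (acc t G) (take i X))" for i s'
  have "achieves f c (for_own (if_acc [Basic (Send rZERO rX)])) s
    (\<lambda>u s'. I (length X) s' \<and> upd ({32,41} \<union> ?Y) s s' \<and> u \<le> length X * (13 + 3) + 2)"
  proof (rule for_own)
    show "I 0 s" using s by (simp add: I_def)
    show "I i s2" if "I i s1" "upd {30,31,32,41} s1 s2" "tape s2 = tape s1" "outbox s2 = outbox s1" for i s1 s2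
      using that rep_upd[OF that(2) _ _ that(3)] upd_get[OF that(2), of 15] by (auto simp: I_def)
  next
    fix i s1 assume i: "i < length X" and I: "I i s1" and c1: "consts_ok m K s1" and x: "get s1 rX = ItemW (X ! i)"
    have tk: "filter (acc t G) (take (Suc i) X) = filter (acc t G) (take i X) @ (if acc t G (X ! i) then [X ! i] else [])"
      using i by (simp add: take_Suc_conv_app_nth)
    show "achieves f c (if_acc [Basic (Send rZERO rX)]) s1 (\<lambda>u s'. I (Suc i) s' \<and> upd ?Y s1 s' \<and> u \<le> 13)"
    proof (rule if_acc[of G _ "X ! i" t])
      fix u :: nat and s' assume u: "u \<le> 12" and T: "tested t G (X ! i) s1 s'"
      { assume a: "\<not> acc t G (X ! i)"
        then show "I (Suc i) s' \<and> upd ?Y s1 s' \<and> u \<le> 13"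
          using T I u unfolding I_def tk by (simp add: tested_def) }
      assume a: "acc t G (X ! i)"
      then show "achieves f c [Basic (Send rZERO rX)] s' (\<lambda>v s''. I (Suc i) s'' \<and> upd ?Y s1 s'' \<and> u + v \<le> 13)"
        using T I u unfolding I_def tk by (simp add: tested_def consts_ok_def rep_def)
    qed (use c1 x I s X i in \<open>auto simp: I_def\<close>)
  qed (use s X in auto)
  then show ?thesis
  proof (rule achieves_mono, elim conjE)
    fix u :: nat and s' assume "I (length X) s'" "upd ({32,41} \<union> ?Y) s s'" "u \<le> length X * (13 + 3) + 2"
    moreover from this have "upd scratch s s'" by (elim upd_subset) auto
    ultimately show "u \<le> length X * 16 + 2 \<and> upd scratch s s' \<and> rep G s' \<and>
      outbox s' = outbox s @ map (\<lambda>x. (0, ItemW x)) (filter (acc t G) X)" by (simp add: I_def)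
  qed
qed

text \<open>\<open>rBI\<close> is meaningful only if \<open>v\<close> exceeds the value of
  \<open>G\<close> and may otherwise be stale. This is why the code compares \<open>rFG\<close> with
  \<open>rBV\<close> before using it.\<close>

definition augmented :: "'a list \<Rightarrow> 'a list \<Rightarrow> real \<Rightarrow> 'a machine \<Rightarrow> bool" where
  "augmented G X v s \<longleftrightarrow> get s rBV = RealW v \<and> f (set G) \<le> v \<and>
     (\<forall>x\<in>set X. cost G + c x \<le> K \<longrightarrow> f (insert x (set G)) \<le> v) \<and>
     (v = f (set G) \<or> (\<exists>x\<in>set X. get s rBI = ItemW x \<and> cost G + c x \<le> K \<and> v = f (insert x (set G))))"

lemma aug_code:
  assumes "rep G s" "set G \<subseteq> E" "get s rX = ItemW x" "x \<in> E" "get s rTAU = RealW t" "consts_ok m K s"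
    and a: "augmented G X v s"
  shows "achieves f c aug_code s (\<lambda>u s'. (\<exists>v'. augmented G (X @ [x]) v' s') \<and> upd ({22,23} \<union> {33..<39}) s s' \<and>
     rep G s' \<and> get s' rTAU = RealW t \<and> outbox s' = outbox s \<and> u \<le> 14)"
  unfolding aug_code_def
proof (rule achieves_seq[OF test_cmds_tested[OF assms(1-6)]], elim conjE)
  fix u :: nat and s' assume u: "u \<le> 10" and T: "tested t G x s s'"
  have U1: "upd ({22,23} \<union> {33..<39}) s s'"
    using T upd_subset[of "{33..<39}" s s' "{22,23} \<union> {33..<39}"] by (auto simp: tested_def)
  have g: "get s' 22 = get s 22" "get s' 23 = get s 23" using T upd_get[of "{33..<39}" s s'] by (auto simp: tested_def)
  have bv: "get s' 22 = RealW v" using a g by (simp add: augmented_def)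
  consider "K < cost G + c x" | "\<not> K < cost G + c x" "v < f (insert x (set G))"
    | "\<not> K < cost G + c x" "\<not> v < f (insert x (set G))" by blast
  then show "achieves f c [Cond (Less rK rSC) [] [Cond (Less rBV rQ) [Basic (Move rBV rQ), Basic (Move rBI rX)] []]] s'
    (\<lambda>w s'. (\<exists>v'. augmented G (X @ [x]) v' s') \<and> upd ({22,23} \<union> {33..<39}) s s' \<and>
     rep G s' \<and> get s' rTAU = RealW t \<and> outbox s' = outbox s \<and> u + w \<le> 14)"
  proof cases
    case 1
    then have "augmented G (X @ [x]) v s'" using a g by (auto simp: augmented_def)
    then have "\<exists>v'. augmented G (X @ [x]) v' s'" by blast
    then show ?thesis using T U1 u 1 by (simp add: tested_def consts_ok_def)
  next
    case 2
    have "augmented G (X @ [x]) (f (insert x (set G))) (put 23 (ItemW x) (put 22 (RealW (f (insert x (set G)))) s'))"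
      unfolding augmented_def
    proof (intro conjI ballI impI)
      fix y assume "y \<in> set (X @ [x])" "cost G + c y \<le> K"
      then consider "y = x" | "y \<in> set X" by auto
      then show "f (insert y (set G)) \<le> f (insert x (set G))"
      proof cases
        assume "y \<in> set X"
        then have "f (insert y (set G)) \<le> v" using a \<open>cost G + c y \<le> K\<close> by (simp add: augmented_def)
        then show ?thesis using 2 by simp
      qed simp
    qed (use a 2 in \<open>simp_all add: augmented_def\<close>)
    then have "\<exists>v'. augmented G (X @ [x]) v' (put 23 (ItemW x) (put 22 (RealW (f (insert x (set G)))) s'))" by blast
    then show ?thesis using T U1 u 2 bv by (simp add: tested_def consts_ok_def rep_def)
  next
    case 3
    then have "augmented G (X @ [x]) v s'" using a g by (auto simp: augmented_def)
    then have "\<exists>v'. augmented G (X @ [x]) v' s'" by blast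
    then show ?thesis using T U1 u 3 bv by (simp add: tested_def consts_ok_def)
  qed
qed

lemma augmented_upd: "augmented G X v s \<Longrightarrow> upd Y s s' \<Longrightarrow> Y \<inter> {22,23} = {} \<Longrightarrow> augmented G X v s'"
  using upd_get[of Y s s' 22] upd_get[of Y s s' 23] by (auto simp: augmented_def)

lemma aug_own:
  assumes s: "rep G s" "set G \<subseteq> E" "get s rTAU = RealW t" "consts_ok m K s"
    and X: "own X s" "set X \<subseteq> E" and bv: "get s rBV = RealW (f (set G))"
  shows "achieves f c (for_own aug_code) s
    (\<lambda>u s'. u \<le> length X * 17 + 2 \<and> upd ({22,23} \<union> scratch) s s' \<and> rep G s' \<and> outbox s' = outbox s \<and>
      (\<exists>v. augmented G X v s'))"
proof -
  let ?Y = "{22,23} \<union> {33..<39}"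
  define I where "I i s' \<longleftrightarrow> rep G s' \<and> get s' rTAU = RealW t \<and> outbox s' = outbox s \<and> (\<exists>v. augmented G (take i X) v s')" for i s'
  have "achieves f c (for_own aug_code) s
    (\<lambda>u s'. I (length X) s' \<and> upd ({32,41} \<union> ?Y) s s' \<and> u \<le> length X * (14 + 3) + 2)"
  proof (rule for_own)
    show "I 0 s" using s bv by (auto simp: I_def augmented_def)
    show "I i s2" if "I i s1" "upd {30,31,32,41} s1 s2" "tape s2 = tape s1" "outbox s2 = outbox s1" for i s1 s2
      using that rep_upd[OF that(2) _ _ that(3)] upd_get[OF that(2), of 15] augmented_upd[OF _ that(2)]
      by (auto simp: I_def) blast
  next
    fix i s1 assume i: "i < length X" and I: "I i s1" and c1: "consts_ok m K s1" and x: "get s1 rX = ItemW (X ! i)"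
    obtain v where v: "augmented G (take i X) v s1" using I by (auto simp: I_def)
    have tk: "take (Suc i) X = take i X @ [X ! i]" using i by (simp add: take_Suc_conv_app_nth)
    show "achieves f c aug_code s1 (\<lambda>u s'. I (Suc i) s' \<and> upd ?Y s1 s' \<and> u \<le> 14)"
      by (rule achieves_mono[OF aug_code[OF _ s(2) x _ _ c1 v]]) (use I i X in \<open>auto simp: I_def tk\<close>)
  qed (use s X in auto)
  then show ?thesis
  proof (rule achieves_mono, elim conjE)
    fix u :: nat and s' assume "I (length X) s'" "upd ({32,41} \<union> ?Y) s s'" "u \<le> length X * (14 + 3) + 2"
    moreover from this have "upd ({22,23} \<union> scratch) s s'" by (elim upd_subset) auto
    ultimately show "u \<le> length X * 17 + 2 \<and> upd ({22,23} \<union> scratch) s s' \<and> rep G s' \<and> outbox s' = outbox s \<and>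
      (\<exists>v. augmented G X v s')" by (simp add: I_def)
  qed
qed

lemma aug_inbox:
  assumes s: "rep G s" "set G \<subseteq> E" "get s rTAU = RealW t" "consts_ok m K s"
    and xs: "inbox s = map ItemW xs" "set xs \<subseteq> E" and bv: "get s rBV = RealW (f (set G))"
  shows "achieves f c (for_inbox aug_code) s
    (\<lambda>u s'. u \<le> length xs * 17 + 3 \<and> upd ({22,23} \<union> scratch) s s' \<and> rep G s' \<and> outbox s' = outbox s \<and>
      (\<exists>v. augmented G xs v s'))"
proof -
  let ?Y = "{22,23} \<union> {33..<39}"
  define I where "I i s' \<longleftrightarrow> rep G s' \<and> get s' rTAU = RealW t \<and> outbox s' = outbox s \<and> (\<exists>v. augmented G (take i xs) v s')" for i s'
  have "achieves f c (for_inbox aug_code) s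
    (\<lambda>u s'. I (length xs) s' \<and> upd ({30,31,32} \<union> ?Y) s s' \<and> u + 0 \<le> 0 + length xs * (14 + 3) + 3)"
  proof (rule for_inbox[where \<Phi> = "\<lambda>_. 0"])
    show "I 0 s" using s bv by (auto simp: I_def augmented_def)
    show "I i s2" if "I i s1" "upd {30,31,32,41} s1 s2" "tape s2 = tape s1" "outbox s2 = outbox s1" for i s1 s2
      using that rep_upd[OF that(2) _ _ that(3)] upd_get[OF that(2), of 15] augmented_upd[OF _ that(2)]
      by (auto simp: I_def) blast
  next
    fix i s1 assume i: "i < length xs" and I: "I i s1" and c1: "consts_ok m K s1" and x: "get s1 rX = inbox s ! i"
    obtain v where v: "augmented G (take i xs) v s1" using I by (auto simp: I_def)
    have x': "get s1 rX = ItemW (xs ! i)" using x xs i by simp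
    have tk: "take (Suc i) xs = take i xs @ [xs ! i]" using i by (simp add: take_Suc_conv_app_nth)
    show "achieves f c aug_code s1 (\<lambda>u s'. I (Suc i) s' \<and> upd ?Y s1 s' \<and> u + 0 \<le> 0 + 14)"
      by (rule achieves_mono[OF aug_code[OF _ s(2) x' _ _ c1 v]]) (use I i xs in \<open>auto simp: I_def tk\<close>)
  qed (use s xs in auto)
  then show ?thesis
  proof (rule achieves_mono, elim conjE)
    fix u :: nat and s' assume "I (length xs) s'" "upd ({30,31,32} \<union> ?Y) s s'" "u + 0 \<le> 0 + length xs * (14 + 3) + 3"
    moreover from this have "upd ({22,23} \<union> scratch) s s'" by (elim upd_subset) auto
    ultimately show "u \<le> length xs * 17 + 3 \<and> upd ({22,23} \<union> scratch) s s' \<and> rep G s' \<and> outbox s' = outbox s \<and>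
      (\<exists>v. augmented G xs v s')" by (simp add: I_def)
  qed
qed

section \<open>The streaming estimate on a machine\<close>

lemma good_list_qstep:
  assumes "set xs \<subseteq> E"
  shows "good_list (snd (foldl qstep (0, []) xs))"
proof -
  have V: "f S \<le> f E" if "feasible E c K S" for S
    by (rule monotone) (use that items_subset in \<open>auto simp: feasible_def\<close>)
  have "0 \<le> f E" using nonneg items_subset by simp
  then have "qinv (f E) {} {} (0, [])" using nonneg[of "{}"] capacity_pos by (simp add: qinv_def)
  then obtain P where "qinv (f E) (set xs) P (foldl qstep (0, []) xs)"
    using qinv_foldl[of "f E" "{}" "{}" "(0, [])" xs] assms V by auto
  then show ?thesis by (auto simp: qinv_def split: prod.splits)
qed

definition qrep :: "real \<times> 'a list \<Rightarrow> 'a machine \<Rightarrow> bool" where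
  "qrep st s \<longleftrightarrow> rep (snd st) s \<and> get s rRHO = RealW (fst st) \<and> get s rTAU = RealW ((fst st + fst st) / K)"

text \<open>Clearing the list is paid for by the insertions that filled it.\<close>

definition pot :: "'a machine \<Rightarrow> nat" where
  "pot s = (case get s rGE of NatW k \<Rightarrow> k | _ \<Rightarrow> 0)"

lemma qs_code:
  assumes q: "qrep (r, S) s" "good_list S" "get s rX = ItemW x" "x \<in> E" "consts_ok m K s"
  shows "achieves f c qs_code s (\<lambda>u s'. qrep (qstep (r, S) x) s' \<and> outbox s' = outbox s \<and>
    upd ({12..<17} \<union> {32..<39} \<union> {41} \<union> gcells) s s' \<and> u + pot s' \<le> pot s + 30)"
proof -
  let ?Y = "{12..<17} \<union> {32..<39} \<union> {41} \<union> gcells"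
  let ?t = "(r + r) / K"
  let ?Q = "\<lambda>u s'. qrep (qstep (r, S) x) s' \<and> outbox s' = outbox s \<and> upd ?Y s s' \<and> u + pot s' \<le> pot s + 30"
  have r: "rep S s" "get s rTAU = RealW ?t" "get s rRHO = RealW r" using q by (auto simp: qrep_def)
  have SE: "set S \<subseteq> E" using q by (simp add: good_list_def)
  have pot: "pot s' = 65 + 4 * length G" if "rep G s'" for G s' using that by (simp add: pot_def rep_def)
  show ?thesis unfolding qs_code_def
  proof (rule achieves_seq[OF test_cmds_tested[OF r(1) SE q(3,4) r(2) q(5)]], elim conjE)
    fix u :: nat and s1 assume u: "u \<le> 10" and T: "tested ?t S x s s1"
    have "upd {33..<39} s s1" using T by (simp add: tested_def)
    then have U1: "upd ?Y s s1" by (elim upd_subset) auto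
    have r1: "rep S s1" "consts_ok m K s1" "outbox s1 = outbox s" using T by (auto simp: tested_def)
    have rho1: "get s1 16 = RealW r" using T upd_get[of "{33..<39}" s s1 16] r by (auto simp: tested_def)
    let ?inner = "[Basic (Move rRHO rFG), Basic (Arith Add rTAU rRHO rRHO), Basic (Arith Div rTAU rTAU rK)] @ clear_code"
    show "achieves f c [Cond (Less rTC rMG) (add_code @ [Cond (Less rCG rK) [] ?inner]) []] s1 (\<lambda>v. ?Q (u + v))"
    proof (cases "?t * c x < f (insert x (set S)) - f (set S)")
      case False
      then have "qstep (r, S) x = (r, S)" by (simp add: qstep_def)
      then show ?thesis using False T U1 u r1 rho1 pot[OF r1(1)] pot[OF r(1)]
        by (simp add: tested_def qrep_def)
    next
      case True
      have "achieves f c (add_code @ [Cond (Less rCG rK) [] ?inner]) s1 (\<lambda>v. ?Q (Suc (u + v)))"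
      proof (rule achieves_seq[OF add_code[OF r1(1) q(2) _ q(4) r1(2)]], goal_cases)
        case (4 v s2)
        then have v: "v = 5" "upd ({12,13,14} \<union> gcells) s1 s2" "outbox s2 = outbox s1" "rep (S @ [x]) s2" by auto
        have "upd ?Y s1 s2" using v(2) by (elim upd_subset) auto
        then have U2: "upd ?Y s s2" using upd_trans[OF U1] by blast
        have c2: "consts_ok m K s2" by (rule consts_ok_upd[OF v(2) r1(2)]) auto
        have g: "get s2 16 = RealW r" "get s2 15 = RealW ?t"
          using upd_get[OF v(2)] rho1 T by (auto simp: tested_def)
        have cg: "get s2 14 = RealW (cost (S @ [x]))" "get s2 13 = RealW (f (set (S @ [x])))"
          using v(4) unfolding rep_def by blast+
        show ?case
        proof (cases "cost (S @ [x]) < K")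
          case c: True
          then have "qstep (r, S) x = (r, S @ [x])" using True by (simp add: qstep_def)
          then show ?thesis using c v U2 g u r1 c2 cg pot[OF v(4)] pot[OF r(1)]
            by (simp add: qrep_def consts_ok_def)
        next
          case c: False
          let ?r = "f (set (S @ [x]))"
          have qs: "qstep (r, S) x = (?r, [])" using True c by (simp add: qstep_def)
          define s3 where "s3 = put 15 (RealW ((?r + ?r) / K)) (put 15 (RealW (?r + ?r)) (put 16 (RealW ?r) s2))"
          have U3: "upd ?Y s s3" "upd {15,16} s2 s3" using U2 by (simp_all add: s3_def)
          have r3: "rep (S @ [x]) s3" by (rule rep_upd[OF U3(2) v(4)]) (auto simp: s3_def)
          have c3: "consts_ok m K s3" by (rule consts_ok_upd[OF U3(2) c2]) auto
          \<comment> \<open>Clearing takes at most \<open>4 * length S + 10\<close> steps, while the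
            potential drops by \<open>4 * length S\<close> over the whole iteration. Only a constant
            remains to be paid.\<close>
          have "achieves f c clear_code s3 (\<lambda>w. ?Q (Suc (Suc (Suc (Suc (Suc (u + (v + w))))))))"
          proof (rule achieves_mono[OF clear_code[OF r3 c3]], elim conjE)
            fix w :: nat and s4
            assume w: "w \<le> 4 * length (S @ [x]) + 6" "upd {12,13,14,32,41} s3 s4" "outbox s4 = outbox s3" "rep [] s4"
            have "upd ?Y s3 s4" using w(2) by (elim upd_subset) auto
            then have U4: "upd ?Y s s4" using upd_trans[OF U3(1)] by blast
            have "get s4 15 = get s3 15" "get s4 16 = get s3 16" using upd_get[OF w(2)] by auto
            then show "?Q (Suc (Suc (Suc (Suc (Suc (u + (v + w))))))) s4"
              using w v U4 r1 u pot[OF w(4)] pot[OF r(1)] unfolding qs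
              by (simp add: qrep_def s3_def)
          qed
          then show ?thesis using c c2 cg by (simp add: consts_ok_def s3_def)
        qed
      qed (use T in \<open>auto simp: tested_def\<close>)
      then show ?thesis using True T by (simp add: tested_def)
    qed
  qed
qed

lemma qs_inbox:
  assumes s: "rep [] s" "get s rRHO = RealW 0" "get s rTAU = RealW 0" "consts_ok m K s"
    and xs: "inbox s = map ItemW xs" "set xs \<subseteq> E"
  shows "achieves f c (for_inbox qs_code) s (\<lambda>u s'. u \<le> length xs * 33 + 3 \<and>
    upd ({12..<17} \<union> scratch \<union> gcells) s s' \<and> outbox s' = outbox s \<and> qrep (foldl qstep (0, []) xs) s')"
proof -
  let ?Y = "{12..<17} \<union> {32..<39} \<union> {41} \<union> gcells"
  define I where "I i s' \<longleftrightarrow> qrep (foldl qstep (0, []) (take i xs)) s' \<and> outbox s' = outbox s" for i s'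
  have ps: "pot s = 65" using s by (simp add: pot_def rep_def)
  have "achieves f c (for_inbox qs_code) s (\<lambda>u s'. I (length xs) s' \<and> upd ({30,31,32} \<union> ?Y) s s' \<and>
      u + pot s' \<le> pot s + length xs * (30 + 3) + 3)"
  proof (rule for_inbox[where \<Phi> = pot])
    show "I 0 s" using s by (simp add: I_def qrep_def)
    show "I i s2" if "I i s1" "upd {30,31,32,41} s1 s2" "tape s2 = tape s1" "outbox s2 = outbox s1" for i s1 s2
      using that rep_upd[OF that(2) _ _ that(3)] upd_get[OF that(2), of 15] upd_get[OF that(2), of 16]
      by (auto simp: I_def qrep_def)
    show "?Y \<inter> {1,3,5,6,7,8,28,30,31} = {}" by auto
    show "pot s' = pot s" if "get s' 12 = get s 12" for s s' using that by (simp add: pot_def)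
  next
    fix i s1 assume i: "i < length xs" and I: "I i s1" and c1: "consts_ok m K s1" and x: "get s1 rX = inbox s ! i"
    obtain r S where rS: "foldl qstep (0, []) (take i xs) = (r, S)" by (cases "foldl qstep (0, []) (take i xs)")
    have "set (take i xs) \<subseteq> E" using xs(2) set_take_subset by fastforce
    then have gS: "good_list S" using good_list_qstep[of "take i xs"] rS by simp
    have tk: "foldl qstep (0, []) (take (Suc i) xs) = qstep (r, S) (xs ! i)"
      using i rS by (simp add: take_Suc_conv_app_nth)
    show "achieves f c qs_code s1 (\<lambda>u s'. I (Suc i) s' \<and> upd ?Y s1 s' \<and> u + pot s' \<le> pot s1 + 30)"
      by (rule achieves_mono[OF qs_code[OF _ gS _ _ c1, of r "xs ! i"]])
        (use I x i xs rS tk in \<open>auto simp: I_def\<close>)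
  qed (use s xs in auto)
  then show ?thesis
  proof (rule achieves_mono, elim conjE)
    fix u :: nat and s' assume a: "I (length xs) s'" "upd ({30,31,32} \<union> ?Y) s s'" "u + pot s' \<le> pot s + length xs * (30 + 3) + 3"
    have "upd ({12..<17} \<union> scratch \<union> gcells) s s'" using a(2) by (elim upd_subset) auto
    moreover have "65 \<le> pot s'" using a(1) by (simp add: I_def qrep_def rep_def pot_def)
    ultimately show "u \<le> length xs * 33 + 3 \<and> upd ({12..<17} \<union> scratch \<union> gcells) s s' \<and>
      outbox s' = outbox s \<and> qrep (foldl qstep (0, []) xs) s'" using a ps by (simp add: I_def)
  qed
qed

section \<open>Random draws on a machine\<close>

definition to_all :: "'a list \<Rightarrow> (nat \<times> 'a word) list" where
  "to_all xs = concat (map (\<lambda>x. map (\<lambda>j. (j, ItemW x)) [0..<m]) xs)"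

lemma draw_upt: "0 < n \<Longrightarrow> draw [0..<n] = pmf_of_set {..<n}"
proof -
  assume "0 < n"
  then have "draw [0..<n] = map_pmf (\<lambda>x. x) (pmf_of_set {..<n})"
    unfolding draw_def by (intro map_pmf_cong) (auto simp: lessThan_empty_iff)
  then show ?thesis by simp
qed

text \<open>The sample consists of positions because \<open>Random\<close> yields naturals; items
  follow by lookup. \<open>i\<close> draws are done and \<open>j\<close> remain, and the real
  counter stops the loop at the first integer not below \<open>l\<close>.\<close>

lemma draw_loop:
  assumes X: "own X s" "X \<noteq> []" and cs: "consts_ok m K s"
    and lim: "get s rLIM = RealW l" "nat \<lceil>l\<rceil> = i + j" "get s rD = RealW (real i)"
  shows "achieves_random f c [Loop (Less rD rLIM) ([Basic (Random rR rNI), Basic (Arith Add rR rR rR), Basic (Arith Add rR rR rR),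
       Basic (ConstN rA 64), Basic (Arith Add rA rA rR), Basic (Load rX rA)] @ bcast 0 rX @ [Basic (Arith Add rD rD rRONE)])] s
     (draws (replicate j [0..<length X])) (\<lambda>t is s'. t = j * (3 * m + 10) + 1 \<and> upd scratch s s' \<and> tape s' = tape s \<and>
        outbox s' = outbox s @ to_all (map ((!) X) is))"
  (is "achieves_random f c [Loop ?b ?p] s _ _")
  using assms
proof (induction j arbitrary: i s)
  case 0
  then have "\<not> holds ?b s" by simp linarith
  then have "runs f c [Loop ?b ?p] s (Suc 0) (return_pmf s)" by (intro runs_Loop) (simp add: runs_Nil)
  then show ?case unfolding achieves_random_def
    by (intro exI[of _ "Suc 0"] exI[of _ "\<lambda>_. s"]) (simp add: to_all_def)
next
  case (Suc j)
  let ?n = "length X" and ?k = "3 * m + 10"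
  let ?rest = "[Basic (Arith Add rR rR rR), Basic (Arith Add rR rR rR),
       Basic (ConstN rA 64), Basic (Arith Add rA rA rR), Basic (Load rX rA)] @ bcast 0 rX @ [Basic (Arith Add rD rD rRONE)]"
  have n0: "0 < ?n" using Suc.prems by simp
  have h: "holds ?b s" using Suc.prems(4,5,6) by simp linarith
  have ex: "exec f c (Random rR rNI) s = map_pmf (\<lambda>a. put 43 (NatW a) s) (pmf_of_set {..<?n})"
    using Suc.prems n0 by (simp add: own_def)
  have "\<exists>s2. runs f c ?rest (put 43 (NatW a) s) (3 * m + 8) (return_pmf s2) \<and> upd scratch s s2 \<and> tape s2 = tape s \<and>
      outbox s2 = outbox s @ to_all [X ! a] \<and> get s2 42 = RealW (real (Suc i))" if a: "a < ?n" for a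
  proof -
    define s1 where "s1 = put 32 (ItemW (X ! a)) (put 44 (NatW (64 + 4 * a)) (put 44 (NatW 64)
       (put 43 (NatW (4 * a)) (put 43 (NatW (2 * a)) (put 43 (NatW a) s)))))"
    have u1: "upd scratch s s1" by (simp add: s1_def)
    have c1: "consts_ok m K s1" by (rule consts_ok_upd[OF u1 Suc.prems(3)]) auto
    have "achieves f c (bcast 0 rX @ [Basic (Arith Add rD rD rRONE)]) s1 (\<lambda>t s2. Suc (Suc (Suc (Suc (Suc t)))) = 3 * m + 8 \<and>
       upd scratch s s2 \<and> tape s2 = tape s \<and> outbox s2 = outbox s @ to_all [X ! a] \<and> get s2 42 = RealW (real (Suc i)))"
    proof (rule achieves_seq[OF bcast[OF c1, of 32 0]], simp, elim conjE)
      fix t :: nat and s2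
      assume t: "t = 3 * (m - 0) + 2" "upd {40} s1 s2" "tape s2 = tape s1"
        "outbox s2 = outbox s1 @ map (\<lambda>i. (i, get s1 32)) [0..<m]"
      have "upd scratch s1 s2" using t(2) by (elim upd_subset) auto
      then have u2: "upd scratch s s2" using upd_trans[OF u1] by blast
      have "get s2 42 = RealW (real i)" "get s2 8 = RealW 1"
        using upd_get[OF t(2), of 42] upd_get[OF t(2), of 8] Suc.prems(6) c1 by (auto simp: s1_def consts_ok_def)
      then show "achieves f c [Basic (Arith Add rD rD rRONE)] s2 (\<lambda>u s2. Suc (Suc (Suc (Suc (Suc (t + u))))) = 3 * m + 8 \<and>
         upd scratch s s2 \<and> tape s2 = tape s \<and> outbox s2 = outbox s @ to_all [X ! a] \<and> get s2 42 = RealW (real (Suc i)))"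
        using t u2 by (simp add: s1_def to_all_def)
    qed
    moreover have "get s (64 + 4 * a) = ItemW (X ! a)" using Suc.prems(1) a by (simp add: own_def)
    ultimately have "achieves f c ?rest (put 43 (NatW a) s) (\<lambda>t s2. t = 3 * m + 8 \<and>
       upd scratch s s2 \<and> tape s2 = tape s \<and> outbox s2 = outbox s @ to_all [X ! a] \<and> get s2 42 = RealW (real (Suc i)))"
      by (simp add: s1_def mult_2[symmetric])
    then show ?thesis by (auto simp: achieves_def)
  qed
  then obtain S2 where S2: "\<And>a. a < ?n \<Longrightarrow> runs f c ?rest (put 43 (NatW a) s) (3 * m + 8) (return_pmf (S2 a)) \<and>
      upd scratch s (S2 a) \<and> tape (S2 a) = tape s \<and> outbox (S2 a) = outbox s @ to_all [X ! a] \<and>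
      get (S2 a) 42 = RealW (real (Suc i))" by metis
  have "\<exists>h. runs f c [Loop ?b ?p] (S2 a) (j * ?k + 1) (map_pmf h (draws (replicate j [0..<?n]))) \<and>
     (\<forall>is\<in>set_pmf (draws (replicate j [0..<?n])). upd scratch (S2 a) (h is) \<and> tape (h is) = tape (S2 a) \<and>
        outbox (h is) = outbox (S2 a) @ to_all (map ((!) X) is))" if a: "a < ?n" for a
  proof -
    have u: "upd scratch s (S2 a)" using S2 a by blast
    have "achieves_random f c [Loop ?b ?p] (S2 a) (draws (replicate j [0..<?n])) (\<lambda>t is s'. t = j * ?k + 1 \<and>
       upd scratch (S2 a) s' \<and> tape s' = tape (S2 a) \<and> outbox s' = outbox (S2 a) @ to_all (map ((!) X) is))"
    proof (rule Suc.IH)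
      show "own X (S2 a)" by (rule own_upd[OF u Suc.prems(1)]) auto
      show "consts_ok m K (S2 a)" by (rule consts_ok_upd[OF u Suc.prems(3)]) auto
      show "get (S2 a) rLIM = RealW l" using upd_get[OF u] Suc.prems(4) by simp
      show "nat \<lceil>l\<rceil> = Suc i + j" using Suc.prems(5) by simp
      show "get (S2 a) rD = RealW (real (Suc i))" using S2 a by blast
    qed (use Suc.prems in auto)
    moreover have "set_pmf (draws (replicate j [0..<?n])) \<noteq> {}" by (rule set_pmf_not_empty)
    ultimately show ?thesis unfolding achieves_random_def by blast
  qed
  then obtain h where h2: "\<And>a. a < ?n \<Longrightarrow> runs f c [Loop ?b ?p] (S2 a) (j * ?k + 1) (map_pmf (h a) (draws (replicate j [0..<?n]))) \<and>
     (\<forall>is\<in>set_pmf (draws (replicate j [0..<?n])). upd scratch (S2 a) (h a is) \<and> tape (h a is) = tape (S2 a) \<and>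
        outbox (h a is) = outbox (S2 a) @ to_all (map ((!) X) is))" by metis
  define hh where "hh is = h (hd is) (tl is)" for "is"
  \<comment> \<open>In \<open>runs_Basic\<close> the continuation is a function of the machine
    state, so the drawn position is read back from register 43.\<close>
  define D where "D s1 = (case get s1 43 of NatW a \<Rightarrow> map_pmf (h a) (draws (replicate j [0..<?n])) | _ \<Rightarrow> return_pmf s1)" for s1
  have "runs f c (Basic (Random rR rNI) # (?rest @ [Loop ?b ?p])) s (Suc (3 * m + 8 + (j * ?k + 1)))
      (bind_pmf (exec f c (Random rR rNI) s) D)"
  proof (rule runs_Basic)
    fix s' assume "s' \<in> set_pmf (exec f c (Random rR rNI) s)"
    then obtain a where a: "a < ?n" "s' = put 43 (NatW a) s" unfolding ex using n0 by (auto simp: lessThan_empty_iff)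
    have "runs f c (?rest @ [Loop ?b ?p]) s' (3 * m + 8 + (j * ?k + 1))
        (bind_pmf (return_pmf (S2 a)) (\<lambda>_. map_pmf (h a) (draws (replicate j [0..<?n]))))"
      using S2[OF a(1)] h2[OF a(1)] by (intro runs_append) (auto simp: a(2))
    then show "runs f c (?rest @ [Loop ?b ?p]) s' (3 * m + 8 + (j * ?k + 1)) (D s')"
      by (simp add: D_def a(2) bind_return_pmf)
  qed
  moreover have "bind_pmf (exec f c (Random rR rNI) s) D = map_pmf hh (draws (replicate (Suc j) [0..<?n]))"
    unfolding ex using n0
    by (simp add: bind_map_pmf D_def draw_upt map_bind_pmf pmf.map_comp o_def hh_def)
  ultimately have "runs f c [Loop ?b ?p] s (Suc (Suc (3 * m + 8 + (j * ?k + 1)))) (map_pmf hh (draws (replicate (Suc j) [0..<?n])))"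
    using h by (intro runs_Loop) simp
  moreover have "Suc (Suc (3 * m + 8 + (j * ?k + 1))) = Suc j * ?k + 1" by simp
  moreover have "upd scratch s (hh is) \<and> tape (hh is) = tape s \<and> outbox (hh is) = outbox s @ to_all (map ((!) X) is)"
    if mem: "is \<in> set_pmf (draws (replicate (Suc j) [0..<?n]))" for "is"
  proof -
    obtain a is' where a: "is = a # is'" "a < ?n" "is' \<in> set_pmf (draws (replicate j [0..<?n]))"
      using mem n0 by (auto simp: draw_upt lessThan_empty_iff)
    have "upd scratch s (S2 a)" "upd scratch (S2 a) (h a is')" using S2[OF a(2)] h2[OF a(2)] a(3) by auto
    then have "upd scratch s (h a is')" by (rule upd_trans)
    then show ?thesis using S2[OF a(2)] h2[OF a(2)] a by (simp add: hh_def to_all_def)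
  qed
  ultimately show ?case unfolding achieves_random_def by metis
qed

definition draw_lists :: "real \<Rightarrow> 'b list \<Rightarrow> 'b list list" where
  "draw_lists l X = (if X = [] then [] else replicate (nat \<lceil>l\<rceil>) X)"

lemma draw_code:
  assumes X: "own X s" and cs: "consts_ok m K s" and lim: "get s rLIM = RealW l"
  shows "achieves_random f c draw_code s (draws (draw_lists l [0..<length X]))
     (\<lambda>t is s'. t \<le> nat \<lceil>l\<rceil> * (3 * m + 10) + 4 \<and> upd ({27} \<union> scratch) s s' \<and> tape s' = tape s \<and>
        outbox s' = outbox s @ to_all (map ((!) X) is))"
proof (cases "X = []")
  case True
  let ?L = "Loop (Less rD rLIM) ([Basic (Random rR rNI), Basic (Arith Add rR rR rR), Basic (Arith Add rR rR rR),
       Basic (ConstN rA 64), Basic (Arith Add rA rA rR), Basic (Load rX rA)] @ bcast 0 rX @ [Basic (Arith Add rD rD rRONE)])"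
  define s1 where "s1 = put 27 (RealW 0) (put 42 (RealW 0) s)"
  have "runs f c [?L] s1 (Suc 0) (return_pmf s1)"
    by (rule runs_Loop) (simp add: s1_def runs_Nil)
  moreover have "upd ({27} \<union> scratch) s s1" by (simp add: s1_def)
  ultimately have "achieves_random f c [?L] s1 (draws (draw_lists l [0..<length X]))
     (\<lambda>t is s'. Suc (Suc (Suc t)) \<le> nat \<lceil>l\<rceil> * (3 * m + 10) + 4 \<and> upd ({27} \<union> scratch) s s' \<and> tape s' = tape s \<and>
        outbox s' = outbox s @ to_all (map ((!) X) is))"
    unfolding achieves_random_def using True
    by (intro exI[of _ "Suc 0"] exI[of _ "\<lambda>_. s1"]) (simp add: draw_lists_def to_all_def s1_def)
  then show ?thesis using True cs X unfolding draw_code_def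
    by (intro achieves_random_Basic achieves_random_Cond) (simp_all add: own_def consts_ok_def s1_def achieves_random_Basic)
next
  case False
  define s1 where "s1 = put 42 (RealW 0) s"
  have u: "upd scratch s s1" by (simp add: s1_def)
  have "achieves_random f c [Loop (Less rD rLIM) ([Basic (Random rR rNI), Basic (Arith Add rR rR rR), Basic (Arith Add rR rR rR),
       Basic (ConstN rA 64), Basic (Arith Add rA rA rR), Basic (Load rX rA)] @ bcast 0 rX @ [Basic (Arith Add rD rD rRONE)])] s1
     (draws (replicate (nat \<lceil>l\<rceil>) [0..<length X])) (\<lambda>t is s'. t = nat \<lceil>l\<rceil> * (3 * m + 10) + 1 \<and> upd scratch s1 s' \<and> tape s' = tape s1 \<and>
        outbox s' = outbox s1 @ to_all (map ((!) X) is))" (is "achieves_random f c ?p _ _ _")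
  proof (rule draw_loop[where i = 0])
    show "own X s1" by (rule own_upd[OF u X]) auto
    show "consts_ok m K s1" by (rule consts_ok_upd[OF u cs]) auto
  qed (use lim False in \<open>auto simp: s1_def\<close>)
  note ar = this
  have dl: "draw_lists l [0..<length X] = replicate (nat \<lceil>l\<rceil>) [0..<length X]"
    using False by (simp add: draw_lists_def)
  have "achieves_random f c ?p s1 (draws (draw_lists l [0..<length X]))
     (\<lambda>t is s'. Suc (Suc t) \<le> nat \<lceil>l\<rceil> * (3 * m + 10) + 4 \<and> upd ({27} \<union> scratch) s s' \<and> tape s' = tape s \<and>
        outbox s' = outbox s @ to_all (map ((!) X) is))"
    unfolding dl
  proof (rule achieves_random_mono[OF ar], elim conjE)
    fix t :: nat and "is" s'
    assume a: "t = nat \<lceil>l\<rceil> * (3 * m + 10) + 1" "upd scratch s1 s'" "tape s' = tape s1"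
      "outbox s' = outbox s1 @ to_all (map ((!) X) is)"
    have "upd ({27} \<union> scratch) s s'" using upd_trans[OF u a(2)] by (elim upd_subset) auto
    then show "Suc (Suc t) \<le> nat \<lceil>l\<rceil> * (3 * m + 10) + 4 \<and> upd ({27} \<union> scratch) s s' \<and> tape s' = tape s \<and>
        outbox s' = outbox s @ to_all (map ((!) X) is)" using a by (simp add: s1_def)
  qed
  then show ?thesis using False cs X unfolding draw_code_def
    by (intro achieves_random_Basic achieves_random_Cond) (simp_all add: own_def consts_ok_def s1_def)
qed

end

section \<open>The rounds of a single machine\<close>

locale mpc_program = mpc_machine U E c K f m H
  for U E :: "'a set" and c :: "'a \<Rightarrow> real" and K :: real and f :: "'a set \<Rightarrow> real" and m H :: nat +
  fixes e tt Z nn :: real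
begin

abbreviation "Kt \<equiv> Ktilde E K"
abbreviation "cap \<equiv> real m * Kt * Z"
abbreviation "vol \<equiv> {4,12,13,14,15,16,22,23,24,26,27} \<union> scratch \<union> gcells"

definition core :: "'a list \<Rightarrow> real \<Rightarrow> real \<Rightarrow> nat \<Rightarrow> 'a list \<Rightarrow> real \<Rightarrow> 'a machine \<Rightarrow> bool" where
  "core X lam kk pass B gb s \<longleftrightarrow> own X s \<and> best B s \<and> get s rM = NatW m \<and> get s rK = RealW K \<and>
     get s rKT = RealW Kt \<and> get s rCAP = RealW cap \<and> get s rLAM = RealW lam \<and> get s rKK = RealW kk \<and>
     get s rPASS = NatW pass \<and> get s rGB = RealW gb \<and> dom (mem s) \<subseteq> {..<addr_lim}"

lemma core_upd:
  assumes "upd Y s s'" "core X lam kk pass B gb s" "Y \<subseteq> vol \<union> {5,6,7,8,28}"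
  shows "core X lam kk pass B gb s'"
proof -
  have "get s' a = get s a" if "a \<in> {1,3,9,25,17,18,19,20}" for a
    by (rule upd_get[OF assms(1)]) (use assms(3) that in auto)
  moreover have "own X s'" by (rule own_upd[OF assms(1)]) (use assms(2,3) in \<open>auto simp: core_def\<close>)
  moreover have "best B s'" by (rule best_upd[OF assms(1)]) (use assms(2,3) in \<open>auto simp: core_def\<close>)
  moreover have "dom (mem s') \<subseteq> {..<addr_lim}" using assms(1,2) by (simp add: upd_def core_def)
  ultimately show ?thesis using assms(2) by (simp add: core_def)
qed

lemma keep:
  assumes "upd Y s s'" "Y \<subseteq> vol" "consts_ok m K s" "core X lam kk pass B gb s"
  shows "consts_ok m K s'" "core X lam kk pass B gb s'"
proof -
  show "consts_ok m K s'" by (rule consts_ok_upd[OF assms(1,3)]) (use assms(2) in auto)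
  show "core X lam kk pass B gb s'" by (rule core_upd[OF assms(1,4)]) (use assms(2) in auto)
qed

lemma core_put:
  "a \<in> vol \<Longrightarrow> a < 64 \<Longrightarrow> core X lam kk pass B gb s \<Longrightarrow> core X lam kk pass B gb (put a w s)"
  by (rule core_upd[of vol s]) auto

lemma consts_ok_put: "a \<in> vol \<Longrightarrow> a < 64 \<Longrightarrow> consts_ok m K s \<Longrightarrow> consts_ok m K (put a w (s :: 'a machine))"
  by (rule consts_ok_upd[of vol s]) auto

lemma rep_put: "a < 64 \<Longrightarrow> a \<notin> {12,13,14} \<Longrightarrow> rep G s \<Longrightarrow> rep G (put a w s)"
  by (rule rep_upd[of "{a}" s]) auto

definition ready :: "'a list \<Rightarrow> real \<Rightarrow> real \<Rightarrow> nat \<Rightarrow> 'a list \<Rightarrow> real \<Rightarrow> 'a list \<Rightarrow> real \<Rightarrow> 'a machine \<Rightarrow> bool" where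
  "ready X lam kk pass B gb G t s \<longleftrightarrow> consts_ok m K s \<and> core X lam kk pass B gb s \<and> rep G s \<and> get s rTAU = RealW t"

lemma ready_put:
  "a \<in> vol \<Longrightarrow> a < 64 \<Longrightarrow> a \<notin> {12,13,14,15} \<Longrightarrow> ready X lam kk pass B gb G t s \<Longrightarrow> ready X lam kk pass B gb G t (put a w s)"
  using core_put consts_ok_put rep_put unfolding ready_def by simp

lemma ready_upd:
  assumes "upd Y s s'" "Y \<subseteq> vol - {15}" "ready X lam kk pass B gb G t s" "rep G' s'"
  shows "ready X lam kk pass B gb G' t s'"
proof -
  have "get s' 15 = get s 15" by (rule upd_get[OF assms(1)]) (use assms(2) in auto)
  moreover have "Y \<subseteq> vol" using assms(2) by auto
  ultimately show ?thesis using assms(3,4) keep[OF assms(1), of X lam kk pass B gb] unfolding ready_def by simp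
qed

lemma round2:
  assumes s: "ready X lam kk pass B gb G t s" and G: "good_list G" "0 \<le> t" "set X \<subseteq> E"
    and xs: "inbox s = map ItemW xs" "set xs \<subseteq> E" and out: "outbox s = []"
  defines "G' \<equiv> foldl (ext t) G xs"
  shows "achieves f c round2 s (\<lambda>u s'. u \<le> 20 * length xs + 16 * length X + 3 * m + 20 \<and>
    ready X lam kk pass B gb G' t s' \<and> get s' rPC = NatW 3 \<and> solution s' = solution s \<and>
    outbox s' = map (\<lambda>i. (i, NatW (length (filter (acc t G') X)))) [0..<m])"
  unfolding round2_def
proof (rule achieves_seq[OF ext_inbox[of G s t xs]], goal_cases)
  case (8 u s1)
  then have u: "u \<le> length xs * 20 + 3" and u1: "upd ({12,13,14} \<union> scratch \<union> gcells) s s1"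
    and o1: "outbox s1 = []" and r1: "rep G' s1" using out by (auto simp: G'_def)
  have s1: "ready X lam kk pass B gb G' t s1" by (rule ready_upd[OF u1 _ s r1]) auto
  have sol1: "solution s1 = solution s" using upd_same[OF u1] by simp
  define s2 where "s2 = put 24 (NatW 0) s1"
  have s2: "ready X lam kk pass B gb G' t s2" using ready_put[OF _ _ _ s1] by (simp add: s2_def)
  have gG': "good_list G'" using good_list_foldl_ext G xs by (simp add: G'_def)
  have "achieves f c (for_own (if_acc [Basic (Arith Add rCNT rCNT rONE)]) @ (bcast 0 rCNT @ [Basic (ConstN rPC 3)])) s2
    (\<lambda>w s'. Suc (u + w) \<le> 20 * length xs + 16 * length X + 3 * m + 20 \<and>
      ready X lam kk pass B gb G' t s' \<and> get s' rPC = NatW 3 \<and> solution s' = solution s \<and>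
      outbox s' = map (\<lambda>i. (i, NatW (length (filter (acc t G') X)))) [0..<m])"
  proof (rule achieves_seq[OF count_own[of G' s2 t X]], goal_cases)
    case (8 v s3)
    then have v: "v \<le> length X * 16 + 2" and u3: "upd ({24} \<union> scratch) s2 s3" and o3: "outbox s3 = []"
      and r3: "rep G' s3" and c3: "get s3 rCNT = NatW (length (filter (acc t G') X))" using o1 by (auto simp: s2_def)
    have s3: "ready X lam kk pass B gb G' t s3" by (rule ready_upd[OF u3 _ s2 r3]) auto
    show ?case
    proof (rule achieves_seq[OF bcast[of s3 24 0]], goal_cases)
      case (3 w s4)
      then have w: "w = 3 * (m - 0) + 2" and u4: "upd {40} s3 s4" and t4: "tape s4 = tape s3"
        and o4: "outbox s4 = map (\<lambda>i. (i, NatW (length (filter (acc t G') X)))) [0..<m]" using o3 c3 by auto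
      have r4: "rep G' s4" by (rule rep_upd[OF u4 r3 _ t4]) auto
      have s4: "ready X lam kk pass B gb G' t s4" by (rule ready_upd[OF u4 _ s3 r4]) auto
      have "solution s4 = solution s" using upd_same[OF u3] upd_same[OF u4] sol1 by (simp add: s2_def)
      then show ?case using ready_put[OF _ _ _ s4] o4 u v w by simp
    qed (use s3 in \<open>auto simp: ready_def\<close>)
  qed (use s2 gG' G in \<open>auto simp: ready_def s2_def core_def good_list_def\<close>)
  then show ?case by (simp add: s2_def)
qed (use s G xs in \<open>auto simp: ready_def\<close>)

lemma round3:
  assumes s: "ready X lam kk pass B gb G t s" and G: "good_list G" "set X \<subseteq> E"
    and ns: "inbox s = map NatW ns" and out: "outbox s = []"
  shows "achieves f c round3 s (\<lambda>u s'. u \<le> 4 * length ns + 16 * length X + 20 \<and>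
    ready X lam kk pass B gb G t s' \<and> get s' rPC = NatW (if kk = 0 then 4 else 6) \<and> solution s' = solution s \<and>
    outbox s' = (if cap < real (sum_list ns) then [] else map (\<lambda>x. (0, ItemW x)) (filter (acc t G) X)))"
proof -
  define s1 where "s1 = put 24 (NatW 0) s"
  have s1: "ready X lam kk pass B gb G t s1" using ready_put[OF _ _ _ s] by (simp add: s1_def)
  let ?Q = "\<lambda>u s'. u \<le> 4 * length ns + 16 * length X + 20 \<and>
    ready X lam kk pass B gb G t s' \<and> get s' rPC = NatW (if kk = 0 then 4 else 6) \<and> solution s' = solution s \<and>
    outbox s' = (if cap < real (sum_list ns) then [] else map (\<lambda>x. (0, ItemW x)) (filter (acc t G) X))"
  define I where "I i s' \<longleftrightarrow> rep G s' \<and> outbox s' = [] \<and> get s' 24 = NatW (sum_list (take i ns))" for i s'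
  have sum: "achieves f c (for_inbox [Basic (Arith Add rCNT rCNT rX)]) s1
     (\<lambda>t s'. I (length ns) s' \<and> upd ({30,31,32} \<union> {24}) s1 s' \<and> t + 0 \<le> 0 + length ns * (1 + 3) + 3)"
  proof (rule for_inbox[where \<Phi> = "\<lambda>_. 0"])
    show "I 0 s1" using s1 out by (auto simp: I_def ready_def) (auto simp: s1_def)
    show "I i s3" if "I i s2" "upd {30,31,32,41} s2 s3" "tape s3 = tape s2" "outbox s3 = outbox s2" for i s2 s3
      using that rep_upd[OF that(2) _ _ that(3)] upd_get[OF that(2), of 24] by (auto simp: I_def)
    show "achieves f c [Basic (Arith Add rCNT rCNT rX)] s' (\<lambda>t s''. I (Suc i) s'' \<and> upd {24} s' s'' \<and> t + 0 \<le> 0 + 1)"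
      if "i < length ns" "I i s'" "get s' rX = inbox s1 ! i" for i s'
      using that ns by (simp add: I_def s1_def take_Suc_conv_app_nth rep_put)
  qed (use s1 ns in \<open>auto simp: ready_def s1_def\<close>)
  have last: "achieves f c [Cond (Equal rKK rRZ) [Basic (ConstN rPC 4)] [Basic (ConstN rPC 6)]] s'
      (\<lambda>w. ?Q (v + w))"
    if "v \<le> 4 * length ns + 16 * length X + 18" "ready X lam kk pass B gb G t s'" "solution s' = solution s"
      "outbox s' = (if cap < real (sum_list ns) then [] else map (\<lambda>x. (0, ItemW x)) (filter (acc t G) X))" for v s'
  proof -
    have "get s' 18 = RealW kk" "get s' 28 = RealW 0" using that by (auto simp: ready_def core_def consts_ok_def)
    then show ?thesis using that ready_put[OF _ _ _ that(2)] by (cases "kk = 0") simp_all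
  qed
  have "achieves f c (for_inbox [Basic (Arith Add rCNT rCNT rX)] @
     [Basic (ToReal rT rCNT), Cond (Less rCAP rT) [] (for_own (if_acc [Basic (Send rZERO rX)])),
      Cond (Equal rKK rRZ) [Basic (ConstN rPC 4)] [Basic (ConstN rPC 6)]]) s1 (\<lambda>u. ?Q (Suc u))"
  proof (rule achieves_seq[OF sum], elim conjE)
    fix u :: nat and s2
    assume I: "I (length ns) s2" and u2: "upd ({30,31,32} \<union> {24}) s1 s2" and u: "u + 0 \<le> 0 + length ns * (1 + 3) + 3"
    have s2: "ready X lam kk pass B gb G t s2" by (rule ready_upd[OF u2 _ s1]) (use I in \<open>auto simp: I_def\<close>)
    define s3 where "s3 = put 45 (RealW (real (sum_list ns))) s2"
    have s3: "ready X lam kk pass B gb G t s3" using ready_put[OF _ _ _ s2] by (simp add: s3_def)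
    have sol: "solution s3 = solution s" using upd_same[OF u2] by (simp add: s3_def s1_def)
    have g: "get s3 25 = RealW cap" "get s3 45 = RealW (real (sum_list ns))"
      using s3 by (auto simp: ready_def core_def) (simp add: s3_def)
    have o3: "outbox s3 = []" using I by (simp add: I_def s3_def)
    have "achieves f c [Cond (Less rCAP rT) [] (for_own (if_acc [Basic (Send rZERO rX)])),
      Cond (Equal rKK rRZ) [Basic (ConstN rPC 4)] [Basic (ConstN rPC 6)]] s3 (\<lambda>w. ?Q (Suc (Suc (u + w))))"
    proof (cases "cap < real (sum_list ns)")
      case True
      then show ?thesis using g last[of "Suc (Suc (Suc u))" s3] s3 sol o3 u by simp
    next
      case False
      have "achieves f c (for_own (if_acc [Basic (Send rZERO rX)]) @
        [Cond (Equal rKK rRZ) [Basic (ConstN rPC 4)] [Basic (ConstN rPC 6)]]) s3 (\<lambda>w. ?Q (Suc (Suc (Suc (u + w)))))"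
      proof (rule achieves_seq[OF send_own[of G s3 t X]], goal_cases)
        case (7 v s4)
        then have v: "v \<le> length X * 16 + 2" and u4: "upd scratch s3 s4" and r4: "rep G s4"
          and o4: "outbox s4 = map (\<lambda>x. (0, ItemW x)) (filter (acc t G) X)" using o3 by auto
        have s4: "ready X lam kk pass B gb G t s4" by (rule ready_upd[OF u4 _ s3 r4]) auto
        have "solution s4 = solution s" using upd_same[OF u4] sol by simp
        then show ?case using last[of "Suc (Suc (Suc (u + v)))" s4] s4 o4 False u v by simp
      qed (use s3 G in \<open>auto simp: ready_def core_def good_list_def\<close>)
      then show ?thesis using False g by simp
    qed
    then show "achieves f c [Basic (ToReal rT rCNT), Cond (Less rCAP rT) [] (for_own (if_acc [Basic (Send rZERO rX)])),
      Cond (Equal rKK rRZ) [Basic (ConstN rPC 4)] [Basic (ConstN rPC 6)]] s2 (\<lambda>w. ?Q (Suc (u + w)))"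
      using I by (simp add: I_def s3_def)
  qed
  then show ?thesis by (simp add: round3_def s1_def)
qed

lemma ready_upd_tau:
  assumes "upd Y s s'" "Y \<subseteq> vol" "ready X lam kk pass B gb G t s" "rep G' s'" "get s' 15 = RealW t'"
  shows "ready X lam kk pass B gb G' t' s'"
  using assms keep[OF assms(1,2), of X lam kk pass B gb] unfolding ready_def by simp

lemma ready_put_tau:
  assumes "ready X lam kk pass B gb G t s"
  shows "ready X lam kk pass B gb G t' (put 15 (RealW t') s)"
  by (rule ready_upd_tau[of "{15}" s _ X lam kk pass B gb G t])
    (use assms in \<open>auto simp: ready_def intro!: rep_put\<close>)

lemma ready_put_lam:
  assumes "ready X lam kk pass B gb G t s"
  shows "ready X lam' kk pass B gb G t (put 17 (RealW lam') s)"
  using assms by (simp add: ready_def core_def consts_ok_def own_def best_def rep_put)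

lemma ready_put_kk:
  assumes "ready X lam kk pass B gb G t s"
  shows "ready X lam kk' pass B gb G t (put 18 (RealW kk') s)"
  using assms by (simp add: ready_def core_def consts_ok_def own_def best_def rep_put)

lemma ready_put_pass:
  assumes "ready X lam kk pass B gb G t s"
  shows "ready X lam kk pass' B gb G t (put 19 (NatW pass') s)"
  using assms by (simp add: ready_def core_def consts_ok_def own_def best_def rep_put)

lemma ready_regs:
  assumes "ready X lam kk pass B gb G t s"
  shows "consts_ok m K s" "rep G s" "own X s" "best B s" "get s 15 = RealW t" "get s 17 = RealW lam"
    "get s 18 = RealW kk" "get s 19 = NatW pass" "get s 20 = RealW gb" "get s 9 = RealW Kt" "get s 3 = RealW K"
    "get s 13 = RealW (f (set G))" "get s 12 = NatW (65 + 4 * length G)" "get s 21 = NatW (66 + 4 * length B)"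
    "get s 28 = RealW 0" "get s 8 = RealW 1" "get s 5 = NatW 1" "get s 6 = NatW 4"
    "dom (mem s) \<subseteq> {..<addr_lim}"
  using assms by (auto simp: ready_def core_def consts_ok_def rep_def best_def)

lemma clear_ready:
  assumes s: "ready X lam kk pass B gb G t s" and G: "good_list G"
  shows "achieves f c clear_code s (\<lambda>u s'. u \<le> 4 * H + 6 \<and> ready X lam kk pass B gb [] t s' \<and>
    outbox s' = outbox s \<and> solution s' = solution s \<and> upd {12,13,14,32,41} s s')"
proof (rule achieves_mono[OF clear_code[OF ready_regs(2,1)[OF s]]], elim conjE)
  fix u :: nat and s' assume u: "u \<le> 4 * length G + 6" and u1: "upd {12,13,14,32,41} s s'"
    and o: "outbox s' = outbox s" and r: "rep [] s'"
  have "ready X lam kk pass B gb [] t s'" by (rule ready_upd[OF u1 _ s r]) auto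
  then show "u \<le> 4 * H + 6 \<and> ready X lam kk pass B gb [] t s' \<and>
    outbox s' = outbox s \<and> solution s' = solution s \<and> upd {12,13,14,32,41} s s'"
    using u o u1 upd_same[OF u1] length_less_H[OF G] by simp
qed

lemma qs_ready:
  assumes s: "ready X lam kk pass B gb [] 0 s" "get s 16 = RealW 0" and xs: "inbox s = map ItemW xs" "set xs \<subseteq> E"
  shows "achieves f c (for_inbox qs_code) s (\<lambda>u s'. u \<le> 33 * length xs + 3 \<and>
    outbox s' = outbox s \<and> solution s' = solution s \<and>
    (\<exists>S t' r. good_list S \<and> ready X lam kk pass B gb S t' s' \<and> get s' 16 = RealW r \<and> estimate xs = r + f (set S)))"
proof (rule achieves_mono[OF qs_inbox[of s xs]], goal_cases)
  case (7 u s')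
  obtain r S where rS: "foldl qstep (0, []) xs = (r, S)" by (cases "foldl qstep (0, []) xs")
  from 7 have u: "u \<le> length xs * 33 + 3" and u1: "upd ({12..<17} \<union> scratch \<union> gcells) s s'"
    and o: "outbox s' = outbox s" and q: "qrep (r, S) s'" using rS by auto
  have "ready X lam kk pass B gb S ((r + r) / K) s'"
    by (rule ready_upd_tau[OF u1 _ s(1)]) (use q in \<open>auto simp: qrep_def\<close>)
  moreover have "good_list S" using good_list_qstep[OF xs(2)] rS by simp
  moreover have "estimate xs = r + f (set S)" by (simp add: estimate_def rS)
  moreover have "get s' 16 = RealW r" using q by (simp add: qrep_def)
  ultimately show ?case using u o upd_same[OF u1] by auto
qed (use s xs ready_regs[OF s(1)] in auto)

lemma bcast_ready:
  assumes s: "ready X lam kk pass B gb G t s" and a: "a \<noteq> 40"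
  shows "achieves f c (bcast j a @ [Basic (ConstN rPC k)]) s (\<lambda>u s'. u \<le> 3 * m + 3 \<and>
    ready X lam kk pass B gb G t s' \<and> solution s' = solution s \<and> get s' rPC = NatW k \<and>
    outbox s' = outbox s @ map (\<lambda>i. (i, get s a)) [j..<m])"
proof (rule achieves_seq[OF bcast[OF ready_regs(1)[OF s] a]], elim conjE)
  fix u :: nat and s' assume u: "u = 3 * (m - j) + 2" and u1: "upd {40} s s'" and t: "tape s' = tape s"
    and o: "outbox s' = outbox s @ map (\<lambda>i. (i, get s a)) [j..<m]"
  have "rep G s'" by (rule rep_upd[OF u1 ready_regs(2)[OF s] _ t]) auto
  then have s': "ready X lam kk pass B gb G t s'" by (intro ready_upd[OF u1 _ s]) auto
  show "achieves f c [Basic (ConstN rPC k)] s' (\<lambda>v s'. u + v \<le> 3 * m + 3 \<and>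
    ready X lam kk pass B gb G t s' \<and> solution s' = solution s \<and> get s' rPC = NatW k \<and>
    outbox s' = outbox s @ map (\<lambda>i. (i, get s a)) [j..<m])"
    using ready_put[OF _ _ _ s'] u o upd_same[OF u1] by simp
qed

lemma round4:
  assumes s: "ready X lam kk pass B gb G t s" and G: "good_list G"
    and xs: "inbox s = map ItemW xs" "set xs \<subseteq> E" and out: "outbox s = []"
  shows "achieves f c round4 s (\<lambda>u s'. u \<le> 33 * length xs + 8 * H + 3 * m + 40 \<and>
    ready X lam kk pass B gb [] 0 s' \<and> get s' rPC = NatW 5 \<and> solution s' = solution s \<and>
    outbox s' = map (\<lambda>i. (i, RealW (estimate xs))) [0..<m])"
  (is "achieves f c round4 s ?Q")
  unfolding round4_def
proof (rule achieves_seq[OF clear_ready[OF s G]], elim conjE)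
  fix u1 :: nat and s1 assume u1: "u1 \<le> 4 * H + 6" and s1: "ready X lam kk pass B gb [] t s1"
    and o1: "outbox s1 = outbox s" "solution s1 = solution s" and U1: "upd {12,13,14,32,41} s s1"
  define s2 where "s2 = put 15 (RealW 0) (put 16 (RealW 0) s1)"
  have s2: "ready X lam kk pass B gb [] 0 s2"
    unfolding s2_def by (rule ready_put_tau) (rule ready_put[OF _ _ _ s1], auto)
  have "achieves f c (for_inbox qs_code @ ([Basic (Arith Add rT rRHO rFG), Basic (ConstR rTAU 0)] @ clear_code @ bcast 0 rT @ [Basic (ConstN rPC 5)])) s2
     (\<lambda>v. ?Q (Suc (Suc (u1 + v))))"
  proof (rule achieves_seq[OF qs_ready[OF s2, of xs]], goal_cases)
    case (4 u2 s3)
    then obtain S t' r where u2: "u2 \<le> 33 * length xs + 3" and o3: "outbox s3 = []" "solution s3 = solution s"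
      and S: "good_list S" and s3: "ready X lam kk pass B gb S t' s3" and r: "get s3 16 = RealW r"
      and est: "estimate xs = r + f (set S)" using o1 out by (auto simp: s2_def)
    define s4 where "s4 = put 15 (RealW 0) (put 45 (RealW (estimate xs)) s3)"
    have s4: "ready X lam kk pass B gb S 0 s4" unfolding s4_def by (rule ready_put_tau, rule ready_put[OF _ _ _ s3]) auto
    have "achieves f c (clear_code @ (bcast 0 rT @ [Basic (ConstN rPC 5)])) s4 (\<lambda>v. ?Q (Suc (Suc (u1 + (u2 + Suc (Suc v))))))"
    proof (rule achieves_seq[OF clear_ready[OF s4 S]], elim conjE)
      fix u3 :: nat and s5 assume u3: "u3 \<le> 4 * H + 6" and s5: "ready X lam kk pass B gb [] 0 s5"
        and o5: "outbox s5 = outbox s4" "solution s5 = solution s4" and U5: "upd {12,13,14,32,41} s4 s5"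
      have g: "get s5 45 = RealW (estimate xs)" using upd_get[OF U5, of 45] by (simp add: s4_def)
      show "achieves f c (bcast 0 rT @ [Basic (ConstN rPC 5)]) s5 (\<lambda>v. ?Q (Suc (Suc (u1 + (u2 + Suc (Suc (u3 + v)))))))"
        by (rule achieves_mono[OF bcast_ready[OF s5]]) (use g u1 u2 u3 o3 o5 in \<open>auto simp: s4_def\<close>)
    qed
    then show ?case using r ready_regs(12)[OF s3] est by (simp add: s4_def)
  qed (use xs upd_same[OF U1] in \<open>auto simp: s2_def\<close>)
  then show "achieves f c ([Basic (ConstR rRHO 0), Basic (ConstR rTAU 0)] @ for_inbox qs_code @
     [Basic (Arith Add rT rRHO rFG), Basic (ConstR rTAU 0)] @ clear_code @ bcast 0 rT @ [Basic (ConstN rPC 5)]) s1 (\<lambda>v. ?Q (u1 + v))"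
    by (simp add: s2_def)
qed

text \<open>The best augmentation within the input of one machine, as a list of at most one item;
  the empty list means that nothing that fits improves on \<open>G\<close>.\<close>

definition cand :: "'a list \<Rightarrow> 'a list \<Rightarrow> 'a list \<Rightarrow> bool" where
  "cand G X cs \<longleftrightarrow> length cs \<le> 1 \<and> set cs \<subseteq> set X \<and>
     (\<forall>x\<in>set X. cost G + c x \<le> K \<longrightarrow> f (insert x (set G)) \<le> f (set G) \<or>
        (\<exists>y\<in>set cs. cost G + c y \<le> K \<and> f (insert x (set G)) \<le> f (insert y (set G))))"

lemma aug_round:
  assumes s: "ready X lam kk pass B gb G t s" and G: "good_list G" "set X \<subseteq> E" and out: "outbox s = []"
  shows "achieves f c aug_round s (\<lambda>u s'. u \<le> 17 * length X + 3 * m + 20 \<and>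
    ready X lam kk pass B gb G t s' \<and> get s' rPC = NatW 8 \<and> solution s' = solution s \<and>
    (\<exists>cs. cand G X cs \<and> outbox s' = to_all cs))"
  (is "achieves f c aug_round s ?Q")
proof -
  define s1 where "s1 = put 22 (RealW (f (set G))) s"
  have s1: "ready X lam kk pass B gb G t s1" unfolding s1_def by (rule ready_put[OF _ _ _ s]) auto
  have "achieves f c (for_own aug_code @ [Cond (Less rFG rBV) (bcast 0 rBI) [], Basic (ConstN rPC 8)]) s1 (\<lambda>v. ?Q (Suc v))"
  proof (rule achieves_seq[OF aug_own[of G s1 t X]], goal_cases)
    case (8 u s2)
    then obtain v where u: "u \<le> length X * 17 + 2" and u2: "upd ({22,23} \<union> scratch) s1 s2" and r2: "rep G s2"
      and o2: "outbox s2 = []" and v: "augmented G X v s2" using out by (auto simp: s1_def)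
    have s2: "ready X lam kk pass B gb G t s2" by (rule ready_upd[OF u2 _ s1 r2]) auto
    have sol: "solution s2 = solution s" using upd_same[OF u2] by (simp add: s1_def)
    have bv: "get s2 22 = RealW v" using v by (simp add: augmented_def)
    show ?case
    proof (cases "f (set G) < v")
      case True
      then obtain x where x: "x \<in> set X" "get s2 23 = ItemW x" "cost G + c x \<le> K" "v = f (insert x (set G))"
        using v by (auto simp: augmented_def)
      have cand: "cand G X [x]" using x v by (auto simp: cand_def augmented_def)
      have "achieves f c (bcast 0 rBI @ [Basic (ConstN rPC 8)]) s2 (\<lambda>w. ?Q (Suc (Suc (u + w))))"
      proof (rule achieves_mono[OF bcast_ready[OF s2]], simp, elim conjE, intro conjI)
        fix w :: nat and s3
        assume "outbox s3 = outbox s2 @ map (\<lambda>i. (i, get s2 23)) [0..<m]"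
        then have "outbox s3 = to_all [x]" using o2 x by (simp add: to_all_def)
        then show "\<exists>cs. cand G X cs \<and> outbox s3 = to_all cs" using cand by blast
      qed (use u sol in auto)
      then show ?thesis using True bv ready_regs(12)[OF s2] by simp
    next
      case False
      then have "cand G X []" using v by (auto simp: cand_def augmented_def intro: order.trans)
      then have "\<exists>cs. cand G X cs \<and> outbox s2 = to_all cs" using o2 by (intro exI[of _ "[]"]) (simp add: to_all_def)
      then show ?thesis using False bv ready_regs(12)[OF s2] ready_put[OF _ _ _ s2] u sol by simp
    qed
  qed (use ready_regs[OF s1] G in \<open>auto simp: s1_def good_list_def\<close>)
  then show ?thesis using ready_regs(12)[OF s] by (simp add: aug_round_def s1_def)
qed

lemma round5:
  assumes s: "ready X lam kk pass B gb G t s" and G: "good_list G" "set X \<subseteq> E" and out: "outbox s = []"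
    and L: "inbox s \<noteq> []" "inbox s ! 0 = RealW L"
  shows "achieves f c round5 s (\<lambda>u s'. u \<le> 17 * length X + 3 * m + 25 \<and>
    ready X (lam + 4 * L) kk pass B gb G t s' \<and> get s' rPC = NatW 8 \<and> solution s' = solution s \<and>
    (\<exists>cs. cand G X cs \<and> outbox s' = to_all cs))"
proof -
  define s1 where "s1 = put 17 (RealW (lam + 4 * L)) (put 32 (RealW (4 * L)) (put 45 (RealW 4) (put 32 (RealW L) (put 30 (NatW 0) s))))"
  have "ready X lam kk pass B gb G t (put 32 (RealW (4 * L)) (put 45 (RealW 4) (put 32 (RealW L) (put 30 (NatW 0) s))))"
    using s by (intro ready_put) auto
  then have s1: "ready X (lam + 4 * L) kk pass B gb G t s1" unfolding s1_def by (rule ready_put_lam)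
  have "achieves f c aug_round s1 (\<lambda>u s'. Suc (Suc (Suc (Suc (Suc u)))) \<le> 17 * length X + 3 * m + 25 \<and>
    ready X (lam + 4 * L) kk pass B gb G t s' \<and> get s' rPC = NatW 8 \<and> solution s' = solution s \<and>
    (\<exists>cs. cand G X cs \<and> outbox s' = to_all cs))"
    by (rule achieves_mono[OF aug_round[OF s1 G]]) (use out in \<open>auto simp: s1_def\<close>)
  then show ?thesis using L ready_regs(6)[OF s] by (simp add: round5_def s1_def)
qed

lemma ext_ready:
  assumes s: "ready X lam kk pass B gb G t s" and G: "good_list G" "0 \<le> t"
    and xs: "inbox s = map ItemW xs" "set xs \<subseteq> E"
  shows "achieves f c (for_inbox (if_acc add_code)) s (\<lambda>u s'. u \<le> 20 * length xs + 3 \<and>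
    ready X lam kk pass B gb (foldl (ext t) G xs) t s' \<and> outbox s' = outbox s \<and> solution s' = solution s \<and> get s' 26 = get s 26)"
proof (rule achieves_mono[OF ext_inbox[of G s t xs]], goal_cases)
  case (8 u s')
  then have u: "u \<le> length xs * 20 + 3" and u1: "upd ({12,13,14} \<union> scratch \<union> gcells) s s'"
    and o: "outbox s' = outbox s" and r: "rep (foldl (ext t) G xs) s'" by auto
  have "ready X lam kk pass B gb (foldl (ext t) G xs) t s'" by (rule ready_upd[OF u1 _ s r]) auto
  moreover have "get s' 26 = get s 26" by (rule upd_get[OF u1]) auto
  ultimately show ?case using u o upd_same[OF u1] by auto
qed (use s G xs ready_regs[OF s] in auto)

lemma round7:
  assumes s: "ready X lam kk pass B gb G t s" and G: "good_list G" "0 \<le> t" "set X \<subseteq> E"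
    and xs: "inbox s = map ItemW xs" "set xs \<subseteq> E" and out: "outbox s = []"
  shows "achieves f c round7 s (\<lambda>u s'. u \<le> 20 * length xs + 17 * length X + 3 * m + 25 \<and>
    ready X lam kk pass B gb (foldl (ext t) G xs) t s' \<and> get s' rPC = NatW 8 \<and> solution s' = solution s \<and>
    (\<exists>cs. cand (foldl (ext t) G xs) X cs \<and> outbox s' = to_all cs))"
  unfolding round7_def
proof (rule achieves_seq[OF ext_ready[OF s G(1,2) xs]], elim conjE)
  fix u :: nat and s1 assume u: "u \<le> 20 * length xs + 3" and s1: "ready X lam kk pass B gb (foldl (ext t) G xs) t s1"
    and o: "outbox s1 = outbox s" "solution s1 = solution s"
  have g: "good_list (foldl (ext t) G xs)" using good_list_foldl_ext G xs by blast
  show "achieves f c aug_round s1 (\<lambda>v s'. u + v \<le> 20 * length xs + 17 * length X + 3 * m + 25 \<and>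
    ready X lam kk pass B gb (foldl (ext t) G xs) t s' \<and> get s' rPC = NatW 8 \<and> solution s' = solution s \<and>
    (\<exists>cs. cand (foldl (ext t) G xs) X cs \<and> outbox s' = to_all cs))"
    by (rule achieves_mono[OF aug_round[OF s1 g G(3)]]) (use out o u in auto)
qed

lemma round6:
  assumes s: "ready X lam kk pass B gb G t s" and G: "good_list G" "0 \<le> t" "set X \<subseteq> E"
    and xs: "inbox s = map ItemW xs" "set xs \<subseteq> E" and out: "outbox s = []"
    and new: "foldl (ext t) G xs = G @ new"
  shows "achieves f c round6 s (\<lambda>u s'. u \<le> 20 * length xs + length new * (3 * m + 5) + 10 \<and>
    ready X lam kk pass B gb (G @ new) t s' \<and> get s' rPC = NatW 7 \<and> solution s' = solution s \<and>
    outbox s' = concat (map (\<lambda>x. map (\<lambda>j. (j, ItemW x)) [1..<m]) new))"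
  (is "achieves f c round6 s ?Q")
proof -
  define s0 where "s0 = put 26 (NatW (65 + 4 * length G)) s"
  have s0: "ready X lam kk pass B gb G t s0" unfolding s0_def by (rule ready_put[OF _ _ _ s]) auto
  let ?p = "Basic (Load rX rGP) # bcast 1 rX @ [Basic (Arith Add rGP rGP rFOUR)]"
  let ?L = "Loop (Less rGP rGE) ?p"
  have "achieves f c (for_inbox (if_acc add_code) @ [?L, Basic (ConstN rPC 7)]) s0 (\<lambda>v. ?Q (Suc v))"
  proof (rule achieves_seq[OF ext_ready[OF s0 G(1,2), of xs]], goal_cases)
    case (3 u s1)
    then have u: "u \<le> 20 * length xs + 3" and s1: "ready X lam kk pass B gb (G @ new) t s1"
      and o1: "outbox s1 = []" "solution s1 = solution s" and g1: "get s1 26 = NatW (65 + 4 * length G)"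
      using new out by (auto simp: s0_def)
    define I where "I i s' \<longleftrightarrow> ready X lam kk pass B gb (G @ new) t s' \<and> solution s' = solution s \<and>
       get s' 26 = NatW (65 + 4 * (length G + i)) \<and>
       outbox s' = concat (map (\<lambda>x. map (\<lambda>j. (j, ItemW x)) [1..<m]) (take i new))" for i s'
    have "achieves f c [?L] s1 (\<lambda>w s'. I (length new) s' \<and> w \<le> length new * (3 * m + 4 + 1) + 1)"
    proof (rule achieves_for_const)
      show "I 0 s1" using s1 o1 g1 by (simp add: I_def)
      show "\<not> holds (Less rGP rGE) s'" if "I (length new) s'" for s'
        using that ready_regs(13)[of X lam kk pass B gb "G @ new" t s'] by (auto simp: I_def)
    next
      fix i s2 assume i: "i < length new" and I: "I i s2"
      have s2: "ready X lam kk pass B gb (G @ new) t s2" and g: "get s2 26 = NatW (65 + 4 * (length G + i))" using I by (auto simp: I_def)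
      have x: "get s2 (65 + 4 * (length G + i)) = ItemW (new ! i)"
        using ready_regs(2)[OF s2] i unfolding rep_def by (auto simp: nth_append dest!: spec[of _ "length G + i"])
      define s3 where "s3 = put 32 (ItemW (new ! i)) s2"
      have s3: "ready X lam kk pass B gb (G @ new) t s3" unfolding s3_def by (rule ready_put[OF _ _ _ s2]) auto
      have "achieves f c (bcast 1 rX @ [Basic (Arith Add rGP rGP rFOUR)]) s3 (\<lambda>w s'. I (Suc i) s' \<and> Suc w \<le> 3 * m + 4)"
      proof (rule achieves_seq[OF bcast[OF ready_regs(1)[OF s3], of 32 1]], simp, elim conjE)
        fix w :: nat and s4 assume w: "w = 3 * (m - 1) + 2" and u4: "upd {40} s3 s4" and t4: "tape s4 = tape s3"
          and o4: "outbox s4 = outbox s3 @ map (\<lambda>i. (i, get s3 32)) [1..<m]"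
        have "rep (G @ new) s4" by (rule rep_upd[OF u4 ready_regs(2)[OF s3] _ t4]) auto
        then have s4: "ready X lam kk pass B gb (G @ new) t s4" by (intro ready_upd[OF u4 _ s3]) auto
        have g4: "get s4 26 = NatW (65 + 4 * (length G + i))" using upd_get[OF u4, of 26] g by (simp add: s3_def)
        show "achieves f c [Basic (Arith Add rGP rGP rFOUR)] s4 (\<lambda>v s'. I (Suc i) s' \<and> Suc (w + v) \<le> 3 * m + 4)"
          using ready_put[OF _ _ _ s4] g4 o4 I w i upd_same[OF u4] ready_regs(18)[OF s4]
          by (simp add: I_def s3_def take_Suc_conv_app_nth)
      qed
      then show "holds (Less rGP rGE) s2 \<and> achieves f c ?p s2 (\<lambda>w s'. I (Suc i) s' \<and> w \<le> 3 * m + 4)"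
        using g x i ready_regs(13)[OF s2] by (simp add: s3_def)
    qed
    then have "achieves f c ([?L] @ [Basic (ConstN rPC 7)]) s1 (\<lambda>w. ?Q (Suc (u + w)))"
    proof (rule achieves_seq, elim conjE)
      fix w :: nat and s2 assume I: "I (length new) s2" and w: "w \<le> length new * (3 * m + 4 + 1) + 1"
      have s2: "ready X lam kk pass B gb (G @ new) t s2" using I by (auto simp: I_def)
      show "achieves f c [Basic (ConstN rPC 7)] s2 (\<lambda>v. ?Q (Suc (u + (w + v))))"
        using ready_put[OF _ _ _ s2] I w u by (simp add: I_def algebra_simps)
    qed
    then show ?case by simp
  qed (use xs in \<open>auto simp: s0_def\<close>)
  then show ?thesis using ready_regs(13)[OF s] by (simp add: round6_def s0_def)
qed

lemma draw_ready:
  assumes s: "ready X lam kk pass B gb G t s" and out: "outbox s = []" and lim: "get s 27 = RealW l"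
  shows "achieves_random f c draw_code s (draws (draw_lists l [0..<length X]))
    (\<lambda>u is s'. u \<le> nat \<lceil>l\<rceil> * (3 * m + 10) + 4 \<and> ready X lam kk pass B gb G t s' \<and>
      get s' rPC = get s rPC \<and> get s' 16 = get s 16 \<and> solution s' = solution s \<and> outbox s' = to_all (map ((!) X) is))"
proof (rule achieves_random_mono[OF draw_code[OF ready_regs(3,1)[OF s] lim]], elim conjE)
  fix u :: nat and "is" s'
  assume u: "u \<le> nat \<lceil>l\<rceil> * (3 * m + 10) + 4" and u1: "upd ({27} \<union> scratch) s s'" and t: "tape s' = tape s"
    and o: "outbox s' = outbox s @ to_all (map ((!) X) is)"
  have "rep G s'" by (rule rep_upd[OF u1 ready_regs(2)[OF s] _ t]) auto
  then have s': "ready X lam kk pass B gb G t s'" by (intro ready_upd[OF u1 _ s]) auto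
  have "get s' 4 = get s 4" "get s' 16 = get s 16" using upd_get[OF u1] by auto
  then show "u \<le> nat \<lceil>l\<rceil> * (3 * m + 10) + 4 \<and> ready X lam kk pass B gb G t s' \<and>
      get s' rPC = get s rPC \<and> get s' 16 = get s 16 \<and> solution s' = solution s \<and> outbox s' = to_all (map ((!) X) is)"
    using u s' o out upd_same[OF u1] by simp
qed

lemma draw_tail:
  assumes s: "ready X lam kk pass B gb G t s" and out: "outbox s = []"
  shows "achieves_random f c ([Basic (Move rLIM rKT), Basic (ConstN rPC 2)] @ draw_code) s (draws (draw_lists Kt [0..<length X]))
    (\<lambda>u is s'. u \<le> nat \<lceil>Kt\<rceil> * (3 * m + 10) + 6 \<and> ready X lam kk pass B gb G t s' \<and>
      get s' rPC = NatW 2 \<and> solution s' = solution s \<and> outbox s' = to_all (map ((!) X) is))"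
proof -
  define s1 where "s1 = put 4 (NatW 2) (put 27 (RealW Kt) s)"
  have s1: "ready X lam kk pass B gb G t s1" unfolding s1_def using s by (intro ready_put) auto
  have "achieves_random f c draw_code s1 (draws (draw_lists Kt [0..<length X]))
    (\<lambda>u is s'. Suc (Suc u) \<le> nat \<lceil>Kt\<rceil> * (3 * m + 10) + 6 \<and> ready X lam kk pass B gb G t s' \<and>
      get s' rPC = NatW 2 \<and> solution s' = solution s \<and> outbox s' = to_all (map ((!) X) is))"
    by (rule achieves_random_mono[OF draw_ready[OF s1]]) (use out in \<open>auto simp: s1_def\<close>)
  then show ?thesis using ready_regs(10)[OF s]
    by (simp only: append.simps) (intro achieves_random_Basic, simp_all add: s1_def)
qed

lemma round1:
  assumes s: "ready X lam kk pass B gb [] 0 s" "get s 16 = RealW 0" and xs: "inbox s = map ItemW xs" "set xs \<subseteq> E"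
    and out: "outbox s = []"
  defines "L \<equiv> estimate xs"
  shows "achieves_random f c round1 s (draws (draw_lists Kt [0..<length X]))
    (\<lambda>u is s'. u \<le> 33 * length xs + 4 * H + nat \<lceil>Kt\<rceil> * (3 * m + 10) + 30 \<and>
      ready X (12 * L) kk pass B gb [] (8 * L / K) s' \<and>
      get s' rPC = NatW 2 \<and> solution s' = solution s \<and> outbox s' = to_all (map ((!) X) is))"
  (is "achieves_random f c round1 s ?d ?Q")
  unfolding round1_def
proof (rule achieves_random_seq[OF qs_ready[OF s xs]], elim conjE exE)
  fix u :: nat and s1 S t' r
  assume u: "u \<le> 33 * length xs + 3" and o1: "outbox s1 = outbox s" "solution s1 = solution s" and S: "good_list S"
    and s1: "ready X lam kk pass B gb S t' s1" and r: "get s1 16 = RealW r" and est: "estimate xs = r + f (set S)"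
  define s2 where "s2 = put 17 (RealW (12 * L)) (put 45 (RealW 12) (put 15 (RealW (8 * L / K))
     (put 15 (RealW (8 * L)) (put 45 (RealW 8) (put 17 (RealW L) s1)))))"
  have "ready X L kk pass B gb S t' (put 17 (RealW L) s1)" by (rule ready_put_lam[OF s1])
  then have "ready X L kk pass B gb S t' (put 45 (RealW 8) (put 17 (RealW L) s1))" by (rule ready_put[rotated 3]) auto
  then have "ready X L kk pass B gb S (8 * L / K) (put 15 (RealW (8 * L / K)) (put 15 (RealW (8 * L)) (put 45 (RealW 8) (put 17 (RealW L) s1))))"
    by (rule ready_put_tau[OF ready_put_tau])
  then have "ready X L kk pass B gb S (8 * L / K) (put 45 (RealW 12) (put 15 (RealW (8 * L / K)) (put 15 (RealW (8 * L)) (put 45 (RealW 8) (put 17 (RealW L) s1)))))"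
    by (rule ready_put[rotated 3]) auto
  then have s2: "ready X (12 * L) kk pass B gb S (8 * L / K) s2" unfolding s2_def by (rule ready_put_lam)
  let ?pre = "[Basic (Arith Add rLAM rRHO rFG), Basic (ConstR rT 8), Basic (Arith Mul rTAU rT rLAM),
      Basic (Arith Div rTAU rTAU rK), Basic (ConstR rT 12), Basic (Arith Mul rLAM rT rLAM)]"
  have pre: "achieves f c ?pre s1 (\<lambda>v s'. v = 6 \<and> s' = s2)"
    using r ready_regs[OF s1] est by (simp add: s2_def L_def)
  show "achieves_random f c (?pre @ clear_code @ [Basic (Move rLIM rKT), Basic (ConstN rPC 2)] @ draw_code) s1 ?d (\<lambda>v. ?Q (u + v))"
  proof (rule achieves_random_seq[OF pre], elim conjE)
    fix v :: nat and s' assume v: "v = 6" and s': "s' = s2"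
    show "achieves_random f c (clear_code @ [Basic (Move rLIM rKT), Basic (ConstN rPC 2)] @ draw_code) s' ?d (\<lambda>w. ?Q (u + (v + w)))"
      unfolding s'
    proof (rule achieves_random_seq[OF clear_ready[OF s2 S]], elim conjE)
      fix w :: nat and s3 assume w: "w \<le> 4 * H + 6" and s3: "ready X (12 * L) kk pass B gb [] (8 * L / K) s3"
        and o3: "outbox s3 = outbox s2" "solution s3 = solution s2"
      show "achieves_random f c ([Basic (Move rLIM rKT), Basic (ConstN rPC 2)] @ draw_code) s3 ?d (\<lambda>x. ?Q (u + (v + (w + x))))"
        by (rule achieves_random_mono[OF draw_tail[OF s3]]) (use u v w o1 o3 out in \<open>auto simp: s2_def\<close>)
    qed
  qed
qed

text \<open>The value -1 marks that nothing has been recorded yet. As \<open>f\<close> is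
  non-negative, any actual candidate replaces it.\<close>

definition best_ok :: "'a list \<Rightarrow> real \<Rightarrow> bool" where
  "best_ok B gb \<longleftrightarrow> feasible E c K (set B) \<and> length B \<le> H \<and> (gb = -1 \<or> f (set B) = gb)"

lemma save_code:
  assumes s: "ready X lam kk pass B gb G t s" and G: "good_list G" and v: "augmented G xs v s" "set xs \<subseteq> E"
  shows "achieves f c save_code s (\<lambda>u s'. u \<le> 5 * H + 10 \<and> outbox s' = outbox s \<and> solution s' = solution s \<and>
    (\<exists>B'. ready X lam kk pass B' v G t s' \<and> best_ok B' v))"
  (is "achieves f c save_code s ?Q")
proof -
  let ?Y = "{20,21,32,41} \<union> bcells"
  let ?p = "[Basic (Load rX rP), Basic (Store rBE rX), Basic (Arith Add rBE rBE rFOUR), Basic (Arith Add rP rP rFOUR)]"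
  let ?L = "Loop (Less rP rGE) ?p"
  define s1 where "s1 = put 41 (NatW 65) (put 21 (NatW 66) (put 20 (RealW v) s))"
  define I where "I i s' \<longleftrightarrow> upd ?Y s s' \<and> outbox s' = outbox s \<and> tape s' = tape s \<and> get s' 20 = RealW v \<and>
     get s' 41 = NatW (65 + 4 * i) \<and> best (take i G) s'" for i s'
  have len: "length G < H" by (rule length_less_H[OF G])
  have fin: "ready X lam kk pass B' v G t s'" if u: "upd ?Y s s'" and t: "tape s' = tape s" and g: "get s' 20 = RealW v" and b: "best B' s'" for B' s'
  proof -
    have "rep G s'" by (rule rep_upd[OF u ready_regs(2)[OF s] _ t]) auto
    moreover have "consts_ok m K s'" by (rule consts_ok_upd[OF u ready_regs(1)[OF s]]) auto
    moreover have "own X s'" by (rule own_upd[OF u ready_regs(3)[OF s]]) auto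
    moreover have "get s' a = get s a" if "a \<in> {1,3,9,25,17,18,19,15}" for a
      by (rule upd_get[OF u]) (use that in auto)
    moreover have "dom (mem s') \<subseteq> {..<addr_lim}" using u ready_regs(19)[OF s] by (simp add: upd_def)
    ultimately show ?thesis using s b g by (simp add: ready_def core_def)
  qed
  have "achieves f c [?L] s1 (\<lambda>w s'. I (length G) s' \<and> w \<le> length G * (4 + 1) + 1)"
  proof (rule achieves_for_const)
    show "I 0 s1" by (simp add: I_def s1_def best_def)
    show "\<not> holds (Less rP rGE) s'" if "I (length G) s'" for s'
    proof -
      have "get s' 12 = get s 12" by (rule upd_get[of ?Y]) (use that in \<open>auto simp: I_def\<close>)
      then show ?thesis using that ready_regs(13)[OF s] by (simp add: I_def)
    qed
  next
    fix i s2 assume i: "i < length G" and I: "I i s2"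
    have u2: "upd ?Y s s2" using I by (simp add: I_def)
    have g: "get s2 12 = get s 12" "get s2 6 = get s 6" "get s2 (65 + 4 * i) = get s (65 + 4 * i)"
      by (rule upd_get[OF u2], simp)+
    have x: "get s (65 + 4 * i) = ItemW (G ! i)" using ready_regs(2)[OF s] i by (simp add: rep_def)
    have b: "get s2 21 = NatW (66 + 4 * i)" using I i by (simp add: I_def best_def)
    have ne: "(66 + 4 * i = 66 + 4 * j) = (i = j)" for j by simp
    define s3 where "s3 = put 41 (NatW (65 + 4 * Suc i)) (put 21 (NatW (66 + 4 * Suc i)) (put (66 + 4 * i) (ItemW (G ! i)) (put 32 (ItemW (G ! i)) s2)))"
    have "I (Suc i) s3"
      using I i len unfolding I_def s3_def
      by (auto simp: best_def nth_append take_Suc_conv_app_nth less_Suc_eq)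
    then show "holds (Less rP rGE) s2 \<and> achieves f c ?p s2 (\<lambda>w s'. I (Suc i) s' \<and> w \<le> 4)"
      using i I g x b ready_regs(13,18)[OF s] by (simp add: I_def s3_def)
  qed
  then have "achieves f c ([?L] @ [Cond (Less rFG rBV) [Basic (Store rBE rBI), Basic (Arith Add rBE rBE rFOUR)] []]) s1
     (\<lambda>w. ?Q (Suc (Suc (Suc w))))"
  proof (rule achieves_seq, elim conjE)
    fix w :: nat and s2 assume I: "I (length G) s2" and w: "w \<le> length G * (4 + 1) + 1"
    have u2: "upd ?Y s s2" using I by (simp add: I_def)
    have g: "get s2 13 = RealW (f (set G))" "get s2 22 = RealW v" "get s2 23 = get s 23" "get s2 6 = NatW 4"
      using upd_get[OF u2, of 13] upd_get[OF u2, of 22] upd_get[OF u2, of 23] upd_get[OF u2, of 6] ready_regs[OF s] v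
      by (auto simp: augmented_def)
    have bG: "best G s2" using I by (simp add: I_def)
    have sol: "solution s2 = solution s" using upd_same[OF u2] by simp
    show "achieves f c [Cond (Less rFG rBV) [Basic (Store rBE rBI), Basic (Arith Add rBE rBE rFOUR)] []] s2
      (\<lambda>z. ?Q (Suc (Suc (Suc (w + z)))))"
    proof (cases "f (set G) < v")
      case True
      then obtain x where x: "x \<in> set xs" "get s 23 = ItemW x" "cost G + c x \<le> K" "v = f (insert x (set G))"
        using v by (auto simp: augmented_def)
      define s3 where "s3 = put 21 (NatW (66 + 4 * Suc (length G))) (put (66 + 4 * length G) (ItemW x) s2)"
      have u3: "upd ?Y s s3" using u2 len by (simp add: s3_def)
      have b3: "best (G @ [x]) s3" using bG by (auto simp: s3_def best_def nth_append less_Suc_eq)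
      have "ready X lam kk pass (G @ [x]) v G t s3"
        by (rule fin[OF u3 _ _ b3]) (use I in \<open>auto simp: s3_def I_def\<close>)
      moreover have "best_ok (G @ [x]) v"
      proof -
        \<comment> \<open>Only an inequality, as \<open>x\<close> may already belong to
          \<open>G\<close>.\<close>
        have "(\<Sum>y\<in>insert x (set G). c y) \<le> cost G + c x"
          using cost_distinct[of G] G x(1) v(2) cost_bounds[of x]
          by (auto simp: good_list_def sum.insert_if)
        then have "feasible E c K (insert x (set G))" using x v(2) G by (auto simp: feasible_def good_list_def)
        then show ?thesis using x len by (simp add: best_ok_def)
      qed
      ultimately have "\<exists>B'. ready X lam kk pass B' v G t s3 \<and> best_ok B' v" by blast
      then show ?thesis using True g x bG w len I sol by (simp add: I_def s3_def best_def)
    next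
      case False
      then have "v = f (set G)" using v by (auto simp: augmented_def)
      then have "best_ok G v" using good_list_feasible[OF G] len by (simp add: best_ok_def)
      moreover have "ready X lam kk pass G v G t s2"
        by (rule fin[OF u2 _ _ bG]) (use I in \<open>auto simp: I_def\<close>)
      ultimately have "\<exists>B'. ready X lam kk pass B' v G t s2 \<and> best_ok B' v" by blast
      then show ?thesis using False g w len I sol by (simp add: I_def)
    qed
  qed
  moreover have "get s 22 = RealW v" using v by (simp add: augmented_def)
  ultimately show ?thesis by (simp add: save_code_def s1_def)
qed

lemma ready_solution [simp]:
  "ready X lam kk pass B gb G t (s\<lparr>solution := A\<rparr>) = ready X lam kk pass B gb G t s"
  by (simp add: ready_def core_def consts_ok_def own_def best_def rep_def)

lemma out_code:
  assumes s: "ready X lam kk pass B gb G t s" and B: "length B \<le> H"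
  shows "achieves f c out_code s (\<lambda>u s'. u \<le> 4 * H + 2 \<and> outbox s' = outbox s \<and>
    solution s' = solution s \<union> set B \<and> ready X lam kk pass B gb G t s')"
proof -
  let ?p = "[Basic (Load rX rP), Basic (Output rX), Basic (Arith Add rP rP rFOUR)]"
  define s1 where "s1 = put 41 (NatW 66) s"
  have s1: "ready X lam kk pass B gb G t s1" unfolding s1_def by (rule ready_put[OF _ _ _ s]) auto
  define I where "I i s' \<longleftrightarrow> ready X lam kk pass B gb G t s' \<and> outbox s' = outbox s \<and>
     get s' 41 = NatW (66 + 4 * i) \<and> solution s' = solution s \<union> set (take i B)" for i s'
  have "achieves f c [Loop (Less rP rBE) ?p] s1 (\<lambda>w s'. I (length B) s' \<and> w \<le> length B * (3 + 1) + 1)"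
  proof (rule achieves_for_const)
    show "I 0 s1" using s1 by (simp add: I_def) (simp add: s1_def)
    show "\<not> holds (Less rP rBE) s'" if "I (length B) s'" for s'
      using that ready_regs(14)[of X lam kk pass B gb G t s'] by (auto simp: I_def)
  next
    fix i s2 assume i: "i < length B" and I: "I i s2"
    have s2: "ready X lam kk pass B gb G t s2" using I by (simp add: I_def)
    have x: "get s2 (66 + 4 * i) = ItemW (B ! i)" using ready_regs(4)[OF s2] i by (simp add: best_def)
    have "ready X lam kk pass B gb G t (put 41 (NatW (66 + 4 * Suc i)) ((put 32 (ItemW (B ! i)) s2)\<lparr>solution := insert (B ! i) (solution s2)\<rparr>))"
      by (intro ready_put) (auto intro!: ready_put[OF _ _ _ s2])
    then show "holds (Less rP rBE) s2 \<and> achieves f c ?p s2 (\<lambda>w s'. I (Suc i) s' \<and> w \<le> 3)"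
      using i I x ready_regs(14,18)[OF s2] by (simp add: I_def take_Suc_conv_app_nth)
  qed
  then have "achieves f c [Loop (Less rP rBE) ?p] s1 (\<lambda>u s'. Suc u \<le> 4 * H + 2 \<and> outbox s' = outbox s \<and>
    solution s' = solution s \<union> set B \<and> ready X lam kk pass B gb G t s')"
    by (rule achieves_mono) (use B in \<open>auto simp: I_def\<close>)
  then show ?thesis by (simp add: out_code_def s1_def)
qed

definition aug_value :: "'a list \<Rightarrow> 'a set \<Rightarrow> real" where
  "aug_value G S = Max (insert (f (set G)) ((\<lambda>x. f (insert x (set G))) ` {x \<in> S. cost G + c x \<le> K}))"

lemma augmented_value: "augmented G xs v s \<Longrightarrow> v = aug_value G (set xs)"
  unfolding aug_value_def by (rule Max_eqI[symmetric]) (auto simp: augmented_def)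

lemma round8_best:
  assumes s: "ready X lam kk pass B gb G t s" "outbox s = []" and G: "good_list G" and xs: "inbox s = map ItemW xs" "set xs \<subseteq> E"
    and B: "best_ok B gb"
  defines "gb' \<equiv> max gb (aug_value G (set xs))"
  shows "achieves f c ([Basic (Move rBV rFG)] @ for_inbox aug_code @ [Cond (Less rGB rBV) save_code []]) s
    (\<lambda>u s'. u \<le> 17 * length xs + 5 * H + 20 \<and> outbox s' = [] \<and> solution s' = solution s \<and>
      (\<exists>B'. ready X lam kk pass B' gb' G t s' \<and> best_ok B' gb'))"
  (is "achieves f c _ s ?Q")
proof -
  define s1 where "s1 = put 22 (RealW (f (set G))) s"
  have s1: "ready X lam kk pass B gb G t s1" unfolding s1_def by (rule ready_put[OF _ _ _ s(1)]) auto
  have "achieves f c (for_inbox aug_code @ [Cond (Less rGB rBV) save_code []]) s1 (\<lambda>u. ?Q (Suc u))"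
  proof (rule achieves_seq[OF aug_inbox[of G s1 t xs]], goal_cases)
    case (8 u s2)
    then obtain v where u: "u \<le> length xs * 17 + 3" and u2: "upd ({22,23} \<union> scratch) s1 s2" and r2: "rep G s2"
      and o2: "outbox s2 = []" and v: "augmented G xs v s2" using s(2) by (auto simp: s1_def)
    have s2: "ready X lam kk pass B gb G t s2" by (rule ready_upd[OF u2 _ s1 r2]) auto
    have sol: "solution s2 = solution s" using upd_same[OF u2] by (simp add: s1_def)
    have bv: "get s2 22 = RealW v" using v by (simp add: augmented_def)
    have gb': "gb' = max gb v" using augmented_value[OF v] by (simp add: gb'_def)
    show ?case
    proof (cases "gb < v")
      case True
      have "achieves f c save_code s2 (\<lambda>w. ?Q (Suc (Suc (u + w))))"
        by (rule achieves_mono[OF save_code[OF s2 G v xs(2)]]) (use u o2 sol gb' True in auto)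
      then show ?thesis using True bv ready_regs(9)[OF s2] by simp
    next
      case False
      then have "\<exists>B'. ready X lam kk pass B' gb' G t s2 \<and> best_ok B' gb'" using s2 B gb' by (intro exI[of _ B]) (simp add: max_def)
      then show ?thesis using False bv ready_regs(9)[OF s2] u o2 sol by simp
    qed
  qed (use ready_regs[OF s1] G xs in \<open>auto simp: s1_def good_list_def\<close>)
  then show ?thesis using ready_regs(12)[OF s(1)] by (simp add: s1_def)
qed

lemma round8:
  assumes s: "ready X lam kk pass B gb G t s" "outbox s = []" and G: "good_list G" and xs: "inbox s = map ItemW xs" "set xs \<subseteq> E"
    and B: "best_ok B gb"
  defines "gb' \<equiv> max gb (aug_value G (set xs))"
  defines "lam' \<equiv> if kk = 0 then lam + gb' else lam"
  shows "achieves_random f c (round8 e nn) s (draws (draw_lists Kt [0..<length X]))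
    (\<lambda>u is s'. u \<le> 17 * length xs + 13 * H + nat \<lceil>Kt\<rceil> * (3 * m + 10) + 60 \<and>
      get s' rPC = NatW 2 \<and> outbox s' = to_all (map ((!) X) is) \<and>
      (\<exists>B'. best_ok B' gb' \<and> solution s' = solution s \<union> (if pass = 1 \<and> kk = nn then set B' else {}) \<and>
        (if pass = 1 then ready X lam' (kk + 1) 0 B' gb' [] (lam' / (2 * e * K * (kk + 1))) s'
         else ready X lam' kk 1 B' gb' G (4 * e * t) s')))"
  (is "achieves_random f c _ s ?d ?Q")
proof -
  let ?c3 = "[Cond (Equal rKK rRZ) [Basic (Arith Add rLAM rLAM rGB)] []]"
  let ?y = "[Cond (Equal rKK rT) out_code [], Basic (ConstN rPASS 0), Basic (Arith Add rKK rKK rRONE),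
          Basic (ConstR rT (2 * e)), Basic (Arith Mul rT rT rK), Basic (Arith Mul rT rT rKK),
          Basic (Arith Div rTAU rLAM rT)] @ clear_code"
  let ?n = "[Basic (ConstN rPASS 1), Basic (ConstR rT (4 * e)), Basic (Arith Mul rTAU rT rTAU)]"
  let ?c4 = "[Basic (ConstR rT nn), Cond (Equal rPASS rONE) ?y ?n]"
  let ?tail = "[Basic (Move rLIM rKT), Basic (ConstN rPC 2)] @ draw_code"
  have eq: "round8 e nn = ([Basic (Move rBV rFG)] @ for_inbox aug_code @ [Cond (Less rGB rBV) save_code []]) @ (?c3 @ (?c4 @ ?tail))"
    by (simp add: round8_def)
  show ?thesis unfolding eq
  proof (rule achieves_random_seq[OF round8_best[OF s G xs B]], elim conjE exE)
    fix u :: nat and s1 B'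
    assume u: "u \<le> 17 * length xs + 5 * H + 20" and o1: "outbox s1 = []" "solution s1 = solution s"
      and "ready X lam kk pass B' (max gb (aug_value G (set xs))) G t s1" "best_ok B' (max gb (aug_value G (set xs)))"
    then have s1: "ready X lam kk pass B' gb' G t s1" and B': "best_ok B' gb'" by (auto simp: gb'_def)
    have "achieves f c ?c3 s1 (\<lambda>w s'. w \<le> 2 \<and> ready X lam' kk pass B' gb' G t s' \<and> outbox s' = [] \<and> solution s' = solution s)"
      using ready_regs[OF s1] s1 o1 ready_put_lam[OF s1, of "lam + gb'"]
      by (cases "kk = 0") (simp_all add: lam'_def)
    then show "achieves_random f c (?c3 @ (?c4 @ ?tail)) s1 ?d (\<lambda>w. ?Q (u + w))"
    proof (rule achieves_random_seq, elim conjE)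
      fix w :: nat and s2 assume w: "w \<le> 2" and s2: "ready X lam' kk pass B' gb' G t s2" and o2: "outbox s2 = []" "solution s2 = solution s"
      define s3 where "s3 = put 45 (RealW nn) s2"
      have s3: "ready X lam' kk pass B' gb' G t s3" unfolding s3_def by (rule ready_put[OF _ _ _ s2]) auto
      have o3: "outbox s3 = []" "solution s3 = solution s" using o2 by (auto simp: s3_def)
      have len: "length B' \<le> H" using B' by (simp add: best_ok_def)
      show "achieves_random f c (?c4 @ ?tail) s2 ?d (\<lambda>v. ?Q (u + (w + v)))"
      proof (cases "pass = 1")
        case False
        define s4 where "s4 = put 15 (RealW (4 * e * t)) (put 45 (RealW (4 * e)) (put 19 (NatW 1) s3))"
        have "ready X lam' kk 1 B' gb' G t (put 45 (RealW (4 * e)) (put 19 (NatW 1) s3))"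
          by (rule ready_put[rotated 3, OF ready_put_pass[OF s3]]) auto
        then have s4: "ready X lam' kk 1 B' gb' G (4 * e * t) s4" unfolding s4_def by (rule ready_put_tau)
        have "achieves f c ?c4 s2 (\<lambda>v s'. v = 5 \<and> s' = s4)"
          using False ready_regs[OF s2] by (simp add: s4_def s3_def)
        then show ?thesis
        proof (rule achieves_random_seq, elim conjE)
          fix v :: nat and s' assume v: "v = 5" and s': "s' = s4"
          have o4: "outbox s4 = []" "solution s4 = solution s" using o3 by (auto simp: s4_def)
          show "achieves_random f c ?tail s' ?d (\<lambda>x. ?Q (u + (w + (v + x))))"
            unfolding s'
            by (rule achieves_random_mono[OF draw_tail[OF s4 o4(1)]]) (use u v w o4 False B' in auto)
        qed
      next
        case True
        have outp: "achieves f c [Cond (Equal rKK rT) out_code []] s3 (\<lambda>v s'. v \<le> 4 * H + 3 \<and> outbox s' = [] \<and>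
           solution s' = solution s \<union> (if kk = nn then set B' else {}) \<and> ready X lam' kk pass B' gb' G t s')"
        proof (cases "kk = nn")
          case k: True
          have "achieves f c out_code s3 (\<lambda>v s'. Suc v \<le> 4 * H + 3 \<and> outbox s' = [] \<and>
             solution s' = solution s \<union> (if kk = nn then set B' else {}) \<and> ready X lam' kk pass B' gb' G t s')"
            by (rule achieves_mono[OF out_code[OF s3 len]]) (use o3 k in auto)
          then show ?thesis using k ready_regs(7)[OF s3] by (simp add: s3_def)
        next
          case k: False
          then show ?thesis using s3 o3 ready_regs(7)[OF s3] by (simp add: s3_def)
        qed
        let ?y' = "[Basic (ConstN rPASS 0), Basic (Arith Add rKK rKK rRONE),
          Basic (ConstR rT (2 * e)), Basic (Arith Mul rT rT rK), Basic (Arith Mul rT rT rKK),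
          Basic (Arith Div rTAU rLAM rT)]"
        have "achieves f c ([Cond (Equal rKK rT) out_code []] @ (?y' @ clear_code)) s3
          (\<lambda>v s'. Suc (Suc v) \<le> 8 * H + 30 \<and> outbox s' = [] \<and> solution s' = solution s \<union> (if kk = nn then set B' else {}) \<and>
            ready X lam' (kk + 1) 0 B' gb' [] (lam' / (2 * e * K * (kk + 1))) s')"
        proof (rule achieves_seq[OF outp], elim conjE)
          fix v :: nat and s4 assume v: "v \<le> 4 * H + 3" and o4: "outbox s4 = []" "solution s4 = solution s \<union> (if kk = nn then set B' else {})"
            and s4: "ready X lam' kk pass B' gb' G t s4"
          let ?T = "2 * e * K * (kk + 1)"
          define s5 where "s5 = put 15 (RealW (lam' / ?T)) (put 45 (RealW ?T) (put 45 (RealW (2 * e * K)) (put 45 (RealW (2 * e))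
             (put 18 (RealW (kk + 1)) (put 19 (NatW 0) s4)))))"
          have "ready X lam' (kk + 1) 0 B' gb' G t (put 18 (RealW (kk + 1)) (put 19 (NatW 0) s4))"
            by (rule ready_put_kk[OF ready_put_pass[OF s4]])
          then have "ready X lam' (kk + 1) 0 B' gb' G t (put 45 (RealW ?T) (put 45 (RealW (2 * e * K)) (put 45 (RealW (2 * e))
             (put 18 (RealW (kk + 1)) (put 19 (NatW 0) s4)))))"
            using ready_put[of 45] by simp
          then have s5: "ready X lam' (kk + 1) 0 B' gb' G (lam' / ?T) s5" unfolding s5_def by (rule ready_put_tau)
          have "achieves f c clear_code s5 (\<lambda>z s'. Suc (Suc (v + Suc (Suc (Suc (Suc (Suc (Suc z))))))) \<le> 8 * H + 30 \<and> outbox s' = [] \<and>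
            solution s' = solution s \<union> (if kk = nn then set B' else {}) \<and> ready X lam' (kk + 1) 0 B' gb' [] (lam' / ?T) s')"
            by (rule achieves_mono[OF clear_ready[OF s5 G]]) (use v o4 in \<open>auto simp: s5_def\<close>)
          then show "achieves f c (?y' @ clear_code) s4 (\<lambda>z s'. Suc (Suc (v + z)) \<le> 8 * H + 30 \<and> outbox s' = [] \<and>
            solution s' = solution s \<union> (if kk = nn then set B' else {}) \<and> ready X lam' (kk + 1) 0 B' gb' [] (lam' / ?T) s')"
            using ready_regs[OF s4] by (simp add: s5_def)
        qed
        then have "achieves f c ?c4 s2
          (\<lambda>v s'. v \<le> 8 * H + 30 \<and> outbox s' = [] \<and> solution s' = solution s \<union> (if kk = nn then set B' else {}) \<and>
            ready X lam' (kk + 1) 0 B' gb' [] (lam' / (2 * e * K * (kk + 1))) s')"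
          using True ready_regs(8,17)[OF s2] by (simp add: s3_def)
        then show ?thesis
        proof (rule achieves_random_seq, elim conjE)
          fix v :: nat and s' assume v: "v \<le> 8 * H + 30" and o: "outbox s' = []" "solution s' = solution s \<union> (if kk = nn then set B' else {})"
            and s': "ready X lam' (kk + 1) 0 B' gb' [] (lam' / (2 * e * K * (kk + 1))) s'"
          show "achieves_random f c ?tail s' ?d (\<lambda>x. ?Q (u + (w + (v + x))))"
            by (rule achieves_random_mono[OF draw_tail[OF s' o(1)]]) (use u v w o True B' in auto)
        qed
      qed
    qed
  qed
qed

lemma round0:
  assumes s: "consts_ok m K s" "get s rN = NatW (card E)" "dom (mem s) \<subseteq> {..<addr_lim}" "tape s = {}" "outbox s = []"
    and X: "inbox s = map ItemW X" "length X \<le> H"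
  shows "achieves_random f c (round0 tt Z) s (draws (draw_lists (tt * Kt) [0..<length X]))
    (\<lambda>u is s'. u \<le> 5 * length X + nat \<lceil>tt * Kt\<rceil> * (3 * m + 10) + 40 \<and>
      ready X 0 0 1 [] (-1) [] 0 s' \<and> get s' 16 = RealW 0 \<and>
      get s' rPC = NatW 1 \<and> solution s' = solution s \<and> outbox s' = to_all (map ((!) X) is))"
  (is "achieves_random f c _ s ?d ?Q")
proof -
  let ?Y = "{10,11} \<union> scratch \<union> {a. 64 \<le> a \<and> a mod 4 = 0}"
  let ?p = "[Basic (Receive rX rIDX), Basic (Store rOE rX), Basic (Arith Add rOE rOE rFOUR), Basic (Arith Add rIDX rIDX rONE)]"
  let ?L = "Loop (Less rIDX rNI) ?p"
  let ?b = "[Basic (ToReal rKT rN), Cond (Less rK rKT) [Basic (Move rKT rK)] [],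
     Basic (ToReal rCAP rM), Basic (Arith Mul rCAP rCAP rKT), Basic (ConstR rT Z),
     Basic (Arith Mul rCAP rCAP rT),
     Basic (ConstN rGE 65), Basic (Query rFG), Basic (ConstR rCG 0), Basic (ConstR rTAU 0),
     Basic (ConstR rRHO 0), Basic (ConstR rLAM 0), Basic (ConstR rKK 0), Basic (ConstN rPASS 1),
     Basic (ConstR rGB (- 1)), Basic (ConstN rBE 66),
     Basic (ConstR rLIM tt), Basic (Arith Mul rLIM rLIM rKT), Basic (ConstN rPC 1)]"
  let ?a = "[Basic (InboxLength rNI), Basic (ConstN rOE 64), Basic (ConstN rIDX 0)]"
  have eq: "round0 tt Z = (?a @ [?L] @ ?b) @ draw_code" by (simp add: round0_def)
  define I where "I i s' \<longleftrightarrow> upd ?Y s s' \<and> tape s' = {} \<and> outbox s' = [] \<and> get s' 10 = NatW (length X) \<and>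
    get s' 30 = NatW i \<and> get s' 11 = NatW (64 + 4 * i) \<and> (\<forall>j<i. get s' (64 + 4 * j) = ItemW (X ! j))" for i s'
  define s1 where "s1 = put 30 (NatW 0) (put 11 (NatW 64) (put 10 (NatW (length X)) s))"
  have loop: "achieves f c [?L] s1 (\<lambda>w s'. I (length X) s' \<and> w \<le> length X * (4 + 1) + 1)"
  proof (rule achieves_for_const)
    show "I 0 s1" using s by (simp add: I_def s1_def)
    show "\<not> holds (Less rIDX rNI) s'" if "I (length X) s'" for s' using that by (simp add: I_def)
  next
    fix i s2 assume i: "i < length X" and I: "I i s2"
    have u2: "upd ?Y s s2" using I by (simp add: I_def)
    have g: "get s2 5 = NatW 1" "get s2 6 = NatW 4" using upd_get[OF u2, of 5] upd_get[OF u2, of 6] s(1) by (auto simp: consts_ok_def)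
    have "inbox s2 = map ItemW X" using upd_same[OF u2] X by simp
    then show "holds (Less rIDX rNI) s2 \<and> achieves f c ?p s2 (\<lambda>w s'. I (Suc i) s' \<and> w \<le> 4)"
      using i I g X by (auto simp: I_def less_Suc_eq)
  qed
  have "achieves f c ([?L] @ ?b) s1 (\<lambda>w s'. Suc (Suc (Suc w)) \<le> 5 * length X + 30 \<and> ready X 0 0 1 [] (-1) [] 0 s' \<and> get s' 16 = RealW 0 \<and>
      get s' rPC = NatW 1 \<and> solution s' = solution s \<and> outbox s' = [] \<and> get s' 27 = RealW (tt * Kt))"
  proof (rule achieves_seq[OF loop], elim conjE)
    fix w :: nat and s2 assume I: "I (length X) s2" and w: "w \<le> length X * (4 + 1) + 1"
    have u2: "upd ?Y s s2" using I by (simp add: I_def)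
    have g: "get s2 a = get s a" if "a \<in> {1,2,3,5,6,7,8,28}" for a by (rule upd_get[OF u2]) (use that in auto)
    have dom: "dom (mem s2) \<subseteq> {..<addr_lim}" using u2 s(3) by (simp add: upd_def)
    have Kt: "Kt = (if K < real (card E) then K else real (card E))" by (simp add: Ktilde_def)
    show "achieves f c ?b s2 (\<lambda>v s'. Suc (Suc (Suc (w + v))) \<le> 5 * length X + 30 \<and> ready X 0 0 1 [] (-1) [] 0 s' \<and> get s' 16 = RealW 0 \<and>
      get s' rPC = NatW 1 \<and> solution s' = solution s \<and> outbox s' = [] \<and> get s' 27 = RealW (tt * Kt))"
      using I w s(1,2) g dom upd_same[OF u2]
      by (simp add: I_def ready_def core_def consts_ok_def own_def best_def rep_def Kt)
  qed
  then have "achieves f c (?a @ [?L] @ ?b) s (\<lambda>w s'. w \<le> 5 * length X + 30 \<and> ready X 0 0 1 [] (-1) [] 0 s' \<and> get s' 16 = RealW 0 \<and>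
      get s' rPC = NatW 1 \<and> solution s' = solution s \<and> outbox s' = [] \<and> get s' 27 = RealW (tt * Kt))"
    using X by (simp add: s1_def)
  then show ?thesis unfolding eq
  proof (rule achieves_random_seq, elim conjE)
    fix w :: nat and s' assume w: "w \<le> 5 * length X + 30" and s': "ready X 0 0 1 [] (-1) [] 0 s'" and g: "get s' 16 = RealW 0"
      "get s' rPC = NatW 1" "solution s' = solution s" "outbox s' = []" "get s' 27 = RealW (tt * Kt)"
    show "achieves_random f c draw_code s' ?d (\<lambda>u. ?Q (w + u))"
      by (rule achieves_random_mono[OF draw_ready[OF s' g(4,5)]]) (use w g in auto)
  qed
qed

end

section \<open>The rounds of the whole system\<close>

text \<open>A round takes at most \<open>60 * H + 150\<close> steps, starts with a load of at most
  \<open>3 * H\<close>, and uses addresses below \<open>80 + 4 * H\<close>. The sum of the three is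
  below \<open>67 * H + 300\<close>.\<close>

locale mpc_system = mpc_program U E c K f m H e tt Z nn
  for U E :: "'a set" and c :: "'a \<Rightarrow> real" and K :: real and f :: "'a set \<Rightarrow> real" and m H :: nat
    and e tt Z nn :: real +
  fixes inp :: "nat \<Rightarrow> 'a list" and T Q M :: nat
  assumes inp_E: "(\<Union>i<m. set (inp i)) = E" and inp_H: "\<And>i. i < m \<Longrightarrow> length (inp i) \<le> H"
    and m1: "1 \<le> m" and mH: "m \<le> H" and BH: "m * nat \<lceil>Kt\<rceil> \<le> H" and LH: "m * nat \<lceil>tt * Kt\<rceil> \<le> H"
    and capH: "cap \<le> real H" and e0: "0 \<le> e"
    and TQM: "67 * H + 300 \<le> T" "67 * H + 300 \<le> Q" "67 * H + 300 \<le> M"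
begin

abbreviation "prg \<equiv> main_program e tt Z nn"
abbreviation "rnd \<equiv> mpc_round f c prg T m"

lemma inp_sub: "i < m \<Longrightarrow> set (inp i) \<subseteq> E"
  using inp_E by auto

lemma good_list_H: "good_list G \<Longrightarrow> m * length G \<le> H"
proof -
  assume "good_list G"
  then have "length G \<le> nat \<lceil>Kt\<rceil>" using length_good_list[of G] by linarith
  then have "m * length G \<le> m * nat \<lceil>Kt\<rceil>" by simp
  then show ?thesis using BH by linarith
qed

lemma dispatch_run:
  assumes "i < length ps" "get s 4 = NatW (j + i)"
    and run: "\<And>s'. upd {45} s s' \<Longrightarrow> tape s' = tape s \<Longrightarrow> outbox s' = outbox s \<Longrightarrow>
      achieves_random f c (ps ! i) s' d (\<lambda>u x s''. u \<le> b \<and> R x s'')"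
  shows "achieves_random f c (dispatch j ps) s d (\<lambda>u x s''. u \<le> b + 2 * Suc i \<and> R x s'')"
  using assms
proof (induction ps arbitrary: i j s)
  case (Cons p ps)
  define s1 where "s1 = put 45 (NatW j) s"
  have u1: "upd {45} s s1" by (simp add: s1_def)
  show ?case
  proof (cases i)
    case 0
    have "achieves_random f c p s1 d (\<lambda>u x s''. u \<le> b \<and> R x s'')"
      using Cons.prems(3)[OF u1] 0 by (simp add: s1_def)
    then have "achieves_random f c p s1 d (\<lambda>u x s''. Suc (Suc u) \<le> b + 2 * Suc i \<and> R x s'')"
      by (rule achieves_random_mono) auto
    then show ?thesis using Cons.prems(2) 0
      by (simp only: dispatch.simps) (intro achieves_random_Basic achieves_random_Cond, simp_all add: s1_def)
  next
    case (Suc i')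
    have "achieves_random f c (dispatch (Suc j) ps) s1 d (\<lambda>u x s''. u \<le> b + 2 * Suc i' \<and> R x s'')"
    proof (rule Cons.IH)
      show "i' < length ps" "get s1 4 = NatW (Suc j + i')" using Cons.prems(1,2) Suc by (auto simp: s1_def)
      fix s' assume "upd {45} s1 s'" "tape s' = tape s1" "outbox s' = outbox s1"
      then show "achieves_random f c (ps ! i') s' d (\<lambda>u x s''. u \<le> b \<and> R x s'')"
        using Cons.prems(3)[of s'] upd_trans[OF u1] Suc by (simp add: s1_def)
    qed
    then have "achieves_random f c (dispatch (Suc j) ps) s1 d (\<lambda>u x s''. Suc (Suc u) \<le> b + 2 * Suc i \<and> R x s'')"
      by (rule achieves_random_mono) (auto simp: Suc)
    then show ?thesis using Cons.prems(2) Suc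
      by (simp only: dispatch.simps) (intro achieves_random_Basic achieves_random_Cond, simp_all add: s1_def)
  qed
qed simp

lemma program_run:
  assumes pc: "get s 4 = NatW i" "i < 9" and s: "get s 1 = NatW m" "get s 3 = RealW K"
    and run: "\<And>s'. upd {5,6,7,8,28,45} s s' \<Longrightarrow> tape s' = tape s \<Longrightarrow> outbox s' = outbox s \<Longrightarrow> consts_ok m K s' \<Longrightarrow>
      achieves_random f c (round_programs e tt Z nn ! i) s' d (\<lambda>u x s''. u \<le> b \<and> R x s'')"
  shows "achieves_random f c prg s d (\<lambda>u x s''. u \<le> b + 25 \<and> R x s'')"
  unfolding main_program_def
proof (rule achieves_random_seq)
  show "achieves f c prologue s (\<lambda>t s'. t = 5 \<and> upd {5,6,7,8,28} s s' \<and> tape s' = tape s \<and> outbox s' = outbox s \<and> consts_ok m K s')"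
    using s by (simp add: prologue_def consts_ok_def)
next
  fix t :: nat and s1 assume a: "t = 5 \<and> upd {5,6,7,8,28} s s1 \<and> tape s1 = tape s \<and> outbox s1 = outbox s \<and> consts_ok m K s1"
  then have u: "upd {5,6,7,8,28} s s1" by simp
  have "achieves_random f c (dispatch 0 (round_programs e tt Z nn)) s1 d (\<lambda>u x s''. u \<le> b + 2 * Suc i \<and> R x s'')"
  proof (rule dispatch_run)
    show "i < length (round_programs e tt Z nn)" using pc by (simp add: round_programs_def)
    show "get s1 4 = NatW (0 + i)" using upd_get[OF u, of 4] pc by simp
    fix s' assume b: "upd {45} s1 s'" "tape s' = tape s1" "outbox s' = outbox s1"
    show "achieves_random f c (round_programs e tt Z nn ! i) s' d (\<lambda>u x s''. u \<le> b \<and> R x s'')"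
    proof (rule run)
      have "upd {5,6,7,8,28,45} s s1" using u by (elim upd_subset) auto
      moreover have "upd {5,6,7,8,28,45} s1 s'" using b(1) by (elim upd_subset) auto
      ultimately show "upd {5,6,7,8,28,45} s s'" by (rule upd_trans)
      show "consts_ok m K s'" by (rule consts_ok_upd[OF b(1)]) (use a in auto)
    qed (use a b in auto)
  qed
  then show "achieves_random f c (dispatch 0 (round_programs e tt Z nn)) s1 d (\<lambda>u x s''. t + u \<le> b + 25 \<and> R x s'')"
    by (rule achieves_random_mono) (use a pc in auto)
qed

lemma ready_start:
  assumes s: "ready X lam kk pass B gb G t s" and u: "upd {5,6,7,8,28,45} s s'" and "tape s' = tape s" "consts_ok m K s'"
  shows "ready X lam kk pass B gb G t s'"
proof -
  have "rep G s'" by (rule rep_upd[OF u ready_regs(2)[OF s]]) (use assms in auto)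
  moreover have "core X lam kk pass B gb s'" by (rule core_upd[OF u]) (use s in \<open>auto simp: ready_def\<close>)
  moreover have "get s' 15 = get s 15" by (rule upd_get[OF u]) auto
  ultimately show ?thesis using assms ready_regs(5)[OF s] by (simp add: ready_def)
qed

lemma program_run_ready:
  assumes s: "ready X lam kk pass B gb G t s" and pc: "get s 4 = NatW i" "i < 9"
    and run: "\<And>s'. ready X lam kk pass B gb G t s' \<Longrightarrow> get s' 16 = get s 16 \<Longrightarrow> inbox s' = inbox s \<Longrightarrow> outbox s' = outbox s \<Longrightarrow>
      solution s' = solution s \<Longrightarrow>
      achieves_random f c (round_programs e tt Z nn ! i) s' d (\<lambda>u x s''. u \<le> b \<and> R x s'')"
  shows "achieves_random f c prg s d (\<lambda>u x s''. u \<le> b + 25 \<and> R x s'')"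
proof (rule program_run[OF pc])
  show "get s 1 = NatW m" "get s 3 = RealW K" using s by (auto simp: ready_def core_def)
  fix s' assume a: "upd {5,6,7,8,28,45} s s'" "tape s' = tape s" "outbox s' = outbox s" "consts_ok m K s'"
  show "achieves_random f c (round_programs e tt Z nn ! i) s' d (\<lambda>u x s''. u \<le> b \<and> R x s'')"
    by (rule run) (use ready_start[OF s a(1,2,4)] a upd_get[OF a(1), of 16] upd_same[OF a(1)] in auto)
qed

section \<open>The joint effect of one round\<close>

definition collect :: "(nat \<Rightarrow> (nat \<times> 'a word) list) \<Rightarrow> nat \<Rightarrow> 'a word list" where
  "collect ob j = concat (map (\<lambda>i. map snd (filter (\<lambda>x. fst x = j) (ob i))) [0..<m])"

text \<open>As the machines are independent, the product of their final distributions is the image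
  of the product of the samples \<open>d i\<close> under fixed maps \<open>h i\<close>.
  \<open>dd\<close> is a default for the indices of non-existing machines.\<close>

lemma round_exec:
  assumes run: "\<And>i. i < m \<Longrightarrow> achieves_random f c prg (g i) (d i) (\<lambda>u x s'. u \<le> 60 * H + 150 \<and> R i x s')"
    and R: "\<And>i x s'. i < m \<Longrightarrow> R i x s' \<Longrightarrow> dom (mem s') \<subseteq> {..<addr_lim}"
    and g: "\<And>i. i < m \<Longrightarrow> queries (g i) = 0" "\<And>i. i < m \<Longrightarrow> load (g i) \<le> 3 * H"
  shows "\<forall>i<m. runs_within f c prg T Q M (g i)"
    "\<exists>h. rnd g = map_pmf (\<lambda>\<omega>. deliver m (\<lambda>i. if i < m then h i (\<omega> i) else undefined)) (Pi_pmf {..<m} dd d) \<and>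
       (\<forall>i<m. \<forall>x\<in>set_pmf (d i). R i x (h i x))"
proof -
  have "\<exists>h. runs_within f c prg T Q M (g i) \<and> map_pmf snd (steps f c T (prg, g i)) = map_pmf h (d i) \<and>
     (\<forall>x\<in>set_pmf (d i). R i x (h x))" if i: "i < m" for i
  proof -
    obtain t h where h: "runs f c prg (g i) t (map_pmf h (d i))" "\<forall>x\<in>set_pmf (d i). t \<le> 60 * H + 150 \<and> R i x (h x)"
      using run[OF i] by (auto simp: achieves_random_def)
    then have t: "t \<le> 60 * H + 150" using set_pmf_not_empty[of "d i"] by blast
    have "runs_within f c prg T Q M (g i)" "map_pmf snd (steps f c T (prg, g i)) = map_pmf h (d i)"
      by (rule runs_within_steps[OF h(1), where a = addr_lim],
          use t TQM g[OF i] R[OF i] h(2) in auto)+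
    then show ?thesis using h(2) by blast
  qed
  then obtain h where h: "\<And>i. i < m \<Longrightarrow> runs_within f c prg T Q M (g i) \<and> map_pmf snd (steps f c T (prg, g i)) = map_pmf (h i) (d i) \<and>
     (\<forall>x\<in>set_pmf (d i). R i x (h i x))" by metis
  then show "\<forall>i<m. runs_within f c prg T Q M (g i)" by blast
  have "Pi_pmf {..<m} undefined (\<lambda>i. map_pmf snd (steps f c T (prg, g i))) = Pi_pmf {..<m} undefined (\<lambda>i. bind_pmf (d i) (\<lambda>x. return_pmf (h i x)))"
    by (rule Pi_pmf_cong) (use h in \<open>auto simp: map_pmf_def\<close>)
  also have "\<dots> = bind_pmf (Pi_pmf {..<m} dd d) (\<lambda>\<omega>. Pi_pmf {..<m} undefined (\<lambda>i. return_pmf (h i (\<omega> i))))"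
    by (rule Pi_pmf_bind) simp
  also have "\<dots> = map_pmf (\<lambda>\<omega> i. if i < m then h i (\<omega> i) else undefined) (Pi_pmf {..<m} dd d)"
    by (simp add: map_pmf_def)
  finally have "rnd g = map_pmf (\<lambda>\<omega>. deliver m (\<lambda>i. if i < m then h i (\<omega> i) else undefined)) (Pi_pmf {..<m} dd d)"
    by (simp add: mpc_round_def pmf.map_comp o_def)
  then show "\<exists>h. rnd g = map_pmf (\<lambda>\<omega>. deliver m (\<lambda>i. if i < m then h i (\<omega> i) else undefined)) (Pi_pmf {..<m} dd d) \<and>
       (\<forall>i<m. \<forall>x\<in>set_pmf (d i). R i x (h i x))" using h by blast
qed

lemma round_exec_det:
  assumes run: "\<And>i. i < m \<Longrightarrow> achieves f c prg (g i) (\<lambda>u s'. u \<le> 60 * H + 150 \<and> R i s')"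
    and R: "\<And>i s'. i < m \<Longrightarrow> R i s' \<Longrightarrow> dom (mem s') \<subseteq> {..<addr_lim}"
    and g: "\<And>i. i < m \<Longrightarrow> queries (g i) = 0" "\<And>i. i < m \<Longrightarrow> load (g i) \<le> 3 * H"
  shows "\<forall>i<m. runs_within f c prg T Q M (g i)" "\<exists>h. rnd g = return_pmf (deliver m h) \<and> (\<forall>i<m. R i (h i))"
proof -
  have run': "achieves_random f c prg (g i) (return_pmf ()) (\<lambda>u x s'. u \<le> 60 * H + 150 \<and> R i s')" if "i < m" for i
    by (rule achieves_random_det[OF run[OF that]])
  show "\<forall>i<m. runs_within f c prg T Q M (g i)"
    by (rule round_exec(1)[where d = "\<lambda>_. return_pmf ()" and R = "\<lambda>i _. R i"]) (use run' R g in auto)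
  have "\<exists>h. rnd g = map_pmf (\<lambda>\<omega>. deliver m (\<lambda>i. if i < m then h i (\<omega> i) else undefined)) (Pi_pmf {..<m} () (\<lambda>_. return_pmf ())) \<and>
     (\<forall>i<m. \<forall>x\<in>set_pmf (return_pmf ()). R i (h i x))"
    by (rule round_exec(2)[where d = "\<lambda>_. return_pmf ()" and R = "\<lambda>i _. R i"]) (use run' R g in auto)
  then obtain h where h: "rnd g = map_pmf (\<lambda>\<omega>. deliver m (\<lambda>i. if i < m then h i (\<omega> i) else undefined)) (Pi_pmf {..<m} () (\<lambda>_. return_pmf ()))"
     "\<forall>i<m. \<forall>x\<in>set_pmf (return_pmf ()). R i (h i x)" by blast
  then have "rnd g = return_pmf (deliver m (\<lambda>i. if i < m then h i () else undefined))" by simp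
  then show "\<exists>h. rnd g = return_pmf (deliver m h) \<and> (\<forall>i<m. R i (h i))"
    using h(2) by (intro exI[of _ "\<lambda>i. if i < m then h i () else undefined"]) simp
qed

text \<open>Identifies what the machines receive with \<open>draws\<close>: positions drawn
  independently on each machine, looked up and concatenated in the order of senders, are one family
  of independent draws, to which the analysis of survivors applies.\<close>

lemma pi_draws:
  "map_pmf (\<lambda>\<omega>. concat (map (\<lambda>i. map ((!) (inp i)) (\<omega> i)) [0..<n]))
     (Pi_pmf {..<n} dd (\<lambda>i. draws (draw_lists l [0..<length (inp i)]))) =
   draws (concat (map (\<lambda>i. draw_lists l (inp i)) [0..<n]))"
proof (induction n)
  case (Suc n)
  have one: "map_pmf (map ((!) X)) (draws (replicate k [0..<length X])) = draws (replicate k X)" if X: "X \<noteq> []" for X :: "'a list" and k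
  proof (induction k)
    case (Suc k)
    have "draw [0..<length X] = pmf_of_set {..<length X}" using X by (intro draw_upt) simp
    then show ?case
      by (simp add: Suc[symmetric] map_bind_pmf pmf.map_comp o_def bind_map_pmf draw_def[of X])
  qed simp
  have one': "map_pmf (map ((!) (inp n))) (draws (draw_lists l [0..<length (inp n)])) = draws (draw_lists l (inp n))"
    using one[of "inp n"] by (simp add: draw_lists_def)
  have upd: "map (\<lambda>i. map ((!) (inp i)) (if i = n then y else \<omega> i)) [0..<n] = map (\<lambda>i. map ((!) (inp i)) (\<omega> i)) [0..<n]"
    for y and \<omega> :: "nat \<Rightarrow> nat list" by auto
  have "Pi_pmf {..<Suc n} dd (\<lambda>i. draws (draw_lists l [0..<length (inp i)])) =
      bind_pmf (draws (draw_lists l [0..<length (inp n)])) (\<lambda>y. bind_pmf (Pi_pmf {..<n} dd (\<lambda>i. draws (draw_lists l [0..<length (inp i)])))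
        (\<lambda>\<omega>. return_pmf (fun_upd \<omega> n y)))"
    unfolding lessThan_Suc by (rule Pi_pmf_insert') auto
  then have "map_pmf (\<lambda>\<omega>. concat (map (\<lambda>i. map ((!) (inp i)) (\<omega> i)) [0..<Suc n])) (Pi_pmf {..<Suc n} dd (\<lambda>i. draws (draw_lists l [0..<length (inp i)]))) =
     bind_pmf (draws (draw_lists l [0..<length (inp n)])) (\<lambda>y. bind_pmf (Pi_pmf {..<n} dd (\<lambda>i. draws (draw_lists l [0..<length (inp i)])))
        (\<lambda>\<omega>. return_pmf (concat (map (\<lambda>i. map ((!) (inp i)) (\<omega> i)) [0..<n]) @ map ((!) (inp n)) y)))"
    by (simp add: map_bind_pmf upd)
  \<comment> \<open>\<open>Pi_pmf_insert'\<close> draws for the last machine first; commuting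
    restores the order of the concatenation.\<close>
  also have "\<dots> = bind_pmf (Pi_pmf {..<n} dd (\<lambda>i. draws (draw_lists l [0..<length (inp i)]))) (\<lambda>\<omega>.
      bind_pmf (draws (draw_lists l [0..<length (inp n)]))
        (\<lambda>y. return_pmf (concat (map (\<lambda>i. map ((!) (inp i)) (\<omega> i)) [0..<n]) @ map ((!) (inp n)) y)))"
    by (rule bind_commute_pmf)
  also have "\<dots> = bind_pmf (draws (concat (map (\<lambda>i. draw_lists l (inp i)) [0..<n]))) (\<lambda>xs. map_pmf ((@) xs) (draws (draw_lists l (inp n))))"
    unfolding Suc[symmetric] one'[symmetric] by (simp add: bind_map_pmf map_pmf_def bind_assoc_pmf bind_return_pmf)
  also have "\<dots> = draws (concat (map (\<lambda>i. draw_lists l (inp i)) [0..<Suc n]))" by (simp add: draws_append)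
  finally show ?case .
qed simp

text \<open>Here \<open>G i\<close> is the list of machine \<open>i\<close>; it differs between machines only while the center completes a
  saturation.\<close>

definition GS :: "nat \<Rightarrow> real \<Rightarrow> real \<Rightarrow> nat \<Rightarrow> real \<Rightarrow> (nat \<Rightarrow> 'a list) \<Rightarrow> real \<Rightarrow> (nat \<Rightarrow> 'a machine) \<Rightarrow> bool" where
  "GS pc lam kk pass gb G t g \<longleftrightarrow> (\<forall>i<m. get (g i) 4 = NatW pc \<and>
     (\<exists>B. best_ok B gb \<and> ready (inp i) lam kk pass B gb (G i) t (g i)) \<and> good_list (G i) \<and>
     outbox (g i) = [] \<and> queries (g i) = 0 \<and> length (inbox (g i)) \<le> H \<and> card (solution (g i)) \<le> H \<and>
     (kk \<le> nn \<longrightarrow> solution (g i) = {}))"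

lemma round_nth:
  "round_programs e tt Z nn ! 2 = round2" "round_programs e tt Z nn ! 3 = round3" "round_programs e tt Z nn ! 4 = round4"
  "round_programs e tt Z nn ! 5 = round5" "round_programs e tt Z nn ! 6 = round6" "round_programs e tt Z nn ! 7 = round7"
  "round_programs e tt Z nn ! 8 = round8 e nn" "round_programs e tt Z nn ! 0 = round0 tt Z" "round_programs e tt Z nn ! 1 = round1"
  by (simp_all add: round_programs_def)

lemma ready_load:
  assumes "ready X lam kk pass B gb G t s" "good_list G" "outbox s = []" "length (inbox s) \<le> H" "card (solution s) \<le> H"
  shows "load s \<le> 3 * H"
proof -
  have "tape s \<subseteq> set G" using assms(1) by (simp add: ready_def rep_def)
  then have "card (tape s) \<le> length G" using card_mono[of "set G" "tape s"] card_length[of G] by simp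
  then show ?thesis using assms length_less_H[of G] by (simp add: load_def)
qed

lemma ready_deliver [simp]:
  "ready X lam kk pass B gb G t (s\<lparr>inbox := a, outbox := b, queries := n\<rparr>) = ready X lam kk pass B gb G t s"
  by (simp add: ready_def core_def consts_ok_def own_def best_def rep_def)

lemma deliver_eq: "deliver m h j = (h j)\<lparr>inbox := collect (\<lambda>i. outbox (h i)) j, outbox := [], queries := 0\<rparr>"
  by (simp add: deliver_def collect_def)

definition step_to :: "(nat \<Rightarrow> 'a machine) \<Rightarrow> (nat \<Rightarrow> 'a machine) \<Rightarrow> bool" where
  "step_to g g' \<longleftrightarrow> (\<forall>i<m. runs_within f c prg T Q M (g i)) \<and> rnd g = return_pmf g'"

text \<open>Lifts a statement about one machine to the system. \<open>OB\<close> abstracts the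
  outboxes, so that the inbox bound required for the next round follows from the message pattern
  alone.\<close>

lemma det_transition:
  assumes g: "GS pc lam kk pass gb G t g" and pc: "pc < 9"
    and run: "\<And>i s B. i < m \<Longrightarrow> ready (inp i) lam kk pass B gb (G i) t s \<Longrightarrow>
      inbox s = inbox (g i) \<Longrightarrow> outbox s = [] \<Longrightarrow>
      achieves f c (round_programs e tt Z nn ! pc) s (\<lambda>u s'. u \<le> 60 * H + 100 \<and> get s' 4 = NatW pc' \<and>
        ready (inp i) lam' kk pass B gb (G' i) t' s' \<and> solution s' = solution s \<and> OB i (outbox s'))"
    and good': "\<And>i. i < m \<Longrightarrow> good_list (G' i)"
    and len: "\<And>ob j. (\<And>i. i < m \<Longrightarrow> OB i (ob i)) \<Longrightarrow> j < m \<Longrightarrow> length (collect ob j) \<le> H"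
  shows "\<exists>g' ob. step_to g g' \<and> GS pc' lam' kk pass gb G' t' g' \<and> (\<forall>i<m. OB i (ob i)) \<and> (\<forall>j<m. inbox (g' j) = collect ob j)"
proof -
  define R where "R i s' \<longleftrightarrow> get s' 4 = NatW pc' \<and> (\<exists>B. best_ok B gb \<and> ready (inp i) lam' kk pass B gb (G' i) t' s') \<and>
    solution s' = solution (g i) \<and> OB i (outbox s')" for i s'
  have run': "achieves f c prg (g i) (\<lambda>u s'. u \<le> 60 * H + 150 \<and> R i s')" if i: "i < m" for i
  proof -
    obtain B where B: "best_ok B gb" "ready (inp i) lam kk pass B gb (G i) t (g i)" using g i by (auto simp: GS_def)
    have "achieves_random f c prg (g i) (return_pmf ()) (\<lambda>u x s'. u \<le> 60 * H + 100 + 25 \<and> R i s')"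
    proof (rule program_run_ready[OF B(2)])
      show "get (g i) 4 = NatW pc" "pc < 9" using g i pc by (auto simp: GS_def)
      fix s assume s: "ready (inp i) lam kk pass B gb (G i) t s" "inbox s = inbox (g i)" "outbox s = outbox (g i)" "solution s = solution (g i)"
      show "achieves_random f c (round_programs e tt Z nn ! pc) s (return_pmf ()) (\<lambda>u x s'. u \<le> 60 * H + 100 \<and> R i s')"
        by (rule achieves_random_det, rule achieves_mono[OF run[OF i s(1,2)]])
          (use s g i B in \<open>auto simp: GS_def R_def\<close>)
    qed
    then obtain u h where "runs f c prg (g i) u (return_pmf (h ()))" "u \<le> 60 * H + 125" "R i (h ())"
      by (auto simp: achieves_random_def)
    then show ?thesis by (auto simp: achieves_def intro!: exI[of _ u] exI[of _ "h ()"])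
  qed
  have dom: "dom (mem s') \<subseteq> {..<addr_lim}" if "R i s'" for i s' using that ready_regs(19) unfolding R_def by blast
  have q: "queries (g i) = 0" "load (g i) \<le> 3 * H" if "i < m" for i
    using g that ready_load by (auto simp: GS_def)
  have rw: "\<forall>i<m. runs_within f c prg T Q M (g i)" by (rule round_exec_det(1)[where R = R]) (use run' dom q in auto)
  have "\<exists>h. rnd g = return_pmf (deliver m h) \<and> (\<forall>i<m. R i (h i))"
    by (rule round_exec_det(2)[where R = R]) (use run' dom q in auto)
  then obtain h where h: "rnd g = return_pmf (deliver m h)" "\<And>i. i < m \<Longrightarrow> R i (h i)" by blast
  define ob where "ob i = outbox (h i)" for i
  have OB: "OB i (ob i)" if "i < m" for i using h(2)[OF that] by (simp add: R_def ob_def)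
  have "GS pc' lam' kk pass gb G' t' (deliver m h)"
    unfolding GS_def
  proof (intro allI impI)
    fix i assume i: "i < m"
    have "length (collect (\<lambda>i. outbox (h i)) i) \<le> H" using len[of ob i] OB i by (simp add: ob_def[abs_def])
    then show "get (deliver m h i) 4 = NatW pc' \<and> (\<exists>B. best_ok B gb \<and> ready (inp i) lam' kk pass B gb (G' i) t' (deliver m h i)) \<and>
      good_list (G' i) \<and> outbox (deliver m h i) = [] \<and> queries (deliver m h i) = 0 \<and> length (inbox (deliver m h i)) \<le> H \<and>
      card (solution (deliver m h i)) \<le> H \<and> (kk \<le> nn \<longrightarrow> solution (deliver m h i) = {})"
      using h(2)[OF i] g i good'[OF i] by (auto simp: deliver_eq R_def GS_def)
  qed
  moreover have "\<forall>j<m. inbox (deliver m h j) = collect ob j" by (simp add: deliver_eq ob_def[abs_def])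
  ultimately show ?thesis using h(1) OB rw unfolding step_to_def by blast
qed

abbreviation "samples l \<equiv> concat (map (\<lambda>i. draw_lists l (inp i)) [0..<m])"

lemma samples_ne: "[] \<notin> set (samples l)"
  by (auto simp: draw_lists_def)

lemma samples_E: "X \<in> set (samples l) \<Longrightarrow> set X \<subseteq> E"
  using inp_sub by (fastforce simp: draw_lists_def split: if_splits)

lemma length_samples: "length (samples l) \<le> m * nat \<lceil>l\<rceil>"
proof -
  have "length (concat (map (\<lambda>i. draw_lists l (inp i)) [0..<n])) \<le> n * nat \<lceil>l\<rceil>" for n
    by (induction n) (auto simp: draw_lists_def)
  then show ?thesis .
qed

lemma draws_samples:
  assumes "D \<in> set_pmf (draws (samples l))"
  shows "set D \<subseteq> E" "length D \<le> m * nat \<lceil>l\<rceil>"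
  using set_draws[OF samples_ne assms] samples_E[of _ l] length_samples[of l] by auto

lemma collect_to_all:
  assumes "j < m"
  shows "collect (\<lambda>i. to_all (xs i)) j = map ItemW (concat (map xs [0..<m]))"
proof -
  have f: "filter (\<lambda>x. fst x = j) (map (\<lambda>k. (k, w)) [0..<n]) = (if j < n then [(j, w)] else [])" for n and w :: "'a word"
    by (induction n) auto
  have "map snd (filter (\<lambda>x. fst x = j) (to_all ys)) = map ItemW ys" for ys
    using assms by (induction ys) (auto simp: to_all_def f)
  then show ?thesis by (simp add: collect_def map_concat o_def)
qed

lemma collect_word:
  assumes "j < m"
  shows "collect (\<lambda>i. map (\<lambda>k. (k, w i)) [0..<m]) j = map w [0..<m]"
proof -
  have f: "filter (\<lambda>x. fst x = j) (map (\<lambda>k. (k, w)) [0..<n]) = (if j < n then [(j, w)] else [])" for n and w :: "'a word"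
    by (induction n) auto
  have "concat (map (\<lambda>i. [w i]) xs) = map w xs" for xs by (induction xs) auto
  then show ?thesis using assms by (simp add: collect_def f)
qed

lemma collect_center:
  "collect (\<lambda>i. map (\<lambda>x. (0, ItemW x)) (xs i)) j = (if j = 0 then map ItemW (concat (map xs [0..<m])) else [])"
  by (simp add: collect_def filter_map o_def map_concat)

lemma collect_others:
  assumes "j < m"
  shows "collect (\<lambda>i. concat (map (\<lambda>x. map (\<lambda>k. (k, ItemW x)) [1..<m]) (xs i))) j =
    (if j = 0 then [] else map ItemW (concat (map xs [0..<m])))"
proof -
  have f: "filter (\<lambda>x. fst x = j) (map (\<lambda>k. (k, w)) [Suc 0..<n]) = (if Suc 0 \<le> j \<and> j < n then [(j, w)] else [])" for n and w :: "'a word"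
    by (induction n) auto
  have "map snd (filter (\<lambda>x. fst x = j) (concat (map (\<lambda>x. map (\<lambda>k. (k, ItemW x)) [1..<m]) ys))) = (if j = 0 then [] else map ItemW ys)" for ys :: "'a list"
    using assms by (induction ys) (simp_all add: f)
  then show ?thesis by (simp add: collect_def map_concat o_def)
qed

text \<open>\<open>Y D\<close> contains the states in which the sample \<open>D\<close> has reached
  all machines. The last conclusion transfers lower bounds for events on samples to states, so
  probabilities have to be computed for \<open>draws\<close> only.\<close>

lemma random_transition:
  assumes run: "\<And>i. i < m \<Longrightarrow> achieves_random f c prg (g i) (draws (draw_lists l [0..<length (inp i)]))
      (\<lambda>u is s'. u \<le> 60 * H + 150 \<and> get s' 4 = NatW pc' \<and>
        (\<exists>B. best_ok B gb' \<and> ready (inp i) lam' kk' pass' B gb' G' t' s') \<and> RHO (get s' 16) \<and> SOL i (solution s') \<and>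
        outbox s' = to_all (map ((!) (inp i)) is))"
    and g: "\<And>i. i < m \<Longrightarrow> queries (g i) = 0" "\<And>i. i < m \<Longrightarrow> load (g i) \<le> 3 * H"
    and sol: "\<And>i A. i < m \<Longrightarrow> SOL i A \<Longrightarrow> card A \<le> H \<and> (kk' \<le> nn \<longrightarrow> A = {})"
    and good: "good_list G'" and l: "m * nat \<lceil>l\<rceil> \<le> H"
  defines "Y \<equiv> \<lambda>D. {g'. GS pc' lam' kk' pass' gb' (\<lambda>_. G') t' g' \<and> (\<forall>i<m. SOL i (solution (g' i)) \<and>
      inbox (g' i) = map ItemW D \<and> RHO (get (g' i) 16))}"
  shows "\<forall>i<m. runs_within f c prg T Q M (g i)"
    "set_pmf (rnd g) \<subseteq> (\<Union>D\<in>set_pmf (draws (samples l)). Y D)"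
    "measure_pmf.prob (draws (samples l)) S \<le> measure_pmf.prob (rnd g) (\<Union>D\<in>S \<inter> set_pmf (draws (samples l)). Y D)"
proof -
  define R where "R i is s' \<longleftrightarrow> get s' 4 = NatW pc' \<and>
        (\<exists>B. best_ok B gb' \<and> ready (inp i) lam' kk' pass' B gb' G' t' s') \<and> RHO (get s' 16) \<and> SOL i (solution s') \<and>
        outbox s' = to_all (map ((!) (inp i)) is)" for i "is" s'
  let ?d = "\<lambda>i. draws (draw_lists l [0..<length (inp i)])"
  have run': "achieves_random f c prg (g i) (?d i) (\<lambda>u is s'. u \<le> 60 * H + 150 \<and> R i is s')" if "i < m" for i
    using run[OF that] by (simp add: R_def)
  have dom: "dom (mem s') \<subseteq> {..<addr_lim}" if "R i is s'" for i "is" s' using that ready_regs(19) unfolding R_def by blast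
  show "\<forall>i<m. runs_within f c prg T Q M (g i)" by (rule round_exec(1)[where R = R and d = ?d]) (use run' dom g in auto)
  have "\<exists>h. rnd g = map_pmf (\<lambda>\<omega>. deliver m (\<lambda>i. if i < m then h i (\<omega> i) else undefined)) (Pi_pmf {..<m} undefined ?d) \<and>
      (\<forall>i<m. \<forall>x\<in>set_pmf (?d i). R i x (h i x))"
    by (rule round_exec(2)[where R = R and d = ?d]) (use run' dom g in auto)
  then obtain h where h: "rnd g = map_pmf (\<lambda>\<omega>. deliver m (\<lambda>i. if i < m then h i (\<omega> i) else undefined)) (Pi_pmf {..<m} undefined ?d)"
    "\<And>i is. i < m \<Longrightarrow> is \<in> set_pmf (?d i) \<Longrightarrow> R i is (h i is)" by blast
  let ?P = "Pi_pmf {..<m} undefined ?d"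
  define F where "F \<omega> = deliver m (\<lambda>i. if i < m then h i (\<omega> i) else undefined)" for \<omega>
  define D where "D \<omega> = concat (map (\<lambda>i. map ((!) (inp i)) (\<omega> i)) [0..<m])" for \<omega> :: "nat \<Rightarrow> nat list"
  have dr: "draws (samples l) = map_pmf D ?P" unfolding D_def by (rule pi_draws[symmetric])
  have FY: "F \<omega> \<in> Y (D \<omega>)" if \<omega>: "\<omega> \<in> set_pmf ?P" for \<omega>
  proof -
    have Ri: "R i (\<omega> i) (h i (\<omega> i))" if "i < m" for i
      using h(2)[OF that, of "\<omega> i"] set_Pi_pmf_subset'[of "{..<m}" undefined ?d] \<omega> that by (auto simp: PiE_dflt_def)
    have "D \<omega> \<in> set_pmf (draws (samples l))" using \<omega> by (simp add: dr)
    then have len: "length (D \<omega>) \<le> H" using draws_samples(2)[of "D \<omega>" l] l by linarith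
    have F: "F \<omega> j = (h j (\<omega> j))\<lparr>inbox := map ItemW (D \<omega>), outbox := [], queries := 0\<rparr>" if j: "j < m" for j
    proof -
      have "collect (\<lambda>i. outbox (if i < m then h i (\<omega> i) else undefined)) j = collect (\<lambda>i. to_all (map ((!) (inp i)) (\<omega> i))) j"
        unfolding collect_def using Ri by (auto simp: R_def intro!: arg_cong[where f = concat])
      also have "\<dots> = map ItemW (D \<omega>)" using collect_to_all[OF j] by (simp add: D_def)
      finally show ?thesis using j by (simp add: F_def deliver_eq)
    qed
    show ?thesis unfolding Y_def GS_def
    proof (intro CollectI conjI allI impI, goal_cases)
      case (8 i) then show ?case using F Ri sol by (auto simp: R_def)
    next
      case (9 i) then show ?case using F Ri sol by (auto simp: R_def)
    qed (use F Ri sol good len in \<open>auto simp: R_def\<close>)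
  qed
  have rg: "rnd g = map_pmf F ?P" using h(1) by (simp add: F_def[abs_def])
  show "set_pmf (rnd g) \<subseteq> (\<Union>D\<in>set_pmf (draws (samples l)). Y D)"
    using FY by (auto simp: rg dr)
  have "measure_pmf.prob (draws (samples l)) S = measure_pmf.prob ?P {\<omega>. D \<omega> \<in> S}"
    unfolding dr measure_map_pmf by (simp add: vimage_def)
  also have "\<dots> \<le> measure_pmf.prob ?P {\<omega>. F \<omega> \<in> (\<Union>D\<in>S \<inter> set_pmf (draws (samples l)). Y D)}"
    by (rule prob_mono_support) (use FY in \<open>auto simp: dr\<close>)
  also have "\<dots> = measure_pmf.prob (rnd g) (\<Union>D\<in>S \<inter> set_pmf (draws (samples l)). Y D)"
    unfolding rg measure_map_pmf by (simp add: vimage_def)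
  finally show "measure_pmf.prob (draws (samples l)) S \<le> measure_pmf.prob (rnd g) (\<Union>D\<in>S \<inter> set_pmf (draws (samples l)). Y D)" .
qed

section \<open>Transitions of the single rounds\<close>

lemma collect_cong: "(\<And>i. i < m \<Longrightarrow> ob i = ob' i) \<Longrightarrow> collect ob j = collect ob' j"
  unfolding collect_def by (intro arg_cong[where f = concat]) simp

lemma transition2:
  assumes g: "GS 2 lam kk pass gb (\<lambda>_. G) t g" and t: "0 \<le> t" and D: "\<And>i. i < m \<Longrightarrow> inbox (g i) = map ItemW D" "set D \<subseteq> E"
  defines "G' \<equiv> foldl (ext t) G D"
  shows "\<exists>g'. step_to g g' \<and> GS 3 lam kk pass gb (\<lambda>_. G') t g' \<and>
    (\<forall>i<m. inbox (g' i) = map NatW (map (\<lambda>i. length (filter (acc t G') (inp i))) [0..<m]))"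
proof -
  let ?n = "\<lambda>i. length (filter (acc t G') (inp i))"
  let ?OB = "\<lambda>i ob. ob = map (\<lambda>k. (k, NatW (?n i))) [0..<m]"
  have G: "good_list G" "length D \<le> H" using g m1 D(1)[of 0] by (auto simp: GS_def)
  have G': "good_list G'" unfolding G'_def by (rule good_list_foldl_ext[OF G(1) t D(2)])
  have col: "collect ob j = map (\<lambda>i. NatW (?n i)) [0..<m]" if "\<And>i. i < m \<Longrightarrow> ?OB i (ob i)" "j < m" for ob j
    using collect_cong[of ob "\<lambda>i. map (\<lambda>k. (k, NatW (?n i))) [0..<m]" j] collect_word[OF that(2)] that(1) by simp
  have run: "achieves f c (round_programs e tt Z nn ! 2) s (\<lambda>u s'. u \<le> 60 * H + 100 \<and> get s' 4 = NatW 3 \<and>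
        ready (inp i) lam kk pass B gb G' t s' \<and> solution s' = solution s \<and> ?OB i (outbox s'))"
    if i: "i < m" and s: "ready (inp i) lam kk pass B gb G t s" "inbox s = inbox (g i)" "outbox s = []" for i s B
  proof -
    have "achieves f c round2 s (\<lambda>u s'. u \<le> 20 * length D + 16 * length (inp i) + 3 * m + 20 \<and>
      ready (inp i) lam kk pass B gb G' t s' \<and> get s' 4 = NatW 3 \<and> solution s' = solution s \<and> ?OB i (outbox s'))"
      unfolding G'_def by (rule round2[OF s(1) G(1) t inp_sub[OF i] _ D(2) s(3)]) (use s D i in auto)
    then show ?thesis unfolding round_nth
      by (rule achieves_mono) (use G inp_H[OF i] mH in auto)
  qed
  have "\<exists>g' ob. step_to g g' \<and> GS 3 lam kk pass gb (\<lambda>_. G') t g' \<and> (\<forall>i<m. ?OB i (ob i)) \<and> (\<forall>j<m. inbox (g' j) = collect ob j)"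
    by (rule det_transition[where OB = ?OB, OF g _ run]) (use G' col mH in simp_all)
  then obtain g' ob where *: "step_to g g'" "GS 3 lam kk pass gb (\<lambda>_. G') t g'" "\<And>i. i < m \<Longrightarrow> ?OB i (ob i)" "\<And>j. j < m \<Longrightarrow> inbox (g' j) = collect ob j"
    by blast
  show ?thesis using *(1,2,4) col[OF *(3)] by (intro exI[of _ g']) simp
qed

lemma transition3:
  assumes g: "GS 3 lam kk pass gb (\<lambda>_. G) t g"
    and ns: "\<And>i. i < m \<Longrightarrow> inbox (g i) = map NatW (map (\<lambda>i. length (filter (acc t G) (inp i))) [0..<m])"
  defines "A \<equiv> if cap < real (\<Sum>i<m. length (filter (acc t G) (inp i))) then []
     else concat (map (\<lambda>i. filter (acc t G) (inp i)) [0..<m])"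
  shows "\<exists>g'. step_to g g' \<and> GS (if kk = 0 then 4 else 6) lam kk pass gb (\<lambda>_. G) t g' \<and>
    (\<forall>i<m. inbox (g' i) = (if i = 0 then map ItemW A else []))"
proof -
  let ?ns = "map (\<lambda>i. length (filter (acc t G) (inp i))) [0..<m]"
  have sum: "sum_list ?ns = (\<Sum>i<m. length (filter (acc t G) (inp i)))"
    by (simp add: interv_sum_list_conv_sum_set_nat atLeast0LessThan)
  let ?ob = "\<lambda>i. if cap < real (sum_list ?ns) then [] else map (\<lambda>x. (0, ItemW x)) (filter (acc t G) (inp i))"
  let ?OB = "\<lambda>i ob. ob = ?ob i"
  have G: "good_list G" using g m1 by (auto simp: GS_def)
  have A: "length A \<le> H"
  proof (cases "cap < real (sum_list ?ns)")
    case False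
    have "length A = sum_list ?ns" using False by (simp add: A_def sum[symmetric] length_concat o_def)
    then have "real (length A) \<le> real H" using False capH by simp
    then show ?thesis by simp
  qed (simp add: A_def sum)
  have col: "collect ob j = (if j = 0 then map ItemW A else [])" if "\<And>i. i < m \<Longrightarrow> ?OB i (ob i)" for ob j
    using collect_cong[of ob ?ob j] collect_center[of "\<lambda>i. filter (acc t G) (inp i)" j] that
    by (cases "cap < real (sum_list ?ns)") (simp_all add: A_def sum collect_def)
  have run: "achieves f c (round_programs e tt Z nn ! 3) s (\<lambda>u s'. u \<le> 60 * H + 100 \<and> get s' 4 = NatW (if kk = 0 then 4 else 6) \<and>
        ready (inp i) lam kk pass B gb G t s' \<and> solution s' = solution s \<and> ?OB i (outbox s'))"
    if i: "i < m" and s: "ready (inp i) lam kk pass B gb G t s" "inbox s = inbox (g i)" "outbox s = []" for i s B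
  proof -
    have "achieves f c round3 s (\<lambda>u s'. u \<le> 4 * length ?ns + 16 * length (inp i) + 20 \<and>
      ready (inp i) lam kk pass B gb G t s' \<and> get s' 4 = NatW (if kk = 0 then 4 else 6) \<and> solution s' = solution s \<and> ?OB i (outbox s'))"
      by (rule round3[OF s(1) G inp_sub[OF i] _ s(3)]) (use s ns i in auto)
    then show ?thesis unfolding round_nth
      by (rule achieves_mono) (use inp_H[OF i] mH in auto)
  qed
  have "\<exists>g' ob. step_to g g' \<and> GS (if kk = 0 then 4 else 6) lam kk pass gb (\<lambda>_. G) t g' \<and> (\<forall>i<m. ?OB i (ob i)) \<and> (\<forall>j<m. inbox (g' j) = collect ob j)"
    by (rule det_transition[where OB = ?OB, OF g _ run]) (use G col A in simp_all)
  then obtain g' ob where *: "step_to g g'" "GS (if kk = 0 then 4 else 6) lam kk pass gb (\<lambda>_. G) t g'" "\<And>i. i < m \<Longrightarrow> ?OB i (ob i)" "\<And>j. j < m \<Longrightarrow> inbox (g' j) = collect ob j"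
    by blast
  show ?thesis using *(1,2,4) col[OF *(3)] by (intro exI[of _ g']) simp
qed

lemma transition4:
  assumes g: "GS 4 lam kk pass gb (\<lambda>_. G) t g"
    and A: "\<And>i. i < m \<Longrightarrow> inbox (g i) = (if i = 0 then map ItemW A else [])" "set A \<subseteq> E"
  shows "\<exists>g'. step_to g g' \<and> GS 5 lam kk pass gb (\<lambda>_. []) 0 g' \<and>
    (\<forall>i<m. inbox (g' i) \<noteq> [] \<and> inbox (g' i) ! 0 = RealW (estimate A))"
proof -
  let ?w = "\<lambda>i :: nat. RealW (estimate (if i = 0 then A else [])) :: 'a word"
  let ?OB = "\<lambda>i ob. ob = map (\<lambda>k. (k, ?w i)) [0..<m]"
  have G: "good_list G" using g m1 by (auto simp: GS_def)
  have lA: "length A \<le> H" using g m1 A(1)[of 0] by (auto simp: GS_def dest!: spec[of _ 0])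
  have col: "collect ob j = map ?w [0..<m]" if "\<And>i. i < m \<Longrightarrow> ?OB i (ob i)" "j < m" for ob j
    using collect_cong[of ob "\<lambda>i. map (\<lambda>k. (k, ?w i)) [0..<m]" j] collect_word[OF that(2)] that(1) by simp
  have run: "achieves f c (round_programs e tt Z nn ! 4) s (\<lambda>u s'. u \<le> 60 * H + 100 \<and> get s' 4 = NatW 5 \<and>
        ready (inp i) lam kk pass B gb [] 0 s' \<and> solution s' = solution s \<and> ?OB i (outbox s'))"
    if i: "i < m" and s: "ready (inp i) lam kk pass B gb G t s" "inbox s = inbox (g i)" "outbox s = []" for i s B
  proof -
    let ?xs = "if i = 0 then A else []"
    have "achieves f c round4 s (\<lambda>u s'. u \<le> 33 * length ?xs + 8 * H + 3 * m + 40 \<and>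
      ready (inp i) lam kk pass B gb [] 0 s' \<and> get s' 4 = NatW 5 \<and> solution s' = solution s \<and>
      outbox s' = map (\<lambda>k. (k, RealW (estimate ?xs))) [0..<m])"
      by (rule round4[OF s(1) G _ _ s(3)]) (use s A i in auto)
    then show ?thesis unfolding round_nth
      by (rule achieves_mono) (use lA mH in \<open>auto split: if_splits\<close>)
  qed
  have "map ?w [0..<m] \<noteq> []" "map ?w [0..<m] ! 0 = RealW (estimate A)" using m1 by auto
  note w = this
  have "\<exists>g' ob. step_to g g' \<and> GS 5 lam kk pass gb (\<lambda>_. []) 0 g' \<and> (\<forall>i<m. ?OB i (ob i)) \<and> (\<forall>j<m. inbox (g' j) = collect ob j)"
    by (rule det_transition[where OB = ?OB, OF g _ run]) (use col mH in simp_all)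
  then obtain g' ob where *: "step_to g g'" "GS 5 lam kk pass gb (\<lambda>_. []) 0 g'" "\<And>i. i < m \<Longrightarrow> ?OB i (ob i)" "\<And>j. j < m \<Longrightarrow> inbox (g' j) = collect ob j"
    by blast
  show ?thesis using *(1,2,4) col[OF *(3)] w by (intro exI[of _ g']) simp
qed

lemma aug_value_mono: "S \<subseteq> S' \<Longrightarrow> S' \<subseteq> E \<Longrightarrow> aug_value G S \<le> aug_value G S'"
  unfolding aug_value_def using finite_subset[OF _ finite_items] by (intro Max_mono) auto

lemma aug_value_ge:
  "f (set G) \<le> aug_value G E" "x \<in> E \<Longrightarrow> cost G + c x \<le> K \<Longrightarrow> f (insert x (set G)) \<le> aug_value G E"
  unfolding aug_value_def using finite_items by (auto intro!: Max_ge)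

text \<open>The best fitting item lies on some machine, whose candidate is at least as good. So at
  most \<open>m\<close> items determine the best augmentation over all of \<open>E\<close>.\<close>

lemma cands_aug_value:
  assumes "\<And>i. i < m \<Longrightarrow> cand G (inp i) (cs i)"
  shows "set (concat (map cs [0..<m])) \<subseteq> E" "length (concat (map cs [0..<m])) \<le> m"
    "aug_value G (set (concat (map cs [0..<m]))) = aug_value G E"
proof -
  let ?C = "set (concat (map cs [0..<m]))"
  show C: "?C \<subseteq> E" using assms inp_sub by (fastforce simp: cand_def)
  have "length (concat (map cs [0..<n])) \<le> n" if "n \<le> m" for n
    using that
  proof (induction n)
    case (Suc n)
    then show ?case using assms[of n] by (simp add: cand_def)
  qed simp
  then show "length (concat (map cs [0..<m])) \<le> m" by blast
  have fin: "finite ?C" by simp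
  have "v \<le> aug_value G ?C" if v: "v \<in> insert (f (set G)) ((\<lambda>x. f (insert x (set G))) ` {x \<in> E. cost G + c x \<le> K})" for v
  proof -
    have 0: "f (set G) \<le> aug_value G ?C" unfolding aug_value_def using fin by (auto intro!: Max_ge)
    have 1: "f (insert y (set G)) \<le> aug_value G ?C" if "y \<in> ?C" "cost G + c y \<le> K" for y
      unfolding aug_value_def using fin that by (intro Max_ge) auto
    show ?thesis
    proof (cases "v = f (set G)")
      case False
      then obtain x where x: "x \<in> E" "cost G + c x \<le> K" "v = f (insert x (set G))" using v by auto
      then obtain i where i: "i < m" "x \<in> set (inp i)" using inp_E by auto
      consider "v \<le> f (set G)" | y where "y \<in> set (cs i)" "cost G + c y \<le> K" "v \<le> f (insert y (set G))"
        using assms[OF i(1)] i(2) x by (auto simp: cand_def)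
      then show ?thesis
      proof cases
        case 2
        then show ?thesis using 1[of y] i(1) by fastforce
      qed (use 0 in simp)
    qed (use 0 in simp)
  qed
  then have "aug_value G E \<le> aug_value G ?C"
    unfolding aug_value_def[of G E] using finite_items by (subst Max_le_iff) auto
  then show "aug_value G ?C = aug_value G E" using aug_value_mono[OF C order.refl] by (intro antisym)
qed

definition cands_in :: "'a list \<Rightarrow> (nat \<Rightarrow> 'a machine) \<Rightarrow> bool" where
  "cands_in G g \<longleftrightarrow> (\<exists>cs. set cs \<subseteq> E \<and> aug_value G (set cs) = aug_value G E \<and> (\<forall>i<m. inbox (g i) = map ItemW cs))"

lemma cands_collect:
  assumes "\<And>i. i < m \<Longrightarrow> \<exists>cs. cand G (inp i) cs \<and> ob i = to_all cs"
  shows "\<exists>cs. set cs \<subseteq> E \<and> aug_value G (set cs) = aug_value G E \<and> length cs \<le> H \<and> (\<forall>j<m. collect ob j = map ItemW cs)"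
proof -
  obtain cs where cs: "\<And>i. i < m \<Longrightarrow> cand G (inp i) (cs i) \<and> ob i = to_all (cs i)" using assms by metis
  have "collect ob j = map ItemW (concat (map cs [0..<m]))" if "j < m" for j
    using collect_cong[of ob "\<lambda>i. to_all (cs i)" j] collect_to_all[OF that] cs by simp
  then show ?thesis using cands_aug_value[of G cs] cs mH by (intro exI[of _ "concat (map cs [0..<m])"]) auto
qed

lemma transition5:
  assumes g: "GS 5 lam kk pass gb (\<lambda>_. G) t g"
    and L: "\<And>i. i < m \<Longrightarrow> inbox (g i) \<noteq> [] \<and> inbox (g i) ! 0 = RealW L"
  shows "\<exists>g'. step_to g g' \<and> GS 8 (lam + 4 * L) kk pass gb (\<lambda>_. G) t g' \<and> cands_in G g'"
proof -
  let ?OB = "\<lambda>i ob. \<exists>cs. cand G (inp i) cs \<and> ob = to_all cs"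
  have G: "good_list G" using g m1 by (auto simp: GS_def)
  have run: "achieves f c (round_programs e tt Z nn ! 5) s (\<lambda>u s'. u \<le> 60 * H + 100 \<and> get s' 4 = NatW 8 \<and>
        ready (inp i) (lam + 4 * L) kk pass B gb G t s' \<and> solution s' = solution s \<and> ?OB i (outbox s'))"
    if i: "i < m" and s: "ready (inp i) lam kk pass B gb G t s" "inbox s = inbox (g i)" "outbox s = []" for i s B
  proof -
    have "achieves f c round5 s (\<lambda>u s'. u \<le> 17 * length (inp i) + 3 * m + 25 \<and>
      ready (inp i) (lam + 4 * L) kk pass B gb G t s' \<and> get s' 4 = NatW 8 \<and> solution s' = solution s \<and> ?OB i (outbox s'))"
      by (rule round5[OF s(1) G inp_sub[OF i] s(3)]) (use s L i in auto)
    then show ?thesis unfolding round_nth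
      by (rule achieves_mono) (use inp_H[OF i] mH in auto)
  qed
  have len: "length (collect ob j) \<le> H" if "\<And>i. i < m \<Longrightarrow> ?OB i (ob i)" "j < m" for ob j
    using cands_collect[of G ob] that by force
  have "\<exists>g' ob. step_to g g' \<and> GS 8 (lam + 4 * L) kk pass gb (\<lambda>_. G) t g' \<and> (\<forall>i<m. ?OB i (ob i)) \<and> (\<forall>j<m. inbox (g' j) = collect ob j)"
    by (rule det_transition[where OB = ?OB, OF g _ run _ len]) (use G in simp_all)
  then obtain g' ob where *: "step_to g g'" "GS 8 (lam + 4 * L) kk pass gb (\<lambda>_. G) t g'" "\<And>i. i < m \<Longrightarrow> ?OB i (ob i)" "\<And>j. j < m \<Longrightarrow> inbox (g' j) = collect ob j"
    by blast
  obtain cs where "set cs \<subseteq> E" "aug_value G (set cs) = aug_value G E" "\<forall>j<m. collect ob j = map ItemW cs"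
    using cands_collect[of G ob, OF *(3)] by blast
  then have "cands_in G g'" unfolding cands_in_def using *(4) by (intro exI[of _ cs]) simp
  then show ?thesis using *(1,2) by blast
qed

lemma transition6:
  assumes g: "GS 6 lam kk pass gb (\<lambda>_. G) t g" and t: "0 \<le> t"
    and A: "\<And>i. i < m \<Longrightarrow> inbox (g i) = (if i = 0 then map ItemW A else [])" "set A \<subseteq> E"
    and new: "foldl (ext t) G A = G @ new"
  shows "\<exists>g'. step_to g g' \<and> GS 7 lam kk pass gb (\<lambda>i. if i = 0 then G @ new else G) t g' \<and>
    (\<forall>i<m. inbox (g' i) = (if i = 0 then [] else map ItemW new))"
proof -
  let ?new = "\<lambda>i :: nat. if i = 0 then new else []"
  let ?ob = "\<lambda>i. concat (map (\<lambda>x. map (\<lambda>k. (k, ItemW x)) [1..<m]) (?new i))"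
  let ?OB = "\<lambda>i ob. ob = ?ob i"
  have G: "good_list G" using g m1 by (auto simp: GS_def)
  have lA: "length A \<le> H" using g m1 A(1)[of 0] by (auto simp: GS_def dest!: spec[of _ 0])
  have G': "good_list (G @ new)" using good_list_foldl_ext[OF G t A(2)] new by simp
  \<comment> \<open>This pays for the broadcast by the center: \<open>length new\<close> items, each
    to fewer than \<open>m\<close> machines.\<close>
  have nH: "m * length new \<le> H" using good_list_H[OF G'] by (simp add: algebra_simps)
  have nH': "length new \<le> H" using nH m1 by (metis le_trans mult_le_mono1 nat_mult_1)
  have cn: "concat (map ?new [0..<m]) = new"
  proof -
    have "[0..<m] = 0 # [1..<m]" using m1 by (simp add: upt_conv_Cons)
    moreover have "concat (map ?new [1..<m]) = []" by auto
    ultimately show ?thesis by simp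
  qed
  have col: "collect ob j = (if j = 0 then [] else map ItemW new)" if "\<And>i. i < m \<Longrightarrow> ?OB i (ob i)" "j < m" for ob j
    using collect_cong[of ob ?ob j] collect_others[OF that(2), of ?new] that(1) cn by simp
  have run: "achieves f c (round_programs e tt Z nn ! 6) s (\<lambda>u s'. u \<le> 60 * H + 100 \<and> get s' 4 = NatW 7 \<and>
        ready (inp i) lam kk pass B gb (if i = 0 then G @ new else G) t s' \<and> solution s' = solution s \<and> ?OB i (outbox s'))"
    if i: "i < m" and s: "ready (inp i) lam kk pass B gb G t s" "inbox s = inbox (g i)" "outbox s = []" for i s B
  proof -
    let ?xs = "if i = 0 then A else []"
    have "achieves f c round6 s (\<lambda>u s'. u \<le> 20 * length ?xs + length (?new i) * (3 * m + 5) + 10 \<and>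
      ready (inp i) lam kk pass B gb (G @ ?new i) t s' \<and> get s' 4 = NatW 7 \<and> solution s' = solution s \<and> ?OB i (outbox s'))"
      by (rule round6[OF s(1) G t inp_sub[OF i] _ _ s(3)]) (use s A i new in auto)
    moreover have "20 * length ?xs + length (?new i) * (3 * m + 5) + 10 \<le> 60 * H + 100"
      using lA nH nH' by (simp add: algebra_simps)
    moreover have "G @ ?new i = (if i = 0 then G @ new else G)" by simp
    ultimately show ?thesis unfolding round_nth by (elim achieves_mono) auto
  qed
  have good: "good_list (if i = 0 then G @ new else G)" for i :: nat using G G' by simp
  have "\<exists>g' ob. step_to g g' \<and> GS 7 lam kk pass gb (\<lambda>i. if i = 0 then G @ new else G) t g' \<and> (\<forall>i<m. ?OB i (ob i)) \<and> (\<forall>j<m. inbox (g' j) = collect ob j)"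
    by (rule det_transition[where OB = ?OB and G' = "\<lambda>i. if i = 0 then G @ new else G", OF g _ run]) (use good col nH' in simp_all)
  then obtain g' ob where *: "step_to g g'" "GS 7 lam kk pass gb (\<lambda>i. if i = 0 then G @ new else G) t g'" "\<And>i. i < m \<Longrightarrow> ?OB i (ob i)" "\<And>j. j < m \<Longrightarrow> inbox (g' j) = collect ob j"
    by blast
  show ?thesis using *(1,2,4) col[OF *(3)] by (intro exI[of _ g']) simp
qed

lemma transition7:
  assumes g: "GS 7 lam kk pass gb Gs t g" and t: "0 \<le> t"
    and xs: "\<And>i. i < m \<Longrightarrow> inbox (g i) = map ItemW (xs i)" "\<And>i. i < m \<Longrightarrow> set (xs i) \<subseteq> E"
    and G: "\<And>i. i < m \<Longrightarrow> foldl (ext t) (Gs i) (xs i) = G"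
  shows "\<exists>g'. step_to g g' \<and> GS 8 lam kk pass gb (\<lambda>_. G) t g' \<and> cands_in G g'"
proof -
  let ?OB = "\<lambda>i ob. \<exists>cs. cand G (inp i) cs \<and> ob = to_all cs"
  have Gs: "good_list (Gs i)" "length (xs i) \<le> H" if "i < m" for i using g that xs(1)[OF that] by (auto simp: GS_def dest!: spec[of _ i])
  have gG: "good_list G" using good_list_foldl_ext[OF Gs(1) t xs(2), of 0 0] G[of 0] m1 by simp
  have run: "achieves f c (round_programs e tt Z nn ! 7) s (\<lambda>u s'. u \<le> 60 * H + 100 \<and> get s' 4 = NatW 8 \<and>
        ready (inp i) lam kk pass B gb G t s' \<and> solution s' = solution s \<and> ?OB i (outbox s'))"
    if i: "i < m" and s: "ready (inp i) lam kk pass B gb (Gs i) t s" "inbox s = inbox (g i)" "outbox s = []" for i s B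
  proof -
    have "achieves f c round7 s (\<lambda>u s'. u \<le> 20 * length (xs i) + 17 * length (inp i) + 3 * m + 25 \<and>
      ready (inp i) lam kk pass B gb (foldl (ext t) (Gs i) (xs i)) t s' \<and> get s' 4 = NatW 8 \<and> solution s' = solution s \<and>
      (\<exists>cs. cand (foldl (ext t) (Gs i) (xs i)) (inp i) cs \<and> outbox s' = to_all cs))"
      by (rule round7[OF s(1) Gs(1)[OF i] t inp_sub[OF i] _ _ s(3)]) (use s xs i in auto)
    then show ?thesis unfolding round_nth G[OF i]
      by (rule achieves_mono) (use inp_H[OF i] mH Gs(2)[OF i] in auto)
  qed
  have len: "length (collect ob j) \<le> H" if "\<And>i. i < m \<Longrightarrow> ?OB i (ob i)" "j < m" for ob j
    using cands_collect[of G ob] that by force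
  have "\<exists>g' ob. step_to g g' \<and> GS 8 lam kk pass gb (\<lambda>_. G) t g' \<and> (\<forall>i<m. ?OB i (ob i)) \<and> (\<forall>j<m. inbox (g' j) = collect ob j)"
    by (rule det_transition[where OB = ?OB, OF g _ run _ len]) (use gG in simp_all)
  then obtain g' ob where *: "step_to g g'" "GS 8 lam kk pass gb (\<lambda>_. G) t g'" "\<And>i. i < m \<Longrightarrow> ?OB i (ob i)" "\<And>j. j < m \<Longrightarrow> inbox (g' j) = collect ob j"
    by blast
  obtain cs where "set cs \<subseteq> E" "aug_value G (set cs) = aug_value G E" "\<forall>j<m. collect ob j = map ItemW cs"
    using cands_collect[of G ob, OF *(3)] by blast
  then have "cands_in G g'" unfolding cands_in_def using *(4) by (intro exI[of _ cs]) simp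
  then show ?thesis using *(1,2) by blast
qed

definition S1 :: "'a list \<Rightarrow> (nat \<Rightarrow> 'a machine) set" where
  "S1 D = {g. GS 1 0 0 1 (-1) (\<lambda>_. []) 0 g \<and> (\<forall>i<m. inbox (g i) = map ItemW D \<and> get (g i) 16 = RealW 0)}"

definition S2 :: "real \<Rightarrow> real \<Rightarrow> nat \<Rightarrow> real \<Rightarrow> 'a list \<Rightarrow> real \<Rightarrow> 'a list \<Rightarrow> (nat \<Rightarrow> 'a machine) set" where
  "S2 lam kk pass gb G t D = {g. GS 2 lam kk pass gb (\<lambda>_. G) t g \<and> (\<forall>i<m. inbox (g i) = map ItemW D)}"

abbreviation "start \<equiv> initial_machine m (card E) K inp"

lemma ceil_H: "m * n \<le> H \<Longrightarrow> n * (3 * m + 10) \<le> 13 * H"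
proof -
  assume a: "m * n \<le> H"
  have "1 * n \<le> m * n" using m1 by (rule mult_le_mono1)
  moreover have "n * (3 * m + 10) = 3 * (m * n) + 10 * n" by (simp add: algebra_simps)
  ultimately show ?thesis using a by linarith
qed

lemma transition0:
  shows "\<forall>i<m. runs_within f c prg T Q M (start i)"
    "set_pmf (rnd start) \<subseteq> (\<Union>D\<in>set_pmf (draws (samples (tt * Kt))). S1 D)"
    "measure_pmf.prob (draws (samples (tt * Kt))) S
       \<le> measure_pmf.prob (rnd start) (\<Union>D\<in>S \<inter> set_pmf (draws (samples (tt * Kt))). S1 D)"
proof -
  let ?SOL = "\<lambda>(i::nat) (A::'a set). A = {}" and ?RHO = "\<lambda>w :: 'a word. w = RealW 0"
  have run: "achieves_random f c prg (start i) (draws (draw_lists (tt * Kt) [0..<length (inp i)]))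
      (\<lambda>u is s'. u \<le> 60 * H + 150 \<and> get s' 4 = NatW 1 \<and>
        (\<exists>B. best_ok B (-1) \<and> ready (inp i) 0 0 1 B (-1) [] 0 s') \<and> ?RHO (get s' 16) \<and> ?SOL i (solution s') \<and>
        outbox s' = to_all (map ((!) (inp i)) is))" if i: "i < m" for i
  proof -
    let ?R = "\<lambda>is s'. get s' 4 = NatW 1 \<and>
        (\<exists>B. best_ok B (-1) \<and> ready (inp i) 0 0 1 B (-1) [] 0 s') \<and> ?RHO (get s' 16) \<and> ?SOL i (solution s') \<and>
        outbox s' = to_all (map ((!) (inp i)) is)"
    have g: "get (start i) 4 = NatW 0" "get (start i) 1 = NatW m" "get (start i) 3 = RealW K" "get (start i) 2 = NatW (card E)"
      "tape (start i) = {}" "outbox (start i) = []" "inbox (start i) = map ItemW (inp i)" "solution (start i) = {}"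
      "dom (mem (start i)) \<subseteq> {..<addr_lim}"
      by (auto simp: initial_machine_def get_def)
    have "achieves_random f c prg (start i) (draws (draw_lists (tt * Kt) [0..<length (inp i)])) (\<lambda>u is s'. u \<le> 60 * H + 100 + 25 \<and> ?R is s')"
    proof (rule program_run[OF g(1) _ g(2,3)])
      fix s' assume s': "upd {5,6,7,8,28,45} (start i) s'" "tape s' = tape (start i)" "outbox s' = outbox (start i)" "consts_ok m K s'"
      have "get s' 2 = NatW (card E)" using upd_get[OF s'(1), of 2] g by simp
      moreover have "dom (mem s') \<subseteq> {..<addr_lim}" using s'(1) g(9) by (simp add: upd_def)
      moreover have "best_ok [] (-1)" using capacity_pos by (simp add: best_ok_def feasible_def)
      moreover have "nat \<lceil>tt * Kt\<rceil> * (3 * m + 10) \<le> 13 * H" by (rule ceil_H[OF LH])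
      ultimately show "achieves_random f c (round_programs e tt Z nn ! 0) s' (draws (draw_lists (tt * Kt) [0..<length (inp i)]))
          (\<lambda>u is s'. u \<le> 60 * H + 100 \<and> ?R is s')"
        unfolding round_nth
        by (intro achieves_random_mono[OF round0[where X = "inp i", OF s'(4)]])
          (use s' g inp_H[OF i] upd_same[OF s'(1)] in auto)
    qed simp
    then show ?thesis by (rule achieves_random_mono) auto
  qed
  have q: "queries (start i) = 0" "load (start i) \<le> 3 * H" if "i < m" for i
    using inp_H[OF that] by (auto simp: initial_machine_def load_def)
  note rt = random_transition[where SOL = ?SOL and RHO = ?RHO and g = start, OF run q _ good_list_Nil LH]
  show "\<forall>i<m. runs_within f c prg T Q M (start i)" by (rule rt(1)) auto
  have sub: "{g'. GS 1 0 0 1 (- 1) (\<lambda>_. []) 0 g' \<and> (\<forall>i<m. solution (g' i) = {} \<and> inbox (g' i) = map ItemW D \<and> get (g' i) 16 = RealW 0)} \<subseteq> S1 D" for D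
    by (auto simp: S1_def)
  show "set_pmf (rnd start) \<subseteq> (\<Union>D\<in>set_pmf (draws (samples (tt * Kt))). S1 D)"
    by (rule order.trans[OF rt(2)]) (use sub in \<open>fastforce simp: S1_def\<close>)+
  show "measure_pmf.prob (draws (samples (tt * Kt))) S
       \<le> measure_pmf.prob (rnd start) (\<Union>D\<in>S \<inter> set_pmf (draws (samples (tt * Kt))). S1 D)"
    by (rule order.trans[OF rt(3) measure_pmf.finite_measure_mono]) (use sub in \<open>fastforce simp: S1_def\<close>)+
qed

lemma transition1:
  assumes g: "g \<in> S1 D" and D: "set D \<subseteq> E"
  defines "L \<equiv> estimate D"
  shows "\<forall>i<m. runs_within f c prg T Q M (g i)"
    "set_pmf (rnd g) \<subseteq> (\<Union>D\<in>set_pmf (draws (samples Kt)). S2 (12 * L) 0 1 (-1) [] (8 * L / K) D)"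
    "measure_pmf.prob (draws (samples Kt)) S
       \<le> measure_pmf.prob (rnd g) (\<Union>D\<in>S \<inter> set_pmf (draws (samples Kt)). S2 (12 * L) 0 1 (-1) [] (8 * L / K) D)"
proof -
  have gs: "GS 1 0 0 1 (-1) (\<lambda>_. []) 0 g" and ib: "\<And>i. i < m \<Longrightarrow> inbox (g i) = map ItemW D \<and> get (g i) 16 = RealW 0"
    using g by (auto simp: S1_def)
  have lD: "length D \<le> H" using gs ib m1 by (auto simp: GS_def dest!: spec[of _ 0])
  let ?SOL = "\<lambda>i A. A = solution (g i)" and ?RHO = "\<lambda>w :: 'a word. True"
  have run: "achieves_random f c prg (g i) (draws (draw_lists Kt [0..<length (inp i)]))
      (\<lambda>u is s'. u \<le> 60 * H + 150 \<and> get s' 4 = NatW 2 \<and>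
        (\<exists>B. best_ok B (-1) \<and> ready (inp i) (12 * L) 0 1 B (-1) [] (8 * L / K) s') \<and> ?RHO (get s' 16) \<and> ?SOL i (solution s') \<and>
        outbox s' = to_all (map ((!) (inp i)) is))" if i: "i < m" for i
  proof -
    let ?R = "\<lambda>is s'. get s' 4 = NatW 2 \<and>
        (\<exists>B. best_ok B (-1) \<and> ready (inp i) (12 * L) 0 1 B (-1) [] (8 * L / K) s') \<and> ?RHO (get s' 16) \<and> ?SOL i (solution s') \<and>
        outbox s' = to_all (map ((!) (inp i)) is)"
    obtain B where B: "best_ok B (-1)" "ready (inp i) 0 0 1 B (-1) [] 0 (g i)" using gs i by (auto simp: GS_def)
    have "achieves_random f c prg (g i) (draws (draw_lists Kt [0..<length (inp i)])) (\<lambda>u is s'. u \<le> 60 * H + 100 + 25 \<and> ?R is s')"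
    proof (rule program_run_ready[OF B(2)])
      show "get (g i) 4 = NatW 1" using gs i by (auto simp: GS_def)
      fix s' assume s': "ready (inp i) 0 0 1 B (- 1) [] 0 s'" "get s' 16 = get (g i) 16" "inbox s' = inbox (g i)"
        "outbox s' = outbox (g i)" "solution s' = solution (g i)"
      have "outbox (g i) = []" using gs i by (auto simp: GS_def)
      moreover have "nat \<lceil>Kt\<rceil> * (3 * m + 10) \<le> 13 * H" by (rule ceil_H[OF BH])
      ultimately show "achieves_random f c (round_programs e tt Z nn ! 1) s' (draws (draw_lists Kt [0..<length (inp i)]))
          (\<lambda>u is s'. u \<le> 60 * H + 100 \<and> ?R is s')"
        unfolding round_nth
        by (intro achieves_random_mono[OF round1[where xs = D, OF s'(1)]])
          (use s' ib[OF i] D lD B in \<open>auto simp: L_def\<close>)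
    qed simp
    then show ?thesis by (rule achieves_random_mono) auto
  qed
  have q: "queries (g i) = 0" "load (g i) \<le> 3 * H" if "i < m" for i
    using gs that ready_load by (auto simp: GS_def)
  have sol: "card A \<le> H \<and> (0 \<le> nn \<longrightarrow> A = {})" if "i < m" "?SOL i A" for i A using gs that by (auto simp: GS_def)
  note rt = random_transition[where SOL = ?SOL and RHO = ?RHO and g = g, OF run q sol good_list_Nil BH]
  show "\<forall>i<m. runs_within f c prg T Q M (g i)" by (rule rt(1))
  show "set_pmf (rnd g) \<subseteq> (\<Union>D\<in>set_pmf (draws (samples Kt)). S2 (12 * L) 0 1 (-1) [] (8 * L / K) D)"
    by (rule order.trans[OF rt(2)]) (auto simp: S2_def)
  show "measure_pmf.prob (draws (samples Kt)) S
       \<le> measure_pmf.prob (rnd g) (\<Union>D\<in>S \<inter> set_pmf (draws (samples Kt)). S2 (12 * L) 0 1 (-1) [] (8 * L / K) D)"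
    by (rule order.trans[OF rt(3) measure_pmf.finite_measure_mono]) (auto simp: S2_def)
qed

definition S8 :: "real \<Rightarrow> real \<Rightarrow> nat \<Rightarrow> real \<Rightarrow> 'a list \<Rightarrow> real \<Rightarrow> (nat \<Rightarrow> 'a machine) set" where
  "S8 lam kk pass gb G t = {g. GS 8 lam kk pass gb (\<lambda>_. G) t g \<and> cands_in G g}"

text \<open>In the last conclusion the solution is exactly \<open>set B\<close> because
  \<open>GS\<close> keeps it empty as long as \<open>kk \<le> nn\<close>; nothing was written
  before.\<close>

lemma transition8:
  assumes g: "g \<in> S8 lam kk pass gb G t"
  defines "gb' \<equiv> max gb (aug_value G E)"
  defines "lam' \<equiv> if kk = 0 then lam + gb' else lam"
  defines "kk' \<equiv> if pass = 1 then kk + 1 else kk" and "pass' \<equiv> if pass = 1 then 0 else 1 :: nat"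
    and "G' \<equiv> if pass = 1 then [] else G"
    and "t' \<equiv> if pass = 1 then lam' / (2 * e * K * (kk + 1)) else 4 * e * t"
  shows "\<forall>i<m. runs_within f c prg T Q M (g i)"
    "set_pmf (rnd g) \<subseteq> (\<Union>D\<in>set_pmf (draws (samples Kt)). S2 lam' kk' pass' gb' G' t' D)"
    "measure_pmf.prob (draws (samples Kt)) S
       \<le> measure_pmf.prob (rnd g) (\<Union>D\<in>S \<inter> set_pmf (draws (samples Kt)). S2 lam' kk' pass' gb' G' t' D)"
    "pass = 1 \<Longrightarrow> kk = nn \<Longrightarrow> g' \<in> set_pmf (rnd g) \<Longrightarrow> \<exists>B. best_ok B gb' \<and> solution (g' 0) = set B"
proof -
  have gs: "GS 8 lam kk pass gb (\<lambda>_. G) t g" and ci: "cands_in G g" using g by (auto simp: S8_def)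
  obtain cs where cs: "set cs \<subseteq> E" "aug_value G (set cs) = aug_value G E" "\<And>i. i < m \<Longrightarrow> inbox (g i) = map ItemW cs"
    using ci by (auto simp: cands_in_def)
  have lcs: "length cs \<le> H" using gs cs(3) m1 by (auto simp: GS_def dest!: spec[of _ 0])
  have G: "good_list G" using gs m1 by (auto simp: GS_def)
  let ?SOL = "\<lambda>i A. if pass = 1 \<and> kk = nn then \<exists>B. best_ok B gb' \<and> A = solution (g i) \<union> set B else A = solution (g i)"
    and ?RHO = "\<lambda>w :: 'a word. True"
  have run: "achieves_random f c prg (g i) (draws (draw_lists Kt [0..<length (inp i)]))
      (\<lambda>u is s'. u \<le> 60 * H + 150 \<and> get s' 4 = NatW 2 \<and>
        (\<exists>B. best_ok B gb' \<and> ready (inp i) lam' kk' pass' B gb' G' t' s') \<and> ?RHO (get s' 16) \<and> ?SOL i (solution s') \<and>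
        outbox s' = to_all (map ((!) (inp i)) is))" if i: "i < m" for i
  proof -
    let ?R = "\<lambda>is s'. get s' 4 = NatW 2 \<and>
        (\<exists>B. best_ok B gb' \<and> ready (inp i) lam' kk' pass' B gb' G' t' s') \<and> ?RHO (get s' 16) \<and> ?SOL i (solution s') \<and>
        outbox s' = to_all (map ((!) (inp i)) is)"
    obtain B where B: "best_ok B gb" "ready (inp i) lam kk pass B gb G t (g i)" using gs i by (auto simp: GS_def)
    have "achieves_random f c prg (g i) (draws (draw_lists Kt [0..<length (inp i)])) (\<lambda>u is s'. u \<le> 60 * H + 100 + 25 \<and> ?R is s')"
    proof (rule program_run_ready[OF B(2)])
      show "get (g i) 4 = NatW 8" using gs i by (auto simp: GS_def)
      fix s' assume s': "ready (inp i) lam kk pass B gb G t s'" "get s' 16 = get (g i) 16" "inbox s' = inbox (g i)"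
        "outbox s' = outbox (g i)" "solution s' = solution (g i)"
      have o: "outbox s' = []" "inbox s' = map ItemW cs" using gs i s' cs by (auto simp: GS_def)
      have b: "nat \<lceil>Kt\<rceil> * (3 * m + 10) \<le> 13 * H" by (rule ceil_H[OF BH])
      show "achieves_random f c (round_programs e tt Z nn ! 8) s' (draws (draw_lists Kt [0..<length (inp i)]))
          (\<lambda>u is s'. u \<le> 60 * H + 100 \<and> ?R is s')"
        unfolding round_nth
      proof (rule achieves_random_mono[OF round8[OF s'(1) o(1) G o(2) cs(1) B(1)]], elim conjE exE)
        fix u :: nat and "is" s'' B'
        assume u: "u \<le> 17 * length cs + 13 * H + nat \<lceil>Kt\<rceil> * (3 * m + 10) + 60"
          and r: "get s'' 4 = NatW 2" "outbox s'' = to_all (map ((!) (inp i)) is)"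
            "best_ok B' (max gb (aug_value G (set cs)))"
            "solution s'' = solution s' \<union> (if pass = 1 \<and> kk = nn then set B' else {})"
            "if pass = 1 then ready (inp i) (if kk = 0 then lam + max gb (aug_value G (set cs)) else lam) (kk + 1) 0 B' (max gb (aug_value G (set cs))) []
                ((if kk = 0 then lam + max gb (aug_value G (set cs)) else lam) / (2 * e * K * (kk + 1))) s''
             else ready (inp i) (if kk = 0 then lam + max gb (aug_value G (set cs)) else lam) kk 1 B' (max gb (aug_value G (set cs))) G (4 * e * t) s''"
        have B': "best_ok B' gb'" using r(3) cs(2) by (simp add: gb'_def)
        have rd: "ready (inp i) lam' kk' pass' B' gb' G' t' s''"
          using r(5) cs(2) by (simp add: gb'_def lam'_def kk'_def pass'_def G'_def t'_def split: if_splits)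
        have "?SOL i (solution s'')" using r(4) B' s'(5) by auto
        then show "u \<le> 60 * H + 100 \<and> ?R is s''" using u b lcs r(1,2) B' rd by auto
      qed
    qed simp
    then show ?thesis by (rule achieves_random_mono) auto
  qed
  have q: "queries (g i) = 0" "load (g i) \<le> 3 * H" if "i < m" for i
    using gs that ready_load by (auto simp: GS_def)
  have sol: "card A \<le> H \<and> (kk' \<le> nn \<longrightarrow> A = {})" if i: "i < m" "?SOL i A" for i A
  proof (cases "pass = 1 \<and> kk = nn")
    case True
    then obtain B where B: "best_ok B gb'" "A = solution (g i) \<union> set B" using i by auto
    have "solution (g i) = {}" using gs i True by (auto simp: GS_def)
    then have "card A \<le> H" using B card_length[of B] by (simp add: best_ok_def)
    then show ?thesis using True by (simp add: kk'_def)
  next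
    case False
    then have "A = solution (g i)" using i by auto
    then show ?thesis using gs i by (auto simp: GS_def kk'_def)
  qed
  have G': "good_list G'" using G by (simp add: G'_def)
  let ?Y = "\<lambda>D. {g'. GS 2 lam' kk' pass' gb' (\<lambda>_. G') t' g' \<and> (\<forall>i<m. ?SOL i (solution (g' i)) \<and> inbox (g' i) = map ItemW D \<and> ?RHO (get (g' i) 16))}"
  note rt = random_transition[where SOL = ?SOL and RHO = ?RHO and g = g, OF run q _ G' BH]
  show "\<forall>i<m. runs_within f c prg T Q M (g i)" by (rule rt(1)) (assumption, assumption, assumption, rule sol)
  have rt2: "set_pmf (rnd g) \<subseteq> (\<Union>D\<in>set_pmf (draws (samples Kt)). ?Y D)" by (rule rt(2)) (assumption, assumption, assumption, rule sol)
  have rt3: "measure_pmf.prob (draws (samples Kt)) S \<le> measure_pmf.prob (rnd g) (\<Union>D\<in>S \<inter> set_pmf (draws (samples Kt)). ?Y D)"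
    by (rule rt(3)) (assumption, assumption, assumption, rule sol)
  have sub: "?Y D \<subseteq> S2 lam' kk' pass' gb' G' t' D" for D unfolding S2_def by blast
  show "set_pmf (rnd g) \<subseteq> (\<Union>D\<in>set_pmf (draws (samples Kt)). S2 lam' kk' pass' gb' G' t' D)"
    by (rule order.trans[OF rt2]) (rule UN_mono[OF order.refl sub])
  show "measure_pmf.prob (draws (samples Kt)) S
       \<le> measure_pmf.prob (rnd g) (\<Union>D\<in>S \<inter> set_pmf (draws (samples Kt)). S2 lam' kk' pass' gb' G' t' D)"
    by (rule order.trans[OF rt3 measure_pmf.finite_measure_mono]) (rule UN_mono[OF order.refl sub], simp)
  assume p: "pass = 1" "kk = nn" and g': "g' \<in> set_pmf (rnd g)"
  have "0 < m" using m1 by simp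
  then have "?SOL 0 (solution (g' 0))" using subsetD[OF rt2 g'] by blast
  then obtain B where B: "best_ok B gb'" "solution (g' 0) = solution (g 0) \<union> set B" using p by auto
  moreover have "solution (g 0) = {}" using gs m1 p by (auto simp: GS_def)
  ultimately show "\<exists>B. best_ok B gb' \<and> solution (g' 0) = set B" by auto
qed

section \<open>Composition of rounds and reachable states\<close>

abbreviation "rs \<equiv> mpc_rounds f c prg T m"

lemma rs_add: "rs (r + s) g = bind_pmf (rs r g) (rs s)"
  by (induction s) (simp_all add: bind_return_pmf' bind_assoc_pmf)

lemma rs_front: "rs (Suc r) g = bind_pmf (rnd g) (rs r)"
  using rs_add[of 1 r g] by (simp add: bind_return_pmf)

lemma rs_step_to: "step_to g g' \<Longrightarrow> rs (Suc r) g = rs r g'"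
  by (simp add: rs_front step_to_def bind_return_pmf del: mpc_rounds.simps)

lemma max_feasible: "feasible E c K S \<Longrightarrow> f S \<le> f E"
  by (rule monotone) (use items_subset in \<open>auto simp: feasible_def\<close>)

lemma estimate_nonneg: "set A \<subseteq> E \<Longrightarrow> 0 \<le> estimate A"
  using estimate_bounds(1)[of A "f E"] max_feasible by blast

text \<open>What the center actually receives: on overflow this is nothing at all, rather than the
  acceptable items.\<close>

definition survivors :: "'a list \<Rightarrow> real \<Rightarrow> 'a list" where
  "survivors G t = (if cap < real (\<Sum>i<m. length (filter (acc t G) (inp i))) then []
     else concat (map (\<lambda>i. filter (acc t G) (inp i)) [0..<m]))"

lemma survivors_E: "set (survivors G t) \<subseteq> E"
  using subsetD[OF inp_sub] by (auto simp: survivors_def)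

definition ok :: "real \<Rightarrow> real \<Rightarrow> real \<Rightarrow> bool" where
  "ok lam kk t \<longleftrightarrow> 0 \<le> lam \<and> 0 \<le> kk \<and> 0 \<le> t"

definition S3 where "S3 lam kk pass gb G t = {g. GS 3 lam kk pass gb (\<lambda>_. G) t g \<and>
    (\<forall>i<m. inbox (g i) = map NatW (map (\<lambda>i. length (filter (acc t G) (inp i))) [0..<m]))}"
definition S46 where "S46 pc lam kk pass gb G t A = {g. GS pc lam kk pass gb (\<lambda>_. G) t g \<and>
    (\<forall>i<m. inbox (g i) = (if i = 0 then map ItemW A else []))}"
definition S5 where "S5 lam kk pass gb G t L = {g. GS 5 lam kk pass gb (\<lambda>_. G) t g \<and>
    (\<forall>i<m. inbox (g i) \<noteq> [] \<and> inbox (g i) ! 0 = RealW L)}"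
definition S7 where "S7 lam kk pass gb G t new = {g. GS 7 lam kk pass gb (\<lambda>i. if i = 0 then G @ new else G) t g \<and>
    (\<forall>i<m. inbox (g i) = (if i = 0 then [] else map ItemW new)) \<and> foldl (ext t) G new = G @ new}"

lemma step2:
  assumes "g \<in> S2 lam kk pass gb G t D" "0 \<le> t" "set D \<subseteq> E"
  shows "\<exists>g'\<in>S3 lam kk pass gb (foldl (ext t) G D) t. step_to g g'"
  using transition2[of lam kk pass gb G t g D] assms by (auto simp: S2_def S3_def)

lemma step3:
  assumes "g \<in> S3 lam kk pass gb G t"
  shows "\<exists>g'\<in>S46 (if kk = 0 then 4 else 6) lam kk pass gb G t (survivors G t). step_to g g'"
  using transition3[of lam kk pass gb G t g] assms by (auto simp: S3_def S46_def survivors_def)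

lemma step4:
  assumes "g \<in> S46 4 lam kk pass gb G t A" "set A \<subseteq> E"
  shows "\<exists>g'\<in>S5 lam kk pass gb [] 0 (estimate A). step_to g g'"
  using transition4[of lam kk pass gb G t g A] assms by (auto simp: S46_def S5_def)

lemma step5:
  assumes "g \<in> S5 lam kk pass gb G t L"
  shows "\<exists>g'\<in>S8 (lam + 4 * L) kk pass gb G t. step_to g g'"
  using transition5[of lam kk pass gb G t g L] assms by (auto simp: S5_def S8_def)

lemma step6:
  assumes "g \<in> S46 6 lam kk pass gb G t A" "set A \<subseteq> E" "0 \<le> t" "foldl (ext t) G A = G @ new"
  shows "\<exists>g'\<in>S7 lam kk pass gb G t new. step_to g g'"
  using transition6[of lam kk pass gb G t g A new] foldl_ext_replay[OF assms(4)] assms by (auto simp: S46_def S7_def)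

text \<open>The lists agree again after this round: the center has an empty inbox and keeps its
  list, the others accept all of \<open>new\<close> by the replay property recorded in
  \<open>S7\<close>.\<close>

lemma step7:
  assumes g: "g \<in> S7 lam kk pass gb G t new" and t: "0 \<le> t"
  shows "\<exists>g'\<in>S8 lam kk pass gb (G @ new) t. step_to g g'"
proof -
  have "good_list (G @ new)" using g m1 by (auto simp: S7_def GS_def dest!: spec[of _ 0])
  then have "set new \<subseteq> E" by (auto simp: good_list_def)
  then have "\<exists>g'. step_to g g' \<and> GS 8 lam kk pass gb (\<lambda>_. G @ new) t g' \<and> cands_in (G @ new) g'"
    by (intro transition7[where Gs = "\<lambda>i. if i = 0 then G @ new else G" and xs = "\<lambda>i. if i = 0 then [] else new"])
      (use g t in \<open>auto simp: S7_def\<close>)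
  then show ?thesis by (auto simp: S8_def)
qed

definition final_set :: "'a list \<Rightarrow> real \<Rightarrow> 'a list \<Rightarrow> 'a list" where
  "final_set G t D = foldl (ext t) (foldl (ext t) G D) (survivors (foldl (ext t) G D) t)"

text \<open>The randomness of a saturation lies entirely in the draw made before it. Once the sample
  \<open>D\<close> is delivered, rounds 2, 3, 6 and 7 are deterministic and collapse to a single
  final state.\<close>

lemma phase:
  assumes g: "g \<in> S2 lam kk pass gb G t D" and t: "0 \<le> t" and D: "set D \<subseteq> E" and kk: "kk \<noteq> 0"
  shows "\<exists>g'\<in>S8 lam kk pass gb (final_set G t D) t. rs 4 g = return_pmf g'"
proof -
  let ?G = "foldl (ext t) G D"
  obtain g1 where g1: "g1 \<in> S3 lam kk pass gb ?G t" "step_to g g1" using step2[OF g t D] by blast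
  obtain g2 where g2: "g2 \<in> S46 6 lam kk pass gb ?G t (survivors ?G t)" "step_to g1 g2" using step3[OF g1(1)] kk by auto
  obtain new where new: "foldl (ext t) ?G (survivors ?G t) = ?G @ new" using foldl_ext_prefix by blast
  obtain g3 where g3: "g3 \<in> S7 lam kk pass gb ?G t new" "step_to g2 g3" using step6[OF g2(1) survivors_E t new] by blast
  obtain g4 where g4: "g4 \<in> S8 lam kk pass gb (?G @ new) t" "step_to g3 g4" using step7[OF g3(1) t] by blast
  have "rs 4 g = return_pmf g4"
    using rs_step_to[OF g1(2), of 3] rs_step_to[OF g2(2), of 2] rs_step_to[OF g3(2), of 1] rs_step_to[OF g4(2), of 0]
    by (simp add: numeral_eq_Suc)
  then show ?thesis using g4(1) new by (auto simp: final_set_def)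
qed

lemma estimate_phase:
  assumes g: "g \<in> S2 lam 0 pass gb G t D" and t: "0 \<le> t" and D: "set D \<subseteq> E"
  shows "\<exists>g'\<in>S8 (lam + 4 * estimate (survivors (foldl (ext t) G D) t)) 0 pass gb [] 0. rs 4 g = return_pmf g'"
proof -
  let ?G = "foldl (ext t) G D"
  obtain g1 where g1: "g1 \<in> S3 lam 0 pass gb ?G t" "step_to g g1" using step2[OF g t D] by blast
  obtain g2 where g2: "g2 \<in> S46 4 lam 0 pass gb ?G t (survivors ?G t)" "step_to g1 g2" using step3[OF g1(1)] by auto
  obtain g3 where g3: "g3 \<in> S5 lam 0 pass gb [] 0 (estimate (survivors ?G t))" "step_to g2 g3"
    using step4[OF g2(1) survivors_E] by blast
  obtain g4 where g4: "g4 \<in> S8 (lam + 4 * estimate (survivors ?G t)) 0 pass gb [] 0" "step_to g3 g4" using step5[OF g3(1)] by blast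
  have "rs 4 g = return_pmf g4"
    using rs_step_to[OF g1(2), of 3] rs_step_to[OF g2(2), of 2] rs_step_to[OF g3(2), of 1] rs_step_to[OF g4(2), of 0]
    by (simp add: numeral_eq_Suc)
  then show ?thesis using g4(1) by blast
qed

text \<open>A set of states closed under rounds whatever the samples are. Overflowing and otherwise
  unlucky draws are included, since the resource bounds have to hold surely; \<open>ok\<close>
  provides the non-negative thresholds on which the greedy lemmas rely.\<close>

definition reachable :: "(nat \<Rightarrow> 'a machine) \<Rightarrow> bool" where
  "reachable g \<longleftrightarrow> g = start \<or> (\<exists>D. set D \<subseteq> E \<and> g \<in> S1 D) \<or>
     (\<exists>lam kk pass gb G t. ok lam kk t \<and>
        ((\<exists>D. set D \<subseteq> E \<and> g \<in> S2 lam kk pass gb G t D) \<or> g \<in> S3 lam kk pass gb G t \<or>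
         (\<exists>A. set A \<subseteq> E \<and> (g \<in> S46 4 lam kk pass gb G t A \<or> g \<in> S46 6 lam kk pass gb G t A)) \<or>
         (\<exists>L. 0 \<le> L \<and> g \<in> S5 lam kk pass gb G t L) \<or> (\<exists>new. g \<in> S7 lam kk pass gb G t new) \<or>
         g \<in> S8 lam kk pass gb G t))"

lemma aug_value_nonneg: "set G \<subseteq> E \<Longrightarrow> 0 \<le> aug_value G E"
  using aug_value_ge(1)[of G] nonneg[of "set G"] items_subset by fastforce

lemma reachable_draws:
  assumes "ok lam kk t" "g \<in> (\<Union>D\<in>set_pmf (draws (samples l)). S2 lam kk pass gb G t D)"
  shows "reachable g"
proof -
  obtain D where D: "D \<in> set_pmf (draws (samples l))" "g \<in> S2 lam kk pass gb G t D" using assms(2) by blast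
  then show ?thesis using draws_samples(1)[OF D(1)] assms(1) unfolding reachable_def by blast
qed

lemma reachable_step:
  assumes "reachable g"
  shows "(\<forall>i<m. runs_within f c prg T Q M (g i)) \<and> (\<forall>g'\<in>set_pmf (rnd g). reachable g')"
proof -
  have det: ?thesis if "\<exists>g'\<in>S. step_to g g'" "\<And>g'. g' \<in> S \<Longrightarrow> reachable g'" for S
    using that by (auto simp: step_to_def)
  consider "g = start" | D where "set D \<subseteq> E" "g \<in> S1 D"
    | lam kk pass gb G t D where "ok lam kk t" "set D \<subseteq> E" "g \<in> S2 lam kk pass gb G t D"
    | lam kk pass gb G t where "ok lam kk t" "g \<in> S3 lam kk pass gb G t"
    | lam kk pass gb G t A where "ok lam kk t" "set A \<subseteq> E" "g \<in> S46 4 lam kk pass gb G t A"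
    | lam kk pass gb G t A where "ok lam kk t" "set A \<subseteq> E" "g \<in> S46 6 lam kk pass gb G t A"
    | lam kk pass gb G t L where "ok lam kk t" "0 \<le> L" "g \<in> S5 lam kk pass gb G t L"
    | lam kk pass gb G t new where "ok lam kk t" "g \<in> S7 lam kk pass gb G t new"
    | lam kk pass gb G t where "ok lam kk t" "g \<in> S8 lam kk pass gb G t"
    using assms unfolding reachable_def by (elim disjE exE conjE) blast+
  then show ?thesis
  proof cases
    case 1
    have "reachable g'" if g': "g' \<in> set_pmf (rnd start)" for g'
    proof -
      obtain D where D: "D \<in> set_pmf (draws (samples (tt * Kt)))" "g' \<in> S1 D"
        using subsetD[OF transition0(2) g'] by blast
      then show ?thesis using draws_samples(1)[OF D(1)] unfolding reachable_def by blast
    qed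
    then show ?thesis using transition0(1) 1 by blast
  next
    case (2 D)
    have L: "0 \<le> estimate D" using estimate_nonneg 2 by blast
    have "ok (12 * estimate D) 0 (8 * estimate D / K)" using L capacity_pos by (simp add: ok_def)
    then have "reachable g'" if "g' \<in> set_pmf (rnd g)" for g'
      using reachable_draws[OF _ subsetD[OF transition1(2)[OF 2(2,1)] that]] by blast
    then show ?thesis using transition1(1)[OF 2(2,1)] by blast
  next
    case (3 lam kk pass gb G t D)
    show ?thesis by (rule det[OF step2[OF 3(3) _ 3(2)]]) (use 3(1) in \<open>auto simp: reachable_def ok_def\<close>)
  next
    case (4 lam kk pass gb G t)
    have "reachable g'" if "g' \<in> S46 (if kk = 0 then 4 else 6) lam kk pass gb G t (survivors G t)" for g'
      using that 4(1) survivors_E[of G t] unfolding reachable_def by (auto split: if_splits)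
    then show ?thesis by (rule det[OF step3[OF 4(2)]])
  next
    case (5 lam kk pass gb G t A)
    have "ok lam kk 0" using 5(1) by (simp add: ok_def)
    then have "reachable g'" if "g' \<in> S5 lam kk pass gb [] 0 (estimate A)" for g'
      using that estimate_nonneg[OF 5(2)] unfolding reachable_def by blast
    then show ?thesis by (rule det[OF step4[OF 5(3,2)]])
  next
    case (6 lam kk pass gb G t A)
    obtain new where new: "foldl (ext t) G A = G @ new" using foldl_ext_prefix by blast
    have "0 \<le> t" using 6(1) by (simp add: ok_def)
    moreover have "reachable g'" if "g' \<in> S7 lam kk pass gb G t new" for g' using that 6(1) unfolding reachable_def by blast
    ultimately show ?thesis by (intro det[OF step6[OF 6(3,2) _ new]])
  next
    case (7 lam kk pass gb G t L)
    have "ok (lam + 4 * L) kk t" using 7(1,2) by (simp add: ok_def)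
    then have "reachable g'" if "g' \<in> S8 (lam + 4 * L) kk pass gb G t" for g' using that unfolding reachable_def by blast
    then show ?thesis by (rule det[OF step5[OF 7(3)]])
  next
    case (8 lam kk pass gb G t new)
    have "reachable g'" if "g' \<in> S8 lam kk pass gb (G @ new) t" for g' using that 8(1) unfolding reachable_def by blast
    moreover have "0 \<le> t" using 8(1) by (simp add: ok_def)
    ultimately show ?thesis by (intro det[OF step7[OF 8(2)]])
  next
    case (9 lam kk pass gb G t)
    have "good_list G" using 9(2) m1 by (auto simp: S8_def GS_def)
    then have "0 \<le> aug_value G E" by (intro aug_value_nonneg) (simp add: good_list_def)
    then have "ok (if kk = 0 then lam + max gb (aug_value G E) else lam) (if pass = 1 then kk + 1 else kk)
      (if pass = 1 then (if kk = 0 then lam + max gb (aug_value G E) else lam) / (2 * e * K * (kk + 1)) else 4 * e * t)"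
      using 9(1) e0 capacity_pos by (auto simp: ok_def intro!: divide_nonneg_nonneg mult_nonneg_nonneg add_nonneg_nonneg)
    then have "reachable g'" if "g' \<in> set_pmf (rnd g)" for g'
      using reachable_draws[OF _ subsetD[OF transition8(2)[OF 9(2)] that]] by blast
    then show ?thesis using transition8(1)[OF 9(2)] by blast
  qed
qed

lemma within: "mpc_within f c prg T Q M m R start"
proof -
  have "reachable g" if "g \<in> set_pmf (rs r start)" for r g
    using that
  proof (induction r arbitrary: g)
    case 0
    then show ?case by (simp add: reachable_def)
  next
    case (Suc r)
    then show ?case using reachable_step by auto
  qed
  then show ?thesis using reachable_step by (auto simp: mpc_within_def)
qed

end

section \<open>The probability of success\<close>

text \<open>\<open>inp_cap\<close> turns Markov's inequality into a failure probability of
  \<open>d\<close>. The \<open>T0\<close> ordinary samples inside the large one raise the chance of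
  reaching a quantile from \<open>d\<close> to \<open>1 - d\<close>. The bound \<open>98 / e\<close>
  is the number \<open>2 * 49 / e\<close> of guesses for an estimate within a factor of 49.\<close>

locale mpc_analysis = mpc_system U E c K f m H e tt Z nn inp T Q M
  for U E :: "'a set" and c :: "'a \<Rightarrow> real" and K :: real and f :: "'a set \<Rightarrow> real" and m H :: nat
    and e tt Z nn :: real and inp :: "nat \<Rightarrow> 'a list" and T Q M :: nat +
  fixes d :: real and T0 N :: nat
  assumes d: "0 < d" "d \<le> 1" and T0: "(1 - d) ^ T0 \<le> d" "T0 * nat \<lceil>Kt\<rceil> \<le> nat \<lceil>tt * Kt\<rceil>"
    and inp_cap: "\<And>i. i < m \<Longrightarrow> real (length (inp i)) \<le> d * cap" and cap0: "0 < cap"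
    and e: "0 < e" "e \<le> 1/4" and nn: "nn = real N" "98 / e \<le> real N"
begin

definition good_draw :: "'a list \<Rightarrow> real \<Rightarrow> 'a list \<Rightarrow> bool" where
  "good_draw G t D \<longleftrightarrow> \<not> cap < real (\<Sum>i<m. length (filter (acc t (foldl (ext t) G D)) (inp i)))"

lemma prob_good_draw:
  assumes "good_list G" "0 \<le> t"
  shows "1 - d \<le> measure_pmf.prob (draws (samples Kt)) {D. good_draw G t D}"
proof -
  have B: "0 < nat \<lceil>Kt\<rceil>" "Kt \<le> real (nat \<lceil>Kt\<rceil>)" using Ktilde_ge_1 by linarith+
  have "measure_pmf.prob (draws (samples Kt))
      {D. cap < (\<Sum>i<m. real (length (filter (acc t (foldl (ext t) G D)) (inp i))))} \<le> d * cap / cap"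
    using survivors_Markov[OF assms(2,1) inp_sub inp_cap _ B cap0] d cap0
    by (simp add: draw_lists_def)
  also have "d * cap / cap = d" using cap0 by (metis nonzero_mult_div_cancel_right less_irrefl)
  also have "{D. cap < (\<Sum>i<m. real (length (filter (acc t (foldl (ext t) G D)) (inp i))))} = - {D. good_draw G t D}"
    by (auto simp: good_draw_def)
  finally have "measure_pmf.prob (draws (samples Kt)) (- {D. good_draw G t D}) \<le> d" .
  then show ?thesis using measure_pmf.prob_compl[of "{D. good_draw G t D}" "draws (samples Kt)"]
    by (simp add: Compl_eq_Diff_UNIV)
qed

text \<open>The list is good and dense for every sample. Only saturation depends on the survivors
  having been delivered, which is what \<open>good_draw\<close> states.\<close>

lemma good_draw_final:
  assumes G: "good_list G" "0 \<le> t" "set D \<subseteq> E"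
  shows "good_list (final_set G t D)"
    "f (set G) + t * (cost (final_set G t D) - cost G) \<le> f (set (final_set G t D))"
    "good_draw G t D \<Longrightarrow> saturated t (final_set G t D)"
proof -
  let ?G = "foldl (ext t) G D"
  have G': "good_list ?G" by (rule good_list_foldl_ext[OF G])
  show "good_list (final_set G t D)" unfolding final_set_def by (rule good_list_foldl_ext[OF G' G(2) survivors_E])
  have "f (set ?G) \<ge> f (set G) + t * (cost ?G - cost G)" by (rule foldl_ext_value[OF G])
  moreover have "f (set (final_set G t D)) \<ge> f (set ?G) + t * (cost (final_set G t D) - cost ?G)"
    unfolding final_set_def by (rule foldl_ext_value[OF G' G(2) survivors_E])
  ultimately show "f (set G) + t * (cost (final_set G t D) - cost G) \<le> f (set (final_set G t D))"
    by (simp add: algebra_simps)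
  assume g: "good_draw G t D"
  show "saturated t (final_set G t D)"
    unfolding final_set_def
  proof (rule saturated_after_survivors[OF G' G(2) survivors_E])
    fix x assume x: "x \<in> E" "acc t ?G x"
    then obtain i where "i < m" "x \<in> set (inp i)" using inp_E by auto
    then show "x \<in> set (survivors ?G t)" using x g by (auto simp: survivors_def good_draw_def)
  qed
qed

section \<open>The optimum of a sample and its quantile\<close>

definition opt_value :: "'a set \<Rightarrow> real" where
  "opt_value S = Max (f ` {A. A \<subseteq> S \<and> feasible E c K A})"

lemma finite_feasible: "finite {A. A \<subseteq> S \<and> feasible E c K A}"
  by (rule finite_subset[of _ "Pow E"]) (auto simp: feasible_def finite_items)

lemma empty_feasible: "feasible E c K {}"
  using capacity_pos by (simp add: feasible_def)

lemma opt_value_ge: "A \<subseteq> S \<Longrightarrow> feasible E c K A \<Longrightarrow> f A \<le> opt_value S"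
  unfolding opt_value_def using finite_feasible[of S] by (intro Max_ge) auto

lemma opt_value_le: "(\<And>A. A \<subseteq> S \<Longrightarrow> feasible E c K A \<Longrightarrow> f A \<le> v) \<Longrightarrow> opt_value S \<le> v"
  unfolding opt_value_def using finite_feasible[of S] empty_feasible by (subst Max_le_iff) auto

lemma opt_value_mono: "A \<subseteq> B \<Longrightarrow> opt_value A \<le> opt_value B"
  by (rule opt_value_le) (auto intro!: opt_value_ge)

text \<open>For the large sample each machine with input draws at least \<open>T0\<close> times as
  often as for an ordinary one, which gives an inclusion of multisets. The order is lost, but
  \<open>draw_set\<close> does not see it.\<close>

lemma samples_repeat:
  obtains Rs where "mset (samples (tt * Kt)) = mset (concat (replicate T0 (samples Kt)) @ Rs)"
    "[] \<notin> set Rs" "\<And>X. X \<in> set Rs \<Longrightarrow> set X \<subseteq> E"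
proof -
  have rep: "mset (concat (replicate n L)) = repeat_mset n (mset L)" for n and L :: "'a list list"
    by (induction n) simp_all
  have k: "repeat_mset T0 (replicate_mset (nat \<lceil>Kt\<rceil>) X) \<subseteq># replicate_mset (nat \<lceil>tt * Kt\<rceil>) X" for X :: "'a list"
    using T0(2) by (simp add: subseteq_mset_def)
  have "repeat_mset T0 (mset (concat (map (\<lambda>i. draw_lists Kt (inp i)) [0..<n])))
      \<subseteq># mset (concat (map (\<lambda>i. draw_lists (tt * Kt) (inp i)) [0..<n]))" for n
  proof (induction n)
    case (Suc n)
    then show ?case using k[of "inp n"] by (auto simp: draw_lists_def intro!: subset_mset.add_mono)
  qed simp
  then obtain R where R: "mset (samples (tt * Kt)) = repeat_mset T0 (mset (samples Kt)) + R"
    using subset_mset.le_iff_add by blast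
  obtain Rs where Rs: "mset Rs = R" using ex_mset by blast
  have m: "mset (samples (tt * Kt)) = mset (concat (replicate T0 (samples Kt)) @ Rs)" using R Rs rep by simp
  then have "set Rs \<subseteq> set (samples (tt * Kt))" using mset_eq_setD[OF m] by auto
  then show ?thesis using that[OF m] samples_ne[of "tt * Kt"] samples_E[of _ "tt * Kt"] by blast
qed

text \<open>The separating level is a quantile of the optimum of an ordinary sample. The large sample
  contains \<open>T0\<close> independent ordinary ones, all of which would have to stay below the quantile.\<close>

lemma level:
  obtains x where "1 - d \<le> measure_pmf.prob (draws (samples Kt)) {D. opt_value (set D) \<le> x}"
    "1 - d \<le> measure_pmf.prob (draws (samples (tt * Kt))) {D. x \<le> opt_value (set D)}"
proof -
  have fin: "finite (set_pmf (draw_set (samples Kt)))"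
    using finite_set_draws[OF samples_ne] by (simp add: draw_set_def)
  obtain x where x: "measure_pmf.prob (draw_set (samples Kt)) {A. x < opt_value A} \<le> d"
    "d \<le> measure_pmf.prob (draw_set (samples Kt)) {A. x \<le> opt_value A}"
    using quantile[OF fin, of d opt_value] d by (metis less_imp_le)
  have compl: "1 - d \<le> measure_pmf.prob (draws Xs) {D. P D}" if "measure_pmf.prob (draws Xs) {D. \<not> P D} \<le> d" for Xs :: "'a list list" and P
  proof -
    have "measure_pmf.prob (draws Xs) {D. \<not> P D} = 1 - measure_pmf.prob (draws Xs) {D. P D}"
      by (subst measure_pmf.prob_compl[symmetric]) (auto intro!: arg_cong2[where f = measure])
    then show ?thesis using that by simp
  qed
  have 1: "1 - d \<le> measure_pmf.prob (draws (samples Kt)) {D. opt_value (set D) \<le> x}"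
    by (rule compl) (use x(1) in \<open>simp add: draw_set_def measure_map_pmf vimage_def not_le\<close>)
  obtain Rs where Rs: "mset (samples (tt * Kt)) = mset (concat (replicate T0 (samples Kt)) @ Rs)"
    "[] \<notin> set Rs" "\<And>X. X \<in> set Rs \<Longrightarrow> set X \<subseteq> E"
    using samples_repeat by metis
  have "measure_pmf.prob (draw_set (concat (replicate T0 (samples Kt)) @ Rs)) {A. opt_value A < x} \<le> (1 - d) ^ T0"
    by (rule draw_set_repeat[where E = E]) (use opt_value_mono samples_ne samples_E Rs(2,3) d x(2) in auto)
  then have "measure_pmf.prob (draw_set (samples (tt * Kt))) {A. opt_value A < x} \<le> d"
    using draw_set_mset_cong[OF Rs(1)] T0(1) by simp
  then have "1 - d \<le> measure_pmf.prob (draws (samples (tt * Kt))) {D. x \<le> opt_value (set D)}"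
    by (intro compl) (simp add: draw_set_def measure_map_pmf vimage_def not_le)
  then show ?thesis using that 1 by blast
qed

text \<open>States just before the round 8 that adds the best value so far to \<open>lam\<close>.
  The bounds concern the estimate after this addition, and -1 is the initial best value.\<close>

definition EstOk :: "real \<Rightarrow> (nat \<Rightarrow> 'a machine) set" where
  "EstOk V = {g. \<exists>lam. g \<in> S8 lam 0 1 (-1) [] 0 \<and> V \<le> lam + max (-1) (aug_value [] E) \<and> lam + max (-1) (aug_value [] E) \<le> 49 * V}"

text \<open>Three events are wanted, each failing with probability at most \<open>d\<close>: the
  large sample reaches the level \<open>x\<close>, the next ordinary sample does not exceed it, and
  the survivors of the latter fit. The first two give the hypothesis \<open>small\<close> of
  \<open>optimum_estimate\<close>, the third gives \<open>alive\<close>.\<close>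

lemma estimation:
  assumes Opt: "optimal E c K f Opt"
  shows "1 - (d + (d + d)) \<le> measure_pmf.prob (rs 6 start) (EstOk (f Opt))"
proof -
  have optf: "feasible E c K Opt" and optV: "\<And>S. feasible E c K S \<Longrightarrow> f S \<le> f Opt" using Opt by (auto simp: optimal_def)
  obtain x where x: "1 - d \<le> measure_pmf.prob (draws (samples Kt)) {D. opt_value (set D) \<le> x}"
    "1 - d \<le> measure_pmf.prob (draws (samples (tt * Kt))) {D. x \<le> opt_value (set D)}" by (rule level)
  have 0: "rs 6 start = bind_pmf (rnd start) (rs 5)" using rs_front[of 5 start] by (simp add: numeral_eq_Suc del: mpc_rounds.simps)
  let ?X1 = "\<Union>D\<in>{D. x \<le> opt_value (set D)} \<inter> set_pmf (draws (samples (tt * Kt))). S1 D"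
  show ?thesis unfolding 0
  proof (rule prob_bind_ge)
    show "1 - d \<le> measure_pmf.prob (rnd start) ?X1" using transition0(3) x(2) order.trans by blast
    fix g1 assume "g1 \<in> ?X1"
    then obtain D1 where D1: "x \<le> opt_value (set D1)" "D1 \<in> set_pmf (draws (samples (tt * Kt)))" "g1 \<in> S1 D1" by auto
    have D1E: "set D1 \<subseteq> E" using draws_samples(1)[OF D1(2)] .
    define L1 where "L1 = estimate D1"
    \<comment> \<open>\<open>t\<close> depends on the first sample only and is thus fixed when the
      second one is drawn, as \<open>prob_good_draw\<close> requires.\<close>
    define t where "t = 8 * L1 / K"
    have L1: "0 \<le> L1" "L1 \<le> 3 * f Opt" "\<And>S. S \<subseteq> set D1 \<Longrightarrow> feasible E c K S \<Longrightarrow> f S \<le> 4 * L1"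
      using estimate_bounds[OF D1E optV] by (auto simp: L1_def)
    have t0: "0 \<le> t" using L1 capacity_pos by (simp add: t_def)
    have 1: "rs 5 g1 = bind_pmf (rnd g1) (rs 4)" using rs_front[of 4 g1] by (simp add: numeral_eq_Suc del: mpc_rounds.simps)
    let ?S = "{D. opt_value (set D) \<le> x \<and> good_draw [] t D}"
    \<comment> \<open>Both events concern the same sample and may be dependent, so their failure
      probabilities are added.\<close>
    have pS: "1 - (d + d) \<le> measure_pmf.prob (draws (samples Kt)) ?S"
    proof -
      let ?p = "draws (samples Kt)" and ?A = "{D. opt_value (set D) \<le> x}" and ?B = "{D. good_draw [] t D}"
      have "measure_pmf.prob ?p (UNIV - ?S) \<le> measure_pmf.prob ?p ((UNIV - ?A) \<union> (UNIV - ?B))"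
        by (rule measure_pmf.finite_measure_mono) auto
      also have "\<dots> \<le> measure_pmf.prob ?p (UNIV - ?A) + measure_pmf.prob ?p (UNIV - ?B)"
        by (rule measure_Un_le) auto
      finally have "1 - measure_pmf.prob ?p ?S \<le> 1 - measure_pmf.prob ?p ?A + (1 - measure_pmf.prob ?p ?B)"
        using measure_pmf.prob_compl[of ?S ?p] measure_pmf.prob_compl[of ?A ?p] measure_pmf.prob_compl[of ?B ?p] by simp
      then show ?thesis using x(1) prob_good_draw[OF good_list_Nil t0] by linarith
    qed
    let ?X2 = "\<Union>D\<in>?S \<inter> set_pmf (draws (samples Kt)). S2 (12 * L1) 0 1 (-1) [] t D"
    have "1 - (d + d + 0) \<le> measure_pmf.prob (rs 5 g1) (EstOk (f Opt))"
      unfolding 1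
    proof (rule prob_bind_ge)
      show "1 - (d + d) \<le> measure_pmf.prob (rnd g1) ?X2"
        using transition1(3)[OF D1(3) D1E, of ?S] pS unfolding L1_def[symmetric] t_def[symmetric] by linarith
      fix g2 assume "g2 \<in> ?X2"
      then obtain D2 where D2: "opt_value (set D2) \<le> x" "good_draw [] t D2" "D2 \<in> set_pmf (draws (samples Kt))"
        "g2 \<in> S2 (12 * L1) 0 1 (-1) [] t D2" by auto
      have D2E: "set D2 \<subseteq> E" using draws_samples(1)[OF D2(3)] .
      define A where "A = survivors (foldl (ext t) [] D2) t"
      obtain g3 where g3: "g3 \<in> S8 (12 * L1 + 4 * estimate A) 0 1 (-1) [] 0" "rs 4 g2 = return_pmf g3"
        using estimate_phase[OF D2(4) t0 D2E] by (auto simp: A_def)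
      have A: "set A \<subseteq> E" by (simp add: A_def survivors_E)
      have v: "f {} \<le> aug_value [] E" "\<And>y. y \<in> E \<Longrightarrow> f {y} \<le> aug_value [] E"
        using aug_value_ge(1)[of "[]"] aug_value_ge(2)[of _ "[]"] cost_bounds by auto
      have v0: "0 \<le> aug_value [] E" by (rule aug_value_nonneg) simp
      have vV: "aug_value [] E \<le> f Opt"
        unfolding aug_value_def using finite_items optV empty_feasible
        by (subst Max_le_iff) (auto simp: feasible_def)
      have "f Opt \<le> 12 * L1 + 4 * estimate A + aug_value [] E"
      proof (rule optimum_estimate[OF D2E A L1(1) _ refl _ v(2,1) optf])
        show "f S \<le> 4 * L1" if "S \<subseteq> set D2" "feasible E c K S" for S
        proof -
          have "f S \<le> opt_value (set D2)" using opt_value_ge that by blast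
          also have "\<dots> \<le> opt_value (set D1)" using D2(1) D1(1) by linarith
          also have "\<dots> \<le> 4 * L1" by (rule opt_value_le) (use L1(3) in auto)
          finally show ?thesis .
        qed
        fix y assume y: "y \<in> E" "acc (8 * L1 / K) (foldl (ext (8 * L1 / K)) [] D2) y"
        then obtain i where "i < m" "y \<in> set (inp i)" using inp_E by auto
        then show "y \<in> set A" using y D2(2) by (auto simp: A_def survivors_def good_draw_def t_def)
      qed
      moreover have "estimate A \<le> 3 * f Opt" using estimate_bounds(2)[OF A optV] .
      \<comment> \<open>The factor 49 is 36 from \<open>12 * L1\<close>, 12 from
        \<open>4 * estimate A\<close> and 1 from the best single item.\<close>
      ultimately have "g3 \<in> EstOk (f Opt)" using g3(1) L1(2) vV v0 by (auto simp: EstOk_def)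
      then show "1 - 0 \<le> measure_pmf.prob (rs 4 g2) (EstOk (f Opt))" by (simp add: g3(2))
    qed (use d in auto)
    then show "1 - (d + d) \<le> measure_pmf.prob (rs 5 g1) (EstOk (f Opt))" by simp
  qed (use d in auto)
qed

section \<open>Guesses of the threshold and their saturations\<close>

definition guess :: "real \<Rightarrow> nat \<Rightarrow> real" where
  "guess L k = L / (2 * e * K * real k)"

text \<open>\<open>Prog L k Opt j\<close>: the state after \<open>j\<close> saturations, where \<open>k\<close> is the right guess; its two
  saturations are those with numbers \<open>2 k - 1\<close> and \<open>2 k\<close>.\<close>

definition Prog :: "real \<Rightarrow> nat \<Rightarrow> 'a set \<Rightarrow> nat \<Rightarrow> (nat \<Rightarrow> 'a machine) set" where
  "Prog L k Opt j = {g. \<exists>lam gb G t. g \<in> S8 lam (real ((j + 1) div 2)) (if even j then 1 else 0) gb G t \<and> 0 \<le> t \<and>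
     (if j = 0 then lam + max gb (aug_value G E) = L else lam = L) \<and> aug_value [] E \<le> max gb (aug_value G E) \<and>
     (j + 1 = 2 * k \<longrightarrow> t = guess L k \<and> t * cost G \<le> f (set G) \<and> saturated t G) \<and>
     (2 * k \<le> j \<longrightarrow> (1/2 - 2 * e) * f Opt \<le> max gb (aug_value G E))}"

text \<open>If the optimum has value 0 or no largest item, every guess counts as right; the empty
  set then already meets the target.\<close>

definition right_guess :: "real \<Rightarrow> nat \<Rightarrow> 'a set \<Rightarrow> bool" where
  "right_guess L k Opt \<longleftrightarrow> f Opt = 0 \<or> Opt = {} \<or> (\<exists>o1\<in>Opt. (\<forall>x\<in>Opt. c x \<le> c o1) \<and>
     guess L k * (K - c o1) \<le> f Opt / 2 \<and> f Opt / 2 \<le> guess L k * (K - c o1 + e * K))"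

lemma right_guess_exists:
  assumes Opt: "feasible E c K Opt" and L: "f Opt \<le> L" "L \<le> 49 * f Opt"
  obtains k where "1 \<le> k" "k \<le> N" "right_guess L k Opt"
proof (cases "f Opt = 0 \<or> Opt = {}")
  case True
  have "1 \<le> 98 / e" using e by (simp add: field_simps)
  then have "1 \<le> N" using nn by linarith
  moreover have "right_guess L 1 Opt" using True by (auto simp: right_guess_def)
  ultimately show ?thesis using that[of 1] by simp
next
  case False
  have OptE: "Opt \<subseteq> E" "finite Opt" using Opt finite_subset[OF _ finite_items] by (auto simp: feasible_def)
  have V: "0 < f Opt" using False nonneg[of Opt] OptE items_subset by (metis order.trans less_eq_real_def)
  obtain o1 where o1: "o1 \<in> Opt" "c o1 = Max (c ` Opt)"
    using Max_in[of "c ` Opt"] OptE False by (metis (no_types, lifting) finite_imageI image_iff image_is_empty)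
  then have max: "\<forall>x\<in>Opt. c x \<le> c o1" using OptE by simp
  have "0 \<le> K - c o1" "K - c o1 \<le> K" using cost_bounds[of o1] o1 OptE by auto
  then obtain k where k: "1 \<le> k" "real k \<le> 2 * 49 / e" "L / (2 * e * K * k) * (K - c o1) \<le> f Opt / 2"
    "f Opt / 2 \<le> L / (2 * e * K * k) * (K - c o1 + e * K)"
    using threshold_grid[OF V L, of "K - c o1" e] e by auto
  have "k \<le> N" using k(2) nn by linarith
  moreover have "right_guess L k Opt" unfolding right_guess_def guess_def using o1(1) max k(3,4) by blast
  ultimately show ?thesis using that k(1) by blast
qed

lemma right_guess_target:
  assumes Opt: "feasible E c K Opt" and rg: "right_guess L k Opt" and t: "t = guess L k" "0 \<le> t"
    and G: "good_list G" "t * cost G \<le> f (set G)" "saturated t G"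
    and G': "good_list G'" "f (set G) + 4 * e * t * (cost G' - cost G) \<le> f (set G')" "saturated (4 * e * t) G'"
    and V: "aug_value [] E \<le> V" "aug_value G E \<le> V" "aug_value G' E \<le> V"
  shows "(1/2 - 2 * e) * f Opt \<le> V"
proof (cases "f Opt = 0 \<or> Opt = {}")
  case True
  have v: "f {} \<le> V" "0 \<le> f {}" using aug_value_ge(1)[of "[]"] V nonneg[of "{}"] by auto
  show ?thesis
  proof (cases "f Opt = 0")
    case True
    then show ?thesis using v by simp
  next
    case False
    then have "(1/2 - 2 * e) * f Opt \<le> 1 * f {}" using True v e by (intro mult_mono) auto
    then show ?thesis using v by simp
  qed
next
  case False
  then obtain o1 where o1: "o1 \<in> Opt" "\<forall>x\<in>Opt. c x \<le> c o1" "t * (K - c o1) \<le> f Opt / 2"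
    "f Opt / 2 \<le> t * (K - c o1 + e * K)" using rg t by (auto simp: right_guess_def)
  have oE: "o1 \<in> E" using o1 Opt by (auto simp: feasible_def)
  have V1: "f {o1} \<le> V" using aug_value_ge(2)[of o1 "[]"] V(1) oE cost_bounds[OF oE] by simp
  show ?thesis
    by (rule threshold_half_approximation[OF Opt o1(1) _ e t(2) o1(3,4) G G' V1])
      (use o1(2) aug_value_ge(1)[of G] aug_value_ge(2)[of _ G] aug_value_ge(1)[of G'] V in \<open>force+\<close>)
qed

text \<open>A wrong guess may be processed on bad samples without harm: its lists are feasible in
  any case, and the best value never decreases. So only the saturations \<open>2 * k - 1\<close> and
  \<open>2 * k\<close> require a good draw and cost \<open>d\<close>.\<close>

lemma phase_prob:
  assumes g: "g \<in> Prog L k Opt j" and L: "0 \<le> L" and k: "1 \<le> k" and Opt: "feasible E c K Opt" "right_guess L k Opt"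
  shows "1 - (if j + 2 = 2 * k \<or> j + 1 = 2 * k then d else 0) \<le> measure_pmf.prob (rs 5 g) (Prog L k Opt (Suc j))"
proof -
  obtain lam gb G t where S: "g \<in> S8 lam (real ((j + 1) div 2)) (if even j then 1 else 0) gb G t" and t0: "0 \<le> t"
    and lam: "if j = 0 then lam + max gb (aug_value G E) = L else lam = L"
    and v1: "aug_value [] E \<le> max gb (aug_value G E)"
    and c1: "j + 1 = 2 * k \<Longrightarrow> t = guess L k \<and> t * cost G \<le> f (set G) \<and> saturated t G"
    and c2: "2 * k \<le> j \<Longrightarrow> (1/2 - 2 * e) * f Opt \<le> max gb (aug_value G E)"
    using g unfolding Prog_def by blast
  define kk where "kk = real ((j + 1) div 2)"
  define gb' where "gb' = max gb (aug_value G E)"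
  define G0 where "G0 = (if even j then [] else G)"
  define t' where "t' = (if even j then L / (2 * e * K * (kk + 1)) else 4 * e * t)"
  have gG: "good_list G" using S m1 by (auto simp: S8_def GS_def)
  have gG0: "good_list G0" using gG by (simp add: G0_def)
  have kk0: "kk = 0 \<longleftrightarrow> j = 0" unfolding kk_def by (cases j) auto
  have lam': "(if kk = 0 then lam + max gb (aug_value G E) else lam) = L" using lam kk0 by simp
  have kk': "(if (if even j then 1 else 0 :: nat) = 1 then kk + 1 else kk) = real ((Suc j + 1) div 2)"
    by (cases "even j") (auto simp: kk_def elim!: oddE evenE)
  have pass': "(if (if even j then 1 else 0 :: nat) = 1 then 0 else 1 :: nat) = (if even (Suc j) then 1 else 0)" by simp
  have G0': "(if (if even j then 1 else 0 :: nat) = 1 then [] else G) = G0" by (simp add: G0_def)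
  have tt': "(if (if even j then 1 else 0 :: nat) = 1 then L / (2 * e * K * (kk + 1)) else 4 * e * t) = t'" by (simp add: t'_def)
  have t'0: "0 \<le> t'" using t0 L e capacity_pos by (simp add: t'_def kk_def)
  note tr = transition8(3)[OF S[folded kk_def], unfolded lam' kk' pass' G0' tt', folded gb'_def]
  \<comment> \<open>The coming saturation has number \<open>j + 1\<close>; the condition says that
    it is one of the two for guess \<open>k\<close>. Otherwise the event \<open>?S\<close> below is
    everything.\<close>
  let ?crit = "j + 2 = 2 * k \<or> j + 1 = 2 * k"
  let ?b = "if ?crit then d else 0"
  let ?S = "{D. ?crit \<longrightarrow> good_draw G0 t' D}"
  let ?X = "\<Union>D\<in>?S \<inter> set_pmf (draws (samples Kt)). S2 L (real ((Suc j + 1) div 2)) (if even (Suc j) then 1 else 0) gb' G0 t' D"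
  have pS: "1 - ?b \<le> measure_pmf.prob (draws (samples Kt)) ?S"
    using prob_good_draw[OF gG0 t'0] by (cases ?crit) auto
  have 5: "rs 5 g = bind_pmf (rnd g) (rs 4)" using rs_front[of 4 g] by (simp add: numeral_eq_Suc del: mpc_rounds.simps)
  have "1 - (?b + 0) \<le> measure_pmf.prob (rs 5 g) (Prog L k Opt (Suc j))"
    unfolding 5
  proof (rule prob_bind_ge)
    show "1 - ?b \<le> measure_pmf.prob (rnd g) ?X" using tr[of ?S] pS by linarith
    fix g2 assume "g2 \<in> ?X"
    then obtain D where D: "?crit \<Longrightarrow> good_draw G0 t' D" "D \<in> set_pmf (draws (samples Kt))"
      "g2 \<in> S2 L (real ((Suc j + 1) div 2)) (if even (Suc j) then 1 else 0) gb' G0 t' D" by auto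
    have DE: "set D \<subseteq> E" using draws_samples(1)[OF D(2)] .
    define F where "F = final_set G0 t' D"
    have nz: "real ((Suc j + 1) div 2) \<noteq> 0" by simp
    obtain g3 where g3: "g3 \<in> S8 L (real ((Suc j + 1) div 2)) (if even (Suc j) then 1 else 0) gb' F t'" "rs 4 g2 = return_pmf g3"
      using phase[OF D(3) t'0 DE nz] by (auto simp: F_def)
    note gd = good_draw_final[OF gG0 t'0 DE, folded F_def]
    have v1': "aug_value [] E \<le> max gb' (aug_value F E)" using v1 by (simp add: gb'_def)
    have first: "t' = guess L k \<and> t' * cost F \<le> f (set F) \<and> saturated t' F" if j: "Suc j + 1 = 2 * k"
    proof -
      \<comment> \<open>Here \<open>j = 2 * k - 2\<close>, and the number of the guess has just been
        raised to \<open>k\<close>.\<close>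
      have ev: "even j" using j by presburger
      have "(j + 1) div 2 + 1 = k" using j by presburger
      then have "kk + 1 = real k" unfolding kk_def by linarith
      then have "t' = guess L k" using ev by (simp add: t'_def guess_def)
      moreover have "t' * cost F \<le> f (set F)" using gd(2) ev nonneg[of "{}"] by (simp add: G0_def)
      moreover have "saturated t' F" using gd(3) D(1) j by simp
      ultimately show ?thesis by blast
    qed
    have second: "(1/2 - 2 * e) * f Opt \<le> max gb' (aug_value F E)" if j: "2 * k \<le> Suc j"
    proof (cases "2 * k \<le> j")
      case True
      then show ?thesis using c2 by (simp add: gb'_def)
    next
      case False
      then have j': "j + 1 = 2 * k" using j by simp
      then have od: "odd j" by presburger
      \<comment> \<open>For odd \<open>j\<close> the list is kept and the threshold multiplied by
        \<open>4 * e\<close>, as the second saturation of a guess demands.\<close>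
      have eq: "G0 = G" "t' = 4 * e * t" using od by (auto simp: G0_def t'_def)
      show ?thesis
      proof (rule right_guess_target[OF Opt _ t0 gG])
        show "f (set G) + 4 * e * t * (cost F - cost G) \<le> f (set F)" using gd(2) eq by simp
        show "saturated (4 * e * t) F" using gd(3) D(1) j' eq by simp
      qed (use c1[OF j'] gd(1) v1 in \<open>auto simp: gb'_def\<close>)
    qed
    have "g3 \<in> Prog L k Opt (Suc j)"
      unfolding Prog_def using g3(1) t'0 v1' first second by (intro CollectI exI[of _ L] exI[of _ gb'] exI[of _ F] exI[of _ t']) auto
    then show "1 - 0 \<le> measure_pmf.prob (rs 4 g2) (Prog L k Opt (Suc j))" by (simp add: g3(2))
  qed (use d in auto)
  then show ?thesis by simp
qed

text \<open>The sum of the two \<open>of_bool\<close> terms counts the decisive saturations among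
  the first \<open>j\<close>. It never exceeds 2, however many guesses are tried.\<close>

lemma phases_prob:
  assumes g: "g \<in> Prog L k Opt 0" and L: "0 \<le> L" and k: "1 \<le> k" and Opt: "feasible E c K Opt" "right_guess L k Opt"
  shows "1 - d * (of_bool (2 * k \<le> j + 1) + of_bool (2 * k \<le> j)) \<le> measure_pmf.prob (rs (5 * j) g) (Prog L k Opt j)"
proof (induction j)
  case 0
  then show ?case using g k by simp
next
  case (Suc j)
  have eq: "rs (5 * Suc j) g = bind_pmf (rs (5 * j) g) (rs 5)" using rs_add[of "5 * j" 5 g] by (simp add: add.commute)
  let ?a = "d * (of_bool (2 * k \<le> j + 1) + of_bool (2 * k \<le> j))" and ?b = "if j + 2 = 2 * k \<or> j + 1 = 2 * k then d else 0"
  have "1 - (?a + ?b) \<le> measure_pmf.prob (rs (5 * Suc j) g) (Prog L k Opt (Suc j))"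
    unfolding eq by (rule prob_bind_ge[OF Suc]) (use d phase_prob[OF _ L k Opt] in auto)
  moreover have "?a + ?b = d * (of_bool (2 * k \<le> Suc j + 1) + of_bool (2 * k \<le> Suc j))"
  proof -
    consider "j + 2 = 2 * k" | "j + 1 = 2 * k" | "j + 2 < 2 * k" | "2 * k < j + 1" by linarith
    then show ?thesis by cases auto
  qed
  ultimately show ?case by simp
qed

text \<open>The rounds are 6 for the estimation, 5 for each of the \<open>2 * N\<close> saturations
  (a round 8 that draws, then rounds 2, 3, 6 and 7), and a last round 8 that writes the output. The
  failure bound collects three events from the estimation and two from the right guess.\<close>

lemma output_approximates:
  assumes Opt: "optimal E c K f Opt"
  shows "1 - 5 * d \<le> measure_pmf.prob (mpc_output f c prg T m (7 + 10 * N) start)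
     {S. is_approximation E c K f (1/2 - 2 * e) S}"
proof -
  let ?V = "f Opt" and ?S = "{g. is_approximation E c K f (1/2 - 2 * e) (solution (g 0))}"
  have optf: "feasible E c K Opt" using Opt by (simp add: optimal_def)
  have V0: "0 \<le> ?V" using nonneg optf items_subset by (auto simp: feasible_def)
  have last: "1 - 0 \<le> measure_pmf.prob (rnd g) ?S" if g: "g \<in> Prog L k Opt (2 * N)" "k \<le> N" for g L k
  proof -
    obtain lam gb G t where S: "g \<in> S8 lam (real ((2 * N + 1) div 2)) 1 gb G t"
      and c2: "(1/2 - 2 * e) * ?V \<le> max gb (aug_value G E)" using g by (auto simp: Prog_def)
    have gG: "set G \<subseteq> E" using S m1 by (auto simp: S8_def GS_def good_list_def)
    have kk: "real ((2 * N + 1) div 2) = nn" using nn by simp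
    have "g' \<in> ?S" if g': "g' \<in> set_pmf (rnd g)" for g'
    proof -
      obtain B where B: "best_ok B (max gb (aug_value G E))" "solution (g' 0) = set B"
        using transition8(4)[OF S refl kk g'] by blast
      \<comment> \<open>This excludes the marker -1 in \<open>best_ok\<close>.\<close>
      have "0 \<le> max gb (aug_value G E)" using aug_value_nonneg[OF gG] by simp
      then have "f (set B) = max gb (aug_value G E)" using B(1) by (auto simp: best_ok_def)
      moreover have "f Opt' = ?V" if "optimal E c K f Opt'" for Opt' using that Opt by (auto simp: optimal_def intro: antisym)
      ultimately show ?thesis using B c2 by (auto simp: is_approximation_def best_ok_def)
    qed
    then have "measure_pmf.prob (rnd g) ?S = 1" by (subst measure_pmf.prob_eq_1) (auto simp: AE_measure_pmf_iff)
    then show ?thesis by simp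
  qed
  have phases: "1 - d * 2 \<le> measure_pmf.prob (rs (10 * N + 1) g) ?S" if g: "g \<in> EstOk ?V" for g
  proof -
    obtain lam where lam: "g \<in> S8 lam 0 1 (-1) [] 0" "?V \<le> lam + max (-1) (aug_value [] E)" "lam + max (-1) (aug_value [] E) \<le> 49 * ?V"
      using g by (auto simp: EstOk_def)
    define L where "L = lam + max (-1) (aug_value [] E)"
    have LV: "?V \<le> L" "L \<le> 49 * ?V" using lam by (auto simp: L_def)
    obtain k where k: "1 \<le> k" "k \<le> N" "right_guess L k Opt" by (rule right_guess_exists[OF optf LV])
    have g0: "g \<in> Prog L k Opt 0"
      unfolding Prog_def using lam(1) k(1)
      by (intro CollectI exI[of _ lam] exI[of _ "-1"] exI[of _ "[]"] exI[of _ 0]) (simp add: L_def)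
    have "1 - d * 2 \<le> measure_pmf.prob (rs (5 * (2 * N)) g) (Prog L k Opt (2 * N))"
      using phases_prob[OF g0 _ k(1) optf k(3), of "2 * N"] LV V0 k(2) by simp
    then have "1 - (d * 2 + 0) \<le> measure_pmf.prob (bind_pmf (rs (5 * (2 * N)) g) rnd) ?S"
      by (rule prob_bind_ge) (use d last k(2) in auto)
    then show ?thesis by simp
  qed
  have "1 - ((d + (d + d)) + d * 2) \<le> measure_pmf.prob (bind_pmf (rs 6 start) (rs (10 * N + 1))) ?S"
    by (rule prob_bind_ge[OF estimation[OF Opt]]) (use d phases in auto)
  also have "bind_pmf (rs 6 start) (rs (10 * N + 1)) = rs (7 + 10 * N) start"
    using rs_add[of 6 "10 * N + 1" start] by (simp add: add.commute)
  finally show ?thesis by (simp add: mpc_output_def measure_map_pmf vimage_def)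
qed

end

section \<open>Choice of the constants\<close>

context submodular_knapsack
begin

lemma optimal_exists: obtains Opt where "optimal E c K f Opt"
proof -
  let ?F = "{S. feasible E c K S}"
  have fin: "finite (f ` ?F)"
    by (rule finite_imageI, rule finite_subset[of _ "Pow E"]) (auto simp: feasible_def finite_items)
  have "{} \<in> ?F" using capacity_pos by (simp add: feasible_def)
  then have "Max (f ` ?F) \<in> f ` ?F" using Max_in[OF fin] by blast
  then obtain S where "S \<in> ?F" "f S = Max (f ` ?F)" by auto
  then have "optimal E c K f S" using Max_ge[OF fin] by (auto simp: optimal_def)
  then show ?thesis by (rule that)
qed

text \<open>The square root is at least 1, so rounding it up at most doubles it. Hence
  \<open>m * Ktilde E K\<close> agrees with \<open>W\<close> up to a factor of 2, which is why the
  ordinary samples of all machines together fit into the memory of one.\<close>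

lemma machine_count_bounds:
  fixes m :: nat and W :: real
  assumes m: "m = nat \<lceil>sqrt (real (card E) / Ktilde E K)\<rceil>" and W: "W = sqrt (real (card E) * Ktilde E K)"
  shows "1 \<le> m" "Ktilde E K \<le> W" "W \<le> real m * Ktilde E K" "real m * Ktilde E K \<le> 2 * W"
proof -
  let ?n = "real (card E)" and ?k = "Ktilde E K"
  define s where "s = sqrt (?n / ?k)"
  have k: "1 \<le> ?k" "?k \<le> ?n" using Ktilde_ge_1 by (auto simp: Ktilde_def)
  then have s1: "1 \<le> s" by (simp add: s_def)
  have "s * ?k = sqrt (?n / ?k) * sqrt (?k * ?k)" using k by (simp add: s_def)
  also have "\<dots> = W" unfolding W real_sqrt_mult[symmetric] using k by simp
  finally have sW: "s * ?k = W" .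
  have ms: "s \<le> real m" "real m \<le> 2 * s" using m s1 unfolding s_def[symmetric] by linarith+
  show "1 \<le> m" using ms(1) s1 by linarith
  show "?k \<le> W" using mult_right_mono[OF s1, of ?k] k sW by simp
  show "W \<le> real m * ?k" using mult_right_mono[OF ms(1), of ?k] k sW by simp
  show "real m * ?k \<le> 2 * W" using mult_right_mono[OF ms(2), of ?k] k unfolding sW[symmetric] mult.assoc by simp
qed

text \<open>\<open>h\<close> adds up the demands on \<open>H\<close> in units of \<open>W\<close>: 4
  for an ordinary sample after rounding up, \<open>2 * (tt + 1)\<close> for the large sample,
  \<open>2 * Z\<close> for the survivors and \<open>A'\<close> for the input. The factor 2 in
  \<open>tt\<close> absorbs the rounding of \<open>Ktilde E K\<close> in each of the
  \<open>T0\<close> ordinary samples.\<close>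

lemma mpc_analysis_for_instance:
  fixes d A' W tt Z h e :: real and T0 m H N T Q M :: nat
  assumes d: "0 < d" "d \<le> 1" and T0: "(1 - d) ^ T0 \<le> d" and A': "1 \<le> A'"
    and tt: "tt = 2 * real T0" and Z: "Z = A' / d" and h: "h = 4 + 2 * (tt + 1) + 2 * Z + A'"
    and e: "0 < e" "e \<le> 1/4" and N: "98 / e \<le> real N"
    and m: "m = nat \<lceil>sqrt (real (card E) / Ktilde E K)\<rceil>" and W: "W = sqrt (real (card E) * Ktilde E K)"
    and H: "H = nat \<lceil>h * W\<rceil>" and inp: "distributed_input E m (A' * W) inp"
    and TQM: "67 * H + 300 \<le> T" "67 * H + 300 \<le> Q" "67 * H + 300 \<le> M"
  shows "mpc_analysis U E c K f m H e tt Z (real N) inp T Q M d T0 N"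
proof -
  let ?k = "Ktilde E K"
  note mb = machine_count_bounds[OF m W]
  have k: "1 \<le> ?k" by (rule Ktilde_ge_1)
  have W1: "1 \<le> W" using k mb by linarith
  have tt0: "0 \<le> tt" and Z0: "0 < Z" using tt Z d A' by auto
  have hH: "a * W \<le> real H" if "a \<le> h" for a
    using mult_right_mono[OF that, of W] W1 unfolding H by linarith
  have mk: "real m \<le> real m * ?k" using mult_left_mono[OF k, of "real m"] by simp
  have ck: "real (nat \<lceil>?k\<rceil>) \<le> 2 * ?k" using k by linarith
  have ctk: "real (nat \<lceil>tt * ?k\<rceil>) \<le> (tt + 1) * ?k"
  proof -
    have "0 \<le> tt * ?k" using tt0 k by simp
    then have "real (nat \<lceil>tt * ?k\<rceil>) \<le> tt * ?k + 1" by linarith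
    then show ?thesis using k by (simp add: algebra_simps)
  qed
  have 1: "?k + 1 \<le> real H" using hH[of 2] k mb h tt0 Z0 A' by simp
  have "2 \<le> h" using h tt0 Z0 A' by simp
  then have 2: "real m \<le> real H" using hH[of 2] mk mb(4) by linarith
  have "real m * real (nat \<lceil>?k\<rceil>) \<le> real m * (2 * ?k)" by (rule mult_left_mono[OF ck]) simp
  also have "\<dots> \<le> 4 * W" using mb(4) by simp
  also have "\<dots> \<le> real H" by (rule hH) (use h tt0 Z0 A' in simp)
  finally have 3: "real (m * nat \<lceil>?k\<rceil>) \<le> real H" by simp
  have "real m * real (nat \<lceil>tt * ?k\<rceil>) \<le> real m * ((tt + 1) * ?k)" by (rule mult_left_mono[OF ctk]) simp
  also have "\<dots> = (tt + 1) * (real m * ?k)" by simp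
  also have "\<dots> \<le> (tt + 1) * (2 * W)" by (rule mult_left_mono[OF mb(4)]) (use tt0 in simp)
  also have "\<dots> = (2 * (tt + 1)) * W" by simp
  also have "\<dots> \<le> real H" by (rule hH) (use h Z0 A' in simp)
  finally have 4: "real (m * nat \<lceil>tt * ?k\<rceil>) \<le> real H" by simp
  have "real m * ?k * Z \<le> 2 * W * Z" by (rule mult_right_mono[OF mb(4)]) (use Z0 in simp)
  also have "\<dots> = (2 * Z) * W" by simp
  also have "\<dots> \<le> real H" by (rule hH) (use h tt0 A' in simp)
  finally have 5: "real m * ?k * Z \<le> real H" .
  have 6: "real (length (inp i)) \<le> A' * W" if "i < m" for i using inp that by (simp add: distributed_input_def)
  have 7: "A' * W \<le> real H" by (rule hH) (use h tt0 Z0 in simp)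
  have "A' * W \<le> A' * (real m * ?k)" by (rule mult_left_mono[OF mb(3)]) (use A' in simp)
  also have "\<dots> = d * (real m * ?k * Z)" using d Z by simp
  finally have 8: "A' * W \<le> d * (real m * ?k * Z)" .
  have "real T0 * real (nat \<lceil>?k\<rceil>) \<le> real T0 * (2 * ?k)" by (rule mult_left_mono[OF ck]) simp
  also have "\<dots> = tt * ?k" by (simp add: tt)
  also have "\<dots> \<le> real (nat \<lceil>tt * ?k\<rceil>)" by linarith
  finally have 9: "T0 * nat \<lceil>?k\<rceil> \<le> nat \<lceil>tt * ?k\<rceil>" by (simp only: of_nat_mult[symmetric] of_nat_le_iff)
  have 10: "0 < real m * ?k * Z" using mb(1) k Z0 by simp
  have 11: "(\<Union>i<m. set (inp i)) = E" using inp by (simp add: distributed_input_def)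
  show ?thesis
  proof unfold_locales
    show "length (inp i) \<le> H" if "i < m" for i using 6[OF that] 7 by linarith
    show "real (length (inp i)) \<le> d * (real m * ?k * Z)" if "i < m" for i using 6[OF that] 8 by linarith
  qed (use 1 2 3 4 5 9 10 11 mb(1) d T0 e N TQM in \<open>simp_all only: of_nat_le_iff less_imp_le\<close>)
qed

lemma main_program_correct:
  fixes d A A' tt Z h e C :: real and T0 m N T :: nat
  assumes d: "0 < d" "d \<le> 1" and T0: "(1 - d) ^ T0 \<le> d" and A': "A' = max A 1"
    and tt: "tt = 2 * real T0" and Z: "Z = A' / d" and h: "h = 4 + 2 * (tt + 1) + 2 * Z + A'"
    and C: "67 * h + 368 \<le> C"
    and e: "0 < e" "e \<le> 1/4" and N: "98 / e \<le> real N"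
    and m: "m = nat \<lceil>sqrt (real (card E) / Ktilde E K)\<rceil>"
    and T: "T = nat \<lfloor>C * sqrt (real (card E) * Ktilde E K)\<rfloor>"
    and inp: "distributed_input E m (A * sqrt (real (card E) * Ktilde E K)) inp"
  shows "mpc_within f c (main_program e tt Z (real N)) T T T m R (initial_machine m (card E) K inp)"
    "1 - 5 * d \<le> measure_pmf.prob
       (mpc_output f c (main_program e tt Z (real N)) T m (7 + 10 * N) (initial_machine m (card E) K inp))
       {S. is_approximation E c K f (1/2 - 2 * e) S}"
proof -
  define W where "W = sqrt (real (card E) * Ktilde E K)"
  define H where "H = nat \<lceil>h * W\<rceil>"
  have W1: "1 \<le> W" using machine_count_bounds[OF m W_def] Ktilde_ge_1 by linarith
  have "A * W \<le> A' * W" using W1 A' by (intro mult_right_mono) auto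
  then have inp': "distributed_input E m (A' * W) inp"
    using inp unfolding W_def[symmetric] distributed_input_def by force
  have h0: "0 \<le> h" using h tt Z d A' by simp
  have "0 \<le> h * W" using h0 W1 by simp
  then have "real H \<le> h * W + 1" unfolding H_def by linarith
  then have "real (67 * H + 300) \<le> 67 * (h * W + 1) + 300" by simp
  \<comment> \<open>The additive constants are absorbed by \<open>1 \<le> W\<close>.\<close>
  also have "\<dots> \<le> (67 * h + 367) * W" using W1 by (simp add: algebra_simps)
  also have "\<dots> \<le> C * W" using C W1 by (intro mult_right_mono) auto
  finally have TH: "67 * H + 300 \<le> T" unfolding T W_def[symmetric] by linarith
  interpret mpc_analysis U E c K f m H e tt Z "real N" inp T T T d T0 N
    by (rule mpc_analysis_for_instance[OF d T0 _ tt Z h e N m W_def H_def inp' TH TH TH]) (use A' in simp)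
  show "mpc_within f c (main_program e tt Z (real N)) T T T m R (initial_machine m (card E) K inp)"
    by (rule within)
  obtain Opt where "optimal E c K f Opt" by (rule optimal_exists)
  then show "1 - 5 * d \<le> measure_pmf.prob
       (mpc_output f c (main_program e tt Z (real N)) T m (7 + 10 * N) (initial_machine m (card E) K inp))
       {S. is_approximation E c K f (1/2 - 2 * e) S}"
    by (rule output_approximates)
qed

text \<open>Covers \<open>\<epsilon> \<ge> 1/2\<close>, where the required factor is not positive.
  As \<open>C / \<epsilon>\<close> becomes arbitrarily small there, a run of no rounds at all has to
  serve as witness.\<close>

lemma empty_is_approximation:
  assumes "1/2 \<le> \<epsilon>"
  shows "is_approximation E c K f (1/2 - \<epsilon>) {}"
proof -
  have "(1/2 - \<epsilon>) * f Opt \<le> f {}" if "optimal E c K f Opt" for Opt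
  proof -
    have "0 \<le> f Opt" using that items_subset by (intro nonneg) (auto simp: optimal_def feasible_def)
    then have "(1/2 - \<epsilon>) * f Opt \<le> 0" using assms by (intro mult_nonpos_nonneg) auto
    then show ?thesis using nonneg[of "{}"] by simp
  qed
  then show ?thesis using capacity_pos by (auto simp: is_approximation_def feasible_def)
qed

end

theorem theorem3:
  fixes \<delta> A :: real
  assumes "\<delta> > 0"
  shows "\<exists>C>0. \<forall>\<epsilon>>0. \<exists>(P :: program) (R :: nat).
    int R \<le> \<lceil>C / \<epsilon>\<rceil> \<and>
    (\<forall>(U :: 'a set) E c K f m T Q M inp.
       submodular_knapsack U E c K f \<longrightarrow>
       m = nat \<lceil>sqrt (real (card E) / Ktilde E K)\<rceil> \<longrightarrow>
       T = nat \<lfloor>C * sqrt (real (card E) * Ktilde E K)\<rfloor> \<longrightarrow>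
       Q = nat \<lfloor>C * sqrt (real (card E) * Ktilde E K)\<rfloor> \<longrightarrow>
       M = nat \<lfloor>C * sqrt (real (card E) * Ktilde E K)\<rfloor> \<longrightarrow>
       distributed_input E m (A * sqrt (real (card E) * Ktilde E K)) inp \<longrightarrow>
       mpc_within f c P T Q M m R (initial_machine m (card E) K inp) \<and>
       measure_pmf.prob (mpc_output f c P T m R (initial_machine m (card E) K inp))
         {S. is_approximation E c K f (1/2 - \<epsilon>) S} \<ge> 1 - \<delta>)"
proof -
  \<comment> \<open>Five events may fail, each with probability at most \<open>d\<close>; the
    minimum with 1/5 keeps \<open>d \<le> 1\<close> for large \<open>\<delta>\<close>.\<close>
  define d where "d = min (\<delta> / 5) (1/5)"
  have d: "0 < d" "d \<le> 1" "5 * d \<le> \<delta>" using assms by (auto simp: d_def)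
  obtain T0 where T0: "(1 - d) ^ T0 \<le> d" using real_arch_pow_inv[of d "1 - d"] d by (auto intro: less_imp_le)
  define A' tt Z where "A' = max A 1" and "tt = 2 * real T0" and "Z = A' / d"
  define h where "h = 4 + 2 * (tt + 1) + 2 * Z + A'"
  \<comment> \<open>The constant 2400 serves two purposes: it covers the 368 of the time bound, and
    \<open>2400 / \<epsilon>\<close> covers the at most \<open>17 + 1960 / \<epsilon>\<close> rounds
    for \<open>\<epsilon> < 1/2\<close>.\<close>
  define C where "C = 67 * h + 2400"
  have h0: "0 \<le> h" using d by (simp add: h_def tt_def Z_def A'_def)
  show ?thesis
  proof (rule exI[of _ C], intro conjI allI impI)
    show "0 < C" using h0 by (simp add: C_def)
    fix \<epsilon> :: real assume eps: "0 < \<epsilon>"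
    show "\<exists>(P :: program) (R :: nat).
      int R \<le> \<lceil>C / \<epsilon>\<rceil> \<and>
      (\<forall>(U :: 'a set) E c K f m T Q M inp.
         submodular_knapsack U E c K f \<longrightarrow>
         m = nat \<lceil>sqrt (real (card E) / Ktilde E K)\<rceil> \<longrightarrow>
         T = nat \<lfloor>C * sqrt (real (card E) * Ktilde E K)\<rfloor> \<longrightarrow>
         Q = nat \<lfloor>C * sqrt (real (card E) * Ktilde E K)\<rfloor> \<longrightarrow>
         M = nat \<lfloor>C * sqrt (real (card E) * Ktilde E K)\<rfloor> \<longrightarrow>
         distributed_input E m (A * sqrt (real (card E) * Ktilde E K)) inp \<longrightarrow>
         mpc_within f c P T Q M m R (initial_machine m (card E) K inp) \<and>
         measure_pmf.prob (mpc_output f c P T m R (initial_machine m (card E) K inp))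
           {S. is_approximation E c K f (1/2 - \<epsilon>) S} \<ge> 1 - \<delta>)"
    proof (cases "1/2 \<le> \<epsilon>")
      case True
      have "0 \<le> C / \<epsilon>" using h0 eps by (simp add: C_def)
      then show ?thesis using assms True
        by (intro exI[of _ "[]"] exI[of _ 0])
          (auto simp: mpc_within_def mpc_output_def initial_machine_def submodular_knapsack.empty_is_approximation)
    next
      case False
      \<comment> \<open>Halving \<open>\<epsilon>\<close> makes up for the loss of
        \<open>2 * e\<close>, and \<open>\<epsilon> < 1/2\<close> gives
        \<open>e \<le> 1/4\<close>.\<close>
      define e N where "e = \<epsilon> / 2" and "N = nat \<lceil>98 / e\<rceil>"
      have e: "0 < e" "e \<le> 1/4" "2 * e = \<epsilon>" using eps False by (auto simp: e_def)
      have "0 \<le> 98 / e" using e by simp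
      then have N: "98 / e \<le> real N" "real N \<le> 98 / e + 1" unfolding N_def by linarith+
      have "17 \<le> 17 / \<epsilon>" using eps False by (simp add: field_simps)
      moreover have "98 / e = 196 / \<epsilon>" by (simp add: e_def)
      moreover have "2400 / \<epsilon> \<le> C / \<epsilon>" using h0 eps by (intro divide_right_mono) (auto simp: C_def)
      moreover have "17 / \<epsilon> + 10 * (196 / \<epsilon>) \<le> 2400 / \<epsilon>" using eps by (simp add: field_simps)
      ultimately have R: "int (7 + 10 * N) \<le> \<lceil>C / \<epsilon>\<rceil>" using N(2) by linarith
      have C: "67 * h + 368 \<le> C" by (simp add: C_def)
      show ?thesis
      proof (intro exI[of _ "main_program e tt Z (real N)"] exI[of _ "7 + 10 * N"] conjI R allI impI, goal_cases)
        case (1 U E c K f m T Q M inp)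
        note i = submodular_knapsack.main_program_correct(1)[OF 1(1) d(1,2) T0 A'_def tt_def Z_def h_def C e(1,2) N(1) 1(2,3,6)]
        show ?case using i unfolding 1(4,5) 1(3)[symmetric] .
      next
        case (2 U E c K f m T Q M inp)
        note i = submodular_knapsack.main_program_correct(2)[OF 2(1) d(1,2) T0 A'_def tt_def Z_def h_def C e(1,2) N(1) 2(2,3,6)]
        then show ?case using d(3) unfolding e(3) by linarith
      qed
    qed
  qed
qed

end
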